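(* Let $k\ge1$ be an odd integer, let $m\ge3k+1$, and suppose that: the regularity condition of order $m$ holds; $q_\lambda+hp_\lambda\ge0$ on $H_T$ for all $h\in(0,h_0]$, $\lambda\in\Lambda_1$; $\sum_{\lambda\in\Lambda_1}\lambda q_\lambda=0$ on $H_T$; $c\ge c_0$ for a constant $c_0>0$; the first and the second structural inequalities of order $m$ hold; $\Lambda_1=-\Lambda_1$; and $q_\lambda=q_{-\lambda}$, $p_{-\lambda}=-p_\lambda$ for all $\lambda\in\Lambda_1$. Then, for any integer $r\ge0$ such that $3k+r\le m-1$, $$\sup_{H_T}|D^rD_h^ku_h|\le N(\|f\|_m+\|g\|_m)h$$ for all $h\in(0,h_0]$, where $N$ depends only on $m$, $\delta$, $c_0$, $\tau_0$, $K$, $|\Lambda_1|$, $\|\Lambda_1\|$, $M_0,\dots,M_m$.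
   Context: Setting. Fix $d\ge1$, $h_0,T\in(0,\infty)$; $H_T=[0,T]\times\mathbb R^d$. $\Lambda_1\subset\mathbb R^d$ is a finite set with $0\notin\Lambda_1$, and $|\Lambda_1|^2:=\sum_{\lambda\in\Lambda_1}|\lambda|^2$. For $\lambda\in\Lambda_1$, $q_\lambda\ge0$, $p_\lambda$, and also $c$, are real Borel functions on $[0,\infty)\times\mathbb R^d$; $f$ is a real Borel function on $H_T$ and $g$ a real Borel function on $\mathbb R^d$. Spaces. $D^k\varphi$ is the collection of all $x$-partial derivatives of order $k$, $|D^k\varphi|^2=\sum_{|\alpha|=k}|D^\alpha\varphi|^2$; $D_h^k$ denotes the $k$-th derivative with respect to the parameter $h$. A bounded Borel function $\psi$ on $H_T$ belongs to $\mathfrak B^m$ if for each $t\in[0,T]$ the function $\psi(t,\cdot)$ is continuous on $\mathbb R^d$ and for all multi-indices $|\alpha|\le m$ the generalized derivatives $D^\alpha\psi$ in $x$ are bounded on $H_T$; then $\|\psi\|_m^2:=\sup_{H_T}\sum_{|\alpha|\le m}|D^\alpha\psi|^2$. The same notation is used for functions independent of $t$. Regularity condition of order $m$ (with constants $M_0,\dots,M_m$): $p_\lambda,q_\lambda,c,f,g\in\mathfrak B^m$ for all $\lambda\in\Lambda_1$ and, for $k=0,\dots,m$, $\sup_{H_T}\big(\sum_{\lambda\in\Lambda_1}(|D^kq_\lambda|^2+|D^kp_\lambda|^2)+|D^kc|^2\big)\le M_k^2$. Finite difference equation. $\delta_{h,\lambda}\varphi(x)=h^{-1}(\varphi(x+h\lambda)-\varphi(x))$,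 $L_h\varphi=\frac1h\sum_{\lambda\in\Lambda_1}q_\lambda\delta_{h,\lambda}\varphi+\sum_{\lambda\in\Lambda_1}p_\lambda\delta_{h,\lambda}\varphi-c\varphi$. Under the regularity condition, for each $h\in(0,h_0]$ the equation $u(t,x)=g(x)+\int_0^t(L_hu(s,x)+f(s,x))\,ds$, $(t,x)\in H_T$, has a unique bounded solution, denoted $u_h$. Structural notation. Fix $\tau_0>0$, numbers $\tau_\lambda\in[0,\infty)$ ($\lambda\in\Lambda_1$), $\delta\in(0,1]$, $K\in[1,\infty)$; $\|\Lambda_1\|^2:=\sum_{\lambda\in\Lambda_1}|\tau_\lambda\lambda|^2$. Let $\Lambda_2=\{\ell^1,\dots,\ell^d\}$ consist of distinct vectors not in $\Lambda_1$ and $\Lambda=\Lambda_1\cup\Lambda_2$. For $\lambda\in\Lambda_1$: $T_{h,\lambda}\varphi(x)=\varphi(x+h\lambda)$, $\bar\delta_{h,\lambda}=\tau_\lambda h^{-1}(T_{h,\lambda}-1)$; for $\ell^i\in\Lambda_2$: $T_{h,\ell^i}=1$ (identity), $\bar\delta_{h,\ell^i}=\tau_0D_i$. For $\lambda=(\lambda^1,\lambda^2)\in\Lambda^2$: $T_{h,\lambda}=T_{h,\lambda^1}T_{h,\lambda^2}$, $\bar\delta_{h,\lambda}=\bar\delta_{h,\lambda^1}\bar\delta_{h,\lambda^2}$. For $\mu\in\Lambda^k$, $k=1,2$: $Q_{h,\mu}\varphi=h^{-1}\sum_{\lambda\in\Lambda_1}(\bar\delta_{h,\mu}q_\lambda)\delta_{h,\lambda}\varphi$,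 $L^0_{h,\mu}\varphi=Q_{h,\mu}\varphi+\sum_{\lambda\in\Lambda_1}(\bar\delta_{h,\mu}p_\lambda)\delta_{h,\lambda}\varphi$. Further $A_h(\varphi)=2\sum_{\lambda\in\Lambda}(\bar\delta_{h,\lambda}\varphi)L^0_{h,\lambda}T_{h,\lambda}\varphi$, $\mathcal Q_h(\varphi)=\sum_{\lambda\in\Lambda_1}(q_\lambda+hp_\lambda)(\delta_{h,\lambda}\varphi)^2$. $\mathfrak K$ is the set of bounded operators $\mathcal K_h=\mathcal K_h(t)$ mapping the space of bounded Borel functions on $\mathbb R^d$ into itself, preserving nonnegativity, with $\mathcal K_h1\le1$. First structural inequality of order $m$ ($m\ge1$): for any $h\in(0,h_0]$ there is $\mathcal K_h=\mathcal K_{h,m}\in\mathfrak K$ such that on $H_T$, for all smooth $\varphi$, $$mA_h(\varphi)\le(1-\delta)\sum_{\lambda\in\Lambda}\mathcal Q_h(\bar\delta_{h,\lambda}\varphi)+K\mathcal Q_h(\varphi)+2(1-\delta)c\,\mathcal K_h\Big(\sum_{\lambda\in\Lambda}|\bar\delta_{h,\lambda}\varphi|^2\Big).$$ Second structural inequality of order $m$ ($m\ge2$): for any $h\in(0,h_0]$ and $n=1,\dots,m$ there is $\mathcal K_h=\mathcal K_{h,n}\in\mathfrak K$ such that on $H_T$, for all smooth $\varphi$, $$n\sum_{\nu\in\Lambda}A_h(\bar\delta_{h,\nu}\varphi)+n(n-1)\sum_{\lambda\in\Lambda^2}(\bar\delta_{h,\lambda}\varphi)Q_{h,\lambda}T_{h,\lambda}\varphi\le(1-\delta)\sum_{\lambda\in\Lambda^2}\mathcal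 Q_h(\bar\delta_{h,\lambda}\varphi)+K\sum_{\lambda\in\Lambda}\mathcal Q_h(\bar\delta_{h,\lambda}\varphi)$$ $$+2(1-\delta)c\,\mathcal K_h\Big(\sum_{\lambda\in\Lambda^2}|\bar\delta_{h,\lambda}\varphi|^2\Big)+K\mathcal K_h\Big(\sum_{\lambda\in\Lambda}|\bar\delta_{h,\lambda}\varphi|^2\Big).$$ *)

theory Defs
  imports "HOL-Analysis.Analysis" "HOL-Probability.Essential_Supremum"
begin

text \<open>
  The dimension \<open>d\<close> has to be quantified inside the formula, because the constant in the estimate
  does not depend on it.  So \<open>\<real>\<^sup>d\<close> is not a type here but the carrier of the
  product measure space \<open>\<Pi>\<^sub>M i\<in>{..<d}. lborel\<close>, i.e. the set of extensional functions on \<open>{..<d}\<close>;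
  functions on \<open>\<real>\<^sup>d\<close> are total functions of which only the values on this carrier matter.
  The topology induced from the product topology of \<^typ>\<open>nat \<Rightarrow> real\<close> is the Euclidean one.
  Coordinates are numbered \<open>0,\<dots>,d-1\<close>.
\<close>

type_synonym vec = "nat \<Rightarrow> real"

definition Rd :: "nat \<Rightarrow> vec set" where
  "Rd d = ({..<d} \<rightarrow>\<^sub>E UNIV)"

definition Leb :: "nat \<Rightarrow> vec measure" where
  "Leb d = PiM {..<d} (\<lambda>_. lborel)"

definition vzero :: "nat \<Rightarrow> vec" where
  "vzero d = (\<lambda>i\<in>{..<d}. 0)"

definition vneg :: "nat \<Rightarrow> vec \<Rightarrow> vec" where
  "vneg d v = (\<lambda>i\<in>{..<d}. - v i)"

definition shift :: "nat \<Rightarrow> real \<Rightarrow> vec \<Rightarrow> vec \<Rightarrow> vec" where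
  "shift d h l x = (\<lambda>i\<in>{..<d}. x i + h * l i)"

definition vnorm :: "nat \<Rightarrow> vec \<Rightarrow> real" where
  "vnorm d v = sqrt (\<Sum>i<d. (v i)\<^sup>2)"

definition bounded_borel :: "nat \<Rightarrow> (vec \<Rightarrow> real) \<Rightarrow> bool" where
  "bounded_borel d \<psi> \<longleftrightarrow> \<psi> \<in> borel_measurable (Leb d) \<and> bounded (\<psi> ` Rd d)"


subsection \<open>Classical partial derivatives\<close>

definition pd :: "nat \<Rightarrow> (vec \<Rightarrow> real) \<Rightarrow> vec \<Rightarrow> real" where
  "pd i \<phi> x = deriv (\<lambda>s. \<phi> (x(i := s))) (x i)"

text \<open>All iterated partial derivatives of order at most \<open>r\<close>, in whatever order, exist.\<close>

definition has_partials :: "nat \<Rightarrow> nat \<Rightarrow> (vec \<Rightarrow> real) \<Rightarrow> bool" where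
  "has_partials d r \<phi> \<longleftrightarrow>
     (\<forall>is i x. set is \<subseteq> {..<d} \<longrightarrow> length is < r \<longrightarrow> i < d \<longrightarrow> x \<in> Rd d \<longrightarrow>
        (\<lambda>s. foldr pd is \<phi> (x(i := s))) differentiable (at (x i)))"

definition smooth :: "nat \<Rightarrow> (vec \<Rightarrow> real) \<Rightarrow> bool" where
  "smooth d \<phi> \<longleftrightarrow> (\<forall>r. has_partials d r \<phi>) \<and>
     (\<forall>is. set is \<subseteq> {..<d} \<longrightarrow> continuous_on (Rd d) (foldr pd is \<phi>))"

definition multi_index :: "nat \<Rightarrow> nat \<Rightarrow> (nat \<Rightarrow> nat) set" where
  "multi_index d k = {\<alpha> \<in> {..<d} \<rightarrow>\<^sub>E {..k}. (\<Sum>i<d. \<alpha> i) = k}"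

definition Dmulti :: "nat \<Rightarrow> (nat \<Rightarrow> nat) \<Rightarrow> (vec \<Rightarrow> real) \<Rightarrow> vec \<Rightarrow> real" where
  "Dmulti d \<alpha> \<phi> = foldr (\<lambda>i. pd i ^^ \<alpha> i) [0..<d] \<phi>"


subsection \<open>Generalized derivatives and the spaces \<open>\<BB>\<^sup>m\<close>\<close>

definition test_function :: "nat \<Rightarrow> (vec \<Rightarrow> real) \<Rightarrow> bool" where
  "test_function d \<phi> \<longleftrightarrow> smooth d \<phi> \<and>
     (\<exists>C. compact C \<and> C \<subseteq> Rd d \<and> (\<forall>x\<in>Rd d - C. \<phi> x = 0))"

definition locally_integrable :: "nat \<Rightarrow> (vec \<Rightarrow> real) \<Rightarrow> bool" where
  "locally_integrable d w \<longleftrightarrow> w \<in> borel_measurable (Leb d) \<and>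
     (\<forall>C. compact C \<longrightarrow> C \<subseteq> Rd d \<longrightarrow> set_integrable (Leb d) C w)"

definition has_gderiv :: "nat \<Rightarrow> (nat \<Rightarrow> nat) \<Rightarrow> (vec \<Rightarrow> real) \<Rightarrow> (vec \<Rightarrow> real) \<Rightarrow> bool" where
  "has_gderiv d \<alpha> \<psi> w \<longleftrightarrow> locally_integrable d \<psi> \<and> locally_integrable d w \<and>
     (\<forall>\<phi>. test_function d \<phi> \<longrightarrow>
        (LINT x|Leb d. \<psi> x * Dmulti d \<alpha> \<phi> x) =
        (- 1) ^ (\<Sum>i<d. \<alpha> i) * (LINT x|Leb d. w x * \<phi> x))"

text \<open>A version of the generalized derivative; it is determined up to null sets.\<close>

definition gderiv :: "nat \<Rightarrow> (nat \<Rightarrow> nat) \<Rightarrow> (vec \<Rightarrow> real) \<Rightarrow> vec \<Rightarrow> real" where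
  "gderiv d \<alpha> \<psi> = (SOME w. has_gderiv d \<alpha> \<psi> w)"

definition gDnorm_sq :: "nat \<Rightarrow> nat \<Rightarrow> (vec \<Rightarrow> real) \<Rightarrow> vec \<Rightarrow> real" where
  "gDnorm_sq d k \<psi> x = (\<Sum>\<alpha>\<in>multi_index d k. (gderiv d \<alpha> \<psi> x)\<^sup>2)"

text \<open>
  The supremum over \<open>[0,T] \<times> \<real>\<^sup>d\<close> of an expression in generalized \<open>x\<close>-derivatives: for
  every \<open>t\<close> these are defined up to Lebesgue null sets in \<open>x\<close>, hence the essential supremum in \<open>x\<close>.
\<close>

definition sup_H :: "nat \<Rightarrow> real \<Rightarrow> (real \<Rightarrow> vec \<Rightarrow> real) \<Rightarrow> ereal" where
  "sup_H d T F = (SUP t\<in>{0..T}. esssup (Leb d) (\<lambda>x. ereal (F t x)))"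

definition borel_on :: "nat \<Rightarrow> real set \<Rightarrow> (real \<Rightarrow> vec \<Rightarrow> real) \<Rightarrow> bool" where
  "borel_on d I \<psi> \<longleftrightarrow> case_prod \<psi> \<in> borel_measurable (restrict_space borel I \<Otimes>\<^sub>M PiM {..<d} (\<lambda>_. borel))"

definition B_space :: "nat \<Rightarrow> real \<Rightarrow> nat \<Rightarrow> (real \<Rightarrow> vec \<Rightarrow> real) set" where
  "B_space d T m = {\<psi>. borel_on d {0..T} \<psi> \<and>
     (\<exists>C. \<forall>t\<in>{0..T}. \<forall>x\<in>Rd d. \<bar>\<psi> t x\<bar> \<le> C) \<and>
     (\<forall>t\<in>{0..T}. continuous_on (Rd d) (\<psi> t)) \<and>
     (\<forall>k\<le>m. \<forall>\<alpha>\<in>multi_index d k.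
        (\<forall>t\<in>{0..T}. \<exists>w. has_gderiv d \<alpha> (\<psi> t) w) \<and>
        sup_H d T (\<lambda>t x. \<bar>gderiv d \<alpha> (\<psi> t) x\<bar>) < \<infinity>)}"

text \<open>Meaningful for \<open>\<psi> \<in> B_space d T m\<close>, where the supremum is finite.\<close>

definition B_norm :: "nat \<Rightarrow> real \<Rightarrow> nat \<Rightarrow> (real \<Rightarrow> vec \<Rightarrow> real) \<Rightarrow> real" where
  "B_norm d T m \<psi> = sqrt (real_of_ereal (sup_H d T (\<lambda>t x. \<Sum>k\<le>m. gDnorm_sq d k (\<psi> t) x)))"

definition regularity ::
  "nat \<Rightarrow> real \<Rightarrow> vec set \<Rightarrow> (vec \<Rightarrow> real \<Rightarrow> vec \<Rightarrow> real) \<Rightarrow> (vec \<Rightarrow> real \<Rightarrow> vec \<Rightarrow> real) \<Rightarrow>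
   (real \<Rightarrow> vec \<Rightarrow> real) \<Rightarrow> (real \<Rightarrow> vec \<Rightarrow> real) \<Rightarrow> (vec \<Rightarrow> real) \<Rightarrow> nat \<Rightarrow> (nat \<Rightarrow> real) \<Rightarrow> bool" where
  "regularity d T \<Lambda>1 q p c f g m M \<longleftrightarrow>
     (\<forall>l\<in>\<Lambda>1. q l \<in> B_space d T m \<and> p l \<in> B_space d T m) \<and>
     c \<in> B_space d T m \<and> f \<in> B_space d T m \<and> (\<lambda>_. g) \<in> B_space d T m \<and>
     (\<forall>k\<le>m. sup_H d T (\<lambda>t x. (\<Sum>l\<in>\<Lambda>1. gDnorm_sq d k (q l t) x + gDnorm_sq d k (p l t) x)
                             + gDnorm_sq d k (c t) x) \<le> ereal ((M k)\<^sup>2))"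


subsection \<open>Derivatives with respect to the parameter \<open>h\<close>\<close>

text \<open>One-sided at the right end point of \<open>(0,h0]\<close>.\<close>

definition Dh :: "real \<Rightarrow> (real \<Rightarrow> real) \<Rightarrow> real \<Rightarrow> real" where
  "Dh h0 F h = vector_derivative F (at h within {0<..h0})"

definition has_h_derivs :: "real \<Rightarrow> nat \<Rightarrow> (real \<Rightarrow> real) \<Rightarrow> bool" where
  "has_h_derivs h0 k F \<longleftrightarrow>
     (\<forall>j<k. \<forall>h\<in>{0<..h0}. (Dh h0 ^^ j) F differentiable (at h within {0<..h0}))"


subsection \<open>Positive contractions of the space of bounded Borel functions\<close>

text \<open>Equality on the carrier is respected automatically, by linearity and positivity.\<close>

definition K_ops :: "nat \<Rightarrow> ((vec \<Rightarrow> real) \<Rightarrow> vec \<Rightarrow> real) set" where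
  "K_ops d = {P.
     (\<forall>\<psi>. bounded_borel d \<psi> \<longrightarrow> bounded_borel d (P \<psi>)) \<and>
     (\<forall>\<psi> \<xi> a b. bounded_borel d \<psi> \<longrightarrow> bounded_borel d \<xi> \<longrightarrow>
        (\<forall>x\<in>Rd d. P (\<lambda>y. a * \<psi> y + b * \<xi> y) x = a * P \<psi> x + b * P \<xi> x)) \<and>
     (\<exists>C. \<forall>\<psi> b. bounded_borel d \<psi> \<longrightarrow> (\<forall>x\<in>Rd d. \<bar>\<psi> x\<bar> \<le> b) \<longrightarrow> (\<forall>x\<in>Rd d. \<bar>P \<psi> x\<bar> \<le> C * b)) \<and>
     (\<forall>\<psi>. bounded_borel d \<psi> \<longrightarrow> (\<forall>x\<in>Rd d. 0 \<le> \<psi> x) \<longrightarrow> (\<forall>x\<in>Rd d. 0 \<le> P \<psi> x)) \<and>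
     (\<forall>x\<in>Rd d. P (\<lambda>_. 1) x \<le> 1)}"


subsection \<open>Finite difference operators\<close>

definition tuples :: "vec set \<Rightarrow> nat \<Rightarrow> vec list set" where
  "tuples \<Lambda> k = {\<mu>. set \<mu> \<subseteq> \<Lambda> \<and> length \<mu> = k}"

locale scheme =
  fixes d :: nat
    and \<Lambda>1 :: "vec set"
    and ell :: "nat \<Rightarrow> vec" \<comment> \<open>\<open>ell i\<close>, \<open>i < d\<close>, enumerates \<open>\<Lambda>\<^sub>2\<close>\<close>
    and \<tau>0 :: real
    and \<tau> :: "vec \<Rightarrow> real"
    and q p :: "vec \<Rightarrow> real \<Rightarrow> vec \<Rightarrow> real"
    and c :: "real \<Rightarrow> vec \<Rightarrow> real"
begin

definition \<delta>d :: "real \<Rightarrow> vec \<Rightarrow> (vec \<Rightarrow> real) \<Rightarrow> vec \<Rightarrow> real" where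
  "\<delta>d h l \<phi> x = (\<phi> (shift d h l x) - \<phi> x) / h"

definition Lh :: "real \<Rightarrow> real \<Rightarrow> (vec \<Rightarrow> real) \<Rightarrow> vec \<Rightarrow> real" where
  "Lh h t \<phi> x = 1 / h * (\<Sum>l\<in>\<Lambda>1. q l t x * \<delta>d h l \<phi> x) + (\<Sum>l\<in>\<Lambda>1. p l t x * \<delta>d h l \<phi> x) - c t x * \<phi> x"

definition bounded_solution ::
  "real \<Rightarrow> (real \<Rightarrow> vec \<Rightarrow> real) \<Rightarrow> (vec \<Rightarrow> real) \<Rightarrow> real \<Rightarrow> (real \<Rightarrow> vec \<Rightarrow> real) \<Rightarrow> bool" where
  "bounded_solution T f g h u \<longleftrightarrow>
     (\<exists>C. \<forall>t\<in>{0..T}. \<forall>x\<in>Rd d. \<bar>u t x\<bar> \<le> C) \<and>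
     (\<forall>t\<in>{0..T}. \<forall>x\<in>Rd d.
        set_integrable lborel {0..t} (\<lambda>s. Lh h s (u s) x + f s x) \<and>
        u t x = g x + (LBINT s:{0..t}. Lh h s (u s) x + f s x))"

definition \<Lambda> :: "vec set" where
  "\<Lambda> = \<Lambda>1 \<union> ell ` {..<d}"

definition Th1 :: "real \<Rightarrow> vec \<Rightarrow> (vec \<Rightarrow> real) \<Rightarrow> vec \<Rightarrow> real" where
  "Th1 h l \<phi> x = (if l \<in> \<Lambda>1 then \<phi> (shift d h l x) else \<phi> x)"

definition dbar1 :: "real \<Rightarrow> vec \<Rightarrow> (vec \<Rightarrow> real) \<Rightarrow> vec \<Rightarrow> real" where
  "dbar1 h l \<phi> x =
     (if l \<in> \<Lambda>1 then \<tau> l / h * (\<phi> (shift d h l x) - \<phi> x)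
      else \<tau>0 * pd (inv_into {..<d} ell l) \<phi> x)"

text \<open>Elements of \<open>\<Lambda>\<^sup>k\<close> are lists of length \<open>k\<close>; an element of \<open>\<Lambda>\<close> is a list of length one.\<close>

definition Th :: "real \<Rightarrow> vec list \<Rightarrow> (vec \<Rightarrow> real) \<Rightarrow> vec \<Rightarrow> real" where
  "Th h \<mu> = foldr (Th1 h) \<mu>"

definition dbar :: "real \<Rightarrow> vec list \<Rightarrow> (vec \<Rightarrow> real) \<Rightarrow> vec \<Rightarrow> real" where
  "dbar h \<mu> = foldr (dbar1 h) \<mu>"

definition Qmu :: "real \<Rightarrow> real \<Rightarrow> vec list \<Rightarrow> (vec \<Rightarrow> real) \<Rightarrow> vec \<Rightarrow> real" where
  "Qmu h t \<mu> \<phi> x = 1 / h * (\<Sum>l\<in>\<Lambda>1. dbar h \<mu> (q l t) x * \<delta>d h l \<phi> x)"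

definition L0mu :: "real \<Rightarrow> real \<Rightarrow> vec list \<Rightarrow> (vec \<Rightarrow> real) \<Rightarrow> vec \<Rightarrow> real" where
  "L0mu h t \<mu> \<phi> x = Qmu h t \<mu> \<phi> x + (\<Sum>l\<in>\<Lambda>1. dbar h \<mu> (p l t) x * \<delta>d h l \<phi> x)"

definition Ah :: "real \<Rightarrow> real \<Rightarrow> (vec \<Rightarrow> real) \<Rightarrow> vec \<Rightarrow> real" where
  "Ah h t \<phi> x = 2 * (\<Sum>\<mu>\<in>tuples \<Lambda> 1. dbar h \<mu> \<phi> x * L0mu h t \<mu> (Th h \<mu> \<phi>) x)"

definition Qform :: "real \<Rightarrow> real \<Rightarrow> (vec \<Rightarrow> real) \<Rightarrow> vec \<Rightarrow> real" where
  "Qform h t \<phi> x = (\<Sum>l\<in>\<Lambda>1. (q l t x + h * p l t x) * (\<delta>d h l \<phi> x)\<^sup>2)"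

definition dbar_sq :: "real \<Rightarrow> nat \<Rightarrow> (vec \<Rightarrow> real) \<Rightarrow> vec \<Rightarrow> real" where
  "dbar_sq h k \<phi> x = (\<Sum>\<mu>\<in>tuples \<Lambda> k. \<bar>dbar h \<mu> \<phi> x\<bar>\<^sup>2)"

text \<open>
  The operators in \<open>K_ops\<close> act on bounded Borel functions only, so in the two structural
  inequalities \<open>\<phi>\<close> ranges over those smooth functions for which the right-hand side is defined.
\<close>

definition first_structural :: "real \<Rightarrow> real \<Rightarrow> real \<Rightarrow> real \<Rightarrow> nat \<Rightarrow> bool" where
  "first_structural h0 T \<delta> K m \<longleftrightarrow>
     (\<forall>h\<in>{0<..h0}. \<exists>P. (\<forall>t\<in>{0..T}. P t \<in> K_ops d) \<and>
        (\<forall>t\<in>{0..T}. \<forall>x\<in>Rd d. \<forall>\<phi>. smooth d \<phi> \<longrightarrow> bounded_borel d (dbar_sq h 1 \<phi>) \<longrightarrow>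
           real m * Ah h t \<phi> x
           \<le> (1 - \<delta>) * (\<Sum>\<mu>\<in>tuples \<Lambda> 1. Qform h t (dbar h \<mu> \<phi>) x)
             + K * Qform h t \<phi> x
             + 2 * (1 - \<delta>) * c t x * P t (dbar_sq h 1 \<phi>) x))"

definition second_structural :: "real \<Rightarrow> real \<Rightarrow> real \<Rightarrow> real \<Rightarrow> nat \<Rightarrow> bool" where
  "second_structural h0 T \<delta> K m \<longleftrightarrow>
     (\<forall>h\<in>{0<..h0}. \<forall>n\<in>{1..m}. \<exists>P. (\<forall>t\<in>{0..T}. P t \<in> K_ops d) \<and>
        (\<forall>t\<in>{0..T}. \<forall>x\<in>Rd d. \<forall>\<phi>. smooth d \<phi> \<longrightarrow>
           bounded_borel d (dbar_sq h 1 \<phi>) \<longrightarrow> bounded_borel d (dbar_sq h 2 \<phi>) \<longrightarrow>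
           real n * (\<Sum>\<nu>\<in>tuples \<Lambda> 1. Ah h t (dbar h \<nu> \<phi>) x)
           + real n * (real n - 1) * (\<Sum>\<mu>\<in>tuples \<Lambda> 2. dbar h \<mu> \<phi> x * Qmu h t \<mu> (Th h \<mu> \<phi>) x)
           \<le> (1 - \<delta>) * (\<Sum>\<mu>\<in>tuples \<Lambda> 2. Qform h t (dbar h \<mu> \<phi>) x)
             + K * (\<Sum>\<mu>\<in>tuples \<Lambda> 1. Qform h t (dbar h \<mu> \<phi>) x)
             + 2 * (1 - \<delta>) * c t x * P t (dbar_sq h 2 \<phi>) x
             + K * P t (dbar_sq h 1 \<phi>) x))"

end

end

theory Submission
 imports Defs "HOL-Real_Asymp.Real_Asymp" "HOL-Combinatorics.Multiset_Permutations"
begin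

text \<open>
  The mesh size \<open>h\<close> is treated as one more space coordinate. For mollified data Picard iteration on a slab
  \<open>\<eta> < h < H\<close> gives solutions that are smooth in \<open>(h, x)\<close> jointly. The structural inequalities are linear in the
  coefficients, so they survive mollification after \<open>\<K>\<close> has been replaced by a supremum bound; with them the
  maximum principle applies to the energies \<open>\<Sum> |\<delta>\<^sub>\<mu> u|\<^sup>2\<close> over all tuples \<open>\<mu>\<close> of length \<open>n \<le> m\<close> and bounds the
  \<open>x\<close>-derivatives of \<open>u\<^sub>h\<close> independently of \<open>h\<close>, of the dimension and of the mollification.

  By Taylor's formula and the symmetry of the coefficients \<open>L\<^sub>h\<close> is an average of second order differential operators
  along \<open>h\<lambda>\<close>, so its \<open>j\<close>-th derivative in \<open>h\<close> costs \<open>j + 2 \<le> 3j\<close> derivatives in \<open>x\<close>, and for odd \<open>j\<close> one more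
  derivative buys a factor \<open>h\<close>. Differentiating the equation \<open>k\<close> times in \<open>h\<close> and induction on \<open>k\<close> yield the estimate,
  with the factor \<open>h\<close> for odd \<open>k\<close>, because either the order of the derivative
  that falls on \<open>L\<^sub>h\<close> or that of the one on \<open>u\<^sub>h\<close> is odd.
  The mollification is removed by means of uniform Lipschitz bounds on the highest derivatives.
\<close>

text \<open>The constant may depend neither on the dimension nor on the number of directions. Hence
  derivatives are indexed by lists, which split under the Leibniz rule with plain binomial weights,
  and whole families of derivatives are estimated at once by Cauchy-Schwarz and duality, never term
  by term. Vectors are total functions on the naturals, so coordinate \<open>d\<close> of a point of
  R^d is free to carry the mesh size. The slab stays away from h = 0 because of the coefficients
  1/h^2, but the estimates on a slice of constant h do not see its lower end \<open>et\<close>. The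
  one exception is the derivative of order k + 1 in h: with 3k + 1 \<le> m there may be too few
  x-derivatives for a uniform bound on it, yet some bound is needed for the k-th derivatives of the
  approximations to converge to that of u_h. A bound that depends on \<open>et\<close> suffices for
  this.\<close>

abbreviation time_measurable :: "real => (real => real) set" where
 "time_measurable T \<equiv> borel_measurable (restrict_space borel {0..T})"

section \<open>Coordinatewise differential calculus\<close>

lemma taylor_lipschitz_deriv:
 fixes f f' :: "real => real"
 assumes "convex S"
  and d: "!!x. x : S ==> (f has_real_derivative f' x) (at x within S)"
  and L: "!!x y. x : S ==> y : S ==> \<bar>f' x - f' y\<bar> <= C * \<bar>x - y\<bar>"
  and x: "x : S" and y: "y : S"
 shows "\<bar>f y - f x - (y - x) * f' x\<bar> <= C * (y - x)^2"
proof -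
 have sub: "closed_segment x y \<subseteq> S"
  using assms closed_segment_subset by blast
 have C0: "0 <= C * \<bar>x - y\<bar>" using L[OF x y] by linarith
 have "norm ((f y - y * f' x) - (f x - x * f' x)) <= (C * \<bar>x - y\<bar>) * norm (y - x)"
 proof (rule field_differentiable_bound[where S = "closed_segment x y" and f' = "%z. f' z - f' x"])
  fix z assume z: "z : closed_segment x y"
  have "(f has_real_derivative f' z) (at z within closed_segment x y)"
   using d[of z] z sub DERIV_subset by blast
  thus "((%z. f z - z * f' x) has_field_derivative f' z - f' x) (at z within closed_segment x y)"
   by (auto intro!: derivative_eq_intros)
  have zx: "\<bar>z - x\<bar> <= \<bar>x - y\<bar>"
   using segment_bound1[OF z] by (simp add: abs_minus_commute)
  show "norm (f' z - f' x) <= C * \<bar>x - y\<bar>"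
  proof (cases "z = x")
   case False
   have "0 <= C * \<bar>z - x\<bar>" using L[of z x] z sub x by fastforce
   hence "0 <= C" using False by (simp add: zero_le_mult_iff)
   thus ?thesis using L[of z x] z sub x zx
    by (smt (verit) mult_left_mono real_norm_def subsetD)
  qed (use C0 in simp)
 qed auto
 moreover have "\<bar>x - y\<bar> * norm (y - x) = (y - x)^2"
  by (simp add: abs_minus_commute[of x y] power2_eq_square)
 hence "C * \<bar>x - y\<bar> * norm (y - x) = C * (y - x)^2" by (simp only: mult.assoc)
 moreover have "(f y - y * f' x) - (f x - x * f' x) = f y - f x - (y - x) * f' x"
  by (simp add: algebra_simps)
 ultimately show ?thesis by (simp only: real_norm_def)
qed

text \<open>The common Lipschitz constant keeps difference quotients and derivatives within
  \<open>C * \<bar>y - x\<bar>\<close> of each other uniformly in n. So convergence of the quotients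
  at a single nearby y makes the derivatives at x a Cauchy sequence. Pointwise convergence of the
  functions is thus enough; all limits of smooth approximations rest on this.\<close>

lemma deriv_pointwise_limit:
 fixes f f' :: "nat => real => real"
 assumes S: "convex S"
  and d: "!!n x. x : S ==> (f n has_real_derivative f' n x) (at x within S)"
  and L: "!!n x y. x : S ==> y : S ==> \<bar>f' n x - f' n y\<bar> <= C * \<bar>x - y\<bar>"
  and lim: "!!x. x : S ==> (%n. f n x) \<longlonglongrightarrow> F x"
  and x: "x : S" and nt: "at x within S ~= bot"
 shows "EX l. (%n. f' n x) \<longlonglongrightarrow> l & (F has_real_derivative l) (at x within S)"
proof -
 have T: "\<bar>f n y - f n x - (y - x) * f' n x\<bar> <= C * (y - x)^2" if "y : S" for n y
  by (rule taylor_lipschitz_deriv[OF S d L x that])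
 have ne: "EX y:S. y ~= x & \<bar>y - x\<bar> < e" if "0 < e" for e
  using nt that unfolding trivial_limit_within islimpt_approachable dist_real_def by blast
 obtain y0 where y0: "y0 : S" "y0 ~= x" using ne[of 1] by auto
 have C0: "0 <= C"
 proof -
  have "0 <= C * (y0 - x)^2" using T[OF y0(1), of 0] by linarith
  thus ?thesis using y0 by (simp add: zero_le_mult_iff)
 qed
 have T': "\<bar>(f n y - f n x) / (y - x) - f' n x\<bar> <= C * \<bar>y - x\<bar>" if "y : S" "y ~= x" for n y
 proof -
  have "\<bar>(f n y - f n x) / (y - x) - f' n x\<bar> = \<bar>f n y - f n x - (y - x) * f' n x\<bar> / \<bar>y - x\<bar>"
   using that by (simp add: diff_divide_distrib flip: abs_divide)
  also have "... <= C * (y - x)^2 / \<bar>y - x\<bar>" using T[OF that(1)] by (intro divide_right_mono) auto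
  also have "... = C * \<bar>y - x\<bar>" using that by (simp add: power2_eq_square abs_if field_simps)
  finally show ?thesis .
 qed
 have "Cauchy (%n. f' n x)"
 proof (rule metric_CauchyI)
  fix e :: real assume e: "0 < e"
  \<comment> \<open>On this scale quotient and derivative differ by at most \<open>e / 4\<close>;
    the \<open>+ 1\<close> covers \<open>C = 0\<close>.\<close>
  have "0 < e / (4 * (C + 1))" using e C0 by simp
  from ne[OF this] obtain y where y: "y : S" "y ~= x" "\<bar>y - x\<bar> < e / (4 * (C + 1))" by blast
  have Cy: "C * \<bar>y - x\<bar> <= e / 4"
  proof -
   have "C * \<bar>y - x\<bar> <= (C + 1) * (e / (4 * (C + 1)))" using y C0 by (intro mult_mono) auto
   also have "... = e / 4" using C0 by (simp add: field_simps)
   finally show ?thesis .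
  qed
  have "convergent (%n. (f n y - f n x) / (y - x))"
   by (intro convergentI[of _ "(F y - F x) / (y - x)"] tendsto_intros lim x y) (use y in auto)
  hence "Cauchy (%n. (f n y - f n x) / (y - x))" by (rule convergent_Cauchy)
  from metric_CauchyD[OF this, of "e / 4"] e
  obtain N where N: "!!m n. m >= N ==> n >= N ==>
    dist ((f m y - f m x) / (y - x)) ((f n y - f n x) / (y - x)) < e / 4" by auto
  show "EX N. ALL m>=N. ALL n>=N. dist (f' m x) (f' n x) < e"
  proof (intro exI[of _ N] allI impI)
   fix m n assume "N <= m" "N <= n"
   from N[OF this] T'[OF y(1,2), of m] T'[OF y(1,2), of n] Cy
   show "dist (f' m x) (f' n x) < e"
    unfolding dist_real_def using e by linarith
  qed
 qed
 then obtain l where l: "(%n. f' n x) \<longlonglongrightarrow> l"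
  using Cauchy_convergent_iff convergent_def by blast
 have B: "\<bar>(F y - F x) / (y - x) - l\<bar> <= C * \<bar>y - x\<bar>" if "y : S" "y ~= x" for y
 proof (rule LIMSEQ_le_const2)
  show "(%n. \<bar>(f n y - f n x) / (y - x) - f' n x\<bar>) \<longlonglongrightarrow> \<bar>(F y - F x) / (y - x) - l\<bar>"
   by (intro tendsto_intros lim l x that) (use that in auto)
 qed (use T'[OF that] in auto)
 have "((%y. (F y - F x) / (y - x) - l) \<longlongrightarrow> 0) (at x within S)"
 proof (rule Lim_null_comparison)
  show "\<forall>\<^sub>F y in at x within S. norm ((F y - F x) / (y - x) - l) <= C * \<bar>y - x\<bar>"
   using B by (auto simp: eventually_at_filter)
  have "((%y. C * \<bar>y - x\<bar>) \<longlongrightarrow> C * \<bar>x - x\<bar>) (at x within S)" by (intro tendsto_intros)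
  thus "((%y. C * \<bar>y - x\<bar>) \<longlongrightarrow> 0) (at x within S)" by simp
 qed
 hence "(F has_real_derivative l) (at x within S)"
  unfolding has_field_derivative_iff by (simp add: Lim_null[symmetric])
 with l show ?thesis by blast
qed

text \<open>Dominated convergence along sequences approaching s. Measurability of the differentiated
  integrand is not a premise: it is a pointwise limit of measurable difference quotients, and later
  applications need it as a result.\<close>

lemma deriv_under_integral:
 fixes f f' :: "'a => real => real"
 assumes S: "open S" "convex S" "s : S"
  and d: "!!si s. si : space M ==> s : S ==> (f si has_real_derivative f' si s) (at s)"
  and b: "!!si s. si : space M ==> s : S ==> \<bar>f' si s\<bar> <= w si"
  and w: "integrable M w"
  and i: "!!s. s : S ==> integrable M (%si. f si s)"
 shows "(%si. f' si s) : borel_measurable M"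
  and "((%s. \<integral>si. f si s \<partial>M) has_real_derivative (\<integral>si. f' si s \<partial>M)) (at s)"
proof -
 have at: "at s within S = at s" using S at_within_open by blast
 have q: "((%y. (f si y - f si s) / (y - s)) \<longlongrightarrow> f' si s) (at s within S)" if "si : space M" for si
  using d[OF that S(3)] unfolding has_field_derivative_iff at .
 have seq: "(%n. (f si (X n) - f si s) / (X n - s)) \<longlonglongrightarrow> f' si s"
  if "si : space M" "ALL n. X n : S - {s}" "X \<longlonglongrightarrow> s" for si X
  using q[OF that(1)] that(2,3) unfolding tendsto_at_iff_sequentially by (auto simp: o_def)
 have m: "(%si. (f si y - f si s) / (y - s)) : borel_measurable M" if "y : S" for y
  using i[OF that] i[OF S(3)] by measurable
 have "EX X. (ALL n. X n : S - {s}) & X \<longlonglongrightarrow> s"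
 proof -
  have "s islimpt S" using S by (metis interior_limit_point interior_open)
  thus ?thesis unfolding islimpt_sequential by auto
 qed
 then obtain X where X: "ALL n. X n : S - {s}" "X \<longlonglongrightarrow> s" by blast
 show mf': "(%si. f' si s) : borel_measurable M"
  by (rule borel_measurable_LIMSEQ_real[where u = "%n si. (f si (X n) - f si s) / (X n - s)"])
   (use seq[OF _ X] m X in auto)
 have "((%y. ((\<integral>si. f si y \<partial>M) - (\<integral>si. f si s \<partial>M)) / (y - s)) \<longlongrightarrow> (\<integral>si. f' si s \<partial>M)) (at s within S)"
  unfolding tendsto_at_iff_sequentially
 proof (intro allI impI)
  fix X assume X: "ALL i. X i : S - {s}" "X \<longlonglongrightarrow> s"
  have "(%n. \<integral>si. (f si (X n) - f si s) / (X n - s) \<partial>M) \<longlonglongrightarrow> (\<integral>si. f' si s \<partial>M)"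
  proof (rule integral_dominated_convergence[OF mf' _ w])
   show "AE si in M. (%n. (f si (X n) - f si s) / (X n - s)) \<longlonglongrightarrow> f' si s"
    using seq[OF _ X] by auto
   show "(%si. (f si (X n) - f si s) / (X n - s)) : borel_measurable M" for n
    using m X by auto
   show "AE si in M. norm ((f si (X n) - f si s) / (X n - s)) <= w si" for n
   proof (rule AE_I2)
    fix si assume th: "si : space M"
    have Xn: "X n : S" "X n ~= s" using X by auto
    have "norm (f si (X n) - f si s) <= w si * norm (X n - s)"
     by (rule field_differentiable_bound[OF S(2)])
      (use th Xn S(3) d b in "auto intro: has_field_derivative_at_within")
    thus "norm ((f si (X n) - f si s) / (X n - s)) <= w si"
     using Xn by (simp add: divide_simps)
   qed
  qed
  moreover have "(\<integral>si. (f si (X n) - f si s) / (X n - s) \<partial>M)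
    = ((\<integral>si. f si (X n) \<partial>M) - (\<integral>si. f si s \<partial>M)) / (X n - s)" for n
  proof -
   have "X n : S" using X by auto
   from Bochner_Integration.integral_diff[OF i[OF this] i[OF S(3)]]
   show ?thesis by (simp only: integral_divide_zero)
  qed
  ultimately show "((%y. ((\<integral>si. f si y \<partial>M) - (\<integral>si. f si s \<partial>M)) / (y - s)) \<circ> X) \<longlonglongrightarrow> (\<integral>si. f' si s \<partial>M)"
   by (simp only: o_def)
 qed
 thus "((%s. \<integral>si. f si s \<partial>M) has_real_derivative (\<integral>si. f' si s \<partial>M)) (at s)"
  unfolding has_field_derivative_iff at .
qed

text \<open>One constant bounds all iterated partial derivatives up to order N in the directions of
  E, taken in any order. Differentiability is required along single coordinates only; continuity,
  when needed, follows from one further order, which gives a Lipschitz bound. Coordinates outside E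
  are mere parameters.\<close>

primrec BD :: "nat set => vec set => nat => real => (vec => real) => bool" where
 "BD E U 0 C ph \<longleftrightarrow> (ALL x:U. \<bar>ph x\<bar> <= C)"
| "BD E U (Suc N) C ph \<longleftrightarrow> (ALL x:U. \<bar>ph x\<bar> <= C) &
  (ALL i:E. (ALL x:U. (%s. ph (x(i := s))) differentiable (at (x i))) & BD E U N C (pd i ph))"

text \<open>The bound may depend on the order but is common to the whole index set, which is a time
  interval, or a one-point type when a single function is meant.\<close>

definition SM :: "nat set => vec set => 'i set => ('i => vec => real) => bool" where
 "SM E U I ph \<longleftrightarrow> (ALL N. EX C. ALL t:I. BD E U N C (ph t))"

definition tr :: "nat => real => vec => vec => vec" where
 "tr k s l x = (%i. if i < k then x i + s * l i else x i)"

definition Dl :: "nat => vec => (vec => real) => vec => real" where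
 "Dl k l ph x = (SUM i<k. l i * pd i ph x)"

text \<open>A domain with product structure in the directions of E: whether a changed coordinate
  leaves it does not depend on the others. This covers \<open>Rd d\<close>, the slab with the mesh
  size as a coordinate, and the whole space.\<close>

locale dom =
 fixes E :: "nat set" and U :: "vec set" and J :: "nat => real set"
 assumes open_J: "i : E ==> open (J i)"
  and convex_J: "i : E ==> convex (J i)"
  and upd_iff: "x : U ==> i : E ==> x(i := s) : U \<longleftrightarrow> s : J i"
  and U_ne: "U ~= {}"
begin

lemma mem_J: "x : U ==> i : E ==> x i : J i"
 using upd_iff[of x i "x i"] by simp

lemma pd_cong:
 assumes "!!x. x : U ==> ph x = ps x" "x : U" "i : E"
 shows "pd i ph x = pd i ps x"
proof -
 have "\<forall>\<^sub>F s in nhds (x i). s : J i"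
  using open_J mem_J assms eventually_nhds_in_open by blast
 hence "\<forall>\<^sub>F s in nhds (x i). ph (x(i := s)) = ps (x(i := s))"
  by eventually_elim (use assms upd_iff in auto)
 thus ?thesis unfolding pd_def by (rule deriv_cong_ev) simp
qed

lemma pd_eqI: "((%s. ph (x(i := s))) has_real_derivative D) (at (x i)) ==> pd i ph x = D"
 unfolding pd_def by (rule DERIV_imp_deriv)

lemma DERIV_cong_U:
 assumes "!!x. x : U ==> ph x = ps x" "x : U" "i : E"
  "((%s. ph (x(i := s))) has_real_derivative D) (at (x i))"
 shows "((%s. ps (x(i := s))) has_real_derivative D) (at (x i))"
proof -
 have "\<forall>\<^sub>F s in nhds (x i). s : J i"
  using open_J mem_J assms eventually_nhds_in_open by blast
 hence "\<forall>\<^sub>F s in nhds (x i). ph (x(i := s)) = ps (x(i := s))"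
  by eventually_elim (use assms upd_iff in auto)
 from DERIV_cong_ev[OF refl this refl, of D] show ?thesis using assms(4) by simp
qed

lemma BD_cong:
 assumes "!!x. x : U ==> ph x = ps x"
 shows "BD E U N C ph \<longleftrightarrow> BD E U N C ps"
 using assms
proof (induction N arbitrary: ph ps)
 case (Suc N)
 have "(%s. ph (x(i := s))) differentiable (at (x i)) \<longleftrightarrow> (%s. ps (x(i := s))) differentiable (at (x i))"
  if "x : U" "i : E" for x i
  using DERIV_cong_U[of ph ps x i] DERIV_cong_U[of ps ph x i] Suc.prems that
  unfolding real_differentiable_def by metis
 moreover have "BD E U N C (pd i ph) \<longleftrightarrow> BD E U N C (pd i ps)" if "i : E" for i
  by (rule Suc.IH, rule pd_cong[OF Suc.prems _ that])
 ultimately show ?case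
  unfolding BD.simps by (intro conj_cong ball_cong refl) (use Suc.prems in auto)
qed simp

lemma BD_bound: "BD E U N C ph ==> x : U ==> \<bar>ph x\<bar> <= C"
 by (cases N) auto

lemma BD_nonneg: "BD E U N C ph ==> 0 <= C"
 using U_ne BD_bound by (metis abs_ge_zero all_not_in_conv order_trans)

lemma BD_DERIV:
 assumes "BD E U (Suc N) C ph" "x : U" "i : E"
 shows "((%s. ph (x(i := s))) has_real_derivative pd i ph x) (at (x i))"
 using assms unfolding pd_def
 by (auto simp: DERIV_deriv_iff_real_differentiable)

lemma BD_DERIV_line:
 assumes "BD E U (Suc N) C ph" "x : U" "i : E" "s : J i"
 shows "((%s. ph (x(i := s))) has_real_derivative pd i ph (x(i := s))) (at s)"
 using BD_DERIV[of N C ph "x(i := s)" i] assms upd_iff by simp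

lemma BD_pd: "BD E U (Suc N) C ph ==> i : E ==> BD E U N C (pd i ph)"
 by simp

lemma BD_SucI:
 assumes "!!x. x : U ==> \<bar>ph x\<bar> <= C"
  and d: "!!i x. i : E ==> x : U ==> ((%s. ph (x(i := s))) has_real_derivative ps i x) (at (x i))"
  and B: "!!i. i : E ==> BD E U N C (ps i)"
 shows "BD E U (Suc N) C ph"
proof -
 have "BD E U N C (pd i ph)" if "i : E" for i
  using B[OF that] BD_cong[of "pd i ph" "ps i" N C] pd_eqI[of ph _ i, OF d[OF that]] by auto
 moreover have "(%s. ph (x(i := s))) differentiable (at (x i))" if "i : E" "x : U" for i x
  using d[OF that] real_differentiable_def by blast
 ultimately show ?thesis using assms(1) by simp
qed

lemma BD_mono: "BD E U N C ph ==> C <= C' ==> N' <= N ==> BD E U N' C' ph"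
proof (induction N' arbitrary: N ph)
 case 0 thus ?case using BD_bound by fastforce
next
 case (Suc N')
 then obtain N2 where N: "N = Suc N2" "N' <= N2" by (cases N) auto
 have "BD E U N' C' (pd i ph)" if "i : E" for i
  using Suc.IH[of N2 "pd i ph"] Suc.prems N that by simp
 thus ?case using Suc.prems N by simp fastforce
qed

lemma BD_foldr:
 "BD E U (N + length is) C ph ==> set is \<subseteq> E ==> BD E U N C (foldr pd is ph)"
proof (induction "is" arbitrary: N)
 case (Cons i "is")
 hence "BD E U (Suc N) C (foldr pd is ph)" by (simp del: BD.simps)
 thus ?case using Cons.prems BD_pd by simp
qed simp

lemma BD_const: "\<bar>a\<bar> <= C ==> BD E U N C (%_. a)"
proof (induction N arbitrary: a)
 case (Suc N)
 show ?case
  by (rule BD_SucI[where ps = "%_ _. 0"]) (use Suc in auto)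
qed auto

lemma BD_add:
 "BD E U N A a ==> BD E U N B b ==> BD E U N (A + B) (%x. a x + b x)"
proof (induction N arbitrary: a b)
 case 0 thus ?case by (auto intro!: order_trans[OF abs_triangle_ineq] add_mono)
next
 case (Suc N)
 show ?case
 proof (rule BD_SucI[where ps = "%i x. pd i a x + pd i b x"])
  show "\<bar>a x + b x\<bar> <= A + B" if "x : U" for x
   using Suc.prems that by (auto intro!: order_trans[OF abs_triangle_ineq] add_mono)
 qed (use Suc BD_DERIV[OF Suc.prems(1)] BD_DERIV[OF Suc.prems(2)] in "auto intro!: DERIV_add simp del: fun_upd_apply")
qed

lemma BD_mult:
 "BD E U N A a ==> BD E U N B b ==> BD E U N (2 ^ N * A * B) (%x. a x * b x)"
proof (induction N arbitrary: a b)
 case 0 thus ?case by (auto simp: abs_mult intro!: mult_mono)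
next
 case (Suc N)
 have nn: "0 <= A" "0 <= B" using Suc.prems BD_nonneg by blast+
 show ?case
 proof (rule BD_SucI[where ps = "%i x. pd i a x * b x + a x * pd i b x"])
  show "\<bar>a x * b x\<bar> <= 2 ^ Suc N * A * B" if "x : U" for x
  proof -
   have "\<bar>a x * b x\<bar> <= A * B" using Suc.prems that nn by (auto simp: abs_mult intro!: mult_mono)
   also have "... <= 2 ^ Suc N * A * B" using nn
    by (metis mult.assoc mult_le_cancel_right1 mult_nonneg_nonneg not_less one_le_numeral one_le_power)
   finally show ?thesis .
  qed
  show "((%s. a (x(i := s)) * b (x(i := s))) has_real_derivative pd i a x * b x + a x * pd i b x) (at (x i))"
   if "i : E" "x : U" for i x
   by (rule DERIV_cong[OF DERIV_mult[OF BD_DERIV[OF Suc.prems(1) that(2,1)] BD_DERIV[OF Suc.prems(2) that(2,1)]]])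
    (simp add: mult.commute)
  show "BD E U N (2 ^ Suc N * A * B) (%x. pd i a x * b x + a x * pd i b x)" if "i : E" for i
  proof -
   have "BD E U N (2 ^ N * A * B + 2 ^ N * A * B) (%x. pd i a x * b x + a x * pd i b x)"
    using Suc.prems that
    by (intro BD_add Suc.IH) (auto intro: BD_mono[of "Suc N"] simp del: BD.simps(2) intro: BD_pd)
   thus ?thesis by (simp only: power_Suc mult_2[symmetric] mult.assoc)
  qed
 qed
qed

lemma BD_cmult: "BD E U N A a ==> BD E U N (\<bar>k\<bar> * A) (%x. k * a x)"
proof (induction N arbitrary: a)
 case 0 thus ?case by (auto simp: abs_mult intro!: mult_mono)
next
 case (Suc N)
 show ?case
  by (rule BD_SucI[where ps = "%i x. k * pd i a x"])
   (use Suc BD_DERIV[OF Suc.prems] in "auto simp: abs_mult intro!: mult_mono DERIV_cmult")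
qed

lemma BD_sum:
 "finite S ==> (!!l. l : S ==> BD E U N (A l) (a l)) ==> BD E U N (SUM l:S. A l) (%x. SUM l:S. a l x)"
 by (induction S rule: finite_induct) (auto intro: BD_const BD_add simp del: BD.simps)

lemma foldr_pd_cong:
 assumes "!!x. x : U ==> a x = b x" "set js \<subseteq> E" "x : U"
 shows "foldr pd js a x = foldr pd js b x"
 using assms(2,3)
proof (induction js arbitrary: x)
 case (Cons j js)
 thus ?case using pd_cong[of "foldr pd js a" "foldr pd js b"] by simp
qed (use assms(1) in simp)

text \<open>A single integrable majorant \<open>w\<close> for all derivatives up to order N lets the
  integral be differentiated N times. It serves for time integrals, for the Picard series (counting
  measure) and for the Taylor averages along h\<lambda>.\<close>

lemma BD_integral:
 assumes "!!si. si : space M ==> BD E U N (w si) (ps si)" "integrable M w"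
  "!!x. x : U ==> (%si. ps si x) : borel_measurable M"
 shows "BD E U N (\<integral>si. w si \<partial>M) (%x. \<integral>si. ps si x \<partial>M)"
  and "!!is x. set is \<subseteq> E ==> length is <= N ==> x : U ==>
   (%si. foldr pd is (ps si) x) : borel_measurable M &
   foldr pd is (%x. \<integral>si. ps si x \<partial>M) x = (\<integral>si. foldr pd is (ps si) x \<partial>M)"
proof -
 have int: "integrable M (%si. ps si x)"
  if "!!si. si : space M ==> BD E U N (w si) (ps si)" "!!x. x : U ==> (%si. ps si x) : borel_measurable M" "x : U"
  for ps :: "'a => vec => real" and N x
  by (rule Bochner_Integration.integrable_bound[OF assms(2) that(2)[OF that(3)]])
   (use BD_bound[OF that(1) that(3)] in fastforce)
 have bd: "\<bar>\<integral>si. ps si x \<partial>M\<bar> <= (\<integral>si. w si \<partial>M)"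
  if "!!si. si : space M ==> BD E U N (w si) (ps si)" "!!x. x : U ==> (%si. ps si x) : borel_measurable M" "x : U"
  for ps :: "'a => vec => real" and N x
 proof -
  have "integrable M (%si. ps si x)" by (rule int[where N = N]) (use that in auto)
  hence "\<bar>\<integral>si. ps si x \<partial>M\<bar> <= (\<integral>si. \<bar>ps si x\<bar> \<partial>M)" "integrable M (%si. \<bar>ps si x\<bar>)"
   using integral_abs_bound by auto
  moreover have "(\<integral>si. \<bar>ps si x\<bar> \<partial>M) <= (\<integral>si. w si \<partial>M)"
   by (rule integral_mono[OF calculation(2) assms(2)]) (use BD_bound[OF that(1) that(3)] in auto)
  ultimately show ?thesis by linarith
 qed
 have du: "(%si. pd i (ps si) x) : borel_measurable M &
   ((%s. \<integral>si. ps si (x(i := s)) \<partial>M) has_real_derivative (\<integral>si. pd i (ps si) x \<partial>M)) (at (x i))"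
  if B: "!!si. si : space M ==> BD E U (Suc N) (w si) (ps si)"
   and m: "!!x. x : U ==> (%si. ps si x) : borel_measurable M" and x: "x : U" and i: "i : E"
  for ps :: "'a => vec => real" and N x i
 proof -
  have b: "\<bar>pd i (ps si) (x(i := s))\<bar> <= w si" if "si : space M" "s : J i" for si s
   using BD_bound[OF BD_pd[OF B[OF that(1)] i], of "x(i := s)"] upd_iff x i that by simp
  have n: "integrable M (%si. ps si (x(i := s)))" if "s : J i" for s
   using int[OF B m] upd_iff x i that by simp
  note * = deriv_under_integral[OF open_J[OF i] convex_J[OF i] mem_J[OF x i],
   where f' = "%si s. pd i (ps si) (x(i := s))" and f = "%si s. ps si (x(i := s))", OF BD_DERIV_line[OF B x i] b assms(2) n]
  show ?thesis using *[simplified] by simp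
 qed
 have "BD E U N (\<integral>si. w si \<partial>M) (%x. \<integral>si. ps si x \<partial>M) &
  (ALL is x. set is \<subseteq> E --> length is <= N --> x : U -->
   (%si. foldr pd is (ps si) x) : borel_measurable M &
   foldr pd is (%x. \<integral>si. ps si x \<partial>M) x = (\<integral>si. foldr pd is (ps si) x \<partial>M))"
  using assms(1,3)
 proof (induction N arbitrary: ps)
  case 0
  thus ?case using bd[of 0 ps] by simp
 next
  case (Suc N)
  have du': "(%si. pd i (ps si) x) : borel_measurable M &
   ((%s. \<integral>si. ps si (x(i := s)) \<partial>M) has_real_derivative (\<integral>si. pd i (ps si) x \<partial>M)) (at (x i))"
   if "x : U" "i : E" for x i
   by (rule du[where N = N]) (use Suc.prems that in auto)
  have bd': "\<bar>\<integral>si. ps si x \<partial>M\<bar> <= (\<integral>si. w si \<partial>M)" if "x : U" for x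
   by (rule bd[where N = "Suc N"]) (use Suc.prems that in auto)
  have IH: "BD E U N (\<integral>si. w si \<partial>M) (%x. \<integral>si. pd i (ps si) x \<partial>M) &
  (ALL is x. set is \<subseteq> E --> length is <= N --> x : U -->
   (%si. foldr pd is (pd i (ps si)) x) : borel_measurable M &
   foldr pd is (%x. \<integral>si. pd i (ps si) x \<partial>M) x = (\<integral>si. foldr pd is (pd i (ps si)) x \<partial>M))" if "i : E" for i
   by (rule Suc.IH) (use Suc.prems(1) du'[OF _ that] that in auto)
  have "BD E U (Suc N) (\<integral>si. w si \<partial>M) (%x. \<integral>si. ps si x \<partial>M)"
   by (rule BD_SucI[where ps = "%i x. \<integral>si. pd i (ps si) x \<partial>M"])
    (use bd' du' IH in auto)
  moreover have "(%si. foldr pd is (ps si) x) : borel_measurable M &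
   foldr pd is (%x. \<integral>si. ps si x \<partial>M) x = (\<integral>si. foldr pd is (ps si) x \<partial>M)"
   if "set is \<subseteq> E" "length is <= Suc N" "x : U" for "is" x
  proof (cases "is" rule: rev_exhaust)
   case Nil thus ?thesis using Suc.prems that by simp
  next
   case (snoc js i)
   have i: "i : E" "set js \<subseteq> E" "length js <= N" using snoc that by auto
   have "foldr pd js (pd i (%x. \<integral>si. ps si x \<partial>M)) x = foldr pd js (%x. \<integral>si. pd i (ps si) x \<partial>M) x"
   proof (rule foldr_pd_cong)
    fix y assume "y : U"
    from pd_eqI[OF conjunct2[OF du'[OF this i(1)]]]
    show "pd i (%x. \<integral>si. ps si x \<partial>M) y = (\<integral>si. pd i (ps si) y \<partial>M)" .
   qed (use i that in auto)
   thus ?thesis using IH[OF i(1)] i that snoc by simp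
  qed
  ultimately show ?case by blast
 qed
 thus "BD E U N (\<integral>si. w si \<partial>M) (%x. \<integral>si. ps si x \<partial>M)"
  and "!!is x. set is \<subseteq> E ==> length is <= N ==> x : U ==>
   (%si. foldr pd is (ps si) x) : borel_measurable M &
   foldr pd is (%x. \<integral>si. ps si x \<partial>M) x = (\<integral>si. foldr pd is (ps si) x \<partial>M)" by auto
qed

lemma BD_lip_line:
 assumes "BD E U (Suc N) C ph" "x : U" "i : E" "s : J i" "s' : J i"
 shows "\<bar>ph (x(i := s)) - ph (x(i := s'))\<bar> <= C * \<bar>s - s'\<bar>"
proof -
 have "norm (ph (x(i := s)) - ph (x(i := s'))) <= C * norm (s - s')"
 proof (rule field_differentiable_bound[OF convex_J[OF assms(3)]])
  show "((%s. ph (x(i := s))) has_field_derivative pd i ph (x(i := z))) (at z within J i)" if "z : J i" for z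
   using BD_DERIV_line[OF assms(1-3) that] has_field_derivative_at_within by blast
  show "norm (pd i ph (x(i := z))) <= C" if "z : J i" for z
   using BD_bound[OF BD_pd[OF assms(1,3)]] upd_iff assms that by simp
 qed (use assms in auto)
 thus ?thesis by simp
qed

text \<open>Bounds of order N + 1 make the derivatives up to order N Lipschitz uniformly in n, which
  is what \<open>deriv_pointwise_limit\<close> asks for; so exactly one order is lost in a pointwise
  limit.\<close>

lemma BD_limit:
 assumes "!!n. BD E U (Suc N) C (ph n)" "!!x. x : U ==> (%n. ph n x) \<longlonglongrightarrow> F x"
 shows "BD E U N C F"
  and "!!is x. set is \<subseteq> E ==> length is <= N ==> x : U ==> (%n. foldr pd is (ph n) x) \<longlonglongrightarrow> foldr pd is F x"
proof -
 have "BD E U N C F & (ALL is x. set is \<subseteq> E --> length is <= N --> x : U --> (%n. foldr pd is (ph n) x) \<longlonglongrightarrow> foldr pd is F x)"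
  using assms
 proof (induction N arbitrary: ph F)
  case 0
  have "\<bar>F x\<bar> <= C" if "x : U" for x
   by (rule LIMSEQ_le_const2[OF tendsto_rabs[OF 0(2)[OF that]]]) (use 0(1) that in auto)
  thus ?case using 0 by auto
 next
  case (Suc N)
  have b: "\<bar>F x\<bar> <= C" if "x : U" for x
   by (rule LIMSEQ_le_const2[OF tendsto_rabs[OF Suc.prems(2)[OF that]]]) (use Suc.prems(1) that in auto)
  have D: "(%n. pd i (ph n) x) \<longlonglongrightarrow> pd i F x & ((%s. F (x(i := s))) has_real_derivative pd i F x) (at (x i))"
   if x: "x : U" and i: "i : E" for x i
  proof -
   have at: "at z within J i = at z" if "z : J i" for z using open_J[OF i] that at_within_open by blast
   have "EX l. (%n. pd i (ph n) (x(i := x i))) \<longlonglongrightarrow> l & ((%s. F (x(i := s))) has_real_derivative l) (at (x i) within J i)"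
   proof (rule deriv_pointwise_limit[OF convex_J[OF i], where C = C and f = "%n s. ph n (x(i := s))" and f' = "%n s. pd i (ph n) (x(i := s))"])
    show "((%s. ph n (x(i := s))) has_real_derivative pd i (ph n) (x(i := z))) (at z within J i)" if "z : J i" for n z
     using BD_DERIV_line[OF Suc.prems(1) x i that] has_field_derivative_at_within by blast
    show "\<bar>pd i (ph n) (x(i := z)) - pd i (ph n) (x(i := y))\<bar> <= C * \<bar>z - y\<bar>" if "z : J i" "y : J i" for n z y
     by (rule BD_lip_line[OF BD_pd[OF Suc.prems(1) i] x i that])
    show "(%n. ph n (x(i := z))) \<longlonglongrightarrow> F (x(i := z))" if "z : J i" for z
    proof -
     have "x(i := z) : U" using upd_iff x i that by simp
     thus ?thesis by (rule Suc.prems(2))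
    qed
   qed (use at mem_J x i in auto)
   then obtain l where l: "(%n. pd i (ph n) x) \<longlonglongrightarrow> l" "((%s. F (x(i := s))) has_real_derivative l) (at (x i))"
    using at[OF mem_J[OF x i]] by auto
   thus ?thesis using pd_eqI[OF l(2)] by simp
  qed
  have IH: "BD E U N C (pd i F) & (ALL is x. set is \<subseteq> E --> length is <= N --> x : U --> (%n. foldr pd is (pd i (ph n)) x) \<longlonglongrightarrow> foldr pd is (pd i F) x)"
   if "i : E" for i
   by (rule Suc.IH) (use BD_pd[OF Suc.prems(1) that] D that in auto)
  have "BD E U (Suc N) C F"
   by (rule BD_SucI[where ps = "%i. pd i F"]) (use b D IH in auto)
  moreover have "(%n. foldr pd is (ph n) x) \<longlonglongrightarrow> foldr pd is F x" if "set is \<subseteq> E" "length is <= Suc N" "x : U" for "is" x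
  proof (cases "is" rule: rev_exhaust)
   case (snoc js i) thus ?thesis using IH[of i] that by auto
  qed (use Suc.prems(2) that in simp)
  ultimately show ?case by blast
 qed
 thus "BD E U N C F"
  and "!!is x. set is \<subseteq> E ==> length is <= N ==> x : U ==> (%n. foldr pd is (ph n) x) \<longlonglongrightarrow> foldr pd is F x" by auto
qed

text \<open>The derivative in direction j is a limit of difference quotients. Differentiated in
  direction i, these quotients are Lipschitz in coordinate i with constant C, by the bound on third
  derivatives and independently of the step. Hence \<open>deriv_pointwise_limit\<close> interchanges
  the i-derivative with the limit.\<close>

lemma pd_commute:
 assumes B: "BD E U 3 C ph" and x: "x : U" and i: "i : E" and j: "j : E"
 shows "pd i (pd j ph) x = pd j (pd i ph) x"
proof (cases "i = j")
 case ij: False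
 have B3: "BD E U (Suc (Suc (Suc 0))) C ph" using B by (simp add: numeral_3_eq_3)
 have "open (J j)" "x j : J j" using open_J j mem_J x by auto
 then obtain e where e: "0 < e" "ball (x j) e \<subseteq> J j" using openE by blast
 \<comment> \<open>The denominator \<open>n + 2\<close> keeps the increments strictly below
   \<open>e\<close>, so that all points stay in \<open>J j\<close>.\<close>
 define t where "t n = e / (real n + 2)" for n
 have t: "0 < t n" "t n < e" for n using e by (auto simp: t_def field_simps intro!: add_pos_nonneg)
 have tj: "x j + t n : J j" for n using t[of n] e(2) by (auto simp: dist_real_def subset_eq)
 have t0: "t \<longlonglongrightarrow> 0" unfolding t_def by real_asymp
 have U1: "x(i := s) : U" if "s : J i" for s using upd_iff x i that by simp
 have U2: "x(i := s, j := r) : U" if "s : J i" "r : J j" for s r using upd_iff[OF U1] i j that by simp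
 have xj: "x(i := s, j := x j) = x(i := s)" for s using ij by auto
 have sw: "x(i := s, j := r) = x(j := r, i := s)" for s r using ij by auto
 have Bi: "BD E U (Suc (Suc 0)) C (pd i ph)" by (rule BD_pd[OF B3 i])
 have Bii: "BD E U (Suc 0) C (pd i (pd i ph))" by (rule BD_pd[OF Bi i])
 have q: "(%n. (ps (x(i := s, j := x j + t n)) - ps (x(i := s))) / t n) \<longlonglongrightarrow> pd j ps (x(i := s))"
  if "BD E U (Suc N) C ps" "s : J i" for ps s N
 proof -
  have "((%r. ps (x(i := s, j := r))) has_real_derivative pd j ps (x(i := s))) (at (x j))"
   using BD_DERIV[OF that(1) U1[OF that(2)] j] ij by simp
  hence "((%h. (ps (x(i := s, j := x j + h)) - ps (x(i := s, j := x j))) / h) \<longlongrightarrow> pd j ps (x(i := s))) (at 0)"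
   by (simp add: DERIV_def)
  moreover have "filterlim t (at 0) sequentially"
   using t0 t by (simp add: filterlim_at less_imp_neq[symmetric])
  ultimately show ?thesis unfolding xj by (rule filterlim_compose)
 qed
 have at: "at z within J i = at z" if "z : J i" for z using open_J[OF i] that at_within_open by blast
 have "EX l. (%n. (%s. (pd i ph (x(i := s, j := x j + t n)) - pd i ph (x(i := s))) / t n) (x i)) \<longlonglongrightarrow> l
   & ((%s. pd j ph (x(i := s))) has_real_derivative l) (at (x i) within J i)"
 proof (rule deriv_pointwise_limit[OF convex_J[OF i], where C = C and f = "%n s. (ph (x(i := s, j := x j + t n)) - ph (x(i := s))) / t n"
   and f' = "%n s. (pd i ph (x(i := s, j := x j + t n)) - pd i ph (x(i := s))) / t n"])
  have xn: "x(j := x j + t n) : U" for n using upd_iff x j tj by simp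
  show "((%s. (ph (x(i := s, j := x j + t n)) - ph (x(i := s))) / t n) has_real_derivative
   (pd i ph (x(i := z, j := x j + t n)) - pd i ph (x(i := z))) / t n) (at z within J i)" if "z : J i" for n z
   unfolding sw using t[of n]
   by (intro DERIV_cdivide DERIV_diff has_field_derivative_at_within[OF BD_DERIV_line[OF B3]] xn x i that)
  show "\<bar>(pd i ph (x(i := z, j := x j + t n)) - pd i ph (x(i := z))) / t n - (pd i ph (x(i := y, j := x j + t n)) - pd i ph (x(i := y))) / t n\<bar> <= C * \<bar>z - y\<bar>"
   if "z : J i" "y : J i" for n z y
  proof -
   have "norm ((%s. (pd i ph (x(i := s, j := x j + t n)) - pd i ph (x(i := s))) / t n) z
     - (%s. (pd i ph (x(i := s, j := x j + t n)) - pd i ph (x(i := s))) / t n) y) <= C * norm (z - y)"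
   proof (rule field_differentiable_bound[OF convex_J[OF i]])
    show "((%s. (pd i ph (x(i := s, j := x j + t n)) - pd i ph (x(i := s))) / t n) has_field_derivative
    (pd i (pd i ph) (x(i := z, j := x j + t n)) - pd i (pd i ph) (x(i := z))) / t n) (at z within J i)" if "z : J i" for z
     unfolding sw using t[of n]
     by (intro DERIV_cdivide DERIV_diff has_field_derivative_at_within[OF BD_DERIV_line[OF Bi]] xn x i that)
    fix z assume z: "z : J i"
    have "\<bar>pd i (pd i ph) (x(i := z, j := x j + t n)) - pd i (pd i ph) (x(i := z, j := x j))\<bar> <= C * \<bar>x j + t n - x j\<bar>"
     by (rule BD_lip_line[OF Bii U1[OF z] j tj mem_J[OF x j]])
    thus "norm ((pd i (pd i ph) (x(i := z, j := x j + t n)) - pd i (pd i ph) (x(i := z))) / t n) <= C"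
     using t[of n] unfolding xj by (simp add: divide_simps)
   qed (use that in auto)
   thus ?thesis by simp
  qed
  show "(%n. (ph (x(i := z, j := x j + t n)) - ph (x(i := z))) / t n) \<longlonglongrightarrow> pd j ph (x(i := z))" if "z : J i" for z
   by (rule q[OF B3 that])
 qed (use at mem_J x i in auto)
 then obtain l where l: "(%n. (pd i ph (x(i := x i, j := x j + t n)) - pd i ph (x(i := x i))) / t n) \<longlonglongrightarrow> l"
  "((%s. pd j ph (x(i := s))) has_real_derivative l) (at (x i))"
  using at[OF mem_J[OF x i]] by auto
 have "l = pd j (pd i ph) x"
  using LIMSEQ_unique[OF l(1) q[OF Bi mem_J[OF x i]]] by simp
 thus ?thesis using pd_eqI[OF l(2)] by simp
qed simp

lemma mix_step: "(%i. if i < Suc k then z i else x i) = (%i. if i < k then z i else x i)(k := z k)" for z x :: vec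
 by (auto simp: less_Suc_eq)

lemma mix_mem:
 assumes "x : U" "!!i. i < k ==> i : E & z i : J i"
 shows "(%i. if i < k then z i else x i) : U"
 using assms(2)
proof (induction k)
 case (Suc k)
 thus ?case unfolding mix_step using upd_iff by simp
qed (use assms(1) in simp)

lemma BD_lip_multi:
 assumes B: "BD E U (Suc N) C ph" and x: "x : U" and z: "!!i. i < k ==> i : E & z i : J i"
 shows "\<bar>ph (%i. if i < k then z i else x i) - ph x\<bar> <= C * (SUM i<k. \<bar>z i - x i\<bar>)"
 using z
proof (induction k)
 case (Suc k)
 let ?y = "%i. if i < k then z i else x i"
 have y: "?y : U" using mix_mem[OF x] Suc.prems by simp
 have "\<bar>ph (?y(k := z k)) - ph (?y(k := x k))\<bar> <= C * \<bar>z k - x k\<bar>"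
  by (rule BD_lip_line[OF B y]) (use Suc.prems mem_J x in auto)
 moreover have "?y(k := x k) = ?y" by auto
 ultimately have "\<bar>ph (?y(k := z k)) - ph ?y\<bar> <= C * \<bar>z k - x k\<bar>" by simp
 moreover have "\<bar>ph ?y - ph x\<bar> <= C * (SUM i<k. \<bar>z i - x i\<bar>)" using Suc by simp
 ultimately show ?case unfolding mix_step sum.lessThan_Suc ring_distribs by linarith
qed simp

lemma BD_taylor_multi:
 assumes B: "BD E U 2 C ph" and x: "x : U" and z: "!!i. i < k ==> i : E & z i : J i"
 shows "\<bar>ph (%i. if i < k then z i else x i) - ph x - (SUM i<k. (z i - x i) * pd i ph x)\<bar> <= C * (SUM i<k. \<bar>z i - x i\<bar>)^2"
 using z
proof (induction k)
 case (Suc k)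
 have B2: "BD E U (Suc (Suc 0)) C ph" using B by (simp add: numeral_2_eq_2)
 have C0: "0 <= C" using BD_nonneg[OF B] .
 let ?y = "%i. if i < k then z i else x i"
 let ?S = "SUM i<k. \<bar>z i - x i\<bar>"
 let ?b = "z k - x k"
 have y: "?y : U" using mix_mem[OF x] Suc.prems by simp
 have k: "k : E" "z k : J k" using Suc.prems by auto
 have yk: "?y(k := x k) = ?y" by auto
 have "\<bar>ph (?y(k := z k)) - ph (?y(k := x k)) - (z k - x k) * pd k ph (?y(k := x k))\<bar> <= C * (z k - x k)^2"
 proof (rule taylor_lipschitz_deriv[OF convex_J[OF k(1)], where f = "%s. ph (?y(k := s))" and f' = "%s. pd k ph (?y(k := s))"])
  show "((%s. ph (?y(k := s))) has_real_derivative pd k ph (?y(k := s))) (at s within J k)" if "s : J k" for s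
   using BD_DERIV_line[OF B2 y k(1) that] has_field_derivative_at_within by blast
  show "\<bar>pd k ph (?y(k := s)) - pd k ph (?y(k := r))\<bar> <= C * \<bar>s - r\<bar>" if "s : J k" "r : J k" for s r
   by (rule BD_lip_line[OF BD_pd[OF B2 k(1)] y k(1) that])
 qed (use k mem_J x in auto)
 hence 1: "\<bar>ph (?y(k := z k)) - ph ?y - ?b * pd k ph ?y\<bar> <= C * ?b^2" unfolding yk .
 have "\<bar>pd k ph ?y - pd k ph x\<bar> <= C * ?S"
  by (rule BD_lip_multi[OF BD_pd[OF B2 k(1)] x]) (use Suc.prems in auto)
 hence "\<bar>?b\<bar> * \<bar>pd k ph ?y - pd k ph x\<bar> <= \<bar>?b\<bar> * (C * ?S)" by (rule mult_left_mono) simp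
 hence 2: "\<bar>?b * pd k ph ?y - ?b * pd k ph x\<bar> <= \<bar>?b\<bar> * (C * ?S)"
  by (simp add: abs_mult flip: right_diff_distrib)
 have 3: "\<bar>ph ?y - ph x - (SUM i<k. (z i - x i) * pd i ph x)\<bar> <= C * ?S^2" using Suc by simp
 have S0: "0 <= ?S" by (simp add: sum_nonneg)
 have "C * ?S^2 + C * ?b^2 + \<bar>?b\<bar> * (C * ?S) <= C * (?S + \<bar>?b\<bar>)^2"
 proof -
  have "C * (?S + \<bar>?b\<bar>)^2 = C * ?S^2 + C * ?b^2 + 2 * (\<bar>?b\<bar> * (C * ?S))"
   by (simp add: power2_eq_square algebra_simps)
  moreover have "0 <= \<bar>?b\<bar> * (C * ?S)" using C0 S0 by simp
  ultimately show ?thesis by linarith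
 qed
 thus ?case using 1 2 3 unfolding mix_step sum.lessThan_Suc by linarith
qed simp

lemma DERIV_dir:
 assumes B: "BD E U 2 C ph" and x: "x : U" and k: "!!i. i < k ==> i : E"
 shows "((%s. ph (tr k s l x)) has_real_derivative Dl k l ph x) (at 0)"
proof -
 have "\<forall>\<^sub>F s in at 0. ALL i:{..<k}. x i + s * l i : J i"
 proof (rule eventually_ball_finite)
  show "ALL i:{..<k}. \<forall>\<^sub>F s in at 0. x i + s * l i : J i"
  proof
   fix i assume "i : {..<k}"
   hence i: "i : E" using k by auto
   have "((%s. x i + s * l i) \<longlongrightarrow> x i + 0 * l i) (at 0)" by (intro tendsto_intros)
   thus "\<forall>\<^sub>F s in at 0. x i + s * l i : J i"
    using topological_tendstoD[OF _ open_J[OF i]] mem_J[OF x i] by simp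
  qed
 qed simp
 hence "\<forall>\<^sub>F s in at 0. norm ((ph (tr k s l x) - ph x) / s - Dl k l ph x) <= C * (SUM i<k. \<bar>l i\<bar>)^2 * \<bar>s\<bar>"
  using eventually_neq_at_within[of 0 0 UNIV]
 proof eventually_elim
  case (elim s)
  have "\<bar>ph (tr k s l x) - ph x - (SUM i<k. (s * l i) * pd i ph x)\<bar> <= C * (SUM i<k. \<bar>s * l i\<bar>)^2"
   using BD_taylor_multi[OF B x, of k "%i. x i + s * l i"] elim k unfolding tr_def by simp
  moreover have "(SUM i<k. (s * l i) * pd i ph x) = s * Dl k l ph x"
   by (simp add: Dl_def sum_distrib_left mult.assoc)
  moreover have "C * (SUM i<k. \<bar>s * l i\<bar>)^2 = C * (SUM i<k. \<bar>l i\<bar>)^2 * \<bar>s\<bar> * \<bar>s\<bar>"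
   by (simp add: abs_mult flip: sum_distrib_left) (simp add: power_mult_distrib power2_eq_square)
  ultimately have "\<bar>ph (tr k s l x) - ph x - s * Dl k l ph x\<bar> / \<bar>s\<bar> <= C * (SUM i<k. \<bar>l i\<bar>)^2 * \<bar>s\<bar>"
   using elim by (simp add: divide_simps)
  thus ?case using elim by (simp add: diff_divide_distrib flip: abs_divide)
 qed
 hence "((%s. (ph (tr k s l x) - ph x) / s - Dl k l ph x) \<longlongrightarrow> 0) (at 0)"
 proof (rule Lim_null_comparison)
  have "((%s. C * (SUM i<k. \<bar>l i\<bar>)^2 * \<bar>s\<bar>) \<longlongrightarrow> C * (SUM i<k. \<bar>l i\<bar>)^2 * \<bar>0\<bar>) (at 0)" by (intro tendsto_intros)
  thus "((%s. C * (SUM i<k. \<bar>l i\<bar>)^2 * \<bar>s\<bar>) \<longlongrightarrow> 0) (at 0)" by simp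
 qed
 hence "((%s. (ph (tr k s l x) - ph x) / s) \<longlongrightarrow> Dl k l ph x) (at 0)"
  by (simp add: Lim_null[symmetric])
 moreover have "tr k 0 l x = x" by (auto simp: tr_def)
 ultimately show ?thesis by (simp add: DERIV_def)
qed

end

section \<open>Primitives in time and the maximum principle\<close>

text \<open>The coefficients are merely measurable in time, so evolution equations are kept in
  integrated form. A bounded rate makes \<open>w\<close> Lipschitz, and sums, squares and
  x-derivatives stay within this class.\<close>

definition prim :: "real => (real => real) => (real => real) => bool" where
 "prim T w r \<longleftrightarrow> r : time_measurable T & (EX C. ALL t:{0..T}. \<bar>r t\<bar> <= C) &
  (ALL t:{0..T}. w t = w 0 + (LBINT s:{0..t}. r s))"

lemma bounded_measurable_set_integrable:
 fixes r :: "real => real"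
 assumes "r : time_measurable T" "!!t. t : {0..T} ==> \<bar>r t\<bar> <= C"
  "A \<subseteq> {0..T}" "A : sets borel"
 shows "set_integrable lborel A r"
proof -
 have "r : borel_measurable (restrict_space borel A)"
  using assms(1,3) measurable_restrict_mono by blast
 hence m: "(%s. indicator A s *\<^sub>R r s) : borel_measurable borel"
  using assms(4) by (subst (asm) borel_measurable_restrict_space_iff) auto
 have "emeasure lborel A <= emeasure lborel {0..T}" using assms(3) by (intro emeasure_mono) auto
 also have "... < \<infinity>" by (simp add: emeasure_lborel_Icc_eq)
 finally have fin: "emeasure lborel A < \<infinity>" .
 have "integrable lborel (%s. C * indicator A s :: real)"
  using fin assms(4) by (intro integrable_mult_right integrable_real_indicator) auto
 thus ?thesis unfolding set_integrable_def
  by (rule Bochner_Integration.integrable_bound)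
   (use m assms(2,3) in "auto simp: indicator_def intro!: AE_I2 order_trans[OF assms(2)]")
qed

lemma primI:
 assumes "r : time_measurable T" "!!t. t : {0..T} ==> \<bar>r t\<bar> <= C"
  "!!t. t : {0..T} ==> w t = w 0 + (LBINT s:{0..t}. r s)"
 shows "prim T w r"
 using assms unfolding prim_def by blast

lemma LBINT_point: "(LBINT s:{a::real}. r s) = (0::real)"
proof -
 have "AE s in lborel. indicator {a} s *\<^sub>R r s = 0"
  using AE_lborel_singleton[of a] by eventually_elim (auto simp: indicator_def)
 thus ?thesis unfolding set_lebesgue_integral_def by (rule integral_eq_zero_AE)
qed

lemma prim_LBINT:
 assumes "r : time_measurable T" "!!t. t : {0..T} ==> \<bar>r t\<bar> <= C"
 shows "prim T (%t. a + (LBINT s:{0..t}. r s)) r"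
 by (rule primI[OF assms]) (simp_all add: LBINT_point)

lemma prim_le:
 assumes p: "prim T w r" and st: "0 <= s" "s <= t" "t <= T" and B: "!!si. s < si ==> si <= t ==> r si <= B"
 shows "w t - w s <= B * (t - s)"
proof -
 from p obtain C where r: "r : time_measurable T" "!!t. t : {0..T} ==> \<bar>r t\<bar> <= C"
  and w: "!!t. t : {0..T} ==> w t = w 0 + (LBINT s:{0..t}. r s)" unfolding prim_def by blast
 have i: "set_integrable lborel A r" if "A \<subseteq> {0..T}" "A : sets borel" for A
  using bounded_measurable_set_integrable[OF r that] .
 have U: "{0..t} = {0..s} \<union> {s<..t}" using st by auto
 have "w t - w s = (LBINT s:{0..t}. r s) - (LBINT s:{0..s}. r s)" using w[of t] w[of s] st by simp
 also have "(LBINT s:{0..t}. r s) = (LBINT s:{0..s}. r s) + (LBINT si:{s<..t}. r si)"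
  unfolding U by (rule set_integral_Un) (use st in "auto intro!: i")
 also have "... - (LBINT s:{0..s}. r s) = (LBINT si:{s<..t}. r si)" by simp
 also have "... <= (LBINT si:{s<..t}. B)"
 proof (rule set_integral_mono)
  show "set_integrable lborel {s<..t} (%si. B)" unfolding set_integrable_def
   using st by (auto intro!: integrable_real_indicator)
 qed (use st B in "auto intro!: i")
 also have "... = B * (t - s)" using st by (simp add: set_lebesgue_integral_def)
 finally show ?thesis .
qed

lemma prim_cmult: "prim T w r ==> prim T (%t. a * w t) (%t. a * r t)"
 unfolding prim_def
proof (elim conjE exE, intro conjI)
 fix C assume r: "r : time_measurable T" "ALL t:{0..T}. \<bar>r t\<bar> <= C"
  "ALL t:{0..T}. w t = w 0 + (LBINT s:{0..t}. r s)"
 show "(%t. a * r t) : time_measurable T" using r by measurable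
 show "EX C. ALL t:{0..T}. \<bar>a * r t\<bar> <= C"
  using r(2) by (intro exI[of _ "\<bar>a\<bar> * C"]) (auto simp: abs_mult intro!: mult_left_mono)
 show "ALL t:{0..T}. a * w t = a * w 0 + (LBINT s:{0..t}. a * r s)"
 proof
  fix t assume "t : {0..T}"
  hence "w t = w 0 + (LBINT s:{0..t}. r s)" using r(3) by blast
  thus "a * w t = a * w 0 + (LBINT s:{0..t}. a * r s)"
   by (simp only: distrib_left set_integral_mult_right)
 qed
qed

lemma prim_add:
 assumes "prim T w1 r1" "prim T w2 r2"
 shows "prim T (%t. w1 t + w2 t) (%t. r1 t + r2 t)"
proof -
 from assms obtain C1 C2 where m: "r1 : time_measurable T" "r2 : time_measurable T"
  and b: "!!t. t : {0..T} ==> \<bar>r1 t\<bar> <= C1" "!!t. t : {0..T} ==> \<bar>r2 t\<bar> <= C2"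
  and w: "!!t. t : {0..T} ==> w1 t = w1 0 + (LBINT s:{0..t}. r1 s)" "!!t. t : {0..T} ==> w2 t = w2 0 + (LBINT s:{0..t}. r2 s)"
  unfolding prim_def by blast
 show ?thesis
 proof (rule primI[where C = "C1 + C2"])
  show "(%t. r1 t + r2 t) : time_measurable T" using m by measurable
  show "\<bar>r1 t + r2 t\<bar> <= C1 + C2" if "t : {0..T}" for t using b[OF that] by linarith
  show "w1 t + w2 t = w1 0 + w2 0 + (LBINT s:{0..t}. r1 s + r2 s)" if t: "t : {0..T}" for t
  proof -
   have "(LBINT s:{0..t}. r1 s + r2 s) = (LBINT s:{0..t}. r1 s) + (LBINT s:{0..t}. r2 s)"
    by (intro set_integral_add bounded_measurable_set_integrable[OF m(1) b(1)] bounded_measurable_set_integrable[OF m(2) b(2)])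
     (use t in auto)
   thus ?thesis using w(1)[OF t] w(2)[OF t] by simp
  qed
 qed
qed

lemma prim_const: "prim T (%_. a) (%_. 0)"
 unfolding prim_def by (auto simp: set_lebesgue_integral_def)

lemma prim_sum: "finite S ==> (!!l. l : S ==> prim T (w l) (r l)) ==> prim T (%t. SUM l:S. w l t) (%t. SUM l:S. r l t)"
 by (induction S rule: finite_induct) (auto intro: prim_const prim_add)

lemma prim_diff: "prim T w1 r1 ==> prim T w2 r2 ==> prim T (%t. w1 t - w2 t) (%t. r1 t - r2 t)"
 using prim_add[OF _ prim_cmult[where a = "-1"], of T w1 r1 w2 r2] by simp

lemma prim_cong:
 assumes "prim T w r" "!!t. t : {0..T} ==> w t = w' t" "!!t. t : {0..T} ==> r t = r' t"
 shows "prim T w' r'"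
proof -
 from assms obtain C where r: "r : time_measurable T" "!!t. t : {0..T} ==> \<bar>r t\<bar> <= C"
  and w: "!!t. t : {0..T} ==> w t = w 0 + (LBINT s:{0..t}. r s)" unfolding prim_def by blast
 show ?thesis
 proof (rule primI)
  show "r' : time_measurable T"
   using r(1) by (rule measurable_cong[THEN iffD1, rotated]) (use assms(3) in "auto simp: space_restrict_space")
  show "\<bar>r' t\<bar> <= C" if "t : {0..T}" for t using r(2)[OF that] assms(3)[OF that] by simp
  show "w' t = w' 0 + (LBINT s:{0..t}. r' s)" if t: "t : {0..T}" for t
  proof -
   have "(LBINT s:{0..t}. r' s) = (LBINT s:{0..t}. r s)"
    by (rule set_lebesgue_integral_cong) (use assms(3) t in auto)
   thus ?thesis using w[OF t] assms(2)[OF t] assms(2)[of 0] t by simp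
  qed
 qed
qed

lemma prim_lipschitz:
 assumes "prim T w r" "!!t. t : {0..T} ==> \<bar>r t\<bar> <= C" "s : {0..T}" "t : {0..T}"
 shows "\<bar>w t - w s\<bar> <= C * \<bar>t - s\<bar>"
proof -
 have *: "\<bar>w t - w s\<bar> <= C * \<bar>t - s\<bar>" if "s <= t" "s : {0..T}" "t : {0..T}" for s t
 proof -
  have "w t - w s <= C * (t - s)"
   by (rule prim_le[OF assms(1)]) (use that assms(2) in "auto intro: order_trans[OF abs_ge_self]")
  moreover have "(-1) * w t - (-1) * w s <= C * (t - s)"
   by (rule prim_le[OF prim_cmult[OF assms(1)]]) (use that assms(2) in "auto intro: order_trans[OF abs_ge_minus_self]")
  ultimately show ?thesis using that by auto
 qed
 show ?thesis using *[of s t] *[of t s] assms(3,4) by (cases "s <= t") (auto simp: abs_minus_commute)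
qed

lemma prim_continuous: "prim T w r ==> continuous_on {0..T} w"
proof -
 assume p: "prim T w r"
 then obtain C where "!!t. t : {0..T} ==> \<bar>r t\<bar> <= C" unfolding prim_def by blast
 note L = prim_lipschitz[OF p this]
 have "(\<bar>C\<bar>)-lipschitz_on {0..T} w"
 proof (rule lipschitz_onI)
  fix x y assume xy: "x : {0..T}" "y : {0..T}"
  have "\<bar>w x - w y\<bar> <= C * \<bar>x - y\<bar>" by (rule L) (use xy in auto)
  also have "... <= \<bar>C\<bar> * \<bar>x - y\<bar>" by (intro mult_right_mono) auto
  finally show "dist (w x) (w y) <= \<bar>C\<bar> * dist x y" by (simp add: dist_real_def)
 qed simp
 thus ?thesis by (rule lipschitz_on_continuous_on)
qed

lemma prim_measurable: "prim T w r ==> w : time_measurable T"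
 using prim_continuous borel_measurable_continuous_on_restrict by blast

lemma prim_bounded: "prim T w r ==> EX C. ALL t:{0..T}. \<bar>w t\<bar> <= C"
 using compact_imp_bounded[OF compact_continuous_image[OF prim_continuous compact_Icc]]
 unfolding bounded_iff by fastforce

text \<open>The difference of the two sides moves by \<open>O((t - s)\<^sup>2)\<close>, so it is constant.\<close>

lemma prim_square:
 assumes p: "prim T w r"
 shows "prim T (%t. (w t)\<^sup>2) (%t. 2 * w t * r t)"
proof -
 from p obtain C where r: "r : time_measurable T" "!!t. t : {0..T} ==> \<bar>r t\<bar> <= C"
  unfolding prim_def by blast
 obtain D where D: "!!t. t : {0..T} ==> \<bar>w t\<bar> <= D" using prim_bounded[OF p] by blast
 have L: "\<bar>w t - w s\<bar> <= C * \<bar>t - s\<bar>" if "s : {0..T}" "t : {0..T}" for s t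
  using prim_lipschitz[OF p r(2) that] .
 define z where "z t = (w 0)^2 + (LBINT s:{0..t}. 2 * w s * r s)" for t
 have pz: "prim T z (%t. 2 * w t * r t)" unfolding z_def
 proof (rule prim_LBINT[where C = "2 * D * C"])
  show "(%t. 2 * w t * r t) : time_measurable T"
   using r(1) prim_measurable[OF p] by measurable
  show "\<bar>2 * w t * r t\<bar> <= 2 * D * C" if t: "t : {0..T}" for t
   using D[OF t] r(2)[OF t] by (simp add: abs_mult mult_mono')
 qed
 define F where "F t = (w t)^2 - z t" for t
 have inc: "\<bar>F t - F s\<bar> <= 3 * C^2 * (t - s)^2" if st: "s <= t" "s : {0..T}" "t : {0..T}" for s t
 proof -
  have C0: "0 <= C" using r(2)[OF st(2)] by linarith
  define G where "G si = z si - 2 * w s * w si" for si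
  have pG: "prim T G (%si. 2 * w si * r si - 2 * w s * r si)"
   unfolding G_def by (intro prim_diff pz prim_cmult[where a = "2 * w s"] p)
  have rb: "\<bar>2 * w si * r si - 2 * w s * r si\<bar> <= 2 * C^2 * (t - s)" if "s < si" "si <= t" for si
  proof -
   have th: "si : {0..T}" using that st by auto
   have "\<bar>2 * w si * r si - 2 * w s * r si\<bar> = 2 * (\<bar>w si - w s\<bar> * \<bar>r si\<bar>)"
   proof -
    have "2 * w si * r si - 2 * w s * r si = 2 * ((w si - w s) * r si)" by (simp add: algebra_simps)
    thus ?thesis by (simp add: abs_mult del: mult.assoc)
   qed
   also have "\<bar>w si - w s\<bar> * \<bar>r si\<bar> <= (C * (t - s)) * C"
   proof (rule mult_mono)
    have "\<bar>w si - w s\<bar> <= C * \<bar>si - s\<bar>" by (rule L[OF st(2) th])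
    also have "... <= C * (t - s)" using that C0 by (intro mult_left_mono) auto
    finally show "\<bar>w si - w s\<bar> <= C * (t - s)" .
   qed (use r(2)[OF th] C0 st in auto)
   finally show ?thesis by (simp add: power2_eq_square mult_ac)
  qed
  have "G t - G s <= 2 * C^2 * (t - s) * (t - s)"
   by (rule prim_le[OF pG]) (use st abs_le_D1[OF rb] in auto)
  moreover have "(-1) * G t - (-1) * G s <= 2 * C^2 * (t - s) * (t - s)"
  proof (rule prim_le[OF prim_cmult[OF pG]])
   fix si assume "s < si" "si <= t"
   from abs_le_D2[OF rb[OF this]] show "- 1 * (2 * w si * r si - 2 * w s * r si) <= 2 * C^2 * (t - s)" by simp
  qed (use st in auto)
  ultimately have 1: "\<bar>G t - G s\<bar> <= 2 * C^2 * (t - s)^2" by (simp add: power2_eq_square mult.assoc abs_le_iff)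
  have 2: "(w t - w s)^2 <= C^2 * (t - s)^2"
   using power_mono[OF L[OF st(2,3)], of 2] by (simp add: power_mult_distrib)
  have "F t - F s = (w t - w s)^2 - (G t - G s)"
   unfolding F_def G_def by (simp add: power2_eq_square algebra_simps)
  thus ?thesis using 1 2 zero_le_power2[of "w t - w s"] by linarith
 qed
 have inc': "\<bar>F t - F s\<bar> <= 3 * C^2 * (t - s)^2" if "s : {0..T}" "t : {0..T}" for s t
  using inc[of s t] inc[of t s] that by (cases "s <= t") (auto simp: abs_minus_commute power2_commute)
 have "EX c. ALL t:{0..T}. F t = c"
 proof (rule has_derivative_zero_constant)
  fix s assume s: "s : {0..T}"
  have "((%t. (F t - F s) / (t - s)) \<longlongrightarrow> 0) (at s within {0..T})"
  proof (rule Lim_null_comparison)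
   show "\<forall>\<^sub>F t in at s within {0..T}. norm ((F t - F s) / (t - s)) <= 3 * C^2 * \<bar>t - s\<bar>"
   proof (unfold eventually_at_filter, intro always_eventually allI impI)
    fix t assume t: "t ~= s" "t : {0..T}"
    have "\<bar>F t - F s\<bar> <= 3 * C^2 * \<bar>t - s\<bar> * \<bar>t - s\<bar>" using inc'[OF s t(2)] by (simp add: power2_eq_square mult.assoc)
    thus "norm ((F t - F s) / (t - s)) <= 3 * C^2 * \<bar>t - s\<bar>" using t by (simp add: divide_simps)
   qed
   have "((%t. 3 * C^2 * \<bar>t - s\<bar>) \<longlongrightarrow> 3 * C^2 * \<bar>s - s\<bar>) (at s within {0..T})" by (intro tendsto_intros)
   thus "((%t. 3 * C^2 * \<bar>t - s\<bar>) \<longlongrightarrow> 0) (at s within {0..T})" by simp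
  qed
  hence "(F has_field_derivative 0) (at s within {0..T})" by (simp add: has_field_derivative_iff)
  thus "(F has_derivative (%h. 0)) (at s within {0..T})" by (simp add: has_field_derivative_def lambda_zero)
 qed simp
 then obtain c where c: "!!t. t : {0..T} ==> F t = c" by blast
 show ?thesis
 proof (cases "0 <= T")
  case True
  hence "F t = 0" if "t : {0..T}" for t
   using c[OF that] c[of 0] by (simp add: F_def z_def LBINT_point)
  thus ?thesis using prim_cong[OF pz, of "%t. (w t)\<^sup>2"] by (simp add: F_def)
 next
  case False thus ?thesis using prim_cong[OF pz, of "%t. (w t)\<^sup>2"] by simp
 qed
qed

text \<open>After the last time at which \<open>w\<close> is at most Y the rate is nonpositive, so
  \<open>w\<close> cannot rise above Y again.\<close>

lemma prim_compare:
 assumes p: "prim T w r" and w0: "w 0 <= Y" and r: "!!t. t : {0..T} ==> Y < w t ==> r t <= 0" and t: "t : {0..T}"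
 shows "w t <= Y"
proof (rule ccontr)
 assume n: "~ w t <= Y"
 define A where "A = {s : {0..t}. w s <= Y}"
 have "continuous_on {0..t} w" using prim_continuous[OF p] t by (auto intro: continuous_on_subset)
 hence "closed A" unfolding A_def
  using continuous_on_closed_Collect_le[of "{0..t}" w "%_. Y"] by simp
 moreover have "0 : A" "bdd_above A" using t w0 by (auto simp: A_def)
 ultimately have S: "Sup A : A" using closed_contains_Sup by blast
 have "w t - w (Sup A) <= 0 * (t - Sup A)"
 proof (rule prim_le[OF p])
  fix si assume th: "Sup A < si" "si <= t"
  hence "si ~: A" using cSup_upper[of si A] \<open>bdd_above A\<close> by fastforce
  thus "r si <= 0" using th S t r[of si] by (auto simp: A_def)
 qed (use S t in "auto simp: A_def")
 thus False using S n by (simp add: A_def)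
qed

text \<open>At points where \<open>V\<close> is close to its supremum \<open>S\<close> the damping
  \<open>-2cV\<close> beats the nonlocal term \<open>2(1 - de)cS\<close> unless \<open>S \<le> R / (2 de c0)\<close>.\<close>

lemma maximum_principle:
 fixes V v :: "real => 'x => real" and L :: "'l set"
 assumes T: "0 <= T" and fin: "finite L"
  and p: "!!x. x : X ==> prim T (%t. V t x) (%t. v t x)"
  and bd: "!!t x. t : {0..T} ==> x : X ==> V t x <= Bm"
  and a: "!!l t x. l : L ==> t : {0..T} ==> x : X ==> 0 <= a l t x & a l t x <= A"
  and c: "!!t x. t : {0..T} ==> x : X ==> c0 <= c t x & c t x <= Cm"
  and sh: "!!l x. l : L ==> x : X ==> sh l x : X"
  and c0: "0 < c0" and de: "0 < de" and R: "0 <= R" and V0: "0 <= V0"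
  and init: "!!x. x : X ==> V 0 x <= V0"
  and ineq: "!!B t x. 0 <= B ==> (!!t x. t : {0..T} ==> x : X ==> V t x <= B) ==> t : {0..T} ==> x : X ==>
   v t x <= (SUM l:L. a l t x * (V t (sh l x) - V t x)) - 2 * c t x * V t x + 2 * (1 - de) * c t x * B + R"
  and t: "t : {0..T}" and x: "x : X"
 shows "V t x <= max V0 (R / (2 * de * c0))"
proof (rule ccontr)
 define Y where "Y = max V0 (R / (2 * de * c0))"
 define S where "S = (SUP z\<in>{0..T} \<times> X. V (fst z) (snd z))"
 assume "~ V t x <= max V0 (R / (2 * de * c0))"
 hence n: "Y < V t x" unfolding Y_def by linarith
 have bdd: "bdd_above ((%z. V (fst z) (snd z)) ` ({0..T} \<times> X))"
  by (rule bdd_aboveI[of _ Bm]) (use bd in auto)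
 have up: "V t x <= S" if "t : {0..T}" "x : X" for t x
  unfolding S_def using cSUP_upper[OF _ bdd, of "(t, x)"] that by auto
 have SY: "Y < S" using n up[OF t x] by linarith
 have S0: "0 < S" using SY V0 by (simp add: Y_def)
 have "R / (2 * de * c0) < S" using SY by (simp add: Y_def)
 hence rho: "0 < 2 * de * c0 * S - R" using c0 de by (simp add: field_simps)
 have A0: "0 <= real (card L) * \<bar>A\<bar>" by simp
 have Cm: "0 < Cm" using c[OF t x] c0 by linarith
 \<comment> \<open>The rate at a point is at most
   \<open>b * (S - V t x) - (2 * de * c t x * S - R)\<close>, where b is the sum of the
   \<open>a l\<close> plus 2c. The denominator bounds b, so this is nonpositive wherever V exceeds
   \<open>S - ga\<close>. Then V never enters that range, against the choice of S as
   supremum.\<close>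
 define ga where "ga = (2 * de * c0 * S - R) / (real (card L) * \<bar>A\<bar> + 2 * Cm)"
 have den: "0 < real (card L) * \<bar>A\<bar> + 2 * Cm" using A0 Cm by linarith
 hence ga0: "0 < ga" unfolding ga_def using rho by (intro divide_pos_pos) auto
 have "V t x <= max V0 (S - ga)" if tx: "t : {0..T}" "x : X" for t x
 proof (rule prim_compare[OF p[OF tx(2)] _ _ tx(1)])
  show "V 0 x <= max V0 (S - ga)" using init[OF tx(2)] by simp
  fix t assume t: "t : {0..T}" and gt: "max V0 (S - ga) < V t x"
  note x = tx(2)
  define b where "b = (SUM l:L. a l t x) + 2 * c t x"
  have b0: "0 <= b" unfolding b_def using a[OF _ t x] c[OF t x] c0 by (auto intro!: add_nonneg_nonneg sum_nonneg)
  have "(SUM l:L. a l t x) <= (SUM l:L. \<bar>A\<bar>)" by (intro sum_mono) (use a[OF _ t x] in force)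
  hence bb: "b <= real (card L) * \<bar>A\<bar> + 2 * Cm" unfolding b_def using c[OF t x] by simp
  have "b * ga <= (real (card L) * \<bar>A\<bar> + 2 * Cm) * ga" using bb ga0 by simp
  also have "... = 2 * de * c0 * S - R" unfolding ga_def using den by simp
  also have "... <= 2 * de * c t x * S - R" using c[OF t x] de S0 by simp
  finally have bg: "b * ga <= 2 * de * c t x * S - R" .
  have "v t x <= (SUM l:L. a l t x * (V t (sh l x) - V t x)) - 2 * c t x * V t x + 2 * (1 - de) * c t x * S + R"
   by (rule ineq[OF _ up t x]) (use S0 in auto)
  also have "(SUM l:L. a l t x * (V t (sh l x) - V t x)) <= (SUM l:L. a l t x * (S - V t x))"
   by (intro sum_mono mult_left_mono) (use a[OF _ t x] up[OF t] sh x in auto)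
  also have "(SUM l:L. a l t x * (S - V t x)) = (SUM l:L. a l t x) * (S - V t x)" by (simp add: sum_distrib_right)
  also have "... - 2 * c t x * V t x + 2 * (1 - de) * c t x * S + R = b * (S - V t x) - (2 * de * c t x * S - R)"
   unfolding b_def by (simp add: algebra_simps)
  also have "... <= b * (S - V t x) - b * ga" using bg by simp
  also have "... = b * (S - ga - V t x)" by (simp add: algebra_simps)
  also have "... <= 0" using b0 gt by (simp add: mult_nonneg_nonpos)
  finally show "v t x <= 0" by simp
 qed
 hence "S <= max V0 (S - ga)" unfolding S_def
  by (intro cSUP_least) (use t x in auto)
 thus False using ga0 SY by (auto simp: Y_def)
qed

section \<open>Sums over index lists and the combinatorics of the Leibniz rule\<close>

definition nl :: "'a set => nat => 'a list set" where
 "nl A n = {xs. set xs \<subseteq> A & length xs = n}"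

lemma finite_nl: "finite A ==> finite (nl A n)"
 unfolding nl_def by (rule finite_lists_length_eq)

lemma nl_0: "nl A 0 = {[]}" by (auto simp: nl_def)

lemma sum_nl_append:
 fixes f :: "'a list => 'b::comm_monoid_add"
 shows "(SUM xs:nl A (m + n). f xs) = (SUM us:nl A m. SUM vs:nl A n. f (us @ vs))"
proof -
 have "(SUM us:nl A m. SUM vs:nl A n. f (us @ vs)) = (SUM (us, vs):nl A m \<times> nl A n. f (us @ vs))"
  by (rule sum.cartesian_product)
 also have "... = (SUM xs:nl A (m + n). f xs)"
 proof (rule sum.reindex_bij_witness[where i = "%xs. (take m xs, drop m xs)" and j = "%(us, vs). us @ vs"])
  fix xs assume "xs : nl A (m + n)"
  thus "(take m xs, drop m xs) : nl A m \<times> nl A n"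
   using set_take_subset[of m xs] set_drop_subset[of m xs] by (auto simp: nl_def)
 qed (auto simp: nl_def)
 finally show ?thesis by simp
qed

lemma sum_nl_1:
 fixes f :: "'a list => 'b::comm_monoid_add"
 shows "(SUM xs:nl A (Suc 0). f xs) = (SUM a:A. f [a])"
 by (rule sum.reindex_bij_witness[where i = "%a. [a]" and j = hd]) (auto simp: nl_def length_Suc_conv)

lemma sum_nl_Suc:
 fixes f :: "'a list => 'b::comm_monoid_add"
 shows "(SUM xs:nl A (Suc n). f xs) = (SUM a:A. SUM xs:nl A n. f (a # xs))"
 using sum_nl_append[of f A "Suc 0" n] by (simp add: sum_nl_1)

lemma sum_nl_snoc:
 fixes f :: "'a list => 'b::comm_monoid_add"
 shows "(SUM xs:nl A (Suc n). f xs) = (SUM xs:nl A n. SUM a:A. f (xs @ [a]))"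
 using sum_nl_append[of f A n "Suc 0"] by (simp add: sum_nl_1)

text \<open>All ways of distributing the positions of a list over two sublists, each keeping its
  order: the terms of the iterated product rule.\<close>

fun splits :: "'a list => ('a list \<times> 'a list) list" where
 "splits [] = [([], [])]"
| "splits (x # xs) = map (%(a, b). (x # a, b)) (splits xs) @ map (%(a, b). (a, x # b)) (splits xs)"

lemma splits_sub: "(a, b) : set (splits xs) ==> set a \<subseteq> set xs & set b \<subseteq> set xs"
 by (induction xs arbitrary: a b) (auto, blast+)

lemma length_splits: "length (splits xs) = 2 ^ length xs"
 by (induction xs) auto

lemma pascal_sum:
 fixes h :: "nat => nat => real"
 shows "(SUM j<=Suc n. real (Suc n choose j) * h j (Suc n - j)) =
  (SUM j<=n. real (n choose j) * h (Suc j) (n - j)) + (SUM j<=n. real (n choose j) * h j (Suc n - j))"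
proof -
 have "(SUM j<=Suc n. real (Suc n choose j) * h j (Suc n - j)) = h 0 (Suc n) + (SUM j<=n. real (Suc n choose Suc j) * h (Suc j) (n - j))"
  by (subst sum.atMost_Suc_shift) simp
 also have "(SUM j<=n. real (Suc n choose Suc j) * h (Suc j) (n - j)) =
  (SUM j<=n. real (n choose j) * h (Suc j) (n - j)) + (SUM j<=n. real (n choose Suc j) * h (Suc j) (n - j))"
  by (simp add: distrib_right sum.distrib)
 also have "h 0 (Suc n) + (...) = (SUM j<=n. real (n choose j) * h (Suc j) (n - j)) + (SUM j<=Suc n. real (n choose j) * h j (Suc n - j))"
  by (subst sum.atMost_Suc_shift) simp
 finally show ?thesis by simp
qed

text \<open>A pair of lists of lengths j and n - j arises from exactly n choose j interleavings.
  Summed over all lists, the Leibniz terms are therefore grouped by length alone, which is why lists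
  replace multi-indices.\<close>

lemma sum_splits:
 fixes G :: "'a list => 'a list => real"
 shows "(SUM xs:nl A n. SUM (s, u)<-splits xs. G s u) =
  (SUM j<=n. real (n choose j) * (SUM s:nl A j. SUM u:nl A (n - j). G s u))"
proof (induction n arbitrary: G)
 case 0 thus ?case by (simp add: nl_0)
next
 case (Suc n)
 have "(SUM xs:nl A (Suc n). SUM (s, u)<-splits xs. G s u) =
   (SUM a:A. (SUM xs:nl A n. SUM (s, u)<-splits xs. G (a # s) u) + (SUM xs:nl A n. SUM (s, u)<-splits xs. G s (a # u)))"
  by (simp add: sum_nl_Suc o_def case_prod_beta' sum.distrib)
 also have "... = (SUM a:A. SUM j<=n. real (n choose j) * (SUM s:nl A j. SUM u:nl A (n - j). G (a # s) u)) +
  (SUM a:A. SUM j<=n. real (n choose j) * (SUM s:nl A j. SUM u:nl A (n - j). G s (a # u)))"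
  unfolding Suc.IH sum.distrib ..
 also have "(SUM a:A. SUM j<=n. real (n choose j) * (SUM s:nl A j. SUM u:nl A (n - j). G (a # s) u)) =
  (SUM j<=n. real (n choose j) * (SUM s:nl A (Suc j). SUM u:nl A (n - j). G s u))"
  by (subst sum.swap) (simp add: sum_nl_Suc sum_distrib_left)
 also have "(SUM a:A. SUM j<=n. real (n choose j) * (SUM s:nl A j. SUM u:nl A (n - j). G s (a # u))) =
  (SUM j<=n. real (n choose j) * (SUM s:nl A j. SUM u:nl A (Suc n - j). G s u))"
  (is "?l = ?r")
 proof -
  have "?l = (SUM j<=n. real (n choose j) * (SUM a:A. SUM s:nl A j. SUM u:nl A (n - j). G s (a # u)))"
   by (subst sum.swap) (simp add: sum_distrib_left)
  also have "... = (SUM j<=n. real (n choose j) * (SUM s:nl A j. SUM a:A. SUM u:nl A (n - j). G s (a # u)))"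
   by (subst sum.swap) simp
  also have "... = ?r" by (rule sum.cong) (auto simp: Suc_diff_le sum_nl_Suc)
  finally show ?thesis .
 qed
 finally show ?case
  using pascal_sum[of n "%i j. SUM s:nl A i. SUM u:nl A j. G s u"] by simp
qed

context dom
begin

lemma SM_obtain:
 assumes "SM E U I ph" obtains C where "0 <= C" "!!t. t : I ==> BD E U N C (ph t)"
proof -
 from assms obtain C where "ALL t:I. BD E U N C (ph t)" unfolding SM_def by blast
 hence "BD E U N \<bar>C\<bar> (ph t)" if "t : I" for t using that BD_mono[of N C "ph t" "\<bar>C\<bar>" N] by auto
 thus ?thesis using that[of "\<bar>C\<bar>"] by auto
qed

lemma SM_BD: "SM E U I ph ==> t : I ==> EX C. BD E U N C (ph t)"
 unfolding SM_def by blast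

lemma SM_cong: "(!!t x. t : I ==> x : U ==> ph t x = ps t x) ==> SM E U I ph \<longleftrightarrow> SM E U I ps"
 unfolding SM_def using BD_cong by (metis (no_types, lifting))

lemma SM_const: "SM E U I (%_ _. a)"
 unfolding SM_def using BD_const[of a "\<bar>a\<bar>"] by blast

lemma SM_add: "SM E U I a ==> SM E U I b ==> SM E U I (%t x. a t x + b t x)"
 unfolding SM_def using BD_add by meson

lemma SM_mult: "SM E U I a ==> SM E U I b ==> SM E U I (%t x. a t x * b t x)"
 unfolding SM_def using BD_mult by meson

lemma SM_cmult: "SM E U I a ==> SM E U I (%t x. k * a t x)"
 by (rule SM_mult[OF SM_const])

lemma SM_diff: "SM E U I a ==> SM E U I b ==> SM E U I (%t x. a t x - b t x)"
 using SM_add[OF _ SM_cmult[where k = "-1"], of I a b] by simp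

lemma SM_sum: "finite S ==> (!!l. l : S ==> SM E U I (a l)) ==> SM E U I (%t x. SUM l:S. a l t x)"
 by (induction S rule: finite_induct) (auto intro: SM_const SM_add)

lemma SM_pd:
 assumes "SM E U I a" "i : E" shows "SM E U I (%t. pd i (a t))"
 unfolding SM_def
proof
 fix N
 obtain C where "!!t. t : I ==> BD E U (Suc N) C (a t)" using SM_obtain[OF assms(1)] by metis
 thus "EX C. ALL t:I. BD E U N C (pd i (a t))" using BD_pd assms(2) by blast
qed

lemma SM_foldr: "SM E U I a ==> set is \<subseteq> E ==> SM E U I (%t. foldr pd is (a t))"
 by (induction "is") (auto intro: SM_pd)

lemma SM_single: "SM E U I a ==> t : I ==> SM E U I' (%_. a t)"
 unfolding SM_def by blast

lemma SM_DERIV: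
 assumes "SM E U I ph" "t : I" "x : U" "i : E"
 shows "((%s. ph t (x(i := s))) has_real_derivative pd i (ph t) x) (at (x i))"
proof -
 obtain C where "BD E U (Suc 0) C (ph t)" using SM_BD[OF assms(1,2)] by blast
 thus ?thesis using BD_DERIV assms by blast
qed

lemma SM_commute:
 assumes "SM E U I ph" "t : I" "x : U" "i : E" "j : E"
 shows "pd i (pd j (ph t)) x = pd j (pd i (ph t)) x"
 using SM_BD[OF assms(1,2), of 3] pd_commute assms by blast

lemma pd_add:
 assumes "SM E U I a" "SM E U I b" "t : I" "x : U" "i : E"
 shows "pd i (%x. a t x + b t x) x = pd i (a t) x + pd i (b t) x"
 by (rule pd_eqI, rule DERIV_add; rule SM_DERIV[OF _ assms(3-5)], fact)

lemma pd_diff: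
 assumes "SM E U I a" "SM E U I b" "t : I" "x : U" "i : E"
 shows "pd i (%x. a t x - b t x) x = pd i (a t) x - pd i (b t) x"
 by (rule pd_eqI, rule DERIV_diff; rule SM_DERIV[OF _ assms(3-5)], fact)

lemma pd_cmult:
 assumes "SM E U I a" "t : I" "x : U" "i : E"
 shows "pd i (%x. k * a t x) x = k * pd i (a t) x"
 by (rule pd_eqI, rule DERIV_cmult, rule SM_DERIV[OF assms])

lemma pd_mult:
 assumes "SM E U I a" "SM E U I b" "t : I" "x : U" "i : E"
 shows "pd i (%x. a t x * b t x) x = pd i (a t) x * b t x + a t x * pd i (b t) x"
proof (rule pd_eqI)
 show "((%s. a t (x(i := s)) * b t (x(i := s))) has_real_derivative pd i (a t) x * b t x + a t x * pd i (b t) x) (at (x i))"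
  by (rule DERIV_cong[OF DERIV_mult[OF SM_DERIV[OF assms(1,3,4,5)] SM_DERIV[OF assms(2,3,4,5)]]])
   (simp add: mult.commute)
qed

lemma pd_sum:
 assumes "finite S" "!!l. l : S ==> SM E U I (a l)" "t : I" "x : U" "i : E"
 shows "pd i (%x. SUM l:S. a l t x) x = (SUM l:S. pd i (a l t) x)"
 by (rule pd_eqI, rule DERIV_sum, rule SM_DERIV[OF assms(2) assms(3-5)])

lemma foldr_pd_commute1:
 assumes "SM E U I ph" "t : I" "x : U" "i : E" "set is \<subseteq> E"
 shows "foldr pd is (pd i (ph t)) x = pd i (foldr pd is (ph t)) x"
 using assms(3,5)
proof (induction "is" arbitrary: x)
 case (Cons j js)
 have js: "j : E" "set js \<subseteq> E" using Cons.prems by auto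
 have "foldr pd (j # js) (pd i (ph t)) x = pd j (foldr pd js (pd i (ph t))) x" by simp
 also have "... = pd j (pd i (foldr pd js (ph t))) x"
  by (rule pd_cong[OF Cons.IH[OF _ js(2)] Cons.prems(1) js(1)])
 also have "... = pd i (pd j (foldr pd js (ph t))) x"
  using SM_commute[OF SM_foldr[OF assms(1), of js] assms(2), of x i j] Cons.prems assms(4) by simp
 finally show ?case by simp
qed simp

text \<open>Differentiation of an integrated evolution equation in a space coordinate. The time
  integral is treated as a parameter integral, and \<open>BD_integral\<close> also supplies
  measurability in time of the differentiated rate.\<close>

lemma prim_pd:
 assumes T: "0 <= T" and v: "SM E U {0..T} v" and r: "SM E U {0..T} r" and p: "!!x. x : U ==> prim T (%t. v t x) (%t. r t x)"
  and x: "x : U" and i: "i : E"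
 shows "prim T (%t. pd i (v t) x) (%t. pd i (r t) x)"
proof -
 obtain C where C0: "0 <= C" and C: "!!t. t : {0..T} ==> BD E U (Suc 0) C (r t)" using SM_obtain[OF r] by metis
 have m: "(%t. r t y) : time_measurable T" if "y : U" for y
  using p[OF that] unfolding prim_def by blast
 have sp: "space (restrict_space borel {0..T}) = {0..T}" by (simp add: space_restrict_space)
 have I: "(LBINT s:{0..t}. f s) = (\<integral>s. f s \<partial>restrict_space lborel {0..t})" for f :: "real => real" and t
  unfolding set_lebesgue_integral_def by (subst integral_restrict_space) auto
 have mt: "f : borel_measurable (restrict_space lborel {0..t})"
  if "f : time_measurable T" "t : {0..T}" for f :: "real => real" and t
 proof -
  have "f : borel_measurable (restrict_space borel {0..t})"
   by (rule measurable_restrict_mono[OF that(1)]) (use that(2) in auto)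
  moreover have "sets (restrict_space borel {0..t}) = sets (restrict_space lborel {0..t})" by (rule sets_restrict_space_cong) simp
  ultimately show ?thesis using measurable_cong_sets by blast
 qed
 have spt: "space (restrict_space lborel {0..t}) = {0..t}" for t :: real by (simp add: space_restrict_space)
 have B: "(%s. foldr pd is (r s) y) : borel_measurable (restrict_space lborel {0..t}) &
   foldr pd is (%x. \<integral>s. r s x \<partial>restrict_space lborel {0..t}) y = (\<integral>s. foldr pd is (r s) y \<partial>restrict_space lborel {0..t})"
  if "t : {0..T}" "y : U" "set is \<subseteq> E" "length is <= Suc 0" for t y "is"
 proof (rule BD_integral(2)[where w = "%_. C" and N = "Suc 0"])
  show "integrable (restrict_space lborel {0..t}) (%_. C)"
   by (subst integrable_restrict_space) (auto intro!: integrable_real_indicator simp: emeasure_lborel_Icc_eq)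
 qed (use that C mt[OF m] spt in auto)
 have D: "((%s. \<integral>si. r si (x(i := s)) \<partial>restrict_space lborel {0..t}) has_real_derivative (\<integral>si. pd i (r si) x \<partial>restrict_space lborel {0..t})) (at (x i))"
  if t: "t : {0..T}" for t
 proof -
  have "BD E U (Suc 0) (\<integral>s. C \<partial>restrict_space lborel {0..t}) (%x. \<integral>s. r s x \<partial>restrict_space lborel {0..t})"
  proof (rule BD_integral(1))
   show "integrable (restrict_space lborel {0..t}) (%_. C)"
    by (subst integrable_restrict_space) (auto intro!: integrable_real_indicator simp: emeasure_lborel_Icc_eq)
  qed (use t C mt[OF m] spt in auto)
  from BD_DERIV[OF this x i] show ?thesis using B[OF t x, of "[i]"] i by simp
 qed
 show ?thesis
 proof (rule primI[where C = C])
  have "(%s. pd i (r s) x) : borel_measurable (restrict_space lborel {0..T})"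
   using B[of T x "[i]"] T x i by simp
  moreover have "sets (restrict_space borel {0..T}) = sets (restrict_space lborel {0..T})" by (rule sets_restrict_space_cong) simp
  ultimately show "(%t. pd i (r t) x) : time_measurable T" using measurable_cong_sets by blast
  show "\<bar>pd i (r t) x\<bar> <= C" if "t : {0..T}" for t using BD_bound[OF BD_pd[OF C[OF that] i] x] .
  show "pd i (v t) x = pd i (v 0) x + (LBINT s:{0..t}. pd i (r s) x)" if t: "t : {0..T}" for t
  proof (rule pd_eqI)
   have "((%s. v 0 (x(i := s)) + (\<integral>si. r si (x(i := s)) \<partial>restrict_space lborel {0..t})) has_real_derivative
    pd i (v 0) x + (\<integral>si. pd i (r si) x \<partial>restrict_space lborel {0..t})) (at (x i))"
    by (intro DERIV_add D[OF t] SM_DERIV[OF v _ x i]) (use T in auto)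
   thus "((%s. v t (x(i := s))) has_real_derivative pd i (v 0) x + (LBINT s:{0..t}. pd i (r s) x)) (at (x i))"
    unfolding I
   proof (rule DERIV_cong_U[OF _ x i, rotated])
    fix y assume "y : U"
    hence "v t y = v 0 y + (LBINT s:{0..t}. r s y)" using p t unfolding prim_def by blast
    thus "v 0 y + (\<integral>si. r si y \<partial>restrict_space lborel {0..t}) = v t y" unfolding I by (rule sym)
   qed
  qed
 qed
qed

lemma prim_foldr_pd:
 assumes T: "0 <= T" and v: "SM E U {0..T} v" and r: "SM E U {0..T} r" and p: "!!x. x : U ==> prim T (%t. v t x) (%t. r t x)"
  and x: "x : U" and "is": "set is \<subseteq> E"
 shows "prim T (%t. foldr pd is (v t) x) (%t. foldr pd is (r t) x)"
 using x "is"
proof (induction "is" arbitrary: x)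
 case (Cons i js)
 thus ?case using prim_pd[OF T SM_foldr[OF v] SM_foldr[OF r], of js js x i] by auto
qed (use p in simp)

end

section \<open>Translations in x and dimension-free estimates of families\<close>

locale domR = dom +
 fixes d :: nat
 assumes low: "i < d ==> i : E & J i = UNIV"
begin

lemma tr_mem: "x : U ==> tr d s l x : U"
 unfolding tr_def by (rule mix_mem) (use low in auto)

lemma tr_upd: "i < d ==> tr d s l (x(i := r)) = (tr d s l x)(i := r + s * l i)"
 by (auto simp: tr_def)

lemma tr_upd': "~ i < d ==> tr d s l (x(i := r)) = (tr d s l x)(i := r)"
 by (auto simp: tr_def)

lemma tr_tr: "tr d s l (tr d r l x) = tr d (s + r) l x"
 by (auto simp: tr_def algebra_simps)

lemma tr_0: "tr d 0 l x = x" by (auto simp: tr_def)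

lemma DERIV_tr_line:
 assumes "BD E U (Suc N) C ph" "x : U" "i : E"
 shows "((%r. ph (tr d s l (x(i := r)))) has_real_derivative pd i ph (tr d s l x)) (at (x i))"
proof (cases "i < d")
 case True
 let ?y = "tr d s l x"
 have "((%r. ph (?y(i := r))) has_real_derivative pd i ph ?y) (at (x i + s * l i))"
  using BD_DERIV[OF assms(1) tr_mem[OF assms(2)] assms(3), of s l] True by (simp add: tr_def)
 hence "((%r. ph (?y(i := r + s * l i))) has_real_derivative pd i ph ?y) (at (x i))"
  by (simp only: DERIV_shift)
 thus ?thesis using tr_upd[OF True] by simp
next
 case False
 thus ?thesis
  using BD_DERIV[OF assms(1) tr_mem[OF assms(2)] assms(3), of s l] tr_upd'[OF False] by (simp add: tr_def)
qed

lemma BD_tr: "BD E U N C ph ==> BD E U N C (%x. ph (tr d s l x))"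
proof (induction N arbitrary: ph)
 case 0 thus ?case using tr_mem by simp
next
 case (Suc N)
 show ?case
  by (rule BD_SucI[where ps = "%i x. pd i ph (tr d s l x)"])
   (use BD_bound[OF Suc.prems tr_mem] DERIV_tr_line[OF Suc.prems] Suc in "auto simp del: fun_upd_apply")
qed

lemma SM_tr: "SM E U I ph ==> SM E U I (%t x. ph t (tr d s l x))"
 unfolding SM_def using BD_tr by blast

lemma pd_tr:
 assumes "SM E U I ph" "t : I" "x : U" "i : E"
 shows "pd i (%x. ph t (tr d s l x)) x = pd i (ph t) (tr d s l x)"
proof -
 obtain C where "BD E U (Suc 0) C (ph t)" using SM_BD[OF assms(1,2)] by blast
 from DERIV_tr_line[OF this assms(3,4)] show ?thesis by (rule pd_eqI)
qed

lemma DERIV_tr: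
 assumes "BD E U 2 C ph" "x : U"
 shows "((%s. ph (tr d s l x)) has_real_derivative Dl d l ph (tr d s l x)) (at s)"
proof -
 have "((%h. ph (tr d h l (tr d s l x))) has_real_derivative Dl d l ph (tr d s l x)) (at 0)"
  by (rule DERIV_dir[OF assms(1) tr_mem[OF assms(2)]]) (use low in auto)
 thus ?thesis unfolding DERIV_def by (simp add: tr_tr tr_0 add.commute)
qed

end

lemma Dl_sq: "(Dl d l ph x)^2 <= (vnorm d l)^2 * (SUM i<d. (pd i ph x)\<^sup>2)"
 unfolding Dl_def vnorm_def using Cauchy_Schwarz_ineq_sum[of l "%i. pd i ph x" "{..<d}"]
 by (simp add: sum_nonneg)

lemma sum_CS_sqrt:
 fixes a b :: "'a => real"
 assumes "(SUM i:S. (b i)\<^sup>2) <= B"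
 shows "\<bar>SUM i:S. a i * b i\<bar> <= sqrt (SUM i:S. (a i)\<^sup>2) * sqrt B"
proof -
 have "(SUM i:S. a i * b i)^2 <= (SUM i:S. (a i)\<^sup>2) * (SUM i:S. (b i)\<^sup>2)" by (rule Cauchy_Schwarz_ineq_sum)
 also have "... <= (SUM i:S. (a i)\<^sup>2) * B" using assms by (intro mult_left_mono) (auto intro: sum_nonneg)
 finally show ?thesis by (metis real_sqrt_abs real_sqrt_le_mono real_sqrt_mult)
qed

text \<open>Closes the duality arguments below: a family is paired with itself, so that its squared
  norm D is bounded by sqrt D times the wanted bound.\<close>

lemma sq_le_of_self_bound:
 fixes D c :: real
 assumes "0 <= D" "D <= sqrt D * c" "0 <= c"
 shows "D <= c^2"
proof (cases "D = 0")
 case False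
 hence "0 < sqrt D" using assms by simp
 moreover have "sqrt D * sqrt D <= sqrt D * c" using assms by simp
 ultimately have "sqrt D <= c" using mult_left_le_imp_le by blast
 thus ?thesis using assms by (simp add: real_sqrt_le_iff sqrt_le_D)
qed simp

text \<open>The mean value inequality for a vector-valued function. Pairing the increment with the
  moving family gives a scalar function F with F s - F 0 = D, and Cauchy-Schwarz bounds its
  derivative. Neither the size of B nor the dimension enters the constant.\<close>

lemma (in domR) diff_family_bound:
 assumes fin: "finite B" and b: "!!b. b : B ==> BD E U 2 (C b) (ps b)" and x: "x : U"
  and S: "!!\<sigma>. (SUM b:B. SUM i<d. (pd i (ps b) (tr d \<sigma> l x))\<^sup>2) <= S"
 shows "(SUM b:B. (ps b (tr d s l x) - ps b x)\<^sup>2) <= s^2 * (vnorm d l)^2 * S"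
proof -
 define \<Delta> where "\<Delta> b = ps b (tr d s l x) - ps b x" for b
 define D where "D = (SUM b:B. (\<Delta> b)\<^sup>2)"
 have D0: "0 <= D" by (simp add: D_def sum_nonneg)
 have vn: "0 <= vnorm d l" by (simp add: vnorm_def sum_nonneg)
 have S0: "0 <= S" using S[of 0] by (meson order_trans sum_nonneg zero_le_power2)
 define F where "F \<sigma> = (SUM b:B. \<Delta> b * ps b (tr d \<sigma> l x))" for \<sigma>
 have "norm (F s - F 0) <= (sqrt D * (vnorm d l * sqrt S)) * norm (s - 0)"
 proof (rule field_differentiable_bound[where S = UNIV])
  show "(F has_field_derivative (SUM b:B. \<Delta> b * Dl d l (ps b) (tr d z l x))) (at z within UNIV)" for z
   unfolding F_def using DERIV_tr[OF b x] by (auto intro!: DERIV_sum DERIV_cmult)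
  fix z
  have "(SUM b:B. (Dl d l (ps b) (tr d z l x))\<^sup>2) <= (SUM b:B. (vnorm d l)\<^sup>2 * (SUM i<d. (pd i (ps b) (tr d z l x))\<^sup>2))"
   by (intro sum_mono Dl_sq)
  also have "... <= (vnorm d l)^2 * S" unfolding sum_distrib_left[symmetric] by (intro mult_left_mono S) simp
  finally have "\<bar>SUM b:B. \<Delta> b * Dl d l (ps b) (tr d z l x)\<bar> <= sqrt D * sqrt ((vnorm d l)^2 * S)"
   unfolding D_def by (rule sum_CS_sqrt)
  thus "norm (SUM b:B. \<Delta> b * Dl d l (ps b) (tr d z l x)) <= sqrt D * (vnorm d l * sqrt S)"
   using vn by (simp add: real_sqrt_mult)
 qed auto
 moreover have "F s - F 0 = D"
  unfolding F_def D_def \<Delta>_def tr_0 by (simp add: power2_eq_square right_diff_distrib flip: sum_subtractf)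
 ultimately have "D <= sqrt D * (vnorm d l * sqrt S * \<bar>s\<bar>)" by (simp add: mult.assoc)
 hence "D <= (vnorm d l * sqrt S * \<bar>s\<bar>)^2" by (rule sq_le_of_self_bound[OF D0]) (use vn S0 in auto)
 thus ?thesis using S0 by (simp add: D_def \<Delta>_def power_mult_distrib mult_ac)
qed

text \<open>A second difference is the first difference, at the point shifted by -s, of a first
  difference. So the previous bound is applied twice, the second time to the family of all first
  derivatives, indexed by B times the coordinates.\<close>

lemma (in domR) second_diff_family_bound:
 assumes fin: "finite B" and b: "!!b. b : B ==> BD E U 3 (C b) (ps b)" and x: "x : U"
  and S: "!!\<sigma>. (SUM b:B. SUM i<d. SUM j<d. (pd j (pd i (ps b)) (tr d \<sigma> l x))\<^sup>2) <= S"
 shows "(SUM b:B. (ps b (tr d s l x) + ps b (tr d (-s) l x) - 2 * ps b x)\<^sup>2) <= s^4 * (vnorm d l)^4 * S"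
proof -
 define et where "et b y = ps b (tr d s l y) - ps b y" for b y
 let ?x = "tr d (-s) l x"
 have B1: "BD E U 2 (C b + C b) (et b)" if "b : B" for b
 proof -
  have "BD E U 2 (C b + \<bar>-1\<bar> * C b) (%y. ps b (tr d s l y) + (-1) * ps b y)"
   by (intro BD_add BD_tr BD_cmult BD_mono[OF b[OF that]]) auto
  thus ?thesis by (simp add: et_def[abs_def])
 qed
 have pe: "pd i (et b) y = pd i (ps b) (tr d s l y) - pd i (ps b) y" if "b : B" "i < d" "y : U" for b i y
 proof (rule pd_eqI)
  have B3: "BD E U (Suc 2) (C b) (ps b)" using b[OF that(1)] by (simp add: numeral_3_eq_3 numeral_2_eq_2)
  show "((%s. et b (y(i := s))) has_real_derivative pd i (ps b) (tr d s l y) - pd i (ps b) y) (at (y i))"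
   unfolding et_def using low that by (intro DERIV_diff DERIV_tr_line[OF B3] BD_DERIV[OF B3]) auto
 qed
 have "(SUM b:B. (et b (tr d s l ?x) - et b ?x)\<^sup>2) <= s^2 * (vnorm d l)^2 * (s^2 * (vnorm d l)^2 * S)"
 proof (rule diff_family_bound[OF fin B1 tr_mem[OF x]])
  fix \<sigma>
  let ?y = "tr d \<sigma> l (tr d (-s) l x)"
  have y: "?y : U" using tr_mem x by blast
  have "(SUM b:B. SUM i<d. (pd i (et b) ?y)\<^sup>2) = (SUM b:B. SUM i<d. (pd i (ps b) (tr d s l ?y) - pd i (ps b) ?y)\<^sup>2)"
   by (intro sum.cong refl) (use pe y in auto)
  also have "... = (SUM z:B \<times> {..<d}. (pd (snd z) (ps (fst z)) (tr d s l ?y) - pd (snd z) (ps (fst z)) ?y)\<^sup>2)"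
   by (simp add: sum.cartesian_product case_prod_beta')
  also have "... <= s^2 * (vnorm d l)^2 * S"
  proof (rule diff_family_bound[where C = "%z. C (fst z)"])
   show "BD E U 2 (C (fst z)) (pd (snd z) (ps (fst z)))" if "z : B \<times> {..<d}" for z
    using b[of "fst z"] that low by (auto simp: numeral_3_eq_3 numeral_2_eq_2 simp del: BD.simps intro: BD_pd)
   show "(SUM z:B \<times> {..<d}. SUM i<d. (pd i (pd (snd z) (ps (fst z))) (tr d \<sigma>' l ?y))\<^sup>2) <= S" for \<sigma>'
    using S[of "\<sigma>' + (\<sigma> + - s)"] by (subst (asm) sum.cartesian_product) (simp add: tr_tr case_prod_beta')
  qed (use fin y in auto)
  finally show "(SUM b:B. SUM i<d. (pd i (et b) ?y)\<^sup>2) <= s^2 * (vnorm d l)^2 * S" .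
 qed
 moreover have "et b (tr d s l ?x) - et b ?x = ps b (tr d s l x) + ps b (tr d (-s) l x) - 2 * ps b x" for b
  by (simp add: et_def tr_tr tr_0)
 moreover have "s^2 * (vnorm d l)^2 * (s^2 * (vnorm d l)^2 * S) = s^4 * (vnorm d l)^4 * S"
  by (simp add: power4_eq_xxxx power2_eq_square mult_ac)
 ultimately show ?thesis by simp
qed

text \<open>Minkowski's inequality for a weighted vector-valued integral, by the same duality: the
  number of components does not enter.\<close>

lemma integral_family_bound:
 fixes f :: "'b => 'a => real"
 assumes fin: "finite B" and w: "integrable M w" "!!si. 0 <= w si" and S0: "0 <= S"
  and i: "!!b. b : B ==> integrable M (%si. w si * f b si)"
  and S: "AE si in M. (SUM b:B. (f b si)\<^sup>2) <= S"
 shows "(SUM b:B. (\<integral>si. w si * f b si \<partial>M)\<^sup>2) <= (\<integral>si. w si \<partial>M)^2 * S"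
proof -
 define \<Delta> where "\<Delta> b = (\<integral>si. w si * f b si \<partial>M)" for b
 define D where "D = (SUM b:B. (\<Delta> b)\<^sup>2)"
 have D0: "0 <= D" by (simp add: D_def sum_nonneg)
 have W0: "0 <= (\<integral>si. w si \<partial>M)" using w(2) by simp
 have "D = (SUM b:B. (\<integral>si. \<Delta> b * (w si * f b si) \<partial>M))" by (simp add: D_def \<Delta>_def power2_eq_square)
 also have "... = (\<integral>si. (SUM b:B. \<Delta> b * (w si * f b si)) \<partial>M)"
  by (rule Bochner_Integration.integral_sum[symmetric]) (use i in auto)
 also have "... <= (\<integral>si. w si * (sqrt D * sqrt S) \<partial>M)"
 proof (rule integral_mono_AE)
  show "integrable M (%si. SUM b:B. \<Delta> b * (w si * f b si))" using i by auto
  show "integrable M (%si. w si * (sqrt D * sqrt S))" using w by auto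
  show "AE si in M. (SUM b:B. \<Delta> b * (w si * f b si)) <= w si * (sqrt D * sqrt S)"
   using S
  proof eventually_elim
   case (elim si)
   have "(SUM b:B. \<Delta> b * (w si * f b si)) = w si * (SUM b:B. \<Delta> b * f b si)" by (simp add: sum_distrib_left mult_ac)
   also have "... <= w si * (sqrt D * sqrt S)"
    using sum_CS_sqrt[OF elim, of \<Delta>] by (intro mult_left_mono w) (simp add: D_def)
   finally show ?case .
  qed
 qed
 also have "... = sqrt D * (sqrt S * (\<integral>si. w si \<partial>M))" by simp
 finally have "D <= (sqrt S * (\<integral>si. w si \<partial>M))^2" using D0 W0 S0 by (intro sq_le_of_self_bound) auto
 thus ?thesis using S0 by (simp add: D_def \<Delta>_def power_mult_distrib mult_ac)
qed

text \<open>A squared norm of the n-th derivative in which each mixed derivative is counted once for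
  every ordering of its directions. It dominates the sum over multi-indices and is at most n! times
  that sum, so the dimension does not enter the comparison.\<close>

definition D2 :: "nat => nat => (vec => real) => vec => real" where
 "D2 d n ph x = (SUM is:nl {..<d} n. (foldr pd is ph x)\<^sup>2)"

lemma D2_nonneg: "0 <= D2 d n ph x" by (simp add: D2_def sum_nonneg)

lemma D2_0: "D2 d 0 ph x = (ph x)^2" by (simp add: D2_def nl_0)

lemma D2_snoc: "D2 d (Suc n) ph x = (SUM i<d. D2 d n (pd i ph) x)"
 unfolding D2_def sum_nl_snoc by (subst sum.swap) simp

lemma D2_Suc: "D2 d (Suc n) ph x = (SUM is:nl {..<d} n. SUM i<d. (pd i (foldr pd is ph) x)\<^sup>2)"
 unfolding D2_def sum_nl_Suc by (subst sum.swap) simp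

section \<open>Energy estimates for the difference scheme\<close>

lemma Rd_upd: "x : Rd d ==> i < d ==> x(i := s) : Rd d"
 by (auto simp: Rd_def PiE_iff extensional_def)

lemma domR_Rd: "domR {..<d} (Rd d) (%_. UNIV) d"
proof
 show "Rd d ~= {}" by (auto simp: Rd_def PiE_eq_empty_iff)
qed (auto simp: Rd_upd)

lemma shift_tr: "x : Rd d ==> shift d s l x = tr d s l x"
 by (auto simp: shift_def tr_def Rd_def PiE_iff extensional_def)

lemma sum_subset_image_le:
 fixes f :: "'b => real"
 assumes "finite B" "inj_on g A" "g ` A \<subseteq> B" "!!b. b : B ==> 0 <= f b"
 shows "(SUM a:A. f (g a)) <= (SUM b:B. f b)"
proof -
 have "(SUM a:A. f (g a)) = (SUM b:g ` A. f b)" using assms(2) by (simp add: sum.reindex)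
 also have "... <= (SUM b:B. f b)" using assms by (intro sum_mono2) auto
 finally show ?thesis .
qed

lemma sum_fst_snd: "(SUM z:A \<times> B. g (fst z) (snd z)) = (SUM a:A. SUM b:B. g a b)"
 by (simp add: sum.cartesian_product case_prod_beta')

lemma vneg_vneg: "l : Rd d ==> vneg d (vneg d l) = l"
 by (auto simp: vneg_def Rd_def PiE_iff extensional_def)

lemma sum_vneg:
 assumes "vneg d ` L = L" "L \<subseteq> Rd d"
 shows "(SUM l:L. f (vneg d l)) = (SUM l:L. f l)"
proof -
 have "inj_on (vneg d) L" by (rule inj_on_inverseI[of _ "vneg d"]) (use vneg_vneg assms(2) in auto)
 hence "(SUM l:L. f (vneg d l)) = (SUM l:vneg d ` L. f l)" by (simp add: sum.reindex)
 thus ?thesis by (simp add: assms(1))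
qed

text \<open>One fixed mesh size and smooth, in practice mollified, coefficients. In
  \<open>struct\<close> the nonlocal operators have been replaced by sup bounds B and B', and the
  inequalities have been summed over the remaining entries \<open>u\<close> of the tuples; this form
  survives mollification. For n = 1 the second sum carries the weight n(n - 1) = 0, so the truncated
  n - 2 is harmless.\<close>

locale energy = scheme d La ell \<tau>0 \<tau> q p c
 for d La ell \<tau>0 \<tau> q p c +
 fixes h T de K c0 nL nL\<tau> Mb :: real and m :: nat
 assumes fin: "finite La" and L1: "La \<subseteq> Rd d" and ell_inj: "inj_on ell {..<d}"
  and disj: "ell ` {..<d} \<inter> La = {}"
  and h0: "0 < h" and T0: "0 <= T" and \<tau>0: "0 < \<tau>0" and de0: "0 < de" and de1: "de <= 1" and K1: "1 <= K" and c00: "0 < c0"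
  and nL: "(SUM l:La. (vnorm d l)\<^sup>2) = nL^2" and nL\<tau>: "(SUM l:La. (\<tau> l * vnorm d l)\<^sup>2) = nL\<tau>^2"
  and q_SM: "l : La ==> SM {..<d} (Rd d) {0..T} (q l)"
  and p_SM: "l : La ==> SM {..<d} (Rd d) {0..T} (p l)"
  and c_SM: "SM {..<d} (Rd d) {0..T} c"
  and q_meas: "l : La ==> x : Rd d ==> (%t. q l t x) : time_measurable T"
  and p_meas: "l : La ==> x : Rd d ==> (%t. p l t x) : time_measurable T"
  and c_meas: "x : Rd d ==> (%t. c t x) : time_measurable T"
  and qp_nonneg: "l : La ==> t : {0..T} ==> x : Rd d ==> 0 <= q l t x + h * p l t x"
  and c_ge: "t : {0..T} ==> x : Rd d ==> c0 <= c t x"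
  and L1_sym: "vneg d ` La = La"
  and q_sym: "l : La ==> t : {0..T} ==> x : Rd d ==> q (vneg d l) t x = q l t x"
  and coef_bound: "k <= m ==> t : {0..T} ==> x : Rd d ==>
   (SUM l:La. D2 d k (q l t) x + D2 d k (p l t) x) + D2 d k (c t) x <= Mb"
  and struct: "1 <= n ==> n <= m ==> t : {0..T} ==> x : Rd d ==> SM {..<d} (Rd d) (UNIV :: unit set) (%_. ph) ==>
   (!!y. y : Rd d ==> dbar_sq h n ph y <= B) ==> (!!y. y : Rd d ==> dbar_sq h (n - 1) ph y <= B') ==>
   real n * (SUM u:nl \<Lambda> (n - 1). Ah h t (dbar h u ph) x)
   + real n * (real n - 1) * (SUM u:nl \<Lambda> (n - 2). SUM s:nl \<Lambda> 2. dbar h s (dbar h u ph) x * Qmu h t s (Th h s (dbar h u ph)) x)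
   <= (1 - de) * (SUM mu:nl \<Lambda> n. Qform h t (dbar h mu ph) x) + K * (SUM mu:nl \<Lambda> (n - 1). Qform h t (dbar h mu ph) x)
    + 2 * (1 - de) * c t x * B + K * B'"
begin

sublocale D: domR "{..<d}" "Rd d" "%_. UNIV" d by (rule domR_Rd)

abbreviation S1 :: "(vec => real) => bool" where "S1 ph \<equiv> SM {..<d} (Rd d) (UNIV :: unit set) (%_. ph)"
abbreviation SR :: "(real => vec => real) => bool" where "SR ph \<equiv> SM {..<d} (Rd d) {0..T} ph"

lemma SR_S1: "SR ph ==> t : {0..T} ==> S1 (ph t)" by (rule D.SM_single)

lemma fin_\<Lambda>: "finite \<Lambda>" using fin by (simp add: \<Lambda>_def)

lemma tuples_nl: "tuples \<Lambda> k = nl \<Lambda> k" by (simp add: tuples_def nl_def)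

lemma \<Lambda>_cases:
 assumes "nu : \<Lambda>"
 obtains "nu : La" "!!ph x. x : Rd d ==> dbar1 h nu ph x = \<tau> nu / h * (ph (tr d h nu x) - ph x)"
   "!!ph x. x : Rd d ==> Th1 h nu ph x = ph (tr d h nu x)"
 | i where "i < d" "nu = ell i" "!!ph x. dbar1 h nu ph x = \<tau>0 * pd i ph x" "!!ph x. Th1 h nu ph x = ph x"
proof (cases "nu : La")
 case True thus ?thesis using that(1) by (simp add: dbar1_def Th1_def shift_tr)
next
 case False
 then obtain i where i: "i < d" "nu = ell i" using assms by (auto simp: \<Lambda>_def)
 hence "inv_into {..<d} ell nu = i" using ell_inj by simp
 thus ?thesis using that(2)[OF i] False by (simp add: dbar1_def Th1_def)
qed

lemma dbar1_ell: "i < d ==> dbar1 h (ell i) ph x = \<tau>0 * pd i ph x"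
 using ell_inj disj by (auto simp: dbar1_def)

text \<open>Linear operators that preserve smoothness and commute with translations and partial
  derivatives. The class contains all shifts, differences and partial derivatives and is closed
  under composition, so its members commute with all of these.\<close>

definition Com :: "((vec => real) => vec => real) => bool" where
 "Com F \<longleftrightarrow> (ALL ph. SR ph --> SR (%t. F (ph t))) & (ALL ph. S1 ph --> S1 (F ph)) &
  (ALL ph ps x. (ALL x:Rd d. ph x = ps x) --> x : Rd d --> F ph x = F ps x) &
  (ALL ph s l x. S1 ph --> x : Rd d --> F (%y. ph (tr d s l y)) x = F ph (tr d s l x)) &
  (ALL ph i x. S1 ph --> i < d --> x : Rd d --> F (pd i ph) x = pd i (F ph) x) &
  (ALL ph ps a b x. S1 ph --> S1 ps --> x : Rd d --> F (%y. a * ph y + b * ps y) x = a * F ph x + b * F ps x)"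

lemma
 assumes "Com F"
 shows Com_SR: "SR ph ==> SR (%t. F (ph t))"
  and Com_S1: "S1 ph' ==> S1 (F ph')"
  and Com_cong: "(!!x. x : Rd d ==> ph' x = ps x) ==> x : Rd d ==> F ph' x = F ps x"
  and Com_tr: "S1 ph' ==> x : Rd d ==> F (%y. ph' (tr d s l y)) x = F ph' (tr d s l x)"
  and Com_pd: "S1 ph' ==> i < d ==> x : Rd d ==> F (pd i ph') x = pd i (F ph') x"
  and Com_lin: "S1 ph' ==> S1 ps ==> x : Rd d ==> F (%y. a * ph' y + b * ps y) x = a * F ph' x + b * F ps x"
 using assms unfolding Com_def by blast+

lemma S1_pd: "S1 ph ==> i < d ==> S1 (pd i ph)" using D.SM_pd by simp
lemma S1_tr: "S1 ph ==> S1 (%y. ph (tr d s l y))" by (rule D.SM_tr)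
lemma S1_cong: "(!!x. x : Rd d ==> ph x = ps x) ==> S1 ph \<longleftrightarrow> S1 ps" by (rule D.SM_cong) simp

lemma Com_comp:
 assumes F: "Com F" and G: "Com G" shows "Com (%ph. F (G ph))"
 unfolding Com_def
proof (intro conjI allI impI)
 show "SR (%t. F (G (ph t)))" if "SR ph" for ph using Com_SR[OF F Com_SR[OF G that]] .
 show "S1 (F (G ph))" if "S1 ph" for ph using Com_S1[OF F Com_S1[OF G that]] .
 show "F (G ph) x = F (G ps) x" if "ALL x:Rd d. ph x = ps x" "x : Rd d" for ph ps x
  by (rule Com_cong[OF F Com_cong[OF G]]) (use that in auto)
 show "F (G (%y. ph (tr d s l y))) x = F (G ph) (tr d s l x)" if "S1 ph" "x : Rd d" for ph s l x
  using Com_cong[OF F Com_tr[OF G that(1)] that(2)] Com_tr[OF F Com_S1[OF G that(1)] that(2)] by simp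
 show "F (G (pd i ph)) x = pd i (F (G ph)) x" if "S1 ph" "i < d" "x : Rd d" for ph i x
  using Com_cong[OF F Com_pd[OF G that(1,2)] that(3)] Com_pd[OF F Com_S1[OF G that(1)] that(2,3)] by simp
 show "F (G (%y. a * ph y + b * ps y)) x = a * F (G ph) x + b * F (G ps) x" if "S1 ph" "S1 ps" "x : Rd d" for ph ps a b x
  using Com_cong[OF F Com_lin[OF G that(1,2)] that(3)] Com_lin[OF F Com_S1[OF G that(1)] Com_S1[OF G that(2)] that(3)] by simp
qed

lemma Com_id: "Com (%ph. ph)" unfolding Com_def by auto

lemma tr_swap: "tr d s l (tr d r k x) = tr d r k (tr d s l x)" by (auto simp: tr_def)

lemma Com_diffop:
 assumes F: "!!ph x. x : Rd d ==> F ph x = a * ph (tr d s l x) + b * ph x"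
 shows "Com F"
 unfolding Com_def
proof (intro conjI allI impI)
 note mem = D.tr_mem
 show "SR (%t. F (ph t))" if "SR ph" for ph
  using D.SM_add[OF D.SM_cmult[OF D.SM_tr[OF that]] D.SM_cmult[OF that]] D.SM_cong[of "{0..T}" "%t. F (ph t)" "%t x. a * ph t (tr d s l x) + b * ph t x"] F by simp
 show "S1 (F ph)" if "S1 ph" for ph
  using D.SM_add[OF D.SM_cmult[OF D.SM_tr[OF that]] D.SM_cmult[OF that]] S1_cong[of "F ph" "%x. a * ph (tr d s l x) + b * ph x"] F by simp
 show "F ph x = F ps x" if "ALL x:Rd d. ph x = ps x" "x : Rd d" for ph ps x using that F mem by simp
 show "F (%y. ph (tr d s' l' y)) x = F ph (tr d s' l' x)" if "S1 ph" "x : Rd d" for ph s' l' x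
  using F that mem tr_swap by simp
 show "F (pd i ph) x = pd i (F ph) x" if "S1 ph" "i < d" "x : Rd d" for ph i x
 proof -
  have "pd i (F ph) x = pd i (%x. a * ph (tr d s l x) + b * ph x) x"
   by (rule D.pd_cong) (use F that in auto)
  also have "... = a * pd i ph (tr d s l x) + b * pd i ph x"
   using D.pd_add[OF D.SM_cmult[OF D.SM_tr[OF that(1)]] D.SM_cmult[OF that(1)] _ that(3), where i = i]
    D.pd_cmult[OF D.SM_tr[OF that(1)] _ that(3), where i = i] D.pd_cmult[OF that(1) _ that(3), where i = i]
    D.pd_tr[OF that(1) _ that(3), where i = i] that(2) by simp
  finally show ?thesis using F that by simp
 qed
 show "F (%y. a' * ph y + b' * ps y) x = a' * F ph x + b' * F ps x" if "S1 ph" "S1 ps" "x : Rd d" for ph ps a' b' x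
  using F that by (simp add: algebra_simps)
qed

lemma Com_pdop:
 assumes "i < d" shows "Com (%ph x. k * pd i ph x)"
 unfolding Com_def
proof (intro conjI allI impI)
 show "SR (%t x. k * pd i (ph t) x)" if "SR ph" for ph using D.SM_cmult[OF D.SM_pd[OF that]] assms by simp
 show "S1 (%x. k * pd i ph x)" if "S1 ph" for ph using D.SM_cmult[OF D.SM_pd[OF that]] assms by simp
 show "k * pd i ph x = k * pd i ps x" if "ALL x:Rd d. ph x = ps x" "x : Rd d" for ph ps x
  using D.pd_cong[of ph ps x i] that assms by simp
 show "k * pd i (%y. ph (tr d s' l' y)) x = k * pd i ph (tr d s' l' x)" if "S1 ph" "x : Rd d" for ph s' l' x
  using D.pd_tr[OF that(1) _ that(2)] assms by simp
 show "k * pd i (pd j ph) x = pd j (%x. k * pd i ph x) x" if "S1 ph" "j < d" "x : Rd d" for ph j x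
  using D.pd_cmult[OF D.SM_pd[OF that(1), where i = i] _ that(3), where i = j and k = k] D.SM_commute[OF that(1) _ that(3), where i = i and j = j] assms that by simp
 show "k * pd i (%y. a * ph y + b * ps y) x = a * (k * pd i ph x) + b * (k * pd i ps x)" if "S1 ph" "S1 ps" "x : Rd d" for ph ps a b x
  using D.pd_add[OF D.SM_cmult[OF that(1)] D.SM_cmult[OF that(2)] _ that(3), where i = i]
   D.pd_cmult[OF that(1) _ that(3), where i = i] D.pd_cmult[OF that(2) _ that(3), where i = i] assms by (simp add: algebra_simps)
qed

lemma Com_dbar1: "nu : \<Lambda> ==> Com (dbar1 h nu)"
proof (erule \<Lambda>_cases)
 assume "!!ph x. x : Rd d ==> dbar1 h nu ph x = \<tau> nu / h * (ph (tr d h nu x) - ph x)"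
 thus ?thesis by (intro Com_diffop[where a = "\<tau> nu / h" and b = "- (\<tau> nu / h)" and s = h and l = nu]) (simp add: right_diff_distrib)
next
 fix i assume i: "i < d" "nu = ell i" "!!ph x. dbar1 h nu ph x = \<tau>0 * pd i ph x"
 hence "dbar1 h nu = (%ph x. \<tau>0 * pd i ph x)" by auto
 thus ?thesis using Com_pdop[OF i(1)] by simp
qed

lemma Com_Th1: "nu : \<Lambda> ==> Com (Th1 h nu)"
proof (erule \<Lambda>_cases)
 assume "!!ph x. x : Rd d ==> Th1 h nu ph x = ph (tr d h nu x)"
 thus ?thesis by (intro Com_diffop[where a = 1 and b = 0 and s = h and l = nu]) simp
next
 fix i assume "!!ph x. Th1 h nu ph x = ph x"
 hence "Th1 h nu = (%ph. ph)" by (intro ext) simp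
 thus ?thesis using Com_id by simp
qed

lemma Com_\<delta>d: "Com (\<delta>d h l)"
 by (rule Com_diffop[where a = "1/h" and b = "-1/h" and s = h and l = l]) (simp add: \<delta>d_def shift_tr diff_divide_distrib)

lemma Com_dbar: "set mu \<subseteq> \<Lambda> ==> Com (dbar h mu)"
proof (induction mu)
 case Nil thus ?case using Com_id by (simp add: dbar_def id_def)
next
 case (Cons nu mu)
 have "dbar h (nu # mu) = (%ph. dbar1 h nu (dbar h mu ph))" by (auto simp: dbar_def)
 thus ?case using Com_comp[OF Com_dbar1, of nu "dbar h mu"] Cons by simp
qed

lemma Com_Th: "set mu \<subseteq> \<Lambda> ==> Com (Th h mu)"
proof (induction mu)
 case Nil thus ?case using Com_id by (simp add: Th_def id_def)
next
 case (Cons nu mu)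
 have "Th h (nu # mu) = (%ph. Th1 h nu (Th h mu ph))" by (auto simp: Th_def)
 thus ?case using Com_comp[OF Com_Th1, of nu "Th h mu"] Cons by simp
qed

lemma dbar_Nil [simp]: "dbar h [] ph = ph" and Th_Nil [simp]: "Th h [] ph = ph"
 and dbar_Cons: "dbar h (nu # mu) ph = dbar1 h nu (dbar h mu ph)"
 and Th_Cons: "Th h (nu # mu) ph = Th1 h nu (Th h mu ph)"
 and dbar_append: "dbar h (mu @ mu') ph = dbar h mu (dbar h mu' ph)"
 by (simp_all add: dbar_def Th_def)

lemma Com_commute_diffop:
 assumes C: "Com F" and "S1 ph" "x : Rd d" and G: "!!ph x. x : Rd d ==> G ph x = a * ph (tr d s l x) + b * ph x"
 shows "F (G ph) x = G (F ph) x"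
proof -
 have "F (G ph) x = F (%y. a * ph (tr d s l y) + b * ph y) x" by (rule Com_cong[OF C]) (use G assms in auto)
 also have "... = a * F ph (tr d s l x) + b * F ph x"
  using Com_lin[OF C S1_tr[OF assms(2)] assms(2,3)] Com_tr[OF C assms(2,3)] by simp
 finally show ?thesis using G assms by simp
qed

lemma Com_commute_dbar1:
 assumes C: "Com F" and "S1 ph" "x : Rd d" "nu : \<Lambda>"
 shows "F (dbar1 h nu ph) x = dbar1 h nu (F ph) x"
 using assms(4)
proof (cases rule: \<Lambda>_cases)
 case 1
 show ?thesis
  by (rule Com_commute_diffop[OF C assms(2,3), where a = "\<tau> nu / h" and b = "- (\<tau> nu / h)" and s = h and l = nu]) (simp add: 1 algebra_simps)
next
 case (2 i)
 have "F (%y. \<tau>0 * pd i ph y + 0 * pd i ph y) x = \<tau>0 * F (pd i ph) x + 0 * F (pd i ph) x"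
  using 2(1) assms by (intro Com_lin[OF C] S1_pd) auto
 moreover have "dbar1 h nu ph = (%y. \<tau>0 * pd i ph y)" using 2 by auto
 ultimately show ?thesis using Com_pd[OF C assms(2) 2(1) assms(3)] 2 by simp
qed

lemma Com_commute_\<delta>d:
 assumes C: "Com F" and "S1 ph" "x : Rd d"
 shows "F (\<delta>d h l ph) x = \<delta>d h l (F ph) x"
 by (rule Com_commute_diffop[OF assms, where a = "1/h" and b = "-1/h" and s = h and l = l]) (simp add: \<delta>d_def shift_tr diff_divide_distrib)

lemma dbar_splits:
 assumes "S1 ph"
 shows "(s, u) : set (splits mu) ==> x : Rd d ==> set mu \<subseteq> \<Lambda> ==> dbar h mu ph x = dbar h s (dbar h u ph) x"
proof (induction mu arbitrary: s u x)
 case (Cons nu mu)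
 have nu: "nu : \<Lambda>" and mu: "set mu \<subseteq> \<Lambda>" using Cons.prems by auto
 consider s' where "s = nu # s'" "(s', u) : set (splits mu)" | u' where "u = nu # u'" "(s, u') : set (splits mu)"
  using Cons.prems(1) by auto
 thus ?case
 proof cases
  case 1
  have "dbar1 h nu (dbar h mu ph) x = dbar1 h nu (dbar h s' (dbar h u ph)) x"
   by (rule Com_cong[OF Com_dbar1[OF nu] Cons.IH[OF 1(2) _ mu] Cons.prems(2)])
  thus ?thesis by (simp add: 1 dbar_Cons)
 next
  case 2
  have su: "set s \<subseteq> \<Lambda>" "set u' \<subseteq> \<Lambda>" using splits_sub[OF 2(2)] mu by auto
  have "dbar1 h nu (dbar h mu ph) x = dbar1 h nu (dbar h s (dbar h u' ph)) x"
   by (rule Com_cong[OF Com_dbar1[OF nu] Cons.IH[OF 2(2) _ mu] Cons.prems(2)])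
  also have "... = dbar h s (dbar1 h nu (dbar h u' ph)) x"
   by (rule Com_commute_dbar1[symmetric, OF Com_dbar[OF su(1)] Com_S1[OF Com_dbar[OF su(2)] assms] Cons.prems(2) nu])
  finally show ?thesis by (simp add: 2 dbar_Cons)
 qed
qed simp

lemma Com_sum_list:
 assumes C: "Com F" and "!!z. z : set zs ==> S1 (f z)" "x : Rd d"
 shows "S1 (%x. SUM z<-zs. f z x) & F (%x. SUM z<-zs. f z x) x = (SUM z<-zs. F (f z) x)"
 using assms(2)
proof (induction zs)
 case Nil
 have "F (%y. 0 * (0::real) + 0 * 0) x = 0 * F (%_. 0) x + 0 * F (%_. 0) x"
  by (rule Com_lin[OF C D.SM_const D.SM_const assms(3)])
 thus ?case using D.SM_const by simp
next
 case (Cons z zs)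
 have "S1 (f z)" "S1 (%x. SUM z<-zs. f z x)" using Cons by auto
 from Com_lin[OF C this assms(3), of 1 1] D.SM_add[OF this] show ?case using Cons by simp
qed

lemma Com_sum:
 assumes C: "Com F" and "finite S" "!!z. z : S ==> S1 (f z)" "x : Rd d"
 shows "F (%x. SUM z:S. f z x) x = (SUM z:S. F (f z) x)"
proof -
 obtain zs where zs: "set zs = S" "distinct zs" using finite_distinct_list[OF assms(2)] by blast
 show ?thesis using Com_sum_list[OF C, of zs f x] assms zs by (simp add: sum_list_distinct_conv_sum_set)
qed

text \<open>In a discrete product rule one factor has to be shifted. Letting the shift fall on
  \<open>b\<close> produces exactly the combination of \<open>L0mu\<close> with \<open>Th\<close>
  that stands in the structural inequalities; in the directions of \<Lambda>2 the shift is the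
  identity.\<close>

lemma dbar1_mult:
 assumes "S1 a" "S1 b" "x : Rd d" "nu : \<Lambda>"
 shows "dbar1 h nu (%x. a x * b x) x = a x * dbar1 h nu b x + dbar1 h nu a x * Th1 h nu b x"
 using assms(4)
proof (cases rule: \<Lambda>_cases)
 case 1 show ?thesis by (simp add: 1(2,3) assms) (simp add: algebra_simps diff_divide_distrib)
next
 case (2 i)
 thus ?thesis using D.pd_mult[OF assms(1,2) _ assms(3), of "()" i] by (simp add: algebra_simps)
qed

lemma dbar_mult:
 assumes a: "S1 a" and b: "S1 b"
 shows "x : Rd d ==> set mu \<subseteq> \<Lambda> ==>
  dbar h mu (%x. a x * b x) x = (SUM (s, u)<-splits mu. dbar h s a x * Th h s (dbar h u b) x)"
proof (induction mu arbitrary: x)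
 case (Cons nu mu)
 have nu: "nu : \<Lambda>" and mu: "set mu \<subseteq> \<Lambda>" using Cons.prems by auto
 let ?f = "%z x. dbar h (fst z) a x * Th h (fst z) (dbar h (snd z) b) x"
 have su: "set (fst z) \<subseteq> \<Lambda>" "set (snd z) \<subseteq> \<Lambda>" if "z : set (splits mu)" for z
  using splits_sub[of "fst z" "snd z" mu] that mu by auto
 have S: "S1 (dbar h (fst z) a)" "S1 (dbar h (snd z) b)" "S1 (Th h (fst z) (dbar h (snd z) b))" if "z : set (splits mu)" for z
  using su[OF that] Com_S1[OF Com_dbar] Com_S1[OF Com_Th] a b by auto
 have S2: "S1 (?f z)" if "z : set (splits mu)" for z using D.SM_mult[OF S(1,3)[OF that]] .
 have "dbar h (nu # mu) (%x. a x * b x) x = dbar1 h nu (%x. SUM z<-splits mu. ?f z x) x"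
  unfolding dbar_Cons by (rule Com_cong[OF Com_dbar1[OF nu] _ Cons.prems(1)]) (use Cons.IH mu in "simp add: case_prod_beta'")
 also have "... = (SUM z<-splits mu. dbar1 h nu (?f z) x)"
  by (rule conjunct2[OF Com_sum_list[OF Com_dbar1[OF nu], where f = ?f]]) (use S2 Cons.prems(1) in auto)
 also have "... = (SUM z<-splits mu. dbar h (fst z) a x * Th h (fst z) (dbar1 h nu (dbar h (snd z) b)) x
   + dbar1 h nu (dbar h (fst z) a) x * Th1 h nu (Th h (fst z) (dbar h (snd z) b)) x)"
 proof (intro arg_cong[where f = sum_list] map_cong refl)
  fix z assume z: "z : set (splits mu)"
  show "dbar1 h nu (?f z) x = dbar h (fst z) a x * Th h (fst z) (dbar1 h nu (dbar h (snd z) b)) x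
   + dbar1 h nu (dbar h (fst z) a) x * Th1 h nu (Th h (fst z) (dbar h (snd z) b)) x"
   using dbar1_mult[OF S(1,3)[OF z] Cons.prems(1) nu]
    Com_commute_dbar1[OF Com_Th[OF su(1)[OF z]] S(2)[OF z] Cons.prems(1) nu] by simp
 qed
 also have "... = (SUM (s, u)<-splits (nu # mu). dbar h s a x * Th h s (dbar h u b) x)"
  by (simp add: o_def case_prod_beta' sum_list_addf dbar_Cons Th_Cons)
 finally show ?case .
qed simp

text \<open>The Leibniz term of L_h in which the differences along \<open>s\<close> fall on the
  coefficients. Unlike \<open>L0mu\<close> it contains the term of order zero, so that the empty
  tuple gives back L_h.\<close>

definition Bop :: "real => vec list => (vec => real) => vec => real" where
 "Bop t s ps x = L0mu h t s ps x - dbar h s (c t) x * ps x"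

lemma Bop_eq: "Bop t s ps x = (SUM l:La. 1 / h * (dbar h s (q l t) x * \<delta>d h l ps x) + dbar h s (p l t) x * \<delta>d h l ps x) - dbar h s (c t) x * ps x"
 by (simp add: Bop_def L0mu_def Qmu_def sum.distrib sum_distrib_left)

lemma Lh_Bop: "Lh h t ph x = Bop t [] ph x"
 by (simp add: Bop_eq Lh_def sum.distrib sum_distrib_left)

lemma dbar_Lh:
 assumes ph: "S1 ph" and t: "t : {0..T}" and x: "x : Rd d" and mu: "set mu \<subseteq> \<Lambda>"
 shows "S1 (Lh h t ph)" "dbar h mu (Lh h t ph) x = (SUM (s, u)<-splits mu. Bop t s (Th h s (dbar h u ph)) x)"
proof -
 note C = Com_dbar[OF mu]
 have qpc: "l : La ==> S1 (q l t)" "l : La ==> S1 (p l t)" "S1 (c t)" for l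
  using SR_S1 q_SM p_SM c_SM t by auto
 have d: "S1 (\<delta>d h l ph)" for l using Com_S1[OF Com_\<delta>d ph] .
 let ?f = "%l x. (1 / h) * (q l t x * \<delta>d h l ph x) + 1 * (p l t x * \<delta>d h l ph x)"
 have f: "S1 (?f l)" if "l : La" for l
  by (intro D.SM_add D.SM_cmult D.SM_mult qpc that d)
 have Leq: "Lh h t ph = (%x. 1 * (SUM l:La. ?f l x) + (-1) * (c t x * ph x))"
  by (auto simp: Lh_Bop Bop_eq)
 have S: "S1 (%x. SUM l:La. ?f l x)" by (intro D.SM_sum fin f)
 have cph: "S1 (%x. c t x * ph x)" by (intro D.SM_mult qpc ph)
 show "S1 (Lh h t ph)" unfolding Leq by (intro D.SM_add D.SM_cmult S cph)
 have dc: "Th h s (dbar h u (\<delta>d h l ph)) x = \<delta>d h l (Th h s (dbar h u ph)) x"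
  if "(s, u) : set (splits mu)" for s u l
 proof -
  have su: "set s \<subseteq> \<Lambda>" "set u \<subseteq> \<Lambda>" using splits_sub[OF that] mu by auto
  have "Th h s (dbar h u (\<delta>d h l ph)) x = Th h s (\<delta>d h l (dbar h u ph)) x"
   by (rule Com_cong[OF Com_Th[OF su(1)] Com_commute_\<delta>d[OF Com_dbar[OF su(2)] ph] x])
  also have "... = \<delta>d h l (Th h s (dbar h u ph)) x"
   by (rule Com_commute_\<delta>d[OF Com_Th[OF su(1)] Com_S1[OF Com_dbar[OF su(2)] ph] x])
  finally show ?thesis .
 qed
 have m: "dbar h mu (%x. a x * \<delta>d h l ph x) x = (SUM z<-splits mu. dbar h (fst z) a x * \<delta>d h l (Th h (fst z) (dbar h (snd z) ph)) x)"
  if "S1 a" for a l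
  unfolding dbar_mult[OF that d x mu] by (intro arg_cong[where f = sum_list] map_cong refl) (auto simp: dc)
 have "dbar h mu (Lh h t ph) x = (SUM l:La. dbar h mu (?f l) x) - dbar h mu (%x. c t x * ph x) x"
  unfolding Leq using Com_lin[OF C S cph x, of 1 "-1"] Com_sum[OF C fin f x] by simp
 also have "... = (SUM l:La. 1 / h * dbar h mu (%x. q l t x * \<delta>d h l ph x) x + dbar h mu (%x. p l t x * \<delta>d h l ph x) x)
   - dbar h mu (%x. c t x * ph x) x"
 proof -
  have "dbar h mu (?f l) x = 1 / h * dbar h mu (%x. q l t x * \<delta>d h l ph x) x + dbar h mu (%x. p l t x * \<delta>d h l ph x) x" if "l : La" for l
   using Com_lin[OF C D.SM_mult[OF qpc(1)[OF that] d] D.SM_mult[OF qpc(2)[OF that] d] x, of "1 / h" l 1] by simp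
  thus ?thesis by simp
 qed
 also have "... = (SUM l:La. SUM z<-splits mu. 1 / h * (dbar h (fst z) (q l t) x * \<delta>d h l (Th h (fst z) (dbar h (snd z) ph)) x)
   + dbar h (fst z) (p l t) x * \<delta>d h l (Th h (fst z) (dbar h (snd z) ph)) x)
   - (SUM z<-splits mu. dbar h (fst z) (c t) x * Th h (fst z) (dbar h (snd z) ph) x)"
  by (intro arg_cong2[where f = "(-)"] sum.cong refl)
   (simp_all only: m[OF qpc(1)] m[OF qpc(2)] dbar_mult[OF qpc(3) ph x mu] sum_list_addf sum_list_const_mult case_prod_beta')
 also have "... = (SUM (s, u)<-splits mu. Bop t s (Th h s (dbar h u ph)) x)"
  unfolding Bop_eq case_prod_beta' sum_list_subtractf
  by (simp add: sum_list_sum_nth sum.swap[of _ La])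
 finally show "dbar h mu (Lh h t ph) x = (SUM (s, u)<-splits mu. Bop t s (Th h s (dbar h u ph)) x)" .
qed

text \<open>A composite shift is evaluation at some point y that depends on neither the function nor
  a further translation. Sup bounds thus pass through \<open>Th\<close>, and differences at x become
  differences at y.\<close>

lemma Th_point:
 assumes "x : Rd d" "set s \<subseteq> \<Lambda>"
 shows "EX y:Rd d. ALL ps r l. Th h s ps x = ps y & Th h s ps (tr d r l x) = ps (tr d r l y)"
 using assms
proof (induction s arbitrary: x)
 case Nil thus ?case by auto
next
 case (Cons nu s)
 have nu: "nu : \<Lambda>" "set s \<subseteq> \<Lambda>" using Cons.prems by auto
 from nu(1) show ?case
 proof (cases rule: \<Lambda>_cases)
  case 1
  obtain y where y: "y : Rd d" "!!ps r l. Th h s ps (tr d h nu x) = ps y & Th h s ps (tr d r l (tr d h nu x)) = ps (tr d r l y)"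
   using Cons.IH[OF D.tr_mem[OF Cons.prems(1)] nu(2), of h nu] by metis
  show ?thesis
   by (rule bexI[OF _ y(1)]) (use y 1 Cons.prems D.tr_mem tr_swap in "auto simp: Th_Cons")
 next
  case (2 i) thus ?thesis using Cons.IH[OF Cons.prems(1) nu(2)] by (simp add: Th_Cons)
 qed
qed

text \<open>From 2w(w' - w) = w'^2 - w^2 - (w' - w)^2 for each direction. \<open>Qform\<close> is
  the discrete carre du champ, the only dissipation available to the energy estimates.\<close>

lemma Lh_square:
 assumes "x : Rd d"
 shows "2 * w x * Lh h t w x = (SUM l:La. (q l t x + h * p l t x) / h^2 * ((w (tr d h l x))^2 - (w x)\<^sup>2))
  - 2 * c t x * (w x)^2 - Qform h t w x"
proof -
 have "2 * w x * Lh h t w x = (SUM l:La. 2 * w x * (1 / h * (q l t x * \<delta>d h l w x) + p l t x * \<delta>d h l w x)) - 2 * c t x * (w x)^2"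
  by (simp add: Lh_Bop Bop_eq right_diff_distrib sum_distrib_left power2_eq_square mult_ac)
 also have "(SUM l:La. 2 * w x * (1 / h * (q l t x * \<delta>d h l w x) + p l t x * \<delta>d h l w x)) =
  (SUM l:La. (q l t x + h * p l t x) / h^2 * ((w (tr d h l x))^2 - (w x)\<^sup>2) - (q l t x + h * p l t x) * (\<delta>d h l w x)^2)"
  using h0 assms by (intro sum.cong refl) (simp add: \<delta>d_def shift_tr power2_eq_square field_simps)
 finally show ?thesis by (simp add: Qform_def sum_subtractf)
qed

lemma Qform_nonneg: "t : {0..T} ==> x : Rd d ==> 0 <= Qform h t w x"
 unfolding Qform_def using qp_nonneg by (auto intro!: sum_nonneg)

lemma dbar_sq_nl: "dbar_sq h k ph x = (SUM mu:nl \<Lambda> k. (dbar h mu ph x)\<^sup>2)"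
 by (simp add: dbar_sq_def tuples_nl)

lemma dbar_sq_nonneg: "0 <= dbar_sq h k ph x" by (simp add: dbar_sq_nl sum_nonneg)

lemma dbar_sq_add: "dbar_sq h (j + k) ph x = (SUM u:nl \<Lambda> k. dbar_sq h j (dbar h u ph) x)"
 unfolding dbar_sq_nl sum_nl_append dbar_append by (rule sum.swap)

lemma nl_sub: "u : nl \<Lambda> k ==> set u \<subseteq> \<Lambda>" by (simp add: nl_def)

lemma dbar_ell:
 assumes "S1 ph"
 shows "set is \<subseteq> {..<d} ==> x : Rd d ==> dbar h (map ell is) ph x = \<tau>0 ^ length is * foldr pd is ph x"
proof (induction "is" arbitrary: x)
 case (Cons i "is")
 have i: "i < d" "set is \<subseteq> {..<d}" using Cons.prems by auto
 have "dbar h (map ell (i # is)) ph x = \<tau>0 * pd i (dbar h (map ell is) ph) x"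
  by (simp add: dbar_Cons dbar1_ell i)
 also have "pd i (dbar h (map ell is) ph) x = pd i (%x. \<tau>0 ^ length is * foldr pd is ph x) x"
  by (rule D.pd_cong[OF Cons.IH[OF i(2)] Cons.prems(2)]) (use i in auto)
 also have "... = \<tau>0 ^ length is * pd i (foldr pd is ph) x"
  by (rule D.pd_cmult[OF D.SM_foldr[OF assms i(2)] _ Cons.prems(2)]) (use i in auto)
 finally show ?case by simp
qed simp

text \<open>Tuples from \<Lambda>2 alone are among all tuples, and along them \<open>dbar\<close> is
  \<tau>0^n times a partial derivative. In this way bounds on the energies return to bounds on
  x-derivatives.\<close>

lemma D2_le_dbar_sq:
 assumes "S1 ph" "x : Rd d"
 shows "\<tau>0 ^ (2 * n) * D2 d n ph x <= dbar_sq h n ph x"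
proof -
 have "\<tau>0 ^ (2 * n) * D2 d n ph x = (SUM is:nl {..<d} n. (dbar h (map ell is) ph x)\<^sup>2)"
  unfolding D2_def sum_distrib_left
  by (intro sum.cong refl) (use dbar_ell[OF assms(1) _ assms(2)] in "auto simp: nl_def power_mult_distrib power_mult[symmetric] mult.commute")
 also have "... <= (SUM mu:nl \<Lambda> n. (dbar h mu ph x)\<^sup>2)"
 proof (rule sum_subset_image_le[where g = "map ell"])
  show "inj_on (map ell) (nl {..<d} n)"
   by (rule inj_onI) (auto simp: nl_def intro!: map_inj_on[of ell] inj_on_subset[OF ell_inj])
  show "map ell ` nl {..<d} n \<subseteq> nl \<Lambda> n" by (force simp: nl_def \<Lambda>_def)
 qed (auto simp: finite_nl fin_\<Lambda>)
 finally show ?thesis by (simp add: dbar_sq_nl)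
qed

text \<open>The squared norm of the family of all first order operators \<open>dbar1\<close>
  relative to the gradient: the directions of \<Lambda>1 contribute the sum of |\<tau> \<lambda>|^2,
  the coordinate directions \<tau>0^2.\<close>

definition ga :: real where "ga = nL\<tau>^2 + \<tau>0^2"

lemma ga_nonneg: "0 <= ga" by (simp add: ga_def)

lemma dbar1_family:
 assumes B: "finite B" and ps: "!!b. b : B ==> S1 (ps b)"
  and S: "!!y. y : Rd d ==> (SUM b:B. SUM i<d. (pd i (ps b) y)\<^sup>2) <= S" and x: "x : Rd d"
 shows "(SUM b:B. SUM nu:\<Lambda>. (dbar1 h nu (ps b) x)\<^sup>2) <= ga * S"
proof -
 obtain C where C: "!!b. b : B ==> BD {..<d} (Rd d) 2 (C b) (ps b)" using D.SM_BD[OF ps, of _ "()" 2] by (metis UNIV_I)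
 have "(SUM b:B. SUM nu:\<Lambda>. (dbar1 h nu (ps b) x)\<^sup>2) =
  (SUM b:B. SUM nu:La. (dbar1 h nu (ps b) x)\<^sup>2) + (SUM b:B. SUM nu:ell ` {..<d}. (dbar1 h nu (ps b) x)\<^sup>2)"
  unfolding \<Lambda>_def using fin disj by (subst sum.union_disjoint) (auto simp: sum.distrib)
 also have "(SUM b:B. SUM nu:ell ` {..<d}. (dbar1 h nu (ps b) x)\<^sup>2) = \<tau>0^2 * (SUM b:B. SUM i<d. (pd i (ps b) x)\<^sup>2)"
  using ell_inj by (simp add: sum.reindex dbar1_ell power_mult_distrib sum_distrib_left)
 also have "... <= \<tau>0^2 * S" by (intro mult_left_mono S x) simp
 also have "(SUM b:B. SUM nu:La. (dbar1 h nu (ps b) x)\<^sup>2) = (SUM nu:La. (\<tau> nu / h)\<^sup>2 * (SUM b:B. (ps b (tr d h nu x) - ps b x)\<^sup>2))"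
  by (subst sum.swap) (simp add: dbar1_def shift_tr x power_mult_distrib sum_distrib_left power_divide)
 also have "... <= (SUM nu:La. (\<tau> nu / h)\<^sup>2 * (h^2 * (vnorm d nu)^2 * S))"
  by (intro sum_mono mult_left_mono D.diff_family_bound[OF B C x] S D.tr_mem x) auto
 also have "... = (SUM nu:La. (\<tau> nu * vnorm d nu)\<^sup>2) * S"
  using h0 by (simp add: sum_distrib_left sum_distrib_right power_mult_distrib power_divide mult_ac)
 also have "... = nL\<tau>^2 * S" by (simp add: nL\<tau>)
 finally show ?thesis by (simp add: ga_def distrib_right)
qed

text \<open>Each induction step trades one operator \<open>dbar1\<close> for a gradient at the cost
  of the factor \<open>ga\<close>; \<open>k\<close> counts the partial derivatives already produced,
  and the statement is generalised over it for this reason.\<close>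

lemma dbar_family_aux:
 assumes "finite B" and ps: "!!b. b : B ==> S1 (ps b)"
 shows "(!!y. y : Rd d ==> (SUM b:B. D2 d (n + k) (ps b) y) <= S) ==> x : Rd d ==>
  (SUM b:B. SUM is:nl {..<d} k. dbar_sq h n (foldr pd is (ps b)) x) <= ga ^ n * S"
proof (induction n arbitrary: k x)
 case 0 thus ?case by (simp add: dbar_sq_nl nl_0 D2_def)
next
 case (Suc n)
 have S1i: "S1 (foldr pd is (ps b))" if "b : B" "is : nl {..<d} k" for b "is" k
  using D.SM_foldr[OF ps[OF that(1)], of "is"] that(2) by (simp add: nl_def)
 let ?I = "(B \<times> nl {..<d} k) \<times> nl \<Lambda> n"
 let ?ps = "%z. dbar h (snd z) (foldr pd (snd (fst z)) (ps (fst (fst z))))"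
 have I: "(SUM z:?I. g (fst (fst z)) (snd (fst z)) (snd z)) = (SUM b:B. SUM is:nl {..<d} k. SUM u:nl \<Lambda> n. g b is u)"
  for g :: "_ => _ => _ => real"
  by (simp add: sum_fst_snd[where g = "%y u. g (fst y) (snd y) u"] sum_fst_snd[where g = "%b is. SUM u:nl \<Lambda> n. g b is u"])
 have "(SUM b:B. SUM is:nl {..<d} k. dbar_sq h (Suc n) (foldr pd is (ps b)) x) = (SUM z:?I. SUM nu:\<Lambda>. (dbar1 h nu (?ps z) x)\<^sup>2)"
  unfolding dbar_sq_nl sum_nl_Suc dbar_Cons I[where g = "%b is u. SUM nu:\<Lambda>. (dbar1 h nu (dbar h u (foldr pd is (ps b))) x)\<^sup>2"]
  by (intro sum.cong refl sum.swap)
 also have "... <= ga * (ga ^ n * S)"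
 proof (rule dbar1_family)
  show "finite ?I" by (intro finite_cartesian_product assms(1) finite_nl fin_\<Lambda>) simp
  show "S1 (?ps z)" if "z : ?I" for z
   using that Com_S1[OF Com_dbar[OF nl_sub] S1i] by auto
  fix y assume y: "y : Rd d"
  have "(SUM z:?I. SUM i<d. (pd i (?ps z) y)\<^sup>2) = (SUM z:?I. SUM i<d. (dbar h (snd z) (pd i (foldr pd (snd (fst z)) (ps (fst (fst z))))) y)\<^sup>2)"
  proof (intro sum.cong refl)
   fix z i assume "z : ?I" "i : {..<d}"
   thus "(pd i (?ps z) y)^2 = (dbar h (snd z) (pd i (foldr pd (snd (fst z)) (ps (fst (fst z))))) y)^2"
    using Com_pd[OF Com_dbar[OF nl_sub] S1i _ y] by auto
  qed
  also have "... = (SUM b:B. SUM is:nl {..<d} k. SUM u:nl \<Lambda> n. SUM i<d. (dbar h u (pd i (foldr pd is (ps b))) y)\<^sup>2)"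
   by (rule I[where g = "%b is u. SUM i<d. (dbar h u (pd i (foldr pd is (ps b))) y)\<^sup>2"])
  also have "... = (SUM b:B. SUM is:nl {..<d} k. SUM i<d. dbar_sq h n (pd i (foldr pd is (ps b))) y)"
   unfolding dbar_sq_nl by (intro sum.cong refl sum.swap)
  also have "... = (SUM b:B. SUM is:nl {..<d} (Suc k). dbar_sq h n (foldr pd is (ps b)) y)"
   unfolding sum_nl_Suc by (intro sum.cong refl) (simp add: sum.swap[of _ "{..<d}"])
  also have "... <= ga ^ n * S"
   by (rule Suc.IH) (use Suc.prems y in auto)
  finally show "(SUM z:?I. SUM i<d. (pd i (?ps z) y)\<^sup>2) <= ga ^ n * S" .
 qed (use Suc.prems in auto)
 finally show ?case by (simp add: mult.assoc)
qed

lemma dbar_family: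
 assumes "finite B" "!!b. b : B ==> S1 (ps b)"
  "!!y. y : Rd d ==> (SUM b:B. D2 d n (ps b) y) <= S" "x : Rd d"
 shows "(SUM b:B. dbar_sq h n (ps b) x) <= ga ^ n * S"
 using dbar_family_aux[OF assms(1,2), where n = n and k = 0 and S = S and x = x] assms(3,4) by (simp add: nl_0)

end

text \<open>A common bound for the Leibniz remainders from c, p and q. The summands 1,
  nL^2/\<tau>0^2 and nL^4/\<tau>0^4 are the prices for no, one and two differences along \<Lambda>1
  on the solution, each turned into a gradient and then into an energy of higher order.\<close>

definition cK1 :: "nat => real => real => real => real => real" where
 "cK1 m \<tau>0 nL nL\<tau> Mb = (1 + (nL\<tau>^2 + \<tau>0^2)) ^ m * Mb * (1 + nL^2 / \<tau>0^2 + nL ^ 4 / \<tau>0 ^ 4)"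

text \<open>The denominator is the parameter \<open>ep\<close> of Young's inequality in
  \<open>energy_ineq\<close>, so small that all remainders together use up no more than
  \<open>de * c0\<close> times the sup of the energy; the quotient multiplies the energies of lower
  order.\<close>

definition cS :: "nat => real => real => real => real => real => real => real" where
 "cS m de c0 \<tau>0 nL nL\<tau> Mb = 4 * 2 ^ m * (cK1 m \<tau>0 nL nL\<tau> Mb + 1) / (de * c0 / (4 * 2 ^ m))"

text \<open>\<open>cXR n\<close> bounds the \<open>n\<close>-th energy and the inhomogeneity in its evolution inequality.\<close>

fun cXR :: "real => real => real => real => real => nat => real \<times> real" where
 "cXR de K c0 Mb A 0 = (1 + 1 / c0^2, 2 + 1 / c0^2)"
| "cXR de K c0 Mb A (Suc n) =
  (let X = fst (cXR de K c0 Mb A n); R = snd (cXR de K c0 Mb A n);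
    S = (K + A) * X + K / de * R; X' = 1 + K / de * X + X + S / (de * c0)
  in (X', (2 * (Mb + 1) + de * c0) * X' + S))"

lemma two_sum_le:
 fixes a b :: "'a => real"
 assumes "0 < ep"
 shows "\<bar>2 * (SUM z:S. a z * b z)\<bar> <= ep * (SUM z:S. (a z)\<^sup>2) + (SUM z:S. (b z)\<^sup>2) / ep"
proof -
 have y: "\<bar>2 * (a z * b z)\<bar> <= ep * (a z)^2 + (b z)^2 / ep" for z
 proof -
  have "0 <= (ep * \<bar>a z\<bar> - \<bar>b z\<bar>)^2 / ep" using assms by simp
  also have "... = ep * (a z)^2 + (b z)^2 / ep - \<bar>2 * (a z * b z)\<bar>"
   using assms by (simp add: power2_diff power_mult_distrib abs_mult field_simps) (simp add: power2_eq_square)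
  finally show ?thesis by simp
 qed
 have "\<bar>2 * (SUM z:S. a z * b z)\<bar> = \<bar>SUM z:S. 2 * (a z * b z)\<bar>" by (simp add: sum_distrib_left)
 also have "... <= (SUM z:S. ep * (a z)^2 + (b z)^2 / ep)" by (rule order_trans[OF sum_abs sum_mono[OF y]])
 finally show ?thesis by (simp add: sum.distrib sum_distrib_left sum_divide_distrib)
qed

context energy
begin

lemma Mb_nonneg: "0 <= Mb"
proof -
 obtain x where x: "x : Rd d" using D.U_ne by blast
 have "0 <= (SUM l:La. D2 d 0 (q l 0) x + D2 d 0 (p l 0) x) + D2 d 0 (c 0) x"
  by (intro add_nonneg_nonneg sum_nonneg D2_nonneg)
 thus ?thesis using coef_bound[OF _ _ x, of 0 0] T0 by simp
qed

lemma tr_vneg: "tr d s (vneg d l) x = tr d (- s) l x"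
 by (auto simp: tr_def vneg_def)

lemma coef_dbar:
 assumes "j <= m" "t : {0..T}" "x : Rd d"
 shows "(SUM l:La. dbar_sq h j (q l t) x) <= ga ^ j * Mb" "(SUM l:La. dbar_sq h j (p l t) x) <= ga ^ j * Mb"
  "dbar_sq h j (c t) x <= ga ^ j * Mb"
proof -
 have "(SUM l:La. D2 d j (q l t) y) <= Mb & (SUM l:La. D2 d j (p l t) y) <= Mb & D2 d j (c t) y <= Mb" if "y : Rd d" for y
 proof -
  have "0 <= (SUM l:La. D2 d j (q l t) y)" "0 <= (SUM l:La. D2 d j (p l t) y)" "0 <= D2 d j (c t) y"
   by (auto intro!: sum_nonneg D2_nonneg)
  thus ?thesis using coef_bound[OF assms(1,2) that] unfolding sum.distrib by linarith
 qed
 note b = this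
 show "(SUM l:La. dbar_sq h j (q l t) x) <= ga ^ j * Mb"
  by (rule dbar_family[OF fin]) (use b SR_S1[OF q_SM assms(2)] assms in auto)
 show "(SUM l:La. dbar_sq h j (p l t) x) <= ga ^ j * Mb"
  by (rule dbar_family[OF fin]) (use b SR_S1[OF p_SM assms(2)] assms in auto)
 show "dbar_sq h j (c t) x <= ga ^ j * Mb"
  using dbar_family[of "{()}" "%_. c t" j Mb x] b SR_S1[OF c_SM assms(2)] assms by simp
qed

abbreviation "ka1 \<equiv> cK1 m \<tau>0 nL nL\<tau> Mb"

lemma ka1_ge:
 assumes "j <= m" "0 <= Y"
 shows "ga ^ j * Mb * Y <= ka1 * Y" "ga ^ j * Mb * (nL^2 / \<tau>0^2) * Y <= ka1 * Y" "ga ^ j * Mb * (nL ^ 4 / \<tau>0 ^ 4) * Y <= ka1 * Y"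
  "ga ^ j <= (1 + ga) ^ m" "0 <= ka1"
proof -
 have "ga ^ j <= (1 + ga) ^ j" using ga_nonneg by (intro power_mono) auto
 also have "... <= (1 + ga) ^ m" using ga_nonneg assms by (intro power_increasing) auto
 finally show g: "ga ^ j <= (1 + ga) ^ m" .
 have eq: "ka1 = (1 + ga) ^ m * Mb * (1 + nL^2 / \<tau>0^2 + nL ^ 4 / \<tau>0 ^ 4)" by (simp add: cK1_def ga_def)
 have nn: "0 <= nL^2 / \<tau>0^2" "0 <= nL ^ 4 / \<tau>0 ^ 4" by auto
 have *: "ga ^ j * Mb * r * Y <= ka1 * Y" if "0 <= r" "r <= 1 + nL^2 / \<tau>0^2 + nL ^ 4 / \<tau>0 ^ 4" for r
  unfolding eq using g that ga_nonneg Mb_nonneg assms by (intro mult_right_mono mult_mono) auto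
 show "ga ^ j * Mb * Y <= ka1 * Y" using *[of 1] nn by simp
 show "ga ^ j * Mb * (nL^2 / \<tau>0^2) * Y <= ka1 * Y" using *[of "nL^2 / \<tau>0^2"] nn by linarith
 show "ga ^ j * Mb * (nL ^ 4 / \<tau>0 ^ 4) * Y <= ka1 * Y" using *[of "nL ^ 4 / \<tau>0 ^ 4"] nn by linarith
 show "0 <= ka1" unfolding eq using nn ga_nonneg Mb_nonneg by (intro mult_nonneg_nonneg) auto
qed

lemma S1_dbar: "S1 ph ==> u : nl \<Lambda> k ==> S1 (dbar h u ph)"
 using Com_S1[OF Com_dbar[OF nl_sub]] .

lemma grad_dbar:
 assumes "S1 ph" "y : Rd d"
 shows "(SUM u:nl \<Lambda> k. D2 d n (dbar h u ph) y) <= dbar_sq h (n + k) ph y / \<tau>0 ^ (2 * n)"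
proof -
 have "\<tau>0 ^ (2 * n) * (SUM u:nl \<Lambda> k. D2 d n (dbar h u ph) y) <= (SUM u:nl \<Lambda> k. dbar_sq h n (dbar h u ph) y)"
  unfolding sum_distrib_left by (intro sum_mono D2_le_dbar_sq S1_dbar assms)
 thus ?thesis unfolding dbar_sq_add using \<tau>0 by (simp add: pos_le_divide_eq mult.commute)
qed

lemma D2_1: "D2 d (Suc 0) ph x = (SUM i<d. (pd i ph x)\<^sup>2)"
 by (simp add: D2_snoc D2_0)

lemma D2_2: "D2 d 2 ph x = (SUM i<d. SUM j<d. (pd j (pd i ph) x)\<^sup>2)"
 by (simp add: numeral_2_eq_2 D2_snoc D2_0)

text \<open>The first of three bounds for Leibniz remainders. With j differences on the coefficient,
  n - j remain on the solution, and the operator adds none for c, one for p and two for q. Energies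
  below order n therefore suffice from j = 1, j = 2 and j = 3 on, respectively; what is left, j = 1
  for q and p and j = 2 for q, is the business of the structural inequalities.\<close>

lemma piece_C:
 assumes ph: "S1 ph" and t: "t : {0..T}" and x: "x : Rd d" and j: "j <= m"
  and Y: "!!y. y : Rd d ==> dbar_sq h k ph y <= Y" "0 <= Y"
 shows "(SUM s:nl \<Lambda> j. SUM u:nl \<Lambda> k. (dbar h s (c t) x * Th h s (dbar h u ph) x)\<^sup>2) <= ka1 * Y"
proof -
 have "(SUM u:nl \<Lambda> k. (dbar h s (c t) x * Th h s (dbar h u ph) x)\<^sup>2) <= (dbar h s (c t) x)^2 * Y" if s: "s : nl \<Lambda> j" for s
 proof -
  obtain y where y: "y : Rd d" "!!ps. Th h s ps x = ps y" using Th_point[OF x nl_sub[OF s]] by blast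
  have "(SUM u:nl \<Lambda> k. (dbar h s (c t) x * Th h s (dbar h u ph) x)\<^sup>2) = (dbar h s (c t) x)^2 * dbar_sq h k ph y"
   by (simp add: y(2) power_mult_distrib dbar_sq_nl sum_distrib_left)
  thus ?thesis using Y(1)[OF y(1)] by (simp add: mult_left_mono)
 qed
 hence "(SUM s:nl \<Lambda> j. SUM u:nl \<Lambda> k. (dbar h s (c t) x * Th h s (dbar h u ph) x)\<^sup>2) <= (SUM s:nl \<Lambda> j. (dbar h s (c t) x)\<^sup>2 * Y)"
  by (rule sum_mono)
 also have "... = dbar_sq h j (c t) x * Y" by (simp add: dbar_sq_nl sum_distrib_right)
 also have "... <= ga ^ j * Mb * Y" by (intro mult_right_mono coef_dbar j t x Y)
 also have "... <= ka1 * Y" by (rule ka1_ge[OF j Y(2)])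
 finally show ?thesis .
qed

lemma coef_sum_CS:
 assumes a: "!!s. s : nl \<Lambda> j ==> (SUM u:A. SUM l:La. (b s u l)\<^sup>2) <= S" and S: "0 <= S"
  and c: "(SUM l:La. dbar_sq h j (f l) x) <= C"
 shows "(SUM s:nl \<Lambda> j. SUM u:A. (SUM l:La. dbar h s (f l) x * b s u l)\<^sup>2) <= C * S"
proof -
 have "(SUM s:nl \<Lambda> j. SUM u:A. (SUM l:La. dbar h s (f l) x * b s u l)\<^sup>2)
  <= (SUM s:nl \<Lambda> j. SUM u:A. (SUM l:La. (dbar h s (f l) x)\<^sup>2) * (SUM l:La. (b s u l)\<^sup>2))"
  by (intro sum_mono Cauchy_Schwarz_ineq_sum)
 also have "... = (SUM s:nl \<Lambda> j. (SUM l:La. (dbar h s (f l) x)\<^sup>2) * (SUM u:A. SUM l:La. (b s u l)\<^sup>2))"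
  by (simp add: sum_distrib_left)
 also have "... <= (SUM s:nl \<Lambda> j. (SUM l:La. (dbar h s (f l) x)\<^sup>2) * S)"
  by (intro sum_mono mult_left_mono a) (auto intro: sum_nonneg)
 also have "... = (SUM l:La. dbar_sq h j (f l) x) * S"
  unfolding dbar_sq_nl sum_distrib_right[symmetric] by (simp add: sum.swap[of _ "nl \<Lambda> j"])
 also have "... <= C * S" by (intro mult_right_mono c S)
 finally show ?thesis .
qed

lemma dbar_BD: "S1 ph ==> EX C. ALL u:nl \<Lambda> k. BD {..<d} (Rd d) N (C u) (dbar h u ph)"
 using D.SM_BD[OF S1_dbar, of _ _ _ "()" N] by (metis UNIV_I)

lemma piece_P:
 assumes ph: "S1 ph" and t: "t : {0..T}" and x: "x : Rd d" and j: "j <= m"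
  and Y: "!!y. y : Rd d ==> dbar_sq h (Suc k) ph y <= Y" "0 <= Y"
 shows "(SUM s:nl \<Lambda> j. SUM u:nl \<Lambda> k. (SUM l:La. dbar h s (p l t) x * \<delta>d h l (Th h s (dbar h u ph)) x)\<^sup>2) <= ka1 * Y"
proof -
 obtain C where C: "!!u. u : nl \<Lambda> k ==> BD {..<d} (Rd d) 2 (C u) (dbar h u ph)" using dbar_BD[OF ph] by metis
 have "(SUM u:nl \<Lambda> k. SUM l:La. (\<delta>d h l (Th h s (dbar h u ph)) x)\<^sup>2) <= nL^2 / \<tau>0^2 * Y" if s: "s : nl \<Lambda> j" for s
 proof -
  obtain y where y: "y : Rd d" "!!ps r l. Th h s ps x = ps y & Th h s ps (tr d r l x) = ps (tr d r l y)"
   using Th_point[OF x nl_sub[OF s]] by blast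
  have "(SUM u:nl \<Lambda> k. SUM l:La. (\<delta>d h l (Th h s (dbar h u ph)) x)\<^sup>2) =
   (SUM l:La. (SUM u:nl \<Lambda> k. (dbar h u ph (tr d h l y) - dbar h u ph y)\<^sup>2) / h^2)"
   by (subst sum.swap) (simp add: \<delta>d_def shift_tr x y(2) power_divide sum_divide_distrib)
  also have "... <= (SUM l:La. (h^2 * (vnorm d l)^2 * (Y / \<tau>0^2)) / h^2)"
  proof (intro sum_mono divide_right_mono D.diff_family_bound[OF _ C])
   fix l \<sigma>
   have z: "tr d \<sigma> l y : Rd d" using D.tr_mem y by blast
   have "(SUM u:nl \<Lambda> k. SUM i<d. (pd i (dbar h u ph) (tr d \<sigma> l y))\<^sup>2) <= dbar_sq h (Suc k) ph (tr d \<sigma> l y) / \<tau>0^2"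
    using grad_dbar[OF ph z, where k = k and n = "Suc 0"] by (simp add: D2_1)
   also have "... <= Y / \<tau>0^2" by (intro divide_right_mono Y z) simp
   finally show "(SUM u:nl \<Lambda> k. SUM i<d. (pd i (dbar h u ph) (tr d \<sigma> l y))\<^sup>2) <= Y / \<tau>0^2" .
  qed (use finite_nl fin_\<Lambda> y in auto)
  also have "... = nL^2 / \<tau>0^2 * Y" using h0 unfolding nL[symmetric] by (simp add: sum_divide_distrib sum_distrib_right)
  finally show ?thesis .
 qed
 hence "(SUM s:nl \<Lambda> j. SUM u:nl \<Lambda> k. (SUM l:La. dbar h s (p l t) x * \<delta>d h l (Th h s (dbar h u ph)) x)\<^sup>2) <= (ga ^ j * Mb) * (nL^2 / \<tau>0^2 * Y)"
  by (rule coef_sum_CS) (use coef_dbar[OF j t x] Y in auto)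
 thus ?thesis using ka1_ge(2)[OF j Y(2)] by (simp add: mult.assoc)
qed

text \<open>Averaging the sum with its reflection turns first differences into second ones. These
  are of order h^2 and compensate the factor 1/h^2 in front.\<close>

lemma Qmu_sym:
 assumes t: "t : {0..T}" and x: "x : Rd d" and s: "set s \<subseteq> \<Lambda>"
 shows "Qmu h t s ps x = (SUM l:La. dbar h s (q l t) x * ((ps (tr d h l x) + ps (tr d (- h) l x) - 2 * ps x) / (2 * h^2)))"
proof -
 have "(SUM l:La. dbar h s (q l t) x * (ps (tr d h l x) - ps x)) = (SUM l:La. dbar h s (q (vneg d l) t) x * (ps (tr d h (vneg d l) x) - ps x))"
  by (rule sum_vneg[OF L1_sym L1, symmetric])
 also have "... = (SUM l:La. dbar h s (q l t) x * (ps (tr d (- h) l x) - ps x))"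
 proof (intro sum.cong refl)
  fix l assume l: "l : La"
  have "dbar h s (q (vneg d l) t) x = dbar h s (q l t) x"
   by (rule Com_cong[OF Com_dbar[OF s] _ x]) (use q_sym[OF l t] in auto)
  thus "dbar h s (q (vneg d l) t) x * (ps (tr d h (vneg d l) x) - ps x) = dbar h s (q l t) x * (ps (tr d (- h) l x) - ps x)"
   by (simp add: tr_vneg)
 qed
 finally have e: "(SUM l:La. dbar h s (q l t) x * (ps (tr d h l x) - ps x)) = (SUM l:La. dbar h s (q l t) x * (ps (tr d (- h) l x) - ps x))" .
 have "Qmu h t s ps x = (SUM l:La. dbar h s (q l t) x * (ps (tr d h l x) - ps x)) / h^2"
  by (simp add: Qmu_def \<delta>d_def shift_tr x sum_divide_distrib power2_eq_square)
 also have "... = ((SUM l:La. dbar h s (q l t) x * (ps (tr d h l x) - ps x)) + (SUM l:La. dbar h s (q l t) x * (ps (tr d (- h) l x) - ps x))) / (2 * h^2)"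
  unfolding e[symmetric] using h0 by simp
 also have "... = (SUM l:La. dbar h s (q l t) x * ((ps (tr d h l x) + ps (tr d (- h) l x) - 2 * ps x) / (2 * h^2)))"
  by (simp add: sum_divide_distrib flip: sum.distrib distrib_left)
 finally show ?thesis .
qed

lemma piece_Q:
 assumes ph: "S1 ph" and t: "t : {0..T}" and x: "x : Rd d" and j: "j <= m"
  and Y: "!!y. y : Rd d ==> dbar_sq h (Suc (Suc k)) ph y <= Y" "0 <= Y"
 shows "(SUM s:nl \<Lambda> j. SUM u:nl \<Lambda> k. (Qmu h t s (Th h s (dbar h u ph)) x)\<^sup>2) <= ka1 * Y"
proof -
 obtain C where C: "!!u. u : nl \<Lambda> k ==> BD {..<d} (Rd d) 3 (C u) (dbar h u ph)" using dbar_BD[OF ph] by metis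
 let ?b = "%s u l. (Th h s (dbar h u ph) (tr d h l x) + Th h s (dbar h u ph) (tr d (- h) l x) - 2 * Th h s (dbar h u ph) x) / (2 * h^2)"
 have "(SUM u:nl \<Lambda> k. SUM l:La. (?b s u l)\<^sup>2) <= nL ^ 4 / \<tau>0 ^ 4 * Y" if s: "s : nl \<Lambda> j" for s
 proof -
  obtain y where y: "y : Rd d" "!!ps r l. Th h s ps x = ps y & Th h s ps (tr d r l x) = ps (tr d r l y)"
   using Th_point[OF x nl_sub[OF s]] by blast
  have "(SUM u:nl \<Lambda> k. SUM l:La. (?b s u l)\<^sup>2) =
   (SUM l:La. (SUM u:nl \<Lambda> k. (dbar h u ph (tr d h l y) + dbar h u ph (tr d (- h) l y) - 2 * dbar h u ph y)\<^sup>2) / (4 * h ^ 4))"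
   by (subst sum.swap) (simp add: y(2) power_divide sum_divide_distrib power_mult_distrib flip: power_mult)
  also have "... <= (SUM l:La. (h ^ 4 * vnorm d l ^ 4 * (Y / \<tau>0 ^ 4)) / (4 * h ^ 4))"
  proof (intro sum_mono divide_right_mono D.second_diff_family_bound[OF _ C])
   fix l \<sigma>
   have z: "tr d \<sigma> l y : Rd d" using D.tr_mem y by blast
   have "(SUM u:nl \<Lambda> k. SUM i<d. SUM j<d. (pd j (pd i (dbar h u ph)) (tr d \<sigma> l y))\<^sup>2) <= dbar_sq h (Suc (Suc k)) ph (tr d \<sigma> l y) / \<tau>0 ^ 4"
    using grad_dbar[OF ph z, where k = k and n = 2] by (simp add: D2_2)
   also have "... <= Y / \<tau>0 ^ 4" by (intro divide_right_mono Y z) simp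
   finally show "(SUM u:nl \<Lambda> k. SUM i<d. SUM j<d. (pd j (pd i (dbar h u ph)) (tr d \<sigma> l y))\<^sup>2) <= Y / \<tau>0 ^ 4" .
  qed (use finite_nl fin_\<Lambda> y in auto)
  also have "... = (SUM l:La. vnorm d l ^ 4) * (Y / \<tau>0 ^ 4) / 4" using h0 by (simp add: sum_divide_distrib sum_distrib_right)
  also have "... <= nL ^ 4 * (Y / \<tau>0 ^ 4) / 1"
  proof (intro frac_le mult_right_mono)
   have "(SUM l:La. vnorm d l ^ 4) = (SUM l:La. ((vnorm d l)^2)\<^sup>2)" by simp
   also have "... <= (SUM l:La. (vnorm d l)\<^sup>2)^2"
    unfolding power2_eq_square[of "sum _ _"] sum_distrib_right power2_eq_square[of "(vnorm d _)^2"]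
    by (intro sum_mono mult_left_mono member_le_sum fin) auto
   also have "... = nL ^ 4" by (simp add: nL)
   finally show "(SUM l:La. vnorm d l ^ 4) <= nL ^ 4" .
  qed (use Y in auto)
  finally show ?thesis by simp
 qed
 hence "(SUM s:nl \<Lambda> j. SUM u:nl \<Lambda> k. (SUM l:La. dbar h s (q l t) x * ?b s u l)\<^sup>2) <= (ga ^ j * Mb) * (nL ^ 4 / \<tau>0 ^ 4 * Y)"
  by (rule coef_sum_CS) (use coef_dbar[OF j t x] Y in auto)
 moreover have "(SUM s:nl \<Lambda> j. SUM u:nl \<Lambda> k. (Qmu h t s (Th h s (dbar h u ph)) x)\<^sup>2) = (SUM s:nl \<Lambda> j. SUM u:nl \<Lambda> k. (SUM l:La. dbar h s (q l t) x * ?b s u l)\<^sup>2)"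
  using Qmu_sym[OF t x nl_sub] by simp
 ultimately show ?thesis using ka1_ge(3)[OF j Y(2)] by (simp add: mult.assoc)
qed

end

context energy
begin

lemma two_piece:
 assumes "0 < ep" "j <= n"
 shows "\<bar>2 * (SUM s:nl \<Lambda> j. SUM u:nl \<Lambda> (n - j). dbar h s (dbar h u ph) x * X s u)\<bar>
  <= ep * dbar_sq h n ph x + (SUM s:nl \<Lambda> j. SUM u:nl \<Lambda> (n - j). (X s u)\<^sup>2) / ep"
proof -
 have "dbar_sq h n ph x = (SUM s:nl \<Lambda> j. SUM u:nl \<Lambda> (n - j). (dbar h s (dbar h u ph) x)\<^sup>2)"
  using dbar_sq_add[of j "n - j" ph x] assms(2) by (simp add: dbar_sq_nl sum.swap[of _ "nl \<Lambda> j"])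
 thus ?thesis
  using two_sum_le[OF assms(1), of "%z. dbar h (fst z) (dbar h (snd z) ph) x" "%z. X (fst z) (snd z)" "nl \<Lambda> j \<times> nl \<Lambda> (n - j)"]
  by (simp add: sum.cartesian_product case_prod_beta')
qed

lemma energy_identity:
 assumes ph: "S1 ph" and t: "t : {0..T}" and x: "x : Rd d"
 shows "(SUM mu:nl \<Lambda> n. 2 * dbar h mu ph x * dbar h mu (Lh h t ph) x) =
  (SUM j<=n. real (n choose j) * (2 * (SUM s:nl \<Lambda> j. SUM u:nl \<Lambda> (n - j). dbar h s (dbar h u ph) x * Bop t s (Th h s (dbar h u ph)) x)))"
proof -
 have "dbar h mu ph x * dbar h mu (Lh h t ph) x = (SUM (s, u)<-splits mu. dbar h s (dbar h u ph) x * Bop t s (Th h s (dbar h u ph)) x)"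
  if "mu : nl \<Lambda> n" for mu
  unfolding dbar_Lh(2)[OF ph t x nl_sub[OF that]] sum_list_const_mult[symmetric] case_prod_beta'
  by (intro arg_cong[where f = sum_list] map_cong refl) (use dbar_splits[OF ph _ x nl_sub[OF that]] in auto)
 hence "(SUM mu:nl \<Lambda> n. dbar h mu ph x * dbar h mu (Lh h t ph) x) =
  (SUM mu:nl \<Lambda> n. SUM (s, u)<-splits mu. dbar h s (dbar h u ph) x * Bop t s (Th h s (dbar h u ph)) x)"
  by simp
 thus ?thesis unfolding sum_splits
  by (simp add: mult.assoc mult.left_commute[of _ 2] flip: sum_distrib_left)
qed

text \<open>The Leibniz sum is sorted by the number j of differences on the coefficients. The term j
  = 0 gives, by \<open>Lh_square\<close>, the operator acting on the energy together with the
  dissipation. The terms treated by the structural inequalities have the binomial weights n and n(n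
  - 1)/2, which explains the factors n and n(n - 1) there. Everything else is a remainder, split by
  Young's inequality into a small multiple of the energy and lower energies.\<close>

lemma energy_ineq:
 assumes ph: "S1 ph" and \<Phi>: "S1 \<Phi>" and t: "t : {0..T}" and x: "x : Rd d" and n: "1 <= n" "n <= m"
  and low: "!!k y. k < n ==> y : Rd d ==> dbar_sq h k ph y <= Y" and Y: "0 <= Y"
  and B: "!!y. y : Rd d ==> dbar_sq h n ph y <= B" and \<Phi>Y: "dbar_sq h n \<Phi> x <= Y"
 shows "(SUM mu:nl \<Lambda> n. 2 * dbar h mu ph x * dbar h mu (%x. Lh h t ph x + \<Phi> x) x) <=
  (SUM l:La. (q l t x + h * p l t x) / h^2 * (dbar_sq h n ph (tr d h l x) - dbar_sq h n ph x))
  - 2 * c t x * dbar_sq h n ph x - de * (SUM mu:nl \<Lambda> n. Qform h t (dbar h mu ph) x)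
  + K * (SUM mu:nl \<Lambda> (n - 1). Qform h t (dbar h mu ph) x)
  + 2 * (1 - de) * c t x * B + de * c0 * B + (K + cS m de c0 \<tau>0 nL nL\<tau> Mb) * Y"
proof -
 \<comment> \<open>The binomial weights add up to 2^n, every Leibniz term leaves at most three
   remainders, and \<Phi> adds a fourth; this choice makes the total coefficient of the energy at
   most \<open>de * c0\<close>.\<close>
 define ep where "ep = de * c0 / (4 * 2 ^ m)"
 have ep: "0 < ep" using de0 c00 by (simp add: ep_def)
 define V where "V = dbar_sq h n ph x"
 have V: "0 <= V" "V <= B" unfolding V_def using dbar_sq_nonneg B x by auto
 let ?Ps = "%s ps. SUM l:La. dbar h s (p l t) x * \<delta>d h l ps x"
 define Z where "Z j = (SUM s:nl \<Lambda> j. SUM u:nl \<Lambda> (n - j). dbar h s (dbar h u ph) x * Bop t s (Th h s (dbar h u ph)) x)" for j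
 define ZQ where "ZQ j = (SUM s:nl \<Lambda> j. SUM u:nl \<Lambda> (n - j). dbar h s (dbar h u ph) x * Qmu h t s (Th h s (dbar h u ph)) x)" for j
 define ZP where "ZP j = (SUM s:nl \<Lambda> j. SUM u:nl \<Lambda> (n - j). dbar h s (dbar h u ph) x * ?Ps s (Th h s (dbar h u ph)))" for j
 define ZC where "ZC j = (SUM s:nl \<Lambda> j. SUM u:nl \<Lambda> (n - j). dbar h s (dbar h u ph) x * (dbar h s (c t) x * Th h s (dbar h u ph) x))" for j
 have Zeq: "Z j = ZQ j + ZP j - ZC j" for j
  unfolding Z_def ZQ_def ZP_def ZC_def Bop_def L0mu_def
  by (simp add: right_diff_distrib distrib_left sum.distrib sum_subtractf)
 define b where "b = ep * V + ka1 * Y / ep"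
 have b0: "0 <= b" unfolding b_def using ep V Y ka1_ge(5)[of 0 Y] by auto
 have bC: "\<bar>2 * ZC j\<bar> <= b" if "1 <= j" "j <= n" for j
 proof -
  have "(SUM s:nl \<Lambda> j. SUM u:nl \<Lambda> (n - j). (dbar h s (c t) x * Th h s (dbar h u ph) x)\<^sup>2) <= ka1 * Y"
   by (rule piece_C[OF ph t x _ low Y]) (use that n in auto)
  thus ?thesis
   using two_piece[OF ep that(2), of ph x "%s u. dbar h s (c t) x * Th h s (dbar h u ph) x"] ep
   unfolding ZC_def b_def V_def by (meson add_left_mono divide_right_mono less_imp_le order_trans)
 qed
 have bP: "\<bar>2 * ZP j\<bar> <= b" if "2 <= j" "j <= n" for j
 proof -
  have "(SUM s:nl \<Lambda> j. SUM u:nl \<Lambda> (n - j). (?Ps s (Th h s (dbar h u ph)))\<^sup>2) <= ka1 * Y"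
   by (rule piece_P[OF ph t x _ low Y]) (use that n in auto)
  thus ?thesis
   using two_piece[OF ep that(2), of ph x "%s u. ?Ps s (Th h s (dbar h u ph))"] ep
   unfolding ZP_def b_def V_def by (meson add_left_mono divide_right_mono less_imp_le order_trans)
 qed
 have bQ: "\<bar>2 * ZQ j\<bar> <= b" if "3 <= j" "j <= n" for j
 proof -
  have "(SUM s:nl \<Lambda> j. SUM u:nl \<Lambda> (n - j). (Qmu h t s (Th h s (dbar h u ph)) x)\<^sup>2) <= ka1 * Y"
   by (rule piece_Q[OF ph t x _ low Y]) (use that n in auto)
  thus ?thesis
   using two_piece[OF ep that(2), of ph x "%s u. Qmu h t s (Th h s (dbar h u ph)) x"] ep
   unfolding ZQ_def b_def V_def by (meson add_left_mono divide_right_mono less_imp_le order_trans)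
 qed
 define main where "main j = (if j = 0 then Z 0 else if j = 1 then ZQ 1 + ZP 1 else if j = 2 then ZQ 2 else 0)" for j :: nat
 have rest: "2 * Z j <= 2 * main j + 3 * b" if "j <= n" for j
 proof -
  consider "j = 0" | "j = 1" | "j = 2" | "3 <= j" by linarith
  thus ?thesis
  proof cases
   case 1 thus ?thesis using b0 by (simp add: main_def)
  next
   case 2 thus ?thesis using b0 bC[of 1] that by (simp add: main_def Zeq abs_le_iff)
  next
   case 3 thus ?thesis using b0 bC[of 2] bP[of 2] that by (simp add: main_def Zeq abs_le_iff)
  next
   case 4
   hence "main j = 0" "2 * Z j = 2 * ZQ j + 2 * ZP j - 2 * ZC j" by (auto simp: main_def Zeq)
   thus ?thesis using bC[of j] bP[of j] bQ[of j] 4 that by (simp add: abs_le_iff)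
  qed
 qed
 have choose_sum: "(SUM j<=n. real (n choose j)) = 2 ^ n"
  using choose_row_sum[of n] by (simp flip: of_nat_sum)
 have "(SUM j<=n. real (n choose j) * (2 * Z j)) <= (SUM j<=n. real (n choose j) * (2 * main j) + real (n choose j) * (3 * b))"
  unfolding distrib_left[symmetric] by (intro sum_mono mult_left_mono rest) auto
 also have "... = (SUM j<=n. real (n choose j) * (2 * main j)) + 2 ^ n * (3 * b)"
  by (simp add: sum.distrib choose_sum flip: sum_distrib_right)
 also have "(SUM j<=n. real (n choose j) * (2 * main j)) = (SUM j<=2. real (n choose j) * (2 * main j))"
 proof -
  have "(SUM j<=n. real (n choose j) * (2 * main j)) = (SUM j<=n + 2. real (n choose j) * (2 * main j))"
   by (rule sum.mono_neutral_left) (auto simp: binomial_eq_0)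
  moreover have "(SUM j<=2. real (n choose j) * (2 * main j)) = (SUM j<=n + 2. real (n choose j) * (2 * main j))"
   by (rule sum.mono_neutral_left) (auto simp: main_def)
  ultimately show ?thesis by simp
 qed
 also have "... = 2 * Z 0 + (real n * (2 * (ZQ 1 + ZP 1)) + real n * (real n - 1) * ZQ 2)"
 proof -
  have "real (n choose 2) * 2 = real n * (real n - 1)"
  proof -
   have "even (n * (n - 1))" by (cases "even n") auto
   hence "2 * (n choose 2) = n * (n - 1)" unfolding choose_two by (rule dvd_mult_div_cancel)
   hence "real (2 * (n choose 2)) = real (n * (n - 1))" by (rule arg_cong)
   thus ?thesis using n by (simp add: of_nat_diff)
  qed
  hence "real (n choose 2) * (2 * ZQ 2) = real n * (real n - 1) * ZQ 2" by (simp flip: mult.assoc)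
  thus ?thesis by (simp add: main_def numeral_2_eq_2)
 qed
 finally have 1: "(SUM j<=n. real (n choose j) * (2 * Z j)) <= 2 * Z 0 + (real n * (2 * (ZQ 1 + ZP 1)) + real n * (real n - 1) * ZQ 2) + 2 ^ n * (3 * b)" .
 have Z0: "2 * Z 0 = (SUM l:La. (q l t x + h * p l t x) / h^2 * (dbar_sq h n ph (tr d h l x) - dbar_sq h n ph x))
  - 2 * c t x * V - (SUM mu:nl \<Lambda> n. Qform h t (dbar h mu ph) x)"
 proof -
  have "2 * Z 0 = (SUM u:nl \<Lambda> n. 2 * dbar h u ph x * Lh h t (dbar h u ph) x)"
   by (simp add: Z_def nl_0 sum_distrib_left mult.assoc Lh_Bop)
  also have "... = (SUM u:nl \<Lambda> n. (SUM l:La. (q l t x + h * p l t x) / h^2 * ((dbar h u ph (tr d h l x))^2 - (dbar h u ph x)\<^sup>2))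
  - 2 * c t x * (dbar h u ph x)^2 - Qform h t (dbar h u ph) x)"
   using Lh_square[OF x] by simp
  also have "... = (SUM u:nl \<Lambda> n. SUM l:La. (q l t x + h * p l t x) / h^2 * ((dbar h u ph (tr d h l x))^2 - (dbar h u ph x)\<^sup>2))
   - 2 * c t x * V - (SUM u:nl \<Lambda> n. Qform h t (dbar h u ph) x)"
   by (simp add: sum_subtractf V_def dbar_sq_nl sum_distrib_left)
  also have "(SUM u:nl \<Lambda> n. SUM l:La. (q l t x + h * p l t x) / h^2 * ((dbar h u ph (tr d h l x))^2 - (dbar h u ph x)\<^sup>2)) =
   (SUM l:La. (q l t x + h * p l t x) / h^2 * (dbar_sq h n ph (tr d h l x) - dbar_sq h n ph x))"
   by (subst sum.swap) (simp only: dbar_sq_nl sum_subtractf[symmetric] sum_distrib_left)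
  finally show ?thesis .
 qed
 have A: "2 * (ZQ 1 + ZP 1) = (SUM u:nl \<Lambda> (n - 1). Ah h t (dbar h u ph) x)"
  unfolding ZQ_def ZP_def Ah_def tuples_nl L0mu_def
  by (simp add: distrib_left sum.distrib sum_distrib_left sum.swap[of _ "nl \<Lambda> (Suc 0)"])
 have Q2: "ZQ 2 = (SUM u:nl \<Lambda> (n - 2). SUM s:nl \<Lambda> 2. dbar h s (dbar h u ph) x * Qmu h t s (Th h s (dbar h u ph)) x)"
  unfolding ZQ_def by (rule sum.swap)
 have 2: "real n * (2 * (ZQ 1 + ZP 1)) + real n * (real n - 1) * ZQ 2 <=
  (1 - de) * (SUM mu:nl \<Lambda> n. Qform h t (dbar h mu ph) x) + K * (SUM mu:nl \<Lambda> (n - 1). Qform h t (dbar h mu ph) x)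
    + 2 * (1 - de) * c t x * B + K * Y"
  unfolding A Q2 by (rule struct[OF n t x ph B low]) (use n in auto)
 have 3: "(SUM mu:nl \<Lambda> n. 2 * dbar h mu ph x * dbar h mu \<Phi> x) <= ep * V + Y / ep"
 proof -
  have "\<bar>2 * (SUM mu:nl \<Lambda> n. dbar h mu ph x * dbar h mu \<Phi> x)\<bar> <= ep * V + dbar_sq h n \<Phi> x / ep"
   using two_sum_le[OF ep, of "%mu. dbar h mu ph x" "%mu. dbar h mu \<Phi> x" "nl \<Lambda> n"] by (simp add: V_def dbar_sq_nl)
  also have "... <= ep * V + Y / ep" using \<Phi>Y ep by (simp add: divide_right_mono)
  finally show ?thesis by (simp add: sum_distrib_left mult.assoc abs_le_iff)
 qed
 have 4: "2 ^ n * (3 * b) + (ep * V + Y / ep) <= de * c0 * B + cS m de c0 \<tau>0 nL nL\<tau> Mb * Y"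
 proof -
  have nm: "(2::real) ^ n <= 2 ^ m" using n by simp
  have one: "(1::real) <= 2 ^ m" by simp
  have K: "0 <= ka1 * Y / ep" "0 <= Y / ep" "0 <= ep * V" using ep V Y ka1_ge(5)[of 0 Y] by auto
  have "2 ^ n * (3 * b) <= 2 ^ m * (3 * b)" using nm b0 by (intro mult_right_mono) auto
  moreover have "ep * V + Y / ep <= 2 ^ m * (ep * V + Y / ep)"
   using mult_right_mono[OF one, of "ep * V + Y / ep"] K by simp
  ultimately have "2 ^ n * (3 * b) + (ep * V + Y / ep) <= 2 ^ m * (4 * (ep * V) + 3 * (ka1 * Y / ep) + Y / ep)"
   unfolding b_def by (simp add: algebra_simps)
  also have "... <= 2 ^ m * (4 * (ep * B) + 4 * ((ka1 + 1) * Y / ep))"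
  proof (intro mult_left_mono)
   have "ep * V <= ep * B" using V ep by simp
   moreover have "(ka1 + 1) * Y / ep = ka1 * Y / ep + Y / ep" by (simp add: add_divide_distrib distrib_right)
   ultimately show "4 * (ep * V) + 3 * (ka1 * Y / ep) + Y / ep <= 4 * (ep * B) + 4 * ((ka1 + 1) * Y / ep)" using K by linarith
  qed simp
  also have "... = de * c0 * B + cS m de c0 \<tau>0 nL nL\<tau> Mb * Y"
  proof -
   have "2 ^ m * (4 * (ep * B)) = de * c0 * B" by (simp add: ep_def)
   moreover have "2 ^ m * (4 * ((ka1 + 1) * Y / ep)) = cS m de c0 \<tau>0 nL nL\<tau> Mb * Y"
    unfolding cS_def ep_def[symmetric] by simp
   ultimately show ?thesis by (simp only: distrib_left)
  qed
  finally show ?thesis .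
 qed
 have "(SUM mu:nl \<Lambda> n. 2 * dbar h mu ph x * dbar h mu (%x. Lh h t ph x + \<Phi> x) x) =
  (SUM mu:nl \<Lambda> n. 2 * dbar h mu ph x * dbar h mu (Lh h t ph) x) + (SUM mu:nl \<Lambda> n. 2 * dbar h mu ph x * dbar h mu \<Phi> x)"
 proof -
  have "dbar h mu (%x. Lh h t ph x + \<Phi> x) x = dbar h mu (Lh h t ph) x + dbar h mu \<Phi> x" if "mu : nl \<Lambda> n" for mu
   using Com_lin[OF Com_dbar[OF nl_sub[OF that]] dbar_Lh(1)[OF ph t x nl_sub[OF that]] \<Phi> x, of 1 1] by simp
  thus ?thesis by (simp add: distrib_left sum.distrib)
 qed
 also have "(SUM mu:nl \<Lambda> n. 2 * dbar h mu ph x * dbar h mu (Lh h t ph) x) = (SUM j<=n. real (n choose j) * (2 * Z j))"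
  unfolding energy_identity[OF ph t x] Z_def ..
 finally show ?thesis using 1 2 3 4 unfolding Z0 V_def[symmetric] left_diff_distrib distrib_right by simp
qed

lemma SR_Lh: "SR v ==> SR (%t. Lh h t (v t))"
proof -
 assume v: "SR v"
 have "SR (%t x. (SUM l:La. 1 / h * (q l t x * \<delta>d h l (v t) x) + p l t x * \<delta>d h l (v t) x) - c t x * v t x)"
  by (intro D.SM_diff D.SM_sum fin D.SM_add D.SM_cmult D.SM_mult q_SM p_SM c_SM v Com_SR[OF Com_\<delta>d])
 thus ?thesis by (simp add: Lh_Bop[abs_def] Bop_eq[abs_def])
qed

lemma prim_dbar:
 assumes v: "SR v" and r: "SR r" and p: "!!x. x : Rd d ==> prim T (%t. v t x) (%t. r t x)"
 shows "set mu \<subseteq> \<Lambda> ==> x : Rd d ==> prim T (%t. dbar h mu (v t) x) (%t. dbar h mu (r t) x)"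
proof (induction mu arbitrary: x)
 case Nil thus ?case using p by simp
next
 case (Cons nu mu)
 have nu: "nu : \<Lambda>" "set mu \<subseteq> \<Lambda>" using Cons.prems by auto
 note IH = Cons.IH[OF nu(2)]
 from nu(1) show ?case
 proof (cases rule: \<Lambda>_cases)
  case 1
  show ?thesis unfolding dbar_Cons 1(2)[OF Cons.prems(2)]
   by (intro prim_cmult prim_diff IH D.tr_mem Cons.prems)
 next
  case (2 i)
  show ?thesis unfolding dbar_Cons 2(3)
   by (intro prim_cmult D.prim_pd[OF T0 Com_SR[OF Com_dbar[OF nu(2)] v] Com_SR[OF Com_dbar[OF nu(2)] r] IH Cons.prems(2)])
    (use 2 in auto)
 qed
qed

lemma coef_a: "EX A. ALL l:La. ALL t:{0..T}. ALL x:Rd d. 0 <= (q l t x + h * p l t x) / h^2 & (q l t x + h * p l t x) / h^2 <= A"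
proof -
 have "EX C. ALL t:{0..T}. ALL x:Rd d. \<bar>q l t x + h * p l t x\<bar> <= C" if l: "l : La" for l
 proof -
  obtain C where "!!t. t : {0..T} ==> BD {..<d} (Rd d) 0 C (%x. q l t x + h * p l t x)"
   using D.SM_obtain[OF D.SM_add[OF q_SM[OF l] D.SM_cmult[OF p_SM[OF l]]]] by metis
  thus ?thesis by (intro exI[of _ C]) auto
 qed
 then obtain C where C: "!!l t x. l : La ==> t : {0..T} ==> x : Rd d ==> \<bar>q l t x + h * p l t x\<bar> <= C l" by metis
 show ?thesis
 proof (intro exI[of _ "(SUM l:La. \<bar>C l\<bar>) / h^2"] ballI conjI)
  fix l t x assume a: "l : La" "t : {0..T}" "x : Rd d"
  show "0 <= (q l t x + h * p l t x) / h^2" using qp_nonneg[OF a] by simp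
  have "q l t x + h * p l t x <= \<bar>C l\<bar>" using C[OF a] by linarith
  also have "... <= (SUM l:La. \<bar>C l\<bar>)" using a fin by (intro member_le_sum) auto
  finally show "(q l t x + h * p l t x) / h^2 <= (SUM l:La. \<bar>C l\<bar>) / h^2" by (rule divide_right_mono) simp
 qed
qed

lemma c_le: "t : {0..T} ==> x : Rd d ==> c t x <= Mb + 1"
proof -
 assume tx: "t : {0..T}" "x : Rd d"
 have "0 <= (SUM l:La. D2 d 0 (q l t) x + D2 d 0 (p l t) x)" by (intro add_nonneg_nonneg sum_nonneg D2_nonneg)
 hence "(c t x)^2 <= Mb" using coef_bound[of 0 t x] tx by (simp add: D2_0)
 moreover have "0 <= (c t x - 1)^2" by simp
 ultimately show ?thesis using Mb_nonneg c_ge[OF tx] c00 by (simp add: power2_diff)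
qed

lemma dbar_sq_bounded:
 assumes "SR v" shows "EX C. ALL t:{0..T}. ALL x:Rd d. dbar_sq h n (v t) x <= C"
proof -
 have "EX C. ALL t:{0..T}. ALL x:Rd d. \<bar>dbar h mu (v t) x\<bar> <= C" if mu: "mu : nl \<Lambda> n" for mu
 proof -
  obtain C where "!!t. t : {0..T} ==> BD {..<d} (Rd d) 0 C (dbar h mu (v t))"
   using D.SM_obtain[OF Com_SR[OF Com_dbar[OF nl_sub[OF mu]] assms]] by metis
  thus ?thesis by (intro exI[of _ C]) auto
 qed
 then obtain C where C: "!!mu t x. mu : nl \<Lambda> n ==> t : {0..T} ==> x : Rd d ==> \<bar>dbar h mu (v t) x\<bar> <= C mu" by metis
 have "dbar_sq h n (v t) x <= (SUM mu:nl \<Lambda> n. (C mu)\<^sup>2)" if "t : {0..T}" "x : Rd d" for t x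
  unfolding dbar_sq_nl
 proof (rule sum_mono)
  fix mu assume "mu : nl \<Lambda> n"
  from C[OF this that] show "(dbar h mu (v t) x)^2 <= (C mu)^2" using power_mono[of "\<bar>dbar h mu (v t) x\<bar>" "C mu" 2] by simp
 qed
 thus ?thesis by blast
qed

abbreviation "Ac \<equiv> cS m de c0 \<tau>0 nL nL\<tau> Mb"
abbreviation "cX n \<equiv> fst (cXR de K c0 Mb Ac n)"
abbreviation "cR n \<equiv> snd (cXR de K c0 Mb Ac n)"

lemma Ac_nonneg: "0 <= Ac" unfolding cS_def using ka1_ge(5)[of 0 0] de0 c00 by simp

lemma cX_cR: "0 <= cR n & 1 <= cX n & cX n <= cX (Suc n)"
proof (induction n)
 case 0
 thus ?case using de0 c00 K1 Ac_nonneg by (auto simp: Let_def intro!: add_nonneg_nonneg divide_nonneg_nonneg mult_nonneg_nonneg)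
next
 case (Suc n)
 let ?X = "cX n" and ?R = "cR n" and ?X' = "cX (Suc n)"
 let ?S = "(K + Ac) * ?X + K / de * ?R"
 have S: "0 <= ?S" using Suc de0 K1 Ac_nonneg by (intro add_nonneg_nonneg mult_nonneg_nonneg divide_nonneg_nonneg) auto
 have R': "0 <= cR (Suc n)"
 proof -
  have "cR (Suc n) = (2 * (Mb + 1) + de * c0) * ?X' + ?S" by (simp add: Let_def)
  moreover have "0 <= (2 * (Mb + 1) + de * c0) * ?X'" using Suc Mb_nonneg de0 c00 by (intro mult_nonneg_nonneg) auto
  ultimately show ?thesis using S by linarith
 qed
 have X': "1 <= ?X'" using Suc by linarith
 have "cX (Suc (Suc n)) = 1 + K / de * ?X' + ?X' + ((K + Ac) * ?X' + K / de * cR (Suc n)) / (de * c0)"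
  by (simp add: Let_def)
 moreover have "0 <= K / de * ?X'" "0 <= ((K + Ac) * ?X' + K / de * cR (Suc n)) / (de * c0)"
  using X' R' de0 c00 K1 Ac_nonneg by (auto intro!: add_nonneg_nonneg divide_nonneg_nonneg mult_nonneg_nonneg)
 ultimately show ?case using R' X' by linarith
qed

text \<open>The energies of different orders are combined into \<open>Z\<^sub>n = W\<^sub>n + (K/de) Z\<^sub>n\<^sub>-\<^sub>1\<close>, so that
  \<open>-de \<Q>\<close> on one level absorbs \<open>K\<Q>\<close> from the next one.\<close>

lemma apriori_energy:
 assumes v: "SR v" and F: "SR F" and p: "!!x. x : Rd d ==> prim T (%t. v t x) (%t. Lh h t (v t) x + F t x)"
  and Y: "0 <= Y" and N: "N <= m"
  and FY: "!!j t x. j <= N ==> t : {0..T} ==> x : Rd d ==> dbar_sq h j (F t) x <= Y"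
  and GY: "!!j x. j <= N ==> x : Rd d ==> dbar_sq h j (v 0) x <= Y"
 shows "n <= N ==> EX Z z. (ALL x:Rd d. prim T (%t. Z t x) (%t. z t x)) &
  (ALL t:{0..T}. ALL x:Rd d. dbar_sq h n (v t) x <= Z t x & Z t x <= cX n * Y &
   z t x <= (SUM l:La. (q l t x + h * p l t x) / h^2 * (Z t (tr d h l x) - Z t x)) - 2 * c t x * Z t x
    - de * (SUM mu:nl \<Lambda> n. Qform h t (dbar h mu (v t)) x) + cR n * Y &
   (ALL k<=n. dbar_sq h k (v t) x <= cX n * Y))"
proof (induction n)
 case 0
 obtain A where A: "!!l t x. l : La ==> t : {0..T} ==> x : Rd d ==> 0 <= (q l t x + h * p l t x) / h^2 & (q l t x + h * p l t x) / h^2 <= A"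
  using coef_a by blast
 obtain B1 where B1: "!!t x. t : {0..T} ==> x : Rd d ==> dbar_sq h 0 (v t) x <= B1" using dbar_sq_bounded[OF v] by blast
 have d0: "dbar_sq h 0 ph x = (ph x)^2" for ph x by (simp add: dbar_sq_nl nl_0)
 define z where "z t x = 2 * v t x * (Lh h t (v t) x + F t x)" for t x
 have pz: "prim T (%t. (v t x)\<^sup>2) (%t. z t x)" if "x : Rd d" for x
  unfolding z_def using prim_square[OF p[OF that]] .
 have z: "z t x = (SUM l:La. (q l t x + h * p l t x) / h^2 * ((v t (tr d h l x))^2 - (v t x)\<^sup>2)) - 2 * c t x * (v t x)\<^sup>2
   - Qform h t (v t) x + 2 * v t x * F t x" if "x : Rd d" for t x
  unfolding z_def distrib_left Lh_square[OF that] by simp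
 \<comment> \<open>Order 0 is closed by the damping alone: one half of it stays in the maximum
   principle, with 1/2 as its parameter, and the other half absorbs the term with F.\<close>
 have b: "(v t x)^2 <= max Y (Y / c0 / (2 * (1 / 2) * c0))" if tx: "t : {0..T}" "x : Rd d" for t x
 proof (rule maximum_principle[OF T0 fin pz _ A _ _ c00 _ _ Y _ _ tx, where c = c and Cm = "Mb + 1" and Bm = B1])
  show "(v 0 x)^2 <= Y" if "x : Rd d" for x using GY[of 0 x] that d0 by simp
  fix B t x assume B: "!!t x. t : {0..T} ==> x : Rd d ==> (v t x)\<^sup>2 <= B" and tx: "t : {0..T}" "x : Rd d"
  have "2 * v t x * F t x <= c0 * (v t x)^2 + (F t x)^2 / c0"
   using two_sum_le[OF c00, of "%_. v t x" "%_. F t x" "{()}"] by (simp add: mult.assoc)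
  moreover have "(F t x)^2 / c0 <= Y / c0" using FY[of 0 t x] tx d0 c00 by (simp add: divide_right_mono)
  moreover have "c0 * (v t x)^2 <= c t x * B" using B[OF tx] c_ge[OF tx] c00 by (intro mult_mono) auto
  ultimately show "z t x <= (SUM l:La. (q l t x + h * p l t x) / h^2 * ((v t (tr d h l x))^2 - (v t x)\<^sup>2)) - 2 * c t x * (v t x)\<^sup>2
   + 2 * (1 - 1 / 2) * c t x * B + Y / c0"
   unfolding z[OF tx(2)] using Qform_nonneg[OF tx, of "v t"] by simp
 qed (use B1 d0 c_ge c_le D.tr_mem Y c00 in auto)
 have b': "(v t x)^2 <= cX 0 * Y" if "t : {0..T}" "x : Rd d" for t x
 proof -
  have "max Y (Y / c0 / (2 * (1 / 2) * c0)) <= Y + Y / c0^2" using Y by (simp add: power2_eq_square)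
  also have "... = cX 0 * Y" by (simp add: distrib_right)
  finally show ?thesis using b[OF that] by linarith
 qed
 show ?case
 proof (rule exI[of _ "%t x. (v t x)\<^sup>2"], rule exI[of _ z], intro conjI ballI pz)
  fix t x assume tx: "t : {0..T}" "x : Rd d"
  show "dbar_sq h 0 (v t) x <= (v t x)^2" "(v t x)^2 <= cX 0 * Y" "ALL k<=0. dbar_sq h k (v t) x <= cX 0 * Y"
   using d0 b'[OF tx] by auto
  have "2 * v t x * F t x <= 1 * (v t x)^2 + (F t x)^2 / 1"
   using two_sum_le[of 1 "%_. v t x" "%_. F t x" "{()}"] by (simp add: mult.assoc)
  moreover have "(F t x)^2 <= Y" using FY[of 0 t x] tx d0 by simp
  moreover have "de * Qform h t (v t) x <= Qform h t (v t) x" using Qform_nonneg[OF tx] de1 de0 by (simp add: mult_left_le_one_le)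
  moreover have "cR 0 * Y = cX 0 * Y + Y" by (simp add: distrib_right)
  ultimately show "z t x <= (SUM l:La. (q l t x + h * p l t x) / h^2 * ((v t (tr d h l x))^2 - (v t x)\<^sup>2)) - 2 * c t x * (v t x)\<^sup>2
    - de * (SUM mu:nl \<Lambda> 0. Qform h t (dbar h mu (v t)) x) + cR 0 * Y"
   unfolding z[OF tx(2)] nl_0 using b'[OF tx] by simp
 qed
next
 case (Suc n)
 from Suc.IH[OF Suc_leD[OF Suc.prems]] obtain Z z where pZ0: "ALL x:Rd d. prim T (%t. Z t x) (%t. z t x)"
  and Z0: "ALL t:{0..T}. ALL x:Rd d. dbar_sq h n (v t) x <= Z t x & Z t x <= cX n * Y &
   z t x <= (SUM l:La. (q l t x + h * p l t x) / h^2 * (Z t (tr d h l x) - Z t x)) - 2 * c t x * Z t x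
    - de * (SUM mu:nl \<Lambda> n. Qform h t (dbar h mu (v t)) x) + cR n * Y &
   (ALL k<=n. dbar_sq h k (v t) x <= cX n * Y)"
  by (elim exE conjE)
 have pZ: "!!x. x : Rd d ==> prim T (%t. Z t x) (%t. z t x)" using pZ0 by blast
 have Z1: "dbar_sq h n (v t) x <= Z t x" and Z2: "Z t x <= cX n * Y"
  and z: "z t x <= (SUM l:La. (q l t x + h * p l t x) / h^2 * (Z t (tr d h l x) - Z t x)) - 2 * c t x * Z t x
    - de * (SUM mu:nl \<Lambda> n. Qform h t (dbar h mu (v t)) x) + cR n * Y" if "t : {0..T}" "x : Rd d" for t x
  using Z0[rule_format, OF that] by blast+
 have low: "dbar_sq h k (v t) x <= cX n * Y" if "t : {0..T}" "x : Rd d" "k <= n" for t x k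
  using Z0[rule_format, OF that(1,2)] that(3) by blast
 obtain A where A: "!!l t x. l : La ==> t : {0..T} ==> x : Rd d ==> 0 <= (q l t x + h * p l t x) / h^2 & (q l t x + h * p l t x) / h^2 <= A"
  using coef_a by blast
 obtain B1 where B1: "!!t x. t : {0..T} ==> x : Rd d ==> dbar_sq h (Suc n) (v t) x <= B1" using dbar_sq_bounded[OF v] by blast
 define ka where "ka = K / de"
 have ka: "0 <= ka" "ka * de = K" using de0 K1 by (auto simp: ka_def)
 let ?X = "cX n" and ?R = "cR n" and ?X' = "cX (Suc n)"
 define S where "S = (K + Ac) * ?X + ka * ?R"
 have X': "?X' = 1 + ka * ?X + ?X + S / (de * c0)" by (simp add: Let_def S_def ka_def)
 have R': "cR (Suc n) = (2 * (Mb + 1) + de * c0) * ?X' + S" by (simp add: Let_def S_def ka_def)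
 have nn: "0 <= ?R" "1 <= ?X" "?X <= ?X'" "1 <= ?X'" using cX_cR[of n] cX_cR[of "Suc n"] by auto
 have S0: "0 <= S" unfolding S_def using nn ka K1 Ac_nonneg by (intro add_nonneg_nonneg mult_nonneg_nonneg) auto
 have XY: "Y <= ?X * Y" using mult_right_mono[OF nn(2) Y] by simp
 define V where "V t x = dbar_sq h (Suc n) (v t) x" for t x
 define w where "w t x = (SUM mu:nl \<Lambda> (Suc n). 2 * dbar h mu (v t) x * dbar h mu (%x. Lh h t (v t) x + F t x) x)" for t x
 have rSR: "SR (%t x. Lh h t (v t) x + F t x)" by (intro D.SM_add SR_Lh v F)
 have pV: "prim T (%t. V t x) (%t. w t x)" if "x : Rd d" for x
  unfolding V_def w_def dbar_sq_nl
  by (intro prim_sum finite_nl fin_\<Lambda> prim_square prim_dbar[OF v rSR p nl_sub that])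
 define Z' where "Z' t x = V t x + ka * Z t x" for t x
 define z' where "z' t x = w t x + ka * z t x" for t x
 have pZ': "prim T (%t. Z' t x) (%t. z' t x)" if "x : Rd d" for x
  unfolding Z'_def z'_def by (intro prim_add prim_cmult pV pZ that)
 have Zn: "0 <= Z t x" if "t : {0..T}" "x : Rd d" for t x using Z1[OF that] dbar_sq_nonneg[of n "v t" x] by linarith
 have VZ: "V t x <= Z' t x" if "t : {0..T}" "x : Rd d" for t x unfolding Z'_def using Zn[OF that] ka by simp
 have z': "z' t x <= (SUM l:La. (q l t x + h * p l t x) / h^2 * (Z' t (tr d h l x) - Z' t x)) - 2 * c t x * Z' t x
    - de * (SUM mu:nl \<Lambda> (Suc n). Qform h t (dbar h mu (v t)) x) + 2 * (1 - de) * c t x * B + de * c0 * B + S * Y"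
  if tx: "t : {0..T}" "x : Rd d" and B: "!!y. y : Rd d ==> V t y <= B" for t x B
 proof -
  let ?a = "%l. (q l t x + h * p l t x) / h^2"
  let ?E = "SUM mu:nl \<Lambda> (Suc n). Qform h t (dbar h mu (v t)) x" and ?E1 = "SUM mu:nl \<Lambda> n. Qform h t (dbar h mu (v t)) x"
  have "w t x <= (SUM l:La. ?a l * (V t (tr d h l x) - V t x)) - 2 * c t x * V t x - de * ?E + K * ?E1
   + 2 * (1 - de) * c t x * B + de * c0 * B + (K + Ac) * (?X * Y)"
   using energy_ineq[OF SR_S1[OF v tx(1)] SR_S1[OF F tx(1)] tx, of "Suc n" "?X * Y" B] Suc.prems N low[OF tx(1)] B Y nn
    FY[OF Suc.prems tx] XY unfolding w_def V_def by (auto simp: less_Suc_eq_le)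
  moreover have "ka * z t x <= ka * ((SUM l:La. ?a l * (Z t (tr d h l x) - Z t x)) - 2 * c t x * Z t x - de * ?E1 + ?R * Y)"
   by (intro mult_left_mono z tx ka)
  moreover have "ka * ((SUM l:La. ?a l * (Z t (tr d h l x) - Z t x)) - 2 * c t x * Z t x - de * ?E1 + ?R * Y)
   = (SUM l:La. ?a l * (ka * Z t (tr d h l x) - ka * Z t x)) - 2 * c t x * (ka * Z t x) - K * ?E1 + ka * ?R * Y"
  proof -
   have "ka * (de * ?E1) = K * ?E1" using ka(2) by (simp flip: mult.assoc)
   moreover have "ka * (SUM l:La. ?a l * (Z t (tr d h l x) - Z t x)) = (SUM l:La. ?a l * (ka * Z t (tr d h l x) - ka * Z t x))"
   proof -
    have "ka * (a * (u - v)) = a * (ka * u - ka * v)" for a u v :: real by (simp add: algebra_simps)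
    thus ?thesis unfolding sum_distrib_left by (intro sum.cong refl)
   qed
   ultimately show ?thesis by (simp add: distrib_left right_diff_distrib mult_ac)
  qed
  moreover have "(SUM l:La. ?a l * (Z' t (tr d h l x) - Z' t x)) = (SUM l:La. ?a l * (V t (tr d h l x) - V t x))
   + (SUM l:La. ?a l * (ka * Z t (tr d h l x) - ka * Z t x))"
   unfolding Z'_def sum.distrib[symmetric] by (intro sum.cong refl) (simp add: right_diff_distrib distrib_left)
  moreover have "2 * c t x * Z' t x = 2 * c t x * V t x + 2 * c t x * (ka * Z t x)" by (simp add: Z'_def distrib_left)
  moreover have "S * Y = (K + Ac) * (?X * Y) + ka * ?R * Y" by (simp add: S_def distrib_right mult.assoc)
  ultimately show ?thesis unfolding z'_def by linarith
 qed
 \<comment> \<open>The structural inequality leaves the fraction \<open>de\<close> of the damping,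
   and the remainders \<open>de * c0 * B\<close> consume half of that; hence
   \<open>de / 2\<close>.\<close>
 have b: "Z' t x <= max (Y + ka * (?X * Y)) (S * Y / (2 * (de / 2) * c0))" if tx: "t : {0..T}" "x : Rd d" for t x
 proof (rule maximum_principle[OF T0 fin pZ' _ A _ _ c00 _ _ _ _ _ tx, where c = c and Cm = "Mb + 1" and Bm = "B1 + ka * (?X * Y)"])
  show "Z' t x <= B1 + ka * (?X * Y)" if "t : {0..T}" "x : Rd d" for t x
   unfolding Z'_def V_def by (intro add_mono B1 mult_left_mono Z2 ka that)
  show "Z' 0 x <= Y + ka * (?X * Y)" if "x : Rd d" for x
   unfolding Z'_def V_def by (intro add_mono GY mult_left_mono Z2 ka that) (use Suc.prems T0 in auto)
  show "0 <= S * Y" using S0 Y by simp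
  show "0 <= Y + ka * (?X * Y)" using Y ka nn by simp
  fix B t x assume B0: "0 <= B" and B: "!!t x. t : {0..T} ==> x : Rd d ==> Z' t x <= B" and tx: "t : {0..T}" "x : Rd d"
  have "V t y <= B" if "y : Rd d" for y using VZ[OF tx(1) that] B[OF tx(1) that] by linarith
  note z'[OF tx this]
  moreover have "0 <= de * (SUM mu:nl \<Lambda> (Suc n). Qform h t (dbar h mu (v t)) x)"
   using de0 by (intro mult_nonneg_nonneg sum_nonneg Qform_nonneg tx) auto
  moreover have "de * c0 * B <= de * c t x * B" using c_ge[OF tx] de0 B0 by (intro mult_right_mono mult_left_mono) auto
  moreover have "2 * (1 - de / 2) * c t x * B = 2 * (1 - de) * c t x * B + de * c t x * B" by (simp add: algebra_simps)
  ultimately show "z' t x <= (SUM l:La. (q l t x + h * p l t x) / h^2 * (Z' t (tr d h l x) - Z' t x)) - 2 * c t x * Z' t x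
   + 2 * (1 - de / 2) * c t x * B + S * Y" by linarith
 qed (use c_ge c_le D.tr_mem de0 in auto)
 have b': "Z' t x <= ?X' * Y" if "t : {0..T}" "x : Rd d" for t x
 proof -
  have "0 <= S * Y / (de * c0)" "0 <= ka * (?X * Y)" using S0 Y de0 c00 ka nn by auto
  hence "max (Y + ka * (?X * Y)) (S * Y / (2 * (de / 2) * c0)) <= Y + ka * (?X * Y) + ?X * Y + S * Y / (de * c0)" using Y XY by simp
  also have "... = ?X' * Y" unfolding X' by (simp add: distrib_right mult.assoc)
  finally show ?thesis using b[OF that] by linarith
 qed
 show ?case
 proof (rule exI[of _ Z'], rule exI[of _ z'], intro conjI ballI pZ')
  fix t x assume tx: "t : {0..T}" "x : Rd d"
  show "dbar_sq h (Suc n) (v t) x <= Z' t x" using VZ[OF tx] by (simp add: V_def)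
  show "Z' t x <= ?X' * Y" by (rule b'[OF tx])
  show "ALL k<=Suc n. dbar_sq h k (v t) x <= ?X' * Y"
  proof (intro allI impI)
   fix k assume "k <= Suc n"
   then consider "k <= n" | "k = Suc n" by linarith
   thus "dbar_sq h k (v t) x <= ?X' * Y"
   proof cases
    case 1 show ?thesis using low[OF tx 1] mult_right_mono[OF nn(3) Y] by linarith
   next
    case 2 thus ?thesis using VZ[OF tx] b'[OF tx] by (simp add: V_def)
   qed
  qed
  \<comment> \<open>The maximum principle discarded the dissipation of this level. With the bound
    just obtained in the role of B, the same inequality is now recorded with the dissipation kept,
    since the next level needs it.\<close>
  have "V t y <= ?X' * Y" if "y : Rd d" for y using VZ[OF tx(1) that] b'[OF tx(1) that] by linarith
  note z'[OF tx this]
  moreover have "2 * (1 - de) * c t x * (?X' * Y) <= 2 * (Mb + 1) * (?X' * Y)"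
  proof (intro mult_right_mono)
   have "(1 - de) * c t x <= 1 * c t x" using de0 c_ge[OF tx] c00 by (intro mult_right_mono) auto
   hence "(1 - de) * c t x <= Mb + 1" using c_le[OF tx] by (metis mult_1 order_trans)
   hence "2 * ((1 - de) * c t x) <= 2 * (Mb + 1)" by (rule mult_left_mono) simp
   thus "2 * (1 - de) * c t x <= 2 * (Mb + 1)" by (simp only: mult.assoc)
  qed (use nn Y in simp)
  moreover have "cR (Suc n) * Y = 2 * (Mb + 1) * (?X' * Y) + de * c0 * (?X' * Y) + S * Y"
   unfolding R' by (simp add: distrib_right mult.assoc)
  ultimately show "z' t x <= (SUM l:La. (q l t x + h * p l t x) / h^2 * (Z' t (tr d h l x) - Z' t x)) - 2 * c t x * Z' t x
    - de * (SUM mu:nl \<Lambda> (Suc n). Qform h t (dbar h mu (v t)) x) + cR (Suc n) * Y" by linarith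
 qed
qed

lemma apriori:
 assumes v: "SR v" and F: "SR F" and p: "!!x. x : Rd d ==> prim T (%t. v t x) (%t. Lh h t (v t) x + F t x)"
  and Y: "0 <= Y" and N: "N <= m"
  and FY: "!!j t x. j <= N ==> t : {0..T} ==> x : Rd d ==> D2 d j (F t) x <= Y"
  and GY: "!!j x. j <= N ==> x : Rd d ==> D2 d j (v 0) x <= Y"
  and tx: "t : {0..T}" "x : Rd d"
 shows "D2 d N (v t) x <= cX N * (1 + ga) ^ m / \<tau>0 ^ (2 * N) * Y"
proof -
 have W: "dbar_sq h j ph x <= (1 + ga) ^ m * Y" if "j <= N" "S1 ph" "!!y. y : Rd d ==> D2 d j ph y <= Y" "x : Rd d" for j ph x
 proof -
  have "dbar_sq h j ph x <= ga ^ j * Y" using dbar_family[of "{()}" "%_. ph" j Y x] that by simp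
  also have "... <= (1 + ga) ^ m * Y" using ka1_ge(4)[of j Y] that N Y by (intro mult_right_mono) auto
  finally show ?thesis .
 qed
 have Y': "0 <= (1 + ga) ^ m * Y" using Y ga_nonneg by simp
 have "ALL t:{0..T}. ALL x:Rd d. ALL k<=N. dbar_sq h k (v t) x <= cX N * ((1 + ga) ^ m * Y)"
  using apriori_energy[OF v F p Y' N _ _ order_refl] W FY GY SR_S1[OF F] SR_S1[OF v] T0 by fastforce
 hence "dbar_sq h N (v t) x <= cX N * ((1 + ga) ^ m * Y)" using tx by blast
 hence "\<tau>0 ^ (2 * N) * D2 d N (v t) x <= cX N * ((1 + ga) ^ m * Y)"
  using D2_le_dbar_sq[OF SR_S1[OF v tx(1)] tx(2), of N] by linarith
 thus ?thesis using \<tau>0 by (simp add: pos_le_divide_eq mult_ac)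
qed

end

section \<open>Solutions depending smoothly on the mesh size\<close>

text \<open>On the slab the coordinate \<open>d\<close> plays the role of the mesh size \<open>h\<close>.\<close>

locale slab =
 fixes d :: nat and et H :: real
 assumes et0: "0 < et" and etH: "et < H"
begin

text \<open>Only coordinate \<open>d\<close> is constrained; the coordinates beyond it are idle, and
  no extensionality is demanded, because a point of \<open>Rd d\<close> whose coordinate
  \<open>d\<close> has been set is no longer in \<open>Rd d\<close>.\<close>

definition US :: "vec set" where "US = {x. et < x d & x d < H}"

definition JS :: "nat => real set" where "JS i = (if i = d then {et<..<H} else UNIV)"

sublocale S: domR UNIV US JS d
proof
 show "US ~= {}" unfolding US_def using etH dense[OF etH] by (auto intro: exI[of _ "%_. _"])
qed (auto simp: JS_def US_def)

abbreviation "SU I ph \<equiv> SM UNIV US I ph"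
abbreviation "BU \<equiv> BD UNIV US"

text \<open>The shift by h\<lambda> with h read off the point itself. Differentiation in coordinate
  \<open>d\<close> therefore also moves the point along \<lambda>.\<close>

definition sg :: "vec => (vec => real) => vec => real" where
 "sg l ph x = ph (tr d (x d) l x)"

lemma DERIV_sg_other:
 assumes "BU (Suc N) C ph" "x : US" "i ~= d"
 shows "((%r. sg l ph (x(i := r))) has_real_derivative sg l (pd i ph) x) (at (x i))"
 using S.DERIV_tr_line[OF assms(1,2), of i "x d" l] assms(3) by (simp add: sg_def)

lemma DERIV_sg_d:
 assumes "BU 2 C ph" "x : US"
 shows "((%r. sg l ph (x(d := r))) has_real_derivative sg l (pd d ph) x + sg l (Dl d l ph) x) (at (x d))"
proof -
 \<comment> \<open>Raising h by s moves the shifted point by s along \<lambda> and its coordinate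
   \<open>d\<close> by s: a straight motion with direction \<open>l(d := 1)\<close> in one dimension
   more, so a single directional derivative gives the chain rule.\<close>
 let ?y = "tr d (x d) l x" and ?l = "l(d := 1)"
 have "((%s. ph (tr (Suc d) s ?l ?y)) has_real_derivative Dl (Suc d) ?l ph ?y) (at 0)"
  by (rule S.DERIV_dir[OF assms(1) S.tr_mem[OF assms(2)]]) simp
 moreover have "tr (Suc d) s ?l ?y = tr d (x d + s) l (x(d := x d + s))" for s
  by (auto simp: tr_def algebra_simps)
 moreover have "Dl (Suc d) ?l ph ?y = Dl d l ph ?y + pd d ph ?y" by (simp add: Dl_def)
 ultimately have "((%s. sg l ph (x(d := x d + s))) has_real_derivative sg l (pd d ph) x + sg l (Dl d l ph) x) (at 0)"
  by (simp add: sg_def add.commute)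
 thus ?thesis by (simp add: DERIV_def)
qed

lemma BU_Dl:
 assumes "BU (Suc N) C ph" shows "BU N ((SUM i<d. \<bar>l i\<bar>) * C) (Dl d l ph)"
proof -
 have "BU N (SUM i<d. \<bar>l i\<bar> * C) (%x. SUM i<d. l i * pd i ph x)"
  by (intro S.BD_sum S.BD_cmult S.BD_pd assms) auto
 thus ?thesis by (simp add: Dl_def[abs_def] sum_distrib_right)
qed

text \<open>Smoothness of all orders is a qualitative premise that licenses the chain rule; the
  quantitative bound of order N is linear in the bound of the same order. Without this absence of
  loss the Picard iteration could not converge in every order.\<close>

lemma BU_sg:
 assumes "!!M. EX C. BU M C ph" "BU N C ph"
 shows "BU N ((1 + (SUM i<d. \<bar>l i\<bar>)) ^ N * C) (sg l ph)"
 using assms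
proof (induction N arbitrary: ph C)
 case 0
 thus ?case using S.tr_mem by (simp add: sg_def)
next
 case (Suc N)
 let ?B = "1 + (SUM i<d. \<bar>l i\<bar>)"
 have B1: "1 <= ?B" by (simp add: sum_nonneg)
 have C0: "0 <= C" using S.BD_nonneg[OF Suc.prems(2)] .
 obtain C2 where C2: "BU 2 C2 ph" using Suc.prems(1) by blast
 have sp: "EX C. BU M C (pd i ph)" for M i
 proof -
  obtain C where "BU (Suc M) C ph" using Suc.prems(1) by blast
  thus ?thesis using S.BD_pd by blast
 qed
 have sD: "EX C. BU M C (%x. pd d ph x + Dl d l ph x)" for M
 proof -
  obtain C where "BU (Suc M) C ph" using Suc.prems(1) by blast
  thus ?thesis using S.BD_add[OF S.BD_pd BU_Dl] by blast
 qed
 show ?case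
 proof (rule S.BD_SucI[where ps = "%i. if i = d then sg l (%x. pd d ph x + Dl d l ph x) else sg l (pd i ph)"])
  fix x assume x: "x : US"
  have "\<bar>sg l ph x\<bar> <= C" unfolding sg_def using S.BD_bound[OF Suc.prems(2) S.tr_mem[OF x]] .
  also have "... <= ?B ^ Suc N * C" using one_le_power[OF B1, of "Suc N"] C0 by (metis mult_le_cancel_right1 not_less)
  finally show "\<bar>sg l ph x\<bar> <= ?B ^ Suc N * C" .
 next
  fix i x assume x: "x : US"
  show "((%s. sg l ph (x(i := s))) has_real_derivative (if i = d then sg l (%x. pd d ph x + Dl d l ph x) else sg l (pd i ph)) x) (at (x i))"
   using DERIV_sg_other[OF Suc.prems(2) x, of i l] DERIV_sg_d[OF C2 x, of l] by (cases "i = d") (simp_all add: sg_def)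
 next
  fix i
  have le: "?B ^ N * C <= ?B ^ Suc N * C" using B1 C0 by (intro mult_right_mono power_increasing) auto
  show "BU N (?B ^ Suc N * C) (if i = d then sg l (%x. pd d ph x + Dl d l ph x) else sg l (pd i ph))"
  proof (cases "i = d")
   case True
   have "BU N (?B * C) (%x. pd d ph x + Dl d l ph x)"
    using S.BD_add[OF S.BD_pd[OF Suc.prems(2)] BU_Dl[OF Suc.prems(2)], of d l] by (simp add: distrib_right)
   from Suc.IH[OF sD this] show ?thesis using True by (simp add: mult_ac)
  next
   case False
   have "BU N (?B ^ N * C) (sg l (pd i ph))" by (rule Suc.IH[OF sp S.BD_pd[OF Suc.prems(2)]]) simp
   from S.BD_mono[OF this le order_refl] show ?thesis using False by simp
  qed
 qed
qed

lemma SU_ex: "SU I ph ==> t : I ==> EX C. BU M C (ph t)" by (rule S.SM_BD)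

lemma SU_sg: "SU I ph ==> SU I (%t. sg l (ph t))"
 unfolding SM_def using BU_sg by meson

lemma SU_Dl: "SU I ph ==> SU I (%t. Dl d l (ph t))"
 unfolding Dl_def by (intro S.SM_sum S.SM_cmult S.SM_pd) auto

lemma pd_sg_other: "SU I ph ==> t : I ==> x : US ==> i ~= d ==> pd i (sg l (ph t)) x = sg l (pd i (ph t)) x"
 using SU_ex[of I ph t "Suc 0"] DERIV_sg_other S.pd_eqI by metis

lemma pd_sg_d: "SU I ph ==> t : I ==> x : US ==> pd d (sg l (ph t)) x = sg l (pd d (ph t)) x + sg l (Dl d l (ph t)) x"
 using SU_ex[of I ph t 2] DERIV_sg_d S.pd_eqI by metis

lemma SU_inverse: "SU I (%_ x. 1 / x d)"
 unfolding SM_def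
proof
 fix N
 have "EX C. BU N C (%x. 1 / x d)"
 proof (induction N)
  case 0
  have "\<bar>1 / x d\<bar> <= 1 / et" if "x : US" for x using that et0 by (auto simp: US_def field_simps)
  thus ?case by auto
 next
  case (Suc N)
  then obtain C where C: "BU N C (%x. 1 / x d)" by blast
  let ?C = "max C (\<bar>-1\<bar> * (2 ^ N * C * C))"
  have "BU (Suc N) ?C (%x. 1 / x d)"
  proof (rule S.BD_SucI[where ps = "%i x. if i = d then (-1) * (1 / x d * (1 / x d)) else 0"])
   show "\<bar>1 / x d\<bar> <= ?C" if "x : US" for x using S.BD_bound[OF C that] by simp
   show "((%s. 1 / (x(i := s)) d) has_real_derivative (if i = d then - 1 * (1 / x d * (1 / x d)) else 0)) (at (x i))"
    if "x : US" for i x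
   proof (cases "i = d")
    case True
    have "x d ~= 0" using that et0 by (auto simp: US_def)
    thus ?thesis using True by (auto intro!: derivative_eq_intros simp: power2_eq_square divide_simps)
   qed simp
   show "BU N ?C (%x. if i = d then - 1 * (1 / x d * (1 / x d)) else 0)" for i
   proof (cases "i = d")
    case True
    have "BU N (\<bar>-1\<bar> * (2 ^ N * C * C)) (%x. -1 * (1 / x d * (1 / x d)))"
     by (rule S.BD_cmult[OF S.BD_mult[OF C C]])
    thus ?thesis using True S.BD_mono[of N _ _ ?C N] by simp
   next
    case False
    have "0 <= ?C" using S.BD_nonneg[OF C] by simp
    thus ?thesis using False S.BD_const[of 0] by simp
   qed
  qed
  thus ?case by blast
 qed
 thus "EX C. ALL t:I. BU N C (%x. 1 / x d)" by blast
qed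

end

section \<open>Picard iteration on the slab\<close>

locale slab_scheme = slab d et H for d et H +
 fixes La :: "vec set" and q p :: "vec => real => vec => real" and c :: "real => vec => real" and T :: real
 assumes fin: "finite La" and T0: "0 <= T"
  and qU: "l : La ==> SM UNIV US {0..T} (q l)"
  and pU: "l : La ==> SM UNIV US {0..T} (p l)"
  and cU: "SM UNIV US {0..T} c"
  and q_meas: "l : La ==> x : US ==> (%t. q l t x) : time_measurable T"
  and p_meas: "l : La ==> x : US ==> (%t. p l t x) : time_measurable T"
  and c_meas: "x : US ==> (%t. c t x) : time_measurable T"
begin

definition al :: "vec => real => vec => real" where
 "al l t x = q l t x * (1 / x d * (1 / x d)) + p l t x * (1 / x d)"

definition Lop :: "real => (vec => real) => vec => real" where
 "Lop t ph x = (SUM l:La. al l t x * (sg l ph x - ph x)) - c t x * ph x"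

lemma alU: "l : La ==> SU {0..T} (al l)"
 unfolding al_def[abs_def] by (intro S.SM_add S.SM_mult qU pU SU_inverse)

lemma SU_Lop: "SU {0..T} ph ==> SU {0..T} (%t. Lop t (ph t))"
 unfolding Lop_def[abs_def] by (intro S.SM_diff S.SM_sum fin S.SM_mult alU cU SU_sg)

text \<open>On the slab 1/h is smooth and bounded, and L_h consists of multiplications and shifts
  only. It is thus bounded in every order without loss of derivatives, with a constant that may
  depend on everything.\<close>

lemma BU_Lop:
 "EX A>0. ALL t:{0..T}. ALL ph C. (ALL M. EX C. BU M C ph) --> BU N C ph --> BU N (A * C) (Lop t ph)"
proof -
 have "EX Ca>=0. ALL t:{0..T}. BU N Ca (al l t)" if "l : La" for l
  by (rule S.SM_obtain[OF alU[OF that]]) blast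
 then obtain Ca where Ca: "!!l. l : La ==> 0 <= Ca l" "!!l t. l : La ==> t : {0..T} ==> BU N (Ca l) (al l t)" by metis
 obtain Cc where Cc: "0 <= Cc" "!!t. t : {0..T} ==> BU N Cc (c t)" using S.SM_obtain[OF cU] by metis
 let ?B = "%l. (1 + (SUM i<d. \<bar>l i\<bar>)) ^ N"
 let ?A = "(SUM l:La. 2 ^ N * Ca l * (?B l + 1)) + 2 ^ N * Cc"
 have "BU N ((?A + 1) * C) (Lop t ph)" if t: "t : {0..T}" and sm: "ALL M. EX C. BU M C ph" and b: "BU N C ph" for t ph C
 proof -
  have C0: "0 <= C" using S.BD_nonneg[OF b] .
  have "BU N ((SUM l:La. 2 ^ N * Ca l * (?B l * C + \<bar>-1\<bar> * C)) + \<bar>-1\<bar> * (2 ^ N * Cc * C))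
   (%x. (SUM l:La. al l t x * (sg l ph x + (-1) * ph x)) + (-1) * (c t x * ph x))"
   using sm by (intro S.BD_add S.BD_sum S.BD_mult S.BD_cmult fin Ca Cc BU_sg t b) auto
  moreover have "(SUM l:La. 2 ^ N * Ca l * (?B l * C + \<bar>-1\<bar> * C)) + \<bar>-1\<bar> * (2 ^ N * Cc * C) = ?A * C"
   by (simp add: sum_distrib_right sum_distrib_left distrib_left distrib_right mult_ac sum.distrib)
  moreover have "?A * C <= (?A + 1) * C" using C0 by (intro mult_right_mono) auto
  ultimately show ?thesis using S.BD_mono[of N] by (simp add: Lop_def[abs_def])
 qed
 moreover have "0 < ?A + 1" using Ca Cc
  by (intro add_nonneg_pos add_nonneg_nonneg sum_nonneg mult_nonneg_nonneg) (auto simp: sum_nonneg)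
 ultimately show ?thesis by blast
qed

lemma Lop_meas:
 assumes "!!x. x : US ==> (%t. ph t x) : time_measurable T" "x : US"
 shows "(%t. Lop t (ph t) x) : time_measurable T"
proof -
 have 1: "(%t. al l t x) : time_measurable T" if "l : La" for l
  unfolding al_def using q_meas[OF that assms(2)] p_meas[OF that assms(2)] by measurable
 have 2: "(%t. sg l (ph t) x) : time_measurable T" for l
  unfolding sg_def by (rule assms(1)[OF S.tr_mem[OF assms(2)]])
 note [measurable] = 1 2 assms(1)[OF assms(2)] c_meas[OF assms(2)]
 show ?thesis unfolding Lop_def by (intro borel_measurable_diff borel_measurable_sum borel_measurable_times 1 2 assms c_meas)
qed

lemma BU_LBINT:
 assumes "!!s. s : {0..T} ==> BU N (w s) (r s)" "continuous_on {0..T} w" "t : {0..T}"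
  "!!x. x : US ==> (%t. r t x) : time_measurable T"
 shows "BU N (LBINT s:{0..t}. w s) (%x. LBINT s:{0..t}. r s x)"
proof -
 have I: "(LBINT s:{0..t}. f s) = (\<integral>s. f s \<partial>restrict_space lborel {0..t})" for f :: "real => real"
  unfolding set_lebesgue_integral_def by (subst integral_restrict_space) auto
 have sp: "space (restrict_space lborel {0..t}) = {0..t}" by (simp add: space_restrict_space)
 have m: "f : borel_measurable (restrict_space lborel {0..t})"
  if "f : time_measurable T" for f :: "real => real"
 proof -
  have "f : borel_measurable (restrict_space borel {0..t})"
   by (rule measurable_restrict_mono[OF that]) (use assms(3) in auto)
  moreover have "sets (restrict_space borel {0..t}) = sets (restrict_space lborel {0..t})" by (rule sets_restrict_space_cong) simp
  ultimately show ?thesis using measurable_cong_sets by blast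
 qed
 show ?thesis unfolding I
 proof (rule S.BD_integral(1))
  have "set_integrable lborel {0..t} w"
   by (rule borel_integrable_atLeastAtMost') (use assms(2,3) in "auto intro: continuous_on_subset")
  thus "integrable (restrict_space lborel {0..t}) w"
   unfolding set_integrable_def by (subst integrable_restrict_space) auto
  show "BU N (w si) (r si)" if "si : space (restrict_space lborel {0..t})" for si
   by (rule assms(1)) (use that assms(3) in "simp add: sp")
  show "(%si. r si x) : borel_measurable (restrict_space lborel {0..t})" if "x : US" for x
   by (rule m[OF assms(4)[OF that]])
 qed
qed

lemma LBINT_exp:
 fixes a b t :: real
 assumes "0 < b" "0 <= t" shows "(LBINT s:{0..t}. a * exp (b * s)) <= a * exp (b * t) / b \<or> a < 0"
proof (cases "a < 0")
 case False
 have "(LBINT s:{0..t}. a * exp (b * s)) = a * exp (b * t) / b - a * exp (b * 0) / b"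
  unfolding set_lebesgue_integral_def
  by (rule integral_FTC_Icc[OF assms(2)])
   (use assms(1) in "auto intro!: derivative_eq_intros continuous_intros simp: has_real_derivative_iff_has_vector_derivative[symmetric]")
 thus ?thesis using False assms by simp
qed simp

context
 fixes F :: "real => vec => real" and G :: "vec => real"
 assumes FU: "SU {0..T} F" and GU: "SU {0..T} (%_. G)"
  and F_meas: "!!x. x : US ==> (%t. F t x) : time_measurable T"
begin

text \<open>The increments of the Picard iteration, not its iterates: the solution is their
  sum.\<close>

primrec W :: "nat => real => vec => real" where
 "W 0 t x = G x + (LBINT s:{0..t}. F s x)"
| "W (Suc n) t x = (LBINT s:{0..t}. Lop s (W n s) x)"

text \<open>Against an exponential that grows twice as fast as the bound of the operator, each
  integration in time gains the factor 1/2. Smoothness and measurability of the earlier increments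
  appear as premises because the lemma is used inside the induction that establishes them; the
  constants are chosen before n.\<close>

lemma W_growth:
 "EX A>0. EX C>=0. ALL n. (ALL n'<=n. ALL t:{0..T}. ALL M. EX D. BU M D (W n' t)) -->
  (ALL n'<=n. ALL x:US. (%t. W n' t x) : time_measurable T) -->
  (ALL n'<=Suc n. ALL t:{0..T}. BU N (C * (1 / 2) ^ n' * exp (A * t)) (W n' t))"
proof -
 obtain A where A: "0 < A" "!!t ph C. t : {0..T} ==> (ALL M. EX C. BU M C ph) ==> BU N C ph ==> BU N (A * C) (Lop t ph)"
  using BU_Lop by blast
 obtain CF where CF: "0 <= CF" "!!t. t : {0..T} ==> BU N CF (F t)" using S.SM_obtain[OF FU] by metis
 obtain CG where CG: "0 <= CG" "BU N CG G" using S.SM_obtain[OF GU, of N] T0 by (metis atLeastAtMost_iff order_refl)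
 define C where "C = CG + CF * T"
 have C0: "0 <= C" using CF CG T0 by (simp add: C_def)
 have W0: "BU N (C * exp (2 * A * t)) (W 0 t)" if t: "t : {0..T}" for t
 proof -
  have "BU N (CG + (LBINT s:{0..t}. CF)) (%x. G x + (LBINT s:{0..t}. F s x))"
   by (intro S.BD_add CG BU_LBINT t CF F_meas) auto
  moreover have "(LBINT s:{0..t}. CF) = CF * t" using t by (simp add: set_lebesgue_integral_def)
  moreover have "CG + CF * t <= C * exp (2 * A * t)"
  proof -
   have "CG + CF * t <= C" using t CF by (auto simp: C_def intro!: mult_left_mono)
   also have "... <= C * exp (2 * A * t)" using C0 t A by (metis atLeastAtMost_iff mult_le_cancel_left1 mult_nonneg_nonneg not_less one_le_exp_iff zero_le_numeral less_imp_le)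
   finally show ?thesis .
  qed
  moreover have "W 0 t = (%x. G x + (LBINT s:{0..t}. F s x))" by (rule ext) simp
  ultimately show ?thesis using S.BD_mono[of N "CG + CF * t" _ "C * exp (2 * A * t)" N] by (simp del: BD.simps)
 qed
 have "BU N (C * (1 / 2) ^ n' * exp (2 * A * t)) (W n' t)"
  if s: "ALL n'<=n. ALL t:{0..T}. ALL M. EX D. BU M D (W n' t)"
  and m: "ALL n'<=n. ALL x:US. (%t. W n' t x) : time_measurable T"
  and n': "n' <= Suc n" and t: "t : {0..T}" for n n' t
  using n' t
 proof (induction n' arbitrary: t)
  case 0 thus ?case using W0 by (simp del: W.simps BD.simps)
 next
  case (Suc k)
  let ?a = "A * (C * (1 / 2) ^ k)"
  have "BU N (LBINT s:{0..t}. ?a * exp (2 * A * s)) (%x. LBINT s:{0..t}. Lop s (W k s) x)"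
  proof (rule BU_LBINT[OF _ _ Suc.prems(2)])
   show "BU N (?a * exp (2 * A * r)) (Lop r (W k r))" if "r : {0..T}" for r
    using A(2)[OF that _ Suc.IH[OF _ that]] s Suc.prems that by (simp add: mult.assoc)
   show "(%t. Lop t (W k t) x) : time_measurable T" if "x : US" for x
    by (rule Lop_meas[OF _ that]) (use m Suc.prems in auto)
  qed (auto intro!: continuous_intros)
  moreover have "(LBINT s:{0..t}. ?a * exp (2 * A * s)) <= C * (1 / 2) ^ Suc k * exp (2 * A * t)"
  proof -
   have "~ ?a < 0" using A C0 by (simp add: not_less)
   hence "(LBINT s:{0..t}. ?a * exp (2 * A * s)) <= ?a * exp (2 * A * t) / (2 * A)"
    using LBINT_exp[of "2 * A" t ?a] A Suc.prems by auto
   also have "... = C * (1 / 2) ^ Suc k * exp (2 * A * t)" using A by (simp add: field_simps)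
   finally show ?thesis .
  qed
  ultimately have "BU N (C * (1 / 2) ^ Suc k * exp (2 * A * t)) (%x. LBINT s:{0..t}. Lop s (W k s) x)"
   using S.BD_mono by blast
  thus ?case by simp
 qed
 thus ?thesis using A C0 by (intro exI[of _ "2 * A"] exI[of _ C] conjI allI impI ballI) auto
qed

lemma W_props:
 "(ALL t:{0..T}. ALL M. EX D. BU M D (W n t)) & (ALL x:US. prim T (%t. W n t x) (%t. if n = 0 then F t x else Lop t (W (n - 1) t) x))"
proof (induction n rule: less_induct)
 case (less n)
 have meas: "(%t. W k t x) : time_measurable T" if "k < n" "x : US" for k x
  using less[OF that(1)] prim_measurable that(2) by blast
 have sm: "EX D. BU M D (W n t)" if t: "t : {0..T}" for t M
 proof (cases n)
  case 0
  obtain CF where CF: "0 <= CF" "!!t. t : {0..T} ==> BU M CF (F t)" using S.SM_obtain[OF FU] by metis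
  obtain CG where CG: "0 <= CG" "BU M CG G" using S.SM_obtain[OF GU, of M] T0 by (metis atLeastAtMost_iff order_refl)
  have "BU M (CG + (LBINT s:{0..t}. CF)) (%x. G x + (LBINT s:{0..t}. F s x))"
   by (intro S.BD_add CG BU_LBINT t CF F_meas) auto
  moreover have "W n t = (%x. G x + (LBINT s:{0..t}. F s x))" by (rule ext) (simp add: 0)
  ultimately show ?thesis by auto
 next
  case (Suc k)
  have "ALL n'<=k. ALL t:{0..T}. ALL M. EX D. BU M D (W n' t)" using less Suc by auto
  moreover have "ALL n'<=k. ALL x:US. (%t. W n' t x) : time_measurable T" using meas Suc by auto
  note sm = this calculation
  from W_growth[of M] obtain A C where gr: "ALL n. (ALL n'<=n. ALL t:{0..T}. ALL M. EX D. BU M D (W n' t)) -->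
   (ALL n'<=n. ALL x:US. (%t. W n' t x) : time_measurable T) -->
   (ALL n'<=Suc n. ALL t:{0..T}. BU M (C * (1 / 2) ^ n' * exp (A * t)) (W n' t))" by (elim exE conjE)
  from gr[THEN spec, THEN mp, THEN mp, OF sm(2,1)] show ?thesis using t Suc by blast
 qed
 have "prim T (%t. W n t x) (%t. if n = 0 then F t x else Lop t (W (n - 1) t) x)" if x: "x : US" for x
 proof (cases n)
  case 0
  obtain CF where CF: "0 <= CF" "!!t. t : {0..T} ==> BU 0 CF (F t)" using S.SM_obtain[OF FU] by metis
  have "prim T (%t. G x + (LBINT s:{0..t}. F s x)) (%t. F t x)"
   by (rule prim_LBINT[OF F_meas[OF x]]) (use CF x in auto)
  thus ?thesis using 0 by simp
 next
  case (Suc k)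
  have s: "ALL n'<=k. ALL t:{0..T}. ALL M. EX D. BU M D (W n' t)" using less Suc by auto
  have m: "ALL n'<=k. ALL x:US. (%t. W n' t x) : time_measurable T" using meas Suc by auto
  from W_growth[of 0] obtain A C where AC: "0 < A" "0 <= C" and gr: "ALL n. (ALL n'<=n. ALL t:{0..T}. ALL M. EX D. BU M D (W n' t)) -->
   (ALL n'<=n. ALL x:US. (%t. W n' t x) : time_measurable T) -->
   (ALL n'<=Suc n. ALL t:{0..T}. BU 0 (C * (1 / 2) ^ n' * exp (A * t)) (W n' t))" by (elim exE conjE)
  have "ALL n'<=Suc k. ALL t:{0..T}. BU 0 (C * (1 / 2) ^ n' * exp (A * t)) (W n' t)"
   using gr[THEN spec, THEN mp, THEN mp, OF s m] .
  hence AC3: "!!t. t : {0..T} ==> BU 0 (C * (1 / 2) ^ k * exp (A * t)) (W k t)" by (simp del: BD.simps)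
  obtain B where B: "0 < B" "!!t ph C. t : {0..T} ==> (ALL M. EX C. BU M C ph) ==> BU 0 C ph ==> BU 0 (B * C) (Lop t ph)"
   using BU_Lop by blast
  have "prim T (%t. 0 + (LBINT s:{0..t}. Lop s (W k s) x)) (%t. Lop t (W k t) x)"
  proof (rule prim_LBINT[where C = "B * (C * (1 / 2) ^ k * exp (A * T))"])
   show "(%t. Lop t (W k t) x) : time_measurable T"
    by (rule Lop_meas[OF _ x]) (use m in auto)
   fix t assume t: "t : {0..T}"
   have "BU 0 (B * (C * (1 / 2) ^ k * exp (A * t))) (Lop t (W k t))" by (rule B(2)[OF t _ AC3[OF t]]) (use s t in auto)
   hence "\<bar>Lop t (W k t) x\<bar> <= B * (C * (1 / 2) ^ k * exp (A * t))" using x by simp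
   also have "... <= B * (C * (1 / 2) ^ k * exp (A * T))" using B AC t by (intro mult_left_mono) auto
   finally show "\<bar>Lop t (W k t) x\<bar> <= B * (C * (1 / 2) ^ k * exp (A * T))" .
  qed
  thus ?thesis using Suc by simp
 qed
 thus ?case using sm by blast
qed

lemma W_bound: "EX C>=0. ALL n. ALL t:{0..T}. BU N (C * (1 / 2) ^ n) (W n t)"
proof -
 from W_growth[of N] obtain A C where AC: "0 < A" "0 <= C" and gr: "ALL n. (ALL n'<=n. ALL t:{0..T}. ALL M. EX D. BU M D (W n' t)) -->
   (ALL n'<=n. ALL x:US. (%t. W n' t x) : time_measurable T) -->
   (ALL n'<=Suc n. ALL t:{0..T}. BU N (C * (1 / 2) ^ n' * exp (A * t)) (W n' t))" by (elim exE conjE)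
 have s: "ALL n'<=n. ALL t:{0..T}. ALL M. EX D. BU M D (W n' t)"
  and m: "ALL n'<=n. ALL x:US. (%t. W n' t x) : time_measurable T" for n
  using W_props prim_measurable by blast+
 have AC3: "BU N (C * (1 / 2) ^ n * exp (A * t)) (W n t)" if "t : {0..T}" for n t
  using gr[THEN spec, THEN mp, THEN mp, OF s m, of n] that by simp
 have "BU N ((C * exp (A * T)) * (1 / 2) ^ n) (W n t)" if t: "t : {0..T}" for n t
 proof (rule S.BD_mono[OF AC3[OF t]])
  have "C * (1 / 2) ^ n * exp (A * t) <= C * (1 / 2) ^ n * exp (A * T)" using AC t by (intro mult_left_mono) auto
  thus "C * (1 / 2) ^ n * exp (A * t) <= C * exp (A * T) * (1 / 2) ^ n" by (simp add: mult_ac)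
 qed simp
 thus ?thesis using AC by (intro exI[of _ "C * exp (A * T)"]) auto
qed

theorem picard:
 "EX v. SU {0..T} v & (ALL x:US. v 0 x = G x & prim T (%t. v t x) (%t. Lop t (v t) x + F t x))"
proof -
 obtain C0 where C0: "0 <= C0" "!!n t. t : {0..T} ==> BU 0 (C0 * (1 / 2) ^ n) (W n t)" using W_bound by blast
 have b0: "\<bar>W n t x\<bar> <= C0 * (1 / 2) ^ n" if "t : {0..T}" "x : US" for n t x using C0(2)[OF that(1)] that(2) by simp
 have geo: "summable (%n. a * (1 / 2 :: real) ^ n)" for a by (intro summable_mult summable_geometric) simp
 have sW: "summable (%n. W n t x)" if "t : {0..T}" "x : US" for t x
  by (rule summable_comparison_test'[OF geo[of C0]]) (use b0[OF that] in auto)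
 define v where "v t x = (\<Sum>n. W n t x)" for t x
 have sums: "(%n. W n t x) sums v t x" if "t : {0..T}" "x : US" for t x
  unfolding v_def using sW[OF that] summable_sums by blast
 \<comment> \<open>The series is read as an integral for the counting measure, so that
   \<open>BD_integral\<close> differentiates it term by term.\<close>
 have vint: "v t x = (\<integral>n. W n t x \<partial>count_space UNIV)" if "t : {0..T}" "x : US" for t x
  unfolding v_def
 proof (rule integral_count_space_nat[symmetric])
  have "integrable (count_space UNIV) (%n::nat. C0 * (1 / 2) ^ n)"
   using geo[of C0] C0 by (simp add: integrable_count_space_nat_iff)
  thus "integrable (count_space UNIV) (%n. W n t x)"
   by (rule Bochner_Integration.integrable_bound) (use b0[OF that] C0 in auto)
 qed
 have SUv: "SU {0..T} v"
  unfolding SM_def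
 proof
  fix N
  obtain C where C: "0 <= C" "!!n t. t : {0..T} ==> BU N (C * (1 / 2) ^ n) (W n t)" using W_bound by blast
  have i: "integrable (count_space UNIV) (%n::nat. C * (1 / 2) ^ n)"
   using geo[of C] C by (simp add: integrable_count_space_nat_iff)
  have "BU N (\<integral>n. C * (1 / 2) ^ n \<partial>count_space UNIV) (v t)" if t: "t : {0..T}" for t
  proof -
   have "BU N (\<integral>n. C * (1 / 2) ^ n \<partial>count_space UNIV) (%x. \<integral>n. W n t x \<partial>count_space UNIV)"
    by (rule S.BD_integral(1)[OF _ i]) (use C t in auto)
   thus ?thesis using S.BD_cong[of "v t" "%x. \<integral>n. W n t x \<partial>count_space UNIV"] vint[OF t] by simp
  qed
  thus "EX C. ALL t:{0..T}. BU N C (v t)" by blast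
 qed
 have v_meas: "(%t. v t x) : time_measurable T" if "x : US" for x
 proof -
  have "(%t. W n t x) : time_measurable T" for n using W_props[of n] prim_measurable that by blast
  thus ?thesis unfolding v_def by measurable
 qed
 obtain B where B: "0 < B" "!!t ph C. t : {0..T} ==> (ALL M. EX C. BU M C ph) ==> BU 0 C ph ==> BU 0 (B * C) (Lop t ph)"
  using BU_Lop by blast
 have Lb: "\<bar>Lop t (W n t) x\<bar> <= B * (C0 * (1 / 2) ^ n)" if "t : {0..T}" "x : US" for n t x
  using B(2)[OF that(1) _ C0(2)[OF that(1)]] W_props[of n] that by simp
 have Lsums: "(%n. Lop t (W n t) x) sums Lop t (v t) x" if "t : {0..T}" "x : US" for t x
  unfolding Lop_def sg_def
  by (intro sums_diff sums_sum sums_mult sums S.tr_mem that)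
 have Lm: "(%t. Lop t (W n t) x) : time_measurable T" if "x : US" for n x
  using W_props[of "Suc n"] that unfolding prim_def by auto
 have LIv: "(%n. LBINT s:{0..t}. Lop s (W n s) x) sums (LBINT s:{0..t}. Lop s (v s) x)" if t: "t : {0..T}" and x: "x : US" for t x
 proof -
  have i: "set_integrable lborel {0..t} (%s. Lop s (W n s) x)" for n
   by (rule bounded_measurable_set_integrable[OF Lm[OF x] Lb[OF _ x]]) (use t in auto)
  have nb: "norm (indicat_real {0..t} s *\<^sub>R Lop s (W n s) x) <= B * C0 * (1 / 2) ^ n * indicat_real {0..t} s" for n s
   using Lb[OF _ x, of s n] t by (cases "s : {0..t}") auto
  have "(%n. \<integral>s. indicat_real {0..t} s *\<^sub>R Lop s (W n s) x \<partial>lborel) sums (\<integral>s. (\<Sum>n. indicat_real {0..t} s *\<^sub>R Lop s (W n s) x) \<partial>lborel)"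
  proof (rule sums_integral)
   show "integrable lborel (%s. indicat_real {0..t} s *\<^sub>R Lop s (W n s) x)" for n using i[of n] unfolding set_integrable_def .
   show "AE s in lborel. summable (%n. norm (indicat_real {0..t} s *\<^sub>R Lop s (W n s) x))"
   proof (rule AE_I2)
    fix s show "summable (%n. norm (indicat_real {0..t} s *\<^sub>R Lop s (W n s) x))"
     by (rule summable_comparison_test'[OF geo[of "B * C0 * indicat_real {0..t} s"]]) (use nb[of s] in "simp add: mult_ac")
   qed
   show "summable (%n. \<integral>s. norm (indicat_real {0..t} s *\<^sub>R Lop s (W n s) x) \<partial>lborel)"
   proof (rule summable_comparison_test'[OF geo[of "B * C0 * t"]])
    fix n :: nat assume "0 <= n"
    have "(\<integral>s. norm (indicat_real {0..t} s *\<^sub>R Lop s (W n s) x) \<partial>lborel) <= (\<integral>s. B * C0 * (1 / 2) ^ n * indicat_real {0..t} s \<partial>lborel)"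
     by (intro integral_mono integrable_norm nb) (use i[of n] t in "auto simp: set_integrable_def emeasure_lborel_Icc_eq")
    also have "... = B * C0 * t * (1 / 2) ^ n" using t by (simp add: mult_ac)
    finally show "norm (\<integral>s. norm (indicat_real {0..t} s *\<^sub>R Lop s (W n s) x) \<partial>lborel) <= B * C0 * t * (1 / 2) ^ n" by simp
   qed
  qed
  moreover have "(\<Sum>n. indicat_real {0..t} s *\<^sub>R Lop s (W n s) x) = indicat_real {0..t} s *\<^sub>R Lop s (v s) x" for s
   using Lsums[OF _ x, of s] t by (cases "s : {0..t}") (auto simp: sums_iff)
  ultimately show ?thesis by (simp add: set_lebesgue_integral_def)
 qed
 have v_eq: "v t x = G x + (LBINT s:{0..t}. F s x) + (LBINT s:{0..t}. Lop s (v s) x)" if "t : {0..T}" "x : US" for t x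
 proof -
  have "(%n. W (Suc n) t x) sums (v t x - W 0 t x)" using sums[OF that] by (subst sums_Suc_iff) simp
  hence "(%n. LBINT s:{0..t}. Lop s (W n s) x) sums (v t x - W 0 t x)" by simp
  from sums_unique2[OF this LIv[OF that]] show ?thesis by simp
 qed
 have "v 0 x = G x & prim T (%t. v t x) (%t. Lop t (v t) x + F t x)" if x: "x : US" for x
 proof -
  obtain CF where CF: "0 <= CF" "!!t. t : {0..T} ==> BU 0 CF (F t)" using S.SM_obtain[OF FU] by metis
  have "SU {0..T} (%t. Lop t (v t))" by (rule SU_Lop[OF SUv])
  then obtain CL where CL: "0 <= CL" "!!t. t : {0..T} ==> BU 0 CL (Lop t (v t))" using S.SM_obtain by metis
  have 1: "prim T (%t. G x + (LBINT s:{0..t}. F s x)) (%t. F t x)"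
   by (rule prim_LBINT[OF F_meas[OF x]]) (use CF x in auto)
  have 2: "prim T (%t. 0 + (LBINT s:{0..t}. Lop s (v s) x)) (%t. Lop t (v t) x)"
   by (rule prim_LBINT[OF Lop_meas[OF v_meas x]]) (use CL x in auto)
  have v0: "v 0 x = G x" using v_eq[OF _ x, of 0] T0 by (simp add: LBINT_point)
  have "prim T (%t. v t x) (%t. F t x + Lop t (v t) x)"
   by (rule prim_cong[OF prim_add[OF 1 2]]) (use v_eq[OF _ x] in auto)
  thus ?thesis using v0 by (simp add: add.commute)
 qed
 thus ?thesis using SUv by blast
qed

end

end

section \<open>Derivatives of the difference operator in the mesh size\<close>

lemma sum_list_square_le:
 fixes f :: "'a => real"
 shows "(SUM z<-zs. f z)^2 <= real (length zs) * (SUM z<-zs. (f z)\<^sup>2)"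
proof -
 have "(SUM i:{0..<length zs}. 1 * f (zs ! i))^2 <= (SUM i:{0..<length zs}. 1\<^sup>2) * (SUM i:{0..<length zs}. (f (zs ! i))\<^sup>2)"
  by (rule Cauchy_Schwarz_ineq_sum)
 thus ?thesis by (simp add: sum_list_sum_nth)
qed

context domR
begin

lemma foldr_pd_sum:
 assumes "finite S" "!!l. l : S ==> SM E U I (a l)" "t : I"
 shows "x : U ==> set is \<subseteq> E ==> foldr pd is (%x. SUM l:S. a l t x) x = (SUM l:S. foldr pd is (a l t) x)"
proof (induction "is" arbitrary: x)
 case (Cons i "is")
 have i: "i : E" "set is \<subseteq> E" using Cons.prems by auto
 have "foldr pd (i # is) (%x. SUM l:S. a l t x) x = pd i (%x. SUM l:S. foldr pd is (a l t) x) x"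
  using pd_cong[OF Cons.IH[OF _ i(2)] Cons.prems(1) i(1)] by simp
 also have "... = (SUM l:S. pd i (foldr pd is (a l t)) x)"
  by (rule pd_sum[OF assms(1) SM_foldr[OF assms(2) i(2)] assms(3) Cons.prems(1) i(1)])
 finally show ?case by simp
qed simp

lemma foldr_pd_cmult:
 assumes "SM E U I a" "t : I"
 shows "x : U ==> set is \<subseteq> E ==> foldr pd is (%x. k * a t x) x = k * foldr pd is (a t) x"
proof (induction "is" arbitrary: x)
 case (Cons i "is")
 have i: "i : E" "set is \<subseteq> E" using Cons.prems by auto
 have "foldr pd (i # is) (%x. k * a t x) x = pd i (%x. k * foldr pd is (a t) x) x"
  using pd_cong[OF Cons.IH[OF _ i(2)] Cons.prems(1) i(1)] by simp
 also have "... = k * pd i (foldr pd is (a t)) x"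
  by (rule pd_cmult[OF SM_foldr[OF assms(1) i(2)] assms(2) Cons.prems(1) i(1)])
 finally show ?case by simp
qed simp

lemma foldr_pd_add:
 assumes "SM E U I a" "SM E U I b" "t : I"
 shows "x : U ==> set is \<subseteq> E ==> foldr pd is (%x. a t x + b t x) x = foldr pd is (a t) x + foldr pd is (b t) x"
proof (induction "is" arbitrary: x)
 case (Cons i "is")
 have i: "i : E" "set is \<subseteq> E" using Cons.prems by auto
 have "foldr pd (i # is) (%x. a t x + b t x) x = pd i (%x. foldr pd is (a t) x + foldr pd is (b t) x) x"
  using pd_cong[OF Cons.IH[OF _ i(2)] Cons.prems(1) i(1)] by simp
 also have "... = pd i (foldr pd is (a t)) x + pd i (foldr pd is (b t)) x"
  by (rule pd_add[OF SM_foldr[OF assms(1) i(2)] SM_foldr[OF assms(2) i(2)] assms(3) Cons.prems(1) i(1)])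
 finally show ?case by simp
qed simp

lemma foldr_pd_mult:
 assumes "SM E U I a" "SM E U I b" "t : I"
 shows "x : U ==> set is \<subseteq> E ==> foldr pd is (%x. a t x * b t x) x = (SUM (s, u)<-splits is. foldr pd s (a t) x * foldr pd u (b t) x)"
proof (induction "is" arbitrary: x)
 case (Cons i "is")
 have i: "i : E" "set is \<subseteq> E" using Cons.prems by auto
 let ?z = "%n. splits is ! n" and ?N = "{0..<length (splits is)}"
 let ?g = "%n t x. foldr pd (fst (?z n)) (a t) x * foldr pd (snd (?z n)) (b t) x"
 have su: "set (fst (?z n)) \<subseteq> E" "set (snd (?z n)) \<subseteq> E" if "n : ?N" for n
  using splits_sub[of "fst (?z n)" "snd (?z n)" "is"] that i by auto
 have S: "SM E U I (%t. foldr pd (fst (?z n)) (a t))" "SM E U I (%t. foldr pd (snd (?z n)) (b t))" if "n : ?N" for n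
  using SM_foldr[OF assms(1) su(1)[OF that]] SM_foldr[OF assms(2) su(2)[OF that]] .
 have "foldr pd (i # is) (%x. a t x * b t x) x = pd i (%x. SUM n:?N. ?g n t x) x"
  using pd_cong[OF Cons.IH[OF _ i(2)] Cons.prems(1) i(1)] by (simp add: sum_list_sum_nth case_prod_beta')
 also have "... = (SUM n:?N. pd i (?g n t) x)"
  by (rule pd_sum[OF _ SM_mult[OF S] assms(3) Cons.prems(1) i(1)]) auto
 also have "... = (SUM n:?N. pd i (foldr pd (fst (?z n)) (a t)) x * foldr pd (snd (?z n)) (b t) x
   + foldr pd (fst (?z n)) (a t) x * pd i (foldr pd (snd (?z n)) (b t)) x)"
  by (intro sum.cong refl pd_mult[OF S assms(3) Cons.prems(1) i(1)])
 also have "... = (SUM (s, u)<-splits (i # is). foldr pd s (a t) x * foldr pd u (b t) x)"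
 proof -
  have *: "(SUM n:?N. f (?z n)) = (SUM z<-splits is. f z)" for f :: "_ => real" by (simp add: sum_list_sum_nth)
  show ?thesis
   unfolding sum.distrib *[of "%z. pd i (foldr pd (fst z) (a t)) x * foldr pd (snd z) (b t) x"]
    *[of "%z. foldr pd (fst z) (a t) x * pd i (foldr pd (snd z) (b t)) x"]
   by (simp add: case_prod_beta' o_def)
 qed
 finally show ?case .
qed simp

end

context domR
begin

lemma nl_low: "is : nl {..<d} n ==> set is \<subseteq> E" using low by (auto simp: nl_def)

text \<open>Cauchy-Schwarz over l before the sums over lists keeps the number of directions out of
  the constant. One factor 2^r is the number of splits in the square of a Leibniz sum, the other is
  the sum of the binomial weights.\<close>

lemma D2_sum_mult:
 assumes fin: "finite S" and a: "!!l. l : S ==> SM E U I (a l)" and b: "!!l. l : S ==> SM E U I (b l)" and t: "t : I" and x: "x : U"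
  and A: "!!j. j <= r ==> (SUM l:S. D2 d j (a l t) x) <= A" and B: "!!j. j <= r ==> (SUM l:S. D2 d j (b l t) x) <= B"
 shows "D2 d r (%x. SUM l:S. a l t x * b l t x) x <= 4 ^ r * (A * B)"
proof -
 have A0: "0 <= A" using A[of 0] by (meson D2_nonneg order_trans sum_nonneg zero_le)
 let ?P = "%s u. SUM l:S. foldr pd s (a l t) x * foldr pd u (b l t) x"
 have e: "(foldr pd is (%x. SUM l:S. a l t x * b l t x) x)^2 <= 2 ^ r * (SUM (s, u)<-splits is. (?P s u)\<^sup>2)" if "is : nl {..<d} r" for "is"
 proof -
  note sub = nl_low[OF that]
  have "foldr pd is (%x. SUM l:S. a l t x * b l t x) x = (SUM l:S. SUM (s, u)<-splits is. foldr pd s (a l t) x * foldr pd u (b l t) x)"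
  proof -
   have "foldr pd is (%x. SUM l:S. a l t x * b l t x) x = (SUM l:S. foldr pd is (%x. a l t x * b l t x) x)"
    by (rule foldr_pd_sum[where a = "%l t x. a l t x * b l t x", OF fin _ t x sub]) (intro SM_mult a b)
   thus ?thesis using foldr_pd_mult[OF a b t x sub] by simp
  qed
  also have "... = (SUM (s, u)<-splits is. ?P s u)"
   by (simp add: sum_list_sum_nth case_prod_beta' sum.swap[of _ S])
  finally show ?thesis
   using sum_list_square_le[of "%(s, u). ?P s u" "splits is"] that
   by (simp add: length_splits nl_def case_prod_beta')
 qed
 have "D2 d r (%x. SUM l:S. a l t x * b l t x) x <= (SUM is:nl {..<d} r. 2 ^ r * (SUM (s, u)<-splits is. (?P s u)\<^sup>2))"
  unfolding D2_def by (intro sum_mono e)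
 also have "... = 2 ^ r * (SUM j<=r. real (r choose j) * (SUM s:nl {..<d} j. SUM u:nl {..<d} (r - j). (?P s u)\<^sup>2))"
  unfolding sum_distrib_left[symmetric] sum_splits ..
 also have "... <= 2 ^ r * (SUM j<=r. real (r choose j) * (A * B))"
 proof (intro mult_left_mono sum_mono)
  fix j assume j: "j : {..r}"
  have "(SUM s:nl {..<d} j. SUM u:nl {..<d} (r - j). (?P s u)\<^sup>2)
   <= (SUM s:nl {..<d} j. SUM u:nl {..<d} (r - j). (SUM l:S. (foldr pd s (a l t) x)\<^sup>2) * (SUM l:S. (foldr pd u (b l t) x)\<^sup>2))"
   by (intro sum_mono Cauchy_Schwarz_ineq_sum)
  also have "... = (SUM s:nl {..<d} j. SUM l:S. (foldr pd s (a l t) x)\<^sup>2) * (SUM u:nl {..<d} (r - j). SUM l:S. (foldr pd u (b l t) x)\<^sup>2)"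
   by (simp only: sum_distrib_left[symmetric] sum_distrib_right[symmetric])
  also have "... = (SUM l:S. D2 d j (a l t) x) * (SUM l:S. D2 d (r - j) (b l t) x)"
   unfolding D2_def by (simp add: sum.swap[of _ S])
  also have "... <= A * B"
   using j by (intro mult_mono A B A0) (auto intro: sum_nonneg D2_nonneg)
  finally show "(SUM s:nl {..<d} j. SUM u:nl {..<d} (r - j). (?P s u)\<^sup>2) <= A * B" .
 qed auto
 also have "... = 2 ^ r * (2 ^ r * (A * B))"
  using choose_row_sum[of r] by (simp flip: sum_distrib_right of_nat_sum)
 also have "... = 4 ^ r * (A * B)" by (simp flip: power_mult_distrib)
 finally show ?thesis .
qed

lemma foldr_pd_Dl:
 assumes "SM E U I ph" "t : I" "x : U" "set is \<subseteq> E"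
 shows "foldr pd is (Dl d l (ph t)) x = Dl d l (foldr pd is (ph t)) x"
proof -
 have S: "SM E U I (%t. pd i (ph t))" if "i : {..<d}" for i using SM_pd[OF assms(1)] low that by simp
 have "foldr pd is (Dl d l (ph t)) x = (SUM i<d. foldr pd is (%x. l i * pd i (ph t) x) x)"
  unfolding Dl_def[abs_def] by (rule foldr_pd_sum[OF _ SM_cmult[OF S] assms(2-4)]) auto
 also have "... = (SUM i<d. l i * pd i (foldr pd is (ph t)) x)"
 proof (intro sum.cong refl)
  fix i assume i: "i : {..<d}"
  show "foldr pd is (%x. l i * pd i (ph t) x) x = l i * pd i (foldr pd is (ph t)) x"
   using foldr_pd_cmult[OF S[OF i] assms(2-4)] foldr_pd_commute1[OF assms(1-3) _ assms(4), of i] i low by simp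
 qed
 finally show ?thesis by (simp add: Dl_def)
qed

lemma SM_Dl: "SM E U I ph ==> SM E U I (%t. Dl d l (ph t))"
 unfolding Dl_def using low by (intro SM_sum SM_cmult SM_pd) auto

lemma SM_Dl_pow: "SM E U I ph ==> SM E U I (%t. (Dl d l ^^ n) (ph t))"
 by (induction n) (auto intro: SM_Dl)

lemma Dl_cong: "(!!x. x : U ==> ph x = ps x) ==> x : U ==> Dl d l ph x = Dl d l ps x"
 unfolding Dl_def using pd_cong[of ph ps x] low by (intro sum.cong refl) auto

lemma foldr_pd_Dl_pow:
 assumes "SM E U I ph" "t : I" "set is \<subseteq> E"
 shows "x : U ==> foldr pd is ((Dl d l ^^ n) (ph t)) x = (Dl d l ^^ n) (foldr pd is (ph t)) x"
proof (induction n arbitrary: x)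
 case (Suc n)
 have "foldr pd is ((Dl d l ^^ Suc n) (ph t)) x = Dl d l (foldr pd is ((Dl d l ^^ n) (ph t))) x"
  using foldr_pd_Dl[OF SM_Dl_pow[OF assms(1)] assms(2) Suc.prems assms(3)] by simp
 also have "... = Dl d l ((Dl d l ^^ n) (foldr pd is (ph t))) x" by (rule Dl_cong[OF Suc.IH Suc.prems])
 finally show ?case by simp
qed simp

lemma D2_Dl_pow:
 assumes "SM E U I ph" "t : I" "x : U"
 shows "D2 d r ((Dl d l ^^ n) (ph t)) x <= ((vnorm d l)\<^sup>2) ^ n * D2 d (r + n) (ph t) x"
proof (induction n arbitrary: r)
 case (Suc n)
 have "D2 d r ((Dl d l ^^ Suc n) (ph t)) x = (SUM is:nl {..<d} r. (Dl d l (foldr pd is ((Dl d l ^^ n) (ph t))) x)\<^sup>2)"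
  unfolding D2_def using foldr_pd_Dl[OF SM_Dl_pow[OF assms(1)] assms(2,3) nl_low] by simp
 also have "... <= (SUM is:nl {..<d} r. (vnorm d l)\<^sup>2 * (SUM i<d. (pd i (foldr pd is ((Dl d l ^^ n) (ph t))) x)\<^sup>2))"
  by (intro sum_mono Dl_sq)
 also have "... = (vnorm d l)^2 * D2 d (Suc r) ((Dl d l ^^ n) (ph t)) x" by (simp add: D2_Suc sum_distrib_left)
 also have "... <= (vnorm d l)^2 * (((vnorm d l)\<^sup>2) ^ n * D2 d (Suc r + n) (ph t) x)"
  by (intro mult_left_mono Suc.IH) simp
 finally show ?case by (simp add: mult_ac)
qed simp

lemma D2_cong: "(!!x. x : U ==> ph x = ps x) ==> x : U ==> D2 d n ph x = D2 d n ps x"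
 unfolding D2_def by (intro sum.cong refl) (use foldr_pd_cong[of ph ps] nl_low in metis)

lemma D2_add_le:
 assumes "SM E U I a" "SM E U I b" "t : I" "x : U"
 shows "D2 d n (%x. a t x + b t x) x <= 2 * D2 d n (a t) x + 2 * D2 d n (b t) x"
proof -
 have *: "(u + v)^2 <= 2 * u^2 + 2 * v^2" for u v :: real
  using zero_le_power2[of "u - v"] by (simp add: power2_sum power2_diff)
 have "D2 d n (%x. a t x + b t x) x = (SUM is:nl {..<d} n. (foldr pd is (a t) x + foldr pd is (b t) x)\<^sup>2)"
  unfolding D2_def using foldr_pd_add[OF assms nl_low] by simp
 also have "... <= (SUM is:nl {..<d} n. 2 * (foldr pd is (a t) x)^2 + 2 * (foldr pd is (b t) x)^2)"
  by (intro sum_mono *)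
 finally show ?thesis by (simp add: D2_def sum.distrib sum_distrib_left)
qed

lemma D2_cmult:
 assumes "SM E U I a" "t : I" "x : U"
 shows "D2 d n (%x. k * a t x) x = k^2 * D2 d n (a t) x"
 unfolding D2_def using foldr_pd_cmult[OF assms nl_low] by (simp add: power_mult_distrib sum_distrib_left)

end

section \<open>Averages over the segment from x to x + h\<lambda>\<close>

context slab
begin

text \<open>\<open>a\<close> is the order of the Taylor remainder: weight 1 for order one, weight 1
  - si for order two. Each derivative in h brings down a factor si, whence the power
  \<open>j\<close>.\<close>

definition om :: "nat => nat => real => real" where
 "om a j si = indicator {0..1} si * ((if a = 2 then 1 - si else 1) * si ^ j)"

lemma om_bound: "\<bar>om a j si\<bar> <= indicator {0..1} si"
proof (cases "si : {0..1}")
 case True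
 hence "\<bar>if a = 2 then 1 - si else 1\<bar> * \<bar>si ^ j\<bar> <= 1 * 1" by (intro mult_mono) (auto simp: power_le_one power_abs)
 thus ?thesis using True by (simp add: om_def abs_mult)
qed (simp add: om_def)

lemma om_meas [measurable]: "om a j : borel_measurable borel"
 unfolding om_def by measurable

definition scl :: "real => vec => vec" where "scl si l = (%i. si * l i)"

lemma Dl_scl: "Dl d (scl si l) ph x = si * Dl d l ph x"
 by (simp add: Dl_def scl_def sum_distrib_left mult.assoc)

lemma sg_scl: "sg (scl si l) ph x = ph (tr d (si * x d) l x)"
proof -
 have "tr d (x d) (scl si l) x = tr d (si * x d) l x" by (auto simp: scl_def tr_def)
 thus ?thesis by (simp add: sg_def)
qed

definition IJ :: "nat => nat => vec => (vec => real) => vec => real" where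
 "IJ a j l ps x = (\<integral>si. om a j si * sg (scl si l) ps x \<partial>lborel)"

lemma sg_scl_meas:
 assumes "SU I ps" "t : I" "x : US"
 shows "(%si. sg (scl si l) (ps t) x) : borel_measurable borel"
proof -
 obtain C where "BU 2 C (ps t)" using SU_ex[OF assms(1,2)] by blast
 note D = S.DERIV_tr[OF this assms(3), of l]
 have "continuous_on UNIV (%s. ps t (tr d s l x))"
  by (rule continuous_at_imp_continuous_on) (use D DERIV_isCont in blast)
 hence "continuous_on UNIV ((%s. ps t (tr d s l x)) \<circ> (%si. si * x d))"
  by (intro continuous_on_compose continuous_intros) (auto intro: continuous_on_subset)
 thus ?thesis unfolding sg_scl by (intro borel_measurable_continuous_onI) (simp add: o_def)
qed

lemma IJ_BD:
 assumes ps: "SU I ps" and t: "t : I" and B: "BU N C (ps t)"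
 shows "!!si. BU N (indicator {0..1} si * ((1 + (SUM i<d. \<bar>l i\<bar>)) ^ N * C)) (%x. om a j si * sg (scl si l) (ps t) x)"
  and "integrable lborel (%si. indicator {0..1::real} si * ((1 + (SUM i<d. \<bar>l i\<bar>)) ^ N * C) :: real)"
  and "!!x. x : US ==> (%si. om a j si * sg (scl si l) (ps t) x) : borel_measurable lborel"
proof -
 have C0: "0 <= C" using S.BD_nonneg[OF B] .
 show "BU N (indicator {0..1} si * ((1 + (SUM i<d. \<bar>l i\<bar>)) ^ N * C)) (%x. om a j si * sg (scl si l) (ps t) x)" for si
 proof (cases "si : {0..1}")
  case True
  have le: "(1 + (SUM i<d. \<bar>scl si l i\<bar>)) ^ N * C <= (1 + (SUM i<d. \<bar>l i\<bar>)) ^ N * C"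
   using True C0 by (intro mult_right_mono power_mono add_left_mono sum_mono) (auto simp: scl_def abs_mult mult_left_le_one_le sum_nonneg)
  have "BU N (\<bar>om a j si\<bar> * ((1 + (SUM i<d. \<bar>scl si l i\<bar>)) ^ N * C)) (%x. om a j si * sg (scl si l) (ps t) x)"
   by (intro S.BD_cmult BU_sg SU_ex[OF ps t] B)
  moreover have "\<bar>om a j si\<bar> * ((1 + (SUM i<d. \<bar>scl si l i\<bar>)) ^ N * C) <= indicator {0..1} si * ((1 + (SUM i<d. \<bar>l i\<bar>)) ^ N * C)"
   using C0 by (intro mult_mono om_bound le) (auto intro!: mult_nonneg_nonneg simp: sum_nonneg add_nonneg_nonneg)
  ultimately show ?thesis by (rule S.BD_mono) simp
 next
  case False thus ?thesis using S.BD_const[of 0 0 N] by (simp add: om_def)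
 qed
 show "integrable lborel (%si. indicator {0..1::real} si * ((1 + (SUM i<d. \<bar>l i\<bar>)) ^ N * C) :: real)"
  by (intro integrable_mult_left integrable_real_indicator) (auto simp: emeasure_lborel_Icc_eq)
 show "(%si. om a j si * sg (scl si l) (ps t) x) : borel_measurable lborel" if "x : US" for x
  using sg_scl_meas[OF ps t that] by simp
qed

lemma BU_IJ:
 assumes ps: "SU I ps" and t: "t : I" and B: "BU N C (ps t)"
 shows "BU N ((1 + (SUM i<d. \<bar>l i\<bar>)) ^ N * C) (IJ a j l (ps t))"
 using S.BD_integral(1)[OF IJ_BD[OF assms]] by (simp add: IJ_def[abs_def])

lemma SU_IJ: "SU I ps ==> SU I (%t. IJ a j l (ps t))"
 unfolding SM_def
proof (intro allI)
 fix N assume "ALL N. EX C. ALL t:I. BU N C (ps t)"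
 hence *: "SU I ps" unfolding SM_def .
 obtain C where "!!t. t : I ==> BU N C (ps t)" using S.SM_obtain[OF *] by metis
 thus "EX C. ALL t:I. BU N C (IJ a j l (ps t))" using BU_IJ[OF *] by blast
qed

lemma IJ_integrable:
 assumes ps: "SU I ps" and t: "t : I" and x: "x : US"
 shows "integrable lborel (%si. om a j si * sg (scl si l) (ps t) x)"
proof -
 obtain C where C: "BU 0 C (ps t)" using SU_ex[OF ps t] by blast
 note * = IJ_BD(1)[OF ps t C, where l = l and a = a and j = j] IJ_BD(2)[OF ps t C, where l = l]
  IJ_BD(3)[OF ps t C, where l = l and a = a and j = j]
 have "norm (om a j si * sg (scl si l) (ps t) x) <= norm (indicator {0..1} si * ((1 + (SUM i<d. \<bar>l i\<bar>)) ^ 0 * C) :: real)" for si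
  using S.BD_bound[OF *(1) x, of si] by simp
 thus ?thesis by (intro Bochner_Integration.integrable_bound[OF *(2) *(3)[OF x]] AE_I2)
qed

lemma IJ_cong: "(!!y. y : US ==> ph y = ps y) ==> x : US ==> IJ a j l ph x = IJ a j l ps x"
 unfolding IJ_def sg_def using S.tr_mem by simp

lemma pd_IJ:
 assumes ps: "SU I ps" and t: "t : I" and x: "x : US"
 shows "i ~= d ==> pd i (IJ a j l (ps t)) x = IJ a j l (pd i (ps t)) x"
  and "pd d (IJ a j l (ps t)) x = IJ a j l (pd d (ps t)) x + IJ a (Suc j) l (Dl d l (ps t)) x"
proof -
 obtain C where C: "BU (Suc 0) C (ps t)" using SU_ex[OF ps t] by blast
 have I: "pd i (IJ a j l (ps t)) x = (\<integral>si. pd i (%x. om a j si * sg (scl si l) (ps t) x) x \<partial>lborel)" for i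
  using S.BD_integral(2)[OF IJ_BD(1)[OF ps t C, where l = l and a = a and j = j] IJ_BD(2)[OF ps t C, where l = l] IJ_BD(3)[OF ps t C, where l = l and a = a and j = j], of "[i]" x] x by (simp add: IJ_def[abs_def])
 have c: "pd i (%x. om a j si * sg (scl si l) (ps t) x) x = om a j si * pd i (sg (scl si l) (ps t)) x" for i si
  using S.pd_cmult[OF SU_sg[OF ps] t x] by simp
 show "pd i (IJ a j l (ps t)) x = IJ a j l (pd i (ps t)) x" if "i ~= d"
  unfolding I c IJ_def using pd_sg_other[OF ps t x that] by simp
 have "om a j si * pd d (sg (scl si l) (ps t)) x = om a j si * sg (scl si l) (pd d (ps t)) x + om a (Suc j) si * sg (scl si l) (Dl d l (ps t)) x" for si
  unfolding pd_sg_d[OF ps t x] sg_def[of _ "Dl d (scl si l) _"] Dl_scl by (simp add: om_def sg_def algebra_simps)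
 thus "pd d (IJ a j l (ps t)) x = IJ a j l (pd d (ps t)) x + IJ a (Suc j) l (Dl d l (ps t)) x"
  unfolding I c IJ_def
  using Bochner_Integration.integral_add[OF IJ_integrable[OF S.SM_pd[OF ps, where i = d] t x, where a = a and j = j and l = l] IJ_integrable[OF SU_Dl[OF ps, where l = l] t x, where a = a and j = "Suc j" and l = l]] by simp
qed

lemma foldr_pd_IJ:
 assumes ps: "SU I ps" and t: "t : I"
 shows "x : US ==> set is \<subseteq> {..<d} ==> foldr pd is (IJ a j l (ps t)) x = IJ a j l (foldr pd is (ps t)) x"
proof (induction "is" arbitrary: x)
 case (Cons i "is")
 have i: "i < d" "set is \<subseteq> {..<d}" using Cons.prems by auto
 have "foldr pd (i # is) (IJ a j l (ps t)) x = pd i (IJ a j l (foldr pd is (ps t))) x"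
  using S.pd_cong[OF Cons.IH[OF _ i(2)] Cons.prems(1)] by simp
 also have "... = IJ a j l (pd i (foldr pd is (ps t))) x"
  by (rule pd_IJ(1)[OF S.SM_foldr[OF ps] t Cons.prems(1)]) (use i in auto)
 finally show ?case by simp
qed simp

lemma D2_IJ:
 assumes ps: "SU I ps" and t: "t : I" and x: "x : US" and S: "!!s. D2 d r (ps t) (tr d s l x) <= B"
 shows "D2 d r (IJ a j l (ps t)) x <= B"
proof -
 have B0: "0 <= B" using S[of 0] D2_nonneg order_trans by blast
 let ?w = "indicat_real {0..1::real}"
 have w: "integrable lborel ?w" by (intro integrable_real_indicator) (auto simp: emeasure_lborel_Icc_eq)
 have "D2 d r (IJ a j l (ps t)) x = (SUM is:nl {..<d} r. (\<integral>si. ?w si * (om a j si * sg (scl si l) (foldr pd is (ps t)) x) \<partial>lborel)\<^sup>2)"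
  unfolding D2_def
  by (intro sum.cong refl) (use foldr_pd_IJ[OF ps t x] in "simp add: nl_def IJ_def om_def mult.assoc[symmetric] flip: indicator_inter_arith")
 also have "... <= (\<integral>si. ?w si \<partial>lborel)^2 * B"
 proof (rule integral_family_bound[OF finite_nl w _ B0])
  show "integrable lborel (%si. ?w si * (om a j si * sg (scl si l) (foldr pd is (ps t)) x))" if "is : nl {..<d} r" for "is"
  proof -
   have "integrable lborel (%si. om a j si * sg (scl si l) (foldr pd is (ps t)) x)"
    by (rule IJ_integrable[OF S.SM_foldr[OF ps] t x]) simp
   thus ?thesis by (simp add: om_def mult.assoc[symmetric] flip: indicator_inter_arith)
  qed
  show "AE si in lborel. (SUM is:nl {..<d} r. (om a j si * sg (scl si l) (foldr pd is (ps t)) x)\<^sup>2) <= B"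
  proof (rule AE_I2)
   fix si :: real
   have "\<bar>om a j si\<bar> <= 1" by (rule order_trans[OF om_bound]) simp
   hence o: "(om a j si)^2 <= 1" by (simp add: abs_square_le_1)
   have "(SUM is:nl {..<d} r. (om a j si * sg (scl si l) (foldr pd is (ps t)) x)\<^sup>2) = (om a j si)^2 * D2 d r (ps t) (tr d (si * x d) l x)"
    by (simp add: D2_def sg_scl power_mult_distrib sum_distrib_left)
   also have "... <= 1 * B" by (intro mult_mono o S D2_nonneg) auto
   finally show "(SUM is:nl {..<d} r. (om a j si * sg (scl si l) (foldr pd is (ps t)) x)\<^sup>2) <= B" by simp
  qed
 qed auto
 finally show ?thesis by simp
qed

definition omI :: "nat => nat => real" where "omI a j = (\<integral>si. om a j si \<partial>lborel)"

text \<open>Replacing the average by its total weight times the value at the end point x gains a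
  factor h for one more x-derivative. When the symmetric sum of these end point values vanishes, the
  whole sum inherits the gain.\<close>

lemma D2_IJ_diff:
 assumes ps: "SU I ps" and t: "t : I" and x: "x : US" and S: "!!s. D2 d (Suc r) (ps t) (tr d s l x) <= B"
 shows "D2 d r (%x. IJ a j l (ps t) x - omI a j * ps t x) x <= (x d)^2 * (vnorm d l)^2 * B"
proof -
 have B0: "0 <= B" using S[of 0] D2_nonneg order_trans by blast
 let ?w = "indicat_real {0..1::real}"
 have w: "integrable lborel ?w" by (intro integrable_real_indicator) (auto simp: emeasure_lborel_Icc_eq)
 have omi: "integrable lborel (om a j)"
  by (rule Bochner_Integration.integrable_bound[OF w]) (use om_bound[of a j] in auto)
 have i: "integrable lborel (%si. om a j si * sg (scl si l) (foldr pd is (ps t)) x)" for "is"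
  by (rule IJ_integrable[OF S.SM_foldr[OF ps] t x]) simp
 have e: "foldr pd is (%x. IJ a j l (ps t) x - omI a j * ps t x) x = (\<integral>si. ?w si * (om a j si * (sg (scl si l) (foldr pd is (ps t)) x - foldr pd is (ps t) x)) \<partial>lborel)"
  if "set is \<subseteq> {..<d}" for "is"
 proof -
  have "foldr pd is (%x. IJ a j l (ps t) x - omI a j * ps t x) x = foldr pd is (%x. IJ a j l (ps t) x + (- omI a j) * ps t x) x" by simp
  also have "... = IJ a j l (foldr pd is (ps t)) x + (- omI a j) * foldr pd is (ps t) x"
   using S.foldr_pd_add[OF SU_IJ[OF ps, where a = a and j = j and l = l] S.SM_cmult[OF ps, where k = "- omI a j"] t x, of "is"] S.foldr_pd_cmult[OF ps t x, of "is" "- omI a j"]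
    foldr_pd_IJ[OF ps t x that] by simp
  also have "... = (\<integral>si. om a j si * sg (scl si l) (foldr pd is (ps t)) x - om a j si * foldr pd is (ps t) x \<partial>lborel)"
   using i[of "is"] omi by (simp add: IJ_def omI_def)
  also have "... = (\<integral>si. ?w si * (om a j si * (sg (scl si l) (foldr pd is (ps t)) x - foldr pd is (ps t) x)) \<partial>lborel)"
   by (intro Bochner_Integration.integral_cong refl) (auto simp: om_def algebra_simps indicator_def)
  finally show ?thesis .
 qed
 have "D2 d r (%x. IJ a j l (ps t) x - omI a j * ps t x) x
  = (SUM is:nl {..<d} r. (\<integral>si. ?w si * (om a j si * (sg (scl si l) (foldr pd is (ps t)) x - foldr pd is (ps t) x)) \<partial>lborel)\<^sup>2)"
  unfolding D2_def by (intro sum.cong refl) (use e in "auto simp: nl_def")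
 also have "... <= (\<integral>si. ?w si \<partial>lborel)^2 * ((x d)^2 * (vnorm d l)^2 * B)"
 proof (rule integral_family_bound[OF finite_nl w])
  show "integrable lborel (%si. ?w si * (om a j si * (sg (scl si l) (foldr pd is (ps t)) x - foldr pd is (ps t) x)))" for "is"
  proof -
   have "integrable lborel (%si. om a j si * sg (scl si l) (foldr pd is (ps t)) x - om a j si * foldr pd is (ps t) x)"
    using i omi by simp
   moreover have "(%si. om a j si * sg (scl si l) (foldr pd is (ps t)) x - om a j si * foldr pd is (ps t) x)
    = (%si. ?w si * (om a j si * (sg (scl si l) (foldr pd is (ps t)) x - foldr pd is (ps t) x)))"
    by (auto simp: om_def algebra_simps indicator_def)
   ultimately show ?thesis by simp
  qed
  show "AE si in lborel. (SUM is:nl {..<d} r. (om a j si * (sg (scl si l) (foldr pd is (ps t)) x - foldr pd is (ps t) x))\<^sup>2) <= (x d)^2 * (vnorm d l)^2 * B"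
  proof (rule AE_I2)
   fix si :: real
   show "(SUM is:nl {..<d} r. (om a j si * (sg (scl si l) (foldr pd is (ps t)) x - foldr pd is (ps t) x))\<^sup>2) <= (x d)^2 * (vnorm d l)^2 * B"
   proof (cases "si : {0..1}")
    case True
    have "\<bar>om a j si\<bar> <= 1" by (rule order_trans[OF om_bound]) simp
    hence o: "(om a j si)^2 <= 1" by (simp add: abs_square_le_1)
    have th: "si^2 <= 1" using True by (simp add: power_le_one)
    obtain C where C: "!!is. BU 2 (C is) (foldr pd is (ps t))" using SU_ex[OF S.SM_foldr[OF ps] t, of _ 2] by (metis subset_UNIV)
    have "(SUM is:nl {..<d} r. (om a j si * (sg (scl si l) (foldr pd is (ps t)) x - foldr pd is (ps t) x))\<^sup>2)
     = (om a j si)^2 * (SUM is:nl {..<d} r. (foldr pd is (ps t) (tr d (si * x d) l x) - foldr pd is (ps t) x)\<^sup>2)"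
     by (simp add: sg_scl power_mult_distrib sum_distrib_left)
    also have "... <= 1 * ((si * x d)^2 * (vnorm d l)^2 * B)"
     by (intro mult_mono o S.diff_family_bound[OF _ C x]) (use S finite_nl in "auto simp: D2_Suc sum_nonneg")
    also have "... = si^2 * ((x d)^2 * (vnorm d l)^2 * B)" by (simp add: power_mult_distrib mult.assoc)
    also have "... <= 1 * ((x d)^2 * (vnorm d l)^2 * B)" using B0 by (intro mult_right_mono th) auto
    finally show ?thesis by simp
   next
    case False thus ?thesis using B0 by (simp add: om_def)
   qed
  qed
 qed (use B0 in auto)
 finally show ?thesis by simp
qed

end

lemma sum_power_le:
 fixes a :: "'a => real"
 assumes "finite S" "!!l. l : S ==> 0 <= a l"
 shows "(SUM l:S. a l ^ Suc p) <= (SUM l:S. a l) ^ Suc p"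
proof -
 have "(SUM l:S. a l ^ Suc p) <= (SUM l:S. a l * (SUM l:S. a l) ^ p)"
  unfolding power_Suc by (intro sum_mono mult_left_mono power_mono member_le_sum assms) (use assms in auto)
 thus ?thesis by (simp add: sum_distrib_right)
qed

section \<open>Symmetric coefficients and the Taylor form of L_h\<close>

locale slab_sym = slab_scheme d et H La q p c T
 for d et H La q p c T +
 fixes nL Mb :: real and m :: nat
 assumes L1: "La \<subseteq> Rd d" and L1_sym: "vneg d ` La = La"
  and q_sym: "l : La ==> t : {0..T} ==> x : US ==> q (vneg d l) t x = q l t x"
  and p_sym: "l : La ==> t : {0..T} ==> x : US ==> p (vneg d l) t x = - p l t x"
  and q_inv: "q l t (x(d := r)) = q l t x" and p_inv: "p l t (x(d := r)) = p l t x" and c_inv: "c t (x(d := r)) = c t x"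
  and nL: "(SUM l:La. (vnorm d l)\<^sup>2) = nL^2"
  and coefU: "k <= m ==> t : {0..T} ==> x : US ==> (SUM l:La. D2 d k (q l t) x) <= Mb & (SUM l:La. D2 d k (p l t) x) <= Mb"
begin

lemma Mb0: "0 <= Mb"
proof -
 obtain x where "x : US" using S.U_ne by blast
 hence "(SUM l:La. D2 d 0 (q l 0) x) <= Mb" using coefU[of 0 0 x] T0 by simp
 thus ?thesis by (meson D2_nonneg order_trans sum_nonneg)
qed

abbreviation "Dn l n \<equiv> Dl d l ^^ n"

lemma Dl_vneg: "Dl d (vneg d l) ph x = - Dl d l ph x"
 by (simp add: Dl_def vneg_def sum_negf)

lemma Dn_vneg:
 assumes "SU I ph" "t : I"
 shows "x : US ==> Dn (vneg d l) n (ph t) x = (-1) ^ n * Dn l n (ph t) x"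
proof (induction n arbitrary: x)
 case (Suc n)
 have "Dn (vneg d l) (Suc n) (ph t) x = - Dl d l (Dn (vneg d l) n (ph t)) x" by (simp add: Dl_vneg)
 also have "Dl d l (Dn (vneg d l) n (ph t)) x = Dl d l (%x. (-1) ^ n * Dn l n (ph t) x) x"
  by (rule S.Dl_cong[OF Suc.IH Suc.prems])
 also have "... = (-1) ^ n * Dl d l (Dn l n (ph t)) x"
  unfolding Dl_def[of d l "%x. (-1) ^ n * Dn l n (ph t) x"] Dl_def[of d l "Dn l n (ph t)"] sum_distrib_left
  by (intro sum.cong refl) (simp add: S.pd_cmult[OF S.SM_Dl_pow[OF assms(1)] assms(2) Suc.prems])
 finally show ?case by simp
qed simp

text \<open>The reflection of l changes the sign of an odd number of derivatives along l and leaves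
  q unchanged; for p, which is odd, the parity is reversed.\<close>

lemma sym_sum_q:
 assumes "SU {0..T} ph" "t : {0..T}" "x : US" "odd n"
 shows "(SUM l:La. q l t x * Dn l n (ph t) x) = 0"
proof -
 have "(SUM l:La. q l t x * Dn l n (ph t) x) = (SUM l:La. q (vneg d l) t x * Dn (vneg d l) n (ph t) x)"
  by (rule sum_vneg[OF L1_sym L1, symmetric])
 also have "... = (SUM l:La. - (q l t x * Dn l n (ph t) x))"
  using q_sym[OF _ assms(2,3)] Dn_vneg[OF assms(1-3)] assms(4) by (intro sum.cong refl) simp
 finally show ?thesis by (simp add: sum_negf)
qed

lemma sym_sum_p:
 assumes "SU {0..T} ph" "t : {0..T}" "x : US" "even n"
 shows "(SUM l:La. p l t x * Dn l n (ph t) x) = 0"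
proof -
 have "(SUM l:La. p l t x * Dn l n (ph t) x) = (SUM l:La. p (vneg d l) t x * Dn (vneg d l) n (ph t) x)"
  by (rule sum_vneg[OF L1_sym L1, symmetric])
 also have "... = (SUM l:La. - (p l t x * Dn l n (ph t) x))"
  using p_sym[OF _ assms(2,3)] Dn_vneg[OF assms(1-3)] assms(4) by (intro sum.cong refl) simp
 finally show ?thesis by (simp add: sum_negf)
qed

definition EQ :: "nat => real => (vec => real) => vec => real" where
 "EQ j t ph x = (SUM l:La. q l t x * IJ 2 j l (Dn l (j + 2) ph) x)"

definition EP :: "nat => real => (vec => real) => vec => real" where
 "EP j t ph x = (SUM l:La. p l t x * IJ 1 j l (Dn l (j + 1) ph) x)"

text \<open>\<open>Ej j\<close> is the \<open>j\<close>-th derivative of \<open>L\<^sub>h\<close> with respect to \<open>h\<close>, written through Taylor's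
  formula with integral remainder so that no negative powers of \<open>h\<close> occur.\<close>

definition Ej :: "nat => real => (vec => real) => vec => real" where
 "Ej j t ph x = EQ j t ph x + EP j t ph x + (if j = 0 then - c t x * ph x else 0)"

lemma SU_EQ: "SU {0..T} ph ==> SU {0..T} (%t. EQ j t (ph t))"
 unfolding EQ_def by (intro S.SM_sum fin S.SM_mult qU SU_IJ S.SM_Dl_pow)

lemma SU_EP: "SU {0..T} ph ==> SU {0..T} (%t. EP j t (ph t))"
 unfolding EP_def by (intro S.SM_sum fin S.SM_mult pU SU_IJ S.SM_Dl_pow)

lemma SU_c0: "SU {0..T} ph ==> SU {0..T} (%t x. if (j::nat) = 0 then - c t x * ph t x else 0)"
 using S.SM_mult[OF S.SM_cmult[OF cU, of "-1"]] S.SM_const by (cases "j = 0") auto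

lemma SU_Ej: "SU {0..T} ph ==> SU {0..T} (%t. Ej j t (ph t))"
 unfolding Ej_def by (intro S.SM_add SU_EQ SU_EP SU_c0)

lemma US_pos: "x : US ==> 0 < x d" using et0 by (auto simp: US_def)

lemma taylor_IJ:
 assumes ph: "SU I ph" and t: "t : I" and x: "x : US"
 shows "IJ 1 0 l (Dn l 1 (ph t)) x = (sg l (ph t) x - ph t x) / x d"
  and "IJ 2 0 l (Dn l 2 (ph t)) x = (sg l (ph t) x - ph t x) / (x d)^2 - Dl d l (ph t) x / x d"
proof -
 have hp: "0 < x d" by (rule US_pos[OF x])
 have D: "((%si. ps t (tr d (si * x d) l x)) has_real_derivative Dl d l (ps t) (tr d (si * x d) l x) * x d) (at si)"
  if ps: "SU I ps" for ps si
 proof -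
  obtain C where "BU 2 C (ps t)" using SU_ex[OF ps t] by blast
  from S.DERIV_tr[OF this x, of l "si * x d"]
  have "((%s. ps t (tr d s l x)) has_real_derivative Dl d l (ps t) (tr d (si * x d) l x)) (at (si * x d))" .
  moreover have "((%si. si * x d) has_real_derivative x d) (at si)" by (auto intro!: derivative_eq_intros)
  ultimately show ?thesis by (rule DERIV_chain2)
 qed
 have S1: "SU I (%t. Dl d l (ph t))" and S2: "SU I (%t. Dl d l (Dl d l (ph t)))"
  using SU_Dl[OF ph] SU_Dl[OF SU_Dl[OF ph]] .
 have c: "isCont (%si. ps t (tr d (si * x d) l x)) si" if "SU I ps" for ps si using D[OF that] DERIV_isCont by blast
 have tr: "tr d (1 * x d) l x = tr d (x d) l x" "tr d (0 * x d) l x = x" by (simp_all add: S.tr_0)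
 have "IJ 1 0 l (Dn l 1 (ph t)) x = (\<integral>si. Dl d l (ph t) (tr d (si * x d) l x) * indicator {0..1} si \<partial>lborel)"
  unfolding IJ_def sg_scl om_def by (intro Bochner_Integration.integral_cong refl) simp
 also have "... = ph t (tr d (1 * x d) l x) / x d - ph t (tr d (0 * x d) l x) / x d"
 proof (rule integral_FTC_Icc_real)
  show "((%si. ph t (tr d (si * x d) l x) / x d) has_real_derivative Dl d l (ph t) (tr d (si * x d) l x)) (at si)" for si
   using DERIV_cdivide[OF D[OF ph, of si], of "x d"] hp by simp
 qed (use c[OF S1] in auto)
 finally show "IJ 1 0 l (Dn l 1 (ph t)) x = (sg l (ph t) x - ph t x) / x d" by (simp add: sg_def S.tr_0 diff_divide_distrib)
 have "IJ 2 0 l (Dn l 2 (ph t)) x = (\<integral>si. ((1 - si) * Dl d l (Dl d l (ph t)) (tr d (si * x d) l x)) * indicator {0..1} si \<partial>lborel)"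
  unfolding IJ_def sg_scl om_def by (intro Bochner_Integration.integral_cong refl) (simp add: numeral_2_eq_2)
 \<comment> \<open>Integration by parts in the second order remainder, written out as an explicit
   antiderivative.\<close>
 also have "... = (%si. (1 - si) * Dl d l (ph t) (tr d (si * x d) l x) / x d + ph t (tr d (si * x d) l x) / (x d)^2) 1
   - (%si. (1 - si) * Dl d l (ph t) (tr d (si * x d) l x) / x d + ph t (tr d (si * x d) l x) / (x d)^2) 0"
 proof (rule integral_FTC_Icc_real)
  show "((%si. (1 - si) * Dl d l (ph t) (tr d (si * x d) l x) / x d + ph t (tr d (si * x d) l x) / (x d)^2)
   has_real_derivative (1 - si) * Dl d l (Dl d l (ph t)) (tr d (si * x d) l x)) (at si)" for si
  proof -
   have "((%si. 1 - si) has_real_derivative -1) (at si)" by (auto intro!: derivative_eq_intros)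
   note DERIV_add[OF DERIV_cdivide[OF DERIV_mult[OF this D[OF S1, of si]], of "x d"] DERIV_cdivide[OF D[OF ph, of si], of "(x d)^2"]]
   thus ?thesis by (rule DERIV_cong) (use hp in "simp add: field_simps power2_eq_square")
  qed
  show "isCont (%si. (1 - si) * Dl d l (Dl d l (ph t)) (tr d (si * x d) l x)) si" for si
   by (intro continuous_intros c[OF S2])
 qed simp
 finally show "IJ 2 0 l (Dn l 2 (ph t)) x = (sg l (ph t) x - ph t x) / (x d)^2 - Dl d l (ph t) x / x d"
  by (simp add: sg_def S.tr_0 diff_divide_distrib)
qed

text \<open>The first order Taylor term of the q part carries a factor 1/h that no remainder
  compensates; it vanishes because the sum of the q-weighted first derivatives along the directions
  is zero by symmetry.\<close>

lemma Lop_Ej: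
 assumes ph: "SU {0..T} ph" and t: "t : {0..T}" and x: "x : US"
 shows "Lop t (ph t) x = Ej 0 t (ph t) x"
proof -
 have hp: "0 < x d" by (rule US_pos[OF x])
 have "EQ 0 t (ph t) x = (SUM l:La. q l t x * ((sg l (ph t) x - ph t x) / (x d)^2 - Dl d l (ph t) x / x d))"
  unfolding EQ_def add_0 taylor_IJ(2)[OF ph t x] ..
 also have "... = (SUM l:La. q l t x * ((sg l (ph t) x - ph t x) / (x d)^2)) - (SUM l:La. q l t x * Dl d l (ph t) x) / x d"
  by (simp add: right_diff_distrib sum_subtractf sum_divide_distrib)
 also have "(SUM l:La. q l t x * Dl d l (ph t) x) = 0" using sym_sum_q[OF ph t x, of 1] by simp
 finally have 1: "EQ 0 t (ph t) x = (SUM l:La. q l t x * ((sg l (ph t) x - ph t x) / (x d)^2))" by simp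
 have 2: "EP 0 t (ph t) x = (SUM l:La. p l t x * ((sg l (ph t) x - ph t x) / x d))"
  unfolding EP_def add_0 taylor_IJ(1)[OF ph t x] ..
 show ?thesis unfolding Ej_def 1 2 Lop_def al_def
  using hp by (simp add: distrib_right sum.distrib power2_eq_square)
qed

lemma pd_inv0: "(!!r. a (x(d := r)) = a x) ==> pd d a x = 0"
 by (rule S.pd_eqI) simp

lemma pd_Ej:
 assumes ph: "SU {0..T} ph" and t: "t : {0..T}" and x: "x : US"
 shows "pd d (Ej j t (ph t)) x = Ej j t (pd d (ph t)) x + Ej (Suc j) t (ph t) x"
proof -
 have Dc: "pd d (Dn l n (ph t)) y = Dn l n (pd d (ph t)) y" if "y : US" for l n y
  using S.foldr_pd_Dl_pow[OF ph t, of "[d]" y n l] that by simp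
 have I: "pd d (IJ a j l (Dn l (j + k) (ph t))) x = IJ a j l (Dn l (j + k) (pd d (ph t))) x + IJ a (Suc j) l (Dn l (Suc j + k) (ph t)) x" for a k l
 proof -
  have "IJ a j l (pd d (Dn l (j + k) (ph t))) x = IJ a j l (Dn l (j + k) (pd d (ph t))) x" by (rule IJ_cong[OF Dc x])
  thus ?thesis using pd_IJ(2)[OF S.SM_Dl_pow[OF ph, where l = l and n = "j + k"] t x, where a = a and j = j and l = l] by simp
 qed
 have Q: "pd d (EQ j t (ph t)) x = EQ j t (pd d (ph t)) x + EQ (Suc j) t (ph t) x"
 proof -
  have S: "SU {0..T} (%t. IJ 2 j l (Dn l (j + 2) (ph t)))" for l by (intro SU_IJ S.SM_Dl_pow ph)
  have "pd d (EQ j t (ph t)) x = (SUM l:La. pd d (%x. q l t x * IJ 2 j l (Dn l (j + 2) (ph t)) x) x)"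
   unfolding EQ_def[abs_def] by (rule S.pd_sum[OF fin S.SM_mult[OF qU S] t x]) auto
  also have "... = (SUM l:La. q l t x * (IJ 2 j l (Dn l (j + 2) (pd d (ph t))) x + IJ 2 (Suc j) l (Dn l (Suc j + 2) (ph t)) x))"
  proof (intro sum.cong refl)
   fix l assume l: "l : La"
   show "pd d (%x. q l t x * IJ 2 j l (Dn l (j + 2) (ph t)) x) x = q l t x * (IJ 2 j l (Dn l (j + 2) (pd d (ph t))) x + IJ 2 (Suc j) l (Dn l (Suc j + 2) (ph t)) x)"
    using S.pd_mult[OF qU[OF l] S[of l] t x, of d] pd_inv0[of "q l t" x] q_inv I[of 2 l 2] by simp
  qed
  finally show ?thesis by (simp add: EQ_def distrib_left sum.distrib)
 qed
 have P: "pd d (EP j t (ph t)) x = EP j t (pd d (ph t)) x + EP (Suc j) t (ph t) x"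
 proof -
  have S: "SU {0..T} (%t. IJ 1 j l (Dn l (j + 1) (ph t)))" for l by (intro SU_IJ S.SM_Dl_pow ph)
  have "pd d (EP j t (ph t)) x = (SUM l:La. pd d (%x. p l t x * IJ 1 j l (Dn l (j + 1) (ph t)) x) x)"
   unfolding EP_def[abs_def] by (rule S.pd_sum[OF fin S.SM_mult[OF pU S] t x]) auto
  also have "... = (SUM l:La. p l t x * (IJ 1 j l (Dn l (j + 1) (pd d (ph t))) x + IJ 1 (Suc j) l (Dn l (Suc j + 1) (ph t)) x))"
  proof (intro sum.cong refl)
   fix l assume l: "l : La"
   show "pd d (%x. p l t x * IJ 1 j l (Dn l (j + 1) (ph t)) x) x = p l t x * (IJ 1 j l (Dn l (j + 1) (pd d (ph t))) x + IJ 1 (Suc j) l (Dn l (Suc j + 1) (ph t)) x)"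
    using S.pd_mult[OF pU[OF l] S[of l] t x, of d] pd_inv0[of "p l t" x] p_inv I[of 1 l 1] by simp
  qed
  finally show ?thesis by (simp add: EP_def distrib_left sum.distrib)
 qed
 have Cc: "pd d (%x. if j = 0 then - c t x * ph t x else 0) x = (if j = 0 then - c t x * pd d (ph t) x else 0)"
 proof (cases "j = 0")
  case True
  have "pd d (%x. - c t x) x = 0" by (rule pd_inv0) (simp add: c_inv)
  thus ?thesis using True S.pd_mult[OF S.SM_cmult[OF cU, of "-1"] ph t x, of d] by simp
 next
  case False thus ?thesis using S.pd_eqI[of "%_. 0" x d 0] by simp
 qed
 have "pd d (Ej j t (ph t)) x = pd d (EQ j t (ph t)) x + pd d (EP j t (ph t)) x + pd d (%x. if j = 0 then - c t x * ph t x else 0) x"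
  unfolding Ej_def[abs_def]
  using S.pd_add[OF S.SM_add[OF SU_EQ[OF ph, where j = j] SU_EP[OF ph, where j = j]] SU_c0[OF ph, where j = j] t x, where i = d] S.pd_add[OF SU_EQ[OF ph, where j = j] SU_EP[OF ph, where j = j] t x, where i = d] by simp
 thus ?thesis unfolding Q P Cc by (simp add: Ej_def)
qed

lemma SU_pdd: "SU I ph ==> SU I (%t. (pd d ^^ n) (ph t))"
 by (induction n) (auto intro: S.SM_pd)

lemma pdd_cong: "(!!y. y : US ==> ph y = ps y) ==> x : US ==> (pd d ^^ n) ph x = (pd d ^^ n) ps x"
proof (induction n arbitrary: x)
 case (Suc n)
 have "pd d ((pd d ^^ n) ph) x = pd d ((pd d ^^ n) ps) x"
  by (rule S.pd_cong[OF Suc.IH[OF Suc.prems(1)] Suc.prems(2)]) auto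
 thus ?case by simp
qed simp

lemma pdd_Ej:
 assumes ph: "SU {0..T} ph" and t: "t : {0..T}"
 shows "x : US ==> (pd d ^^ k) (Ej 0 t (ph t)) x = (SUM j<=k. real (k choose j) * Ej j t ((pd d ^^ (k - j)) (ph t)) x)"
proof (induction k arbitrary: x)
 case (Suc k)
 let ?e = "%i n. Ej i t ((pd d ^^ n) (ph t)) x"
 have "(pd d ^^ Suc k) (Ej 0 t (ph t)) x = pd d (%x. SUM j<=k. real (k choose j) * Ej j t ((pd d ^^ (k - j)) (ph t)) x) x"
  using S.pd_cong[OF Suc.IH Suc.prems UNIV_I, where i = d] by simp
 also have "... = (SUM j<=k. pd d (%x. real (k choose j) * Ej j t ((pd d ^^ (k - j)) (ph t)) x) x)"
  by (rule S.pd_sum[OF _ S.SM_cmult[OF SU_Ej[OF SU_pdd[OF ph]]] t Suc.prems]) auto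
 also have "... = (SUM j<=k. real (k choose j) * (?e j (Suc k - j) + ?e (Suc j) (k - j)))"
 proof (intro sum.cong refl)
  fix j assume j: "j : {..k}"
  thus "pd d (%x. real (k choose j) * Ej j t ((pd d ^^ (k - j)) (ph t)) x) x = real (k choose j) * (?e j (Suc k - j) + ?e (Suc j) (k - j))"
   using S.pd_cmult[OF SU_Ej[OF SU_pdd[OF ph, where n = "k - j"], where j = j] t Suc.prems, where i = d and k = "real (k choose j)"] pd_Ej[OF SU_pdd[OF ph, where n = "k - j"] t Suc.prems, of j]
   by (simp add: Suc_diff_le)
 qed
 also have "... = (SUM j<=Suc k. real (Suc k choose j) * ?e j (Suc k - j))"
  unfolding pascal_sum[of k ?e] distrib_left sum.distrib by (rule add.commute)
 finally show ?case .
qed simp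

text \<open>Of the powers of 4, 4^r comes from the product estimate and one more factor from adding
  the q and p parts. The power of nL counts derivatives along the directions, of which at most j + 3
  occur.\<close>

definition cE :: real where "cE = 4 ^ (m + 2) * Mb * (1 + nL\<^sup>2) ^ (m + 3)"

lemma cE_nonneg: "0 <= cE" unfolding cE_def using Mb0 by simp

lemma nL_pow: "0 <= B ==> n <= m + 3 ==> 4 ^ r * (Mb * ((nL\<^sup>2) ^ n * B)) <= 4 ^ r * (Mb * (1 + nL\<^sup>2) ^ (m + 3) * B)"
proof -
 assume B: "0 <= B" and n: "n <= m + 3"
 have "(nL\<^sup>2) ^ n <= (1 + nL\<^sup>2) ^ n" by (intro power_mono) auto
 also have "... <= (1 + nL\<^sup>2) ^ (m + 3)" using n by (intro power_increasing) auto
 finally have "Mb * ((nL\<^sup>2) ^ n * B) <= Mb * ((1 + nL\<^sup>2) ^ (m + 3) * B)"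
  using B Mb0 by (intro mult_left_mono mult_right_mono) auto
 thus ?thesis by (simp add: mult.assoc)
qed

lemma sum_vnorm_pow: "(SUM l:La. ((vnorm d l)\<^sup>2) ^ Suc n * B) <= (nL\<^sup>2) ^ Suc n * B" if "0 <= B" for B
proof -
 have "(SUM l:La. ((vnorm d l)\<^sup>2) ^ Suc n) <= (nL\<^sup>2) ^ Suc n"
  using sum_power_le[OF fin, of "%l. (vnorm d l)\<^sup>2" n] by (simp add: nL)
 thus ?thesis unfolding sum_distrib_right[symmetric] using that by (intro mult_right_mono)
qed

text \<open>The premise on B concerns only points with the same coordinates from \<open>d\<close>
  on, in particular the same h: the averages move in x alone. So estimates that are available for
  one mesh size at a time suffice.\<close>

lemma D2_Ej_bound:
 assumes ph: "SU {0..T} ph" and t: "t : {0..T}" and x: "x : US" and r: "r <= m" and j: "1 <= j" "j <= m"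
  and B: "!!s y. s <= r + j + 2 ==> y : US ==> (!!i. d <= i ==> y i = x i) ==> D2 d s (ph t) y <= B"
 shows "D2 d r (Ej j t (ph t)) x <= cE * B"
proof -
 have B0: "0 <= B" using B[of 0 x] x D2_nonneg order_trans by blast
 have tb: "D2 d i (IJ a j l (Dn l n (ph t))) x <= ((vnorm d l)\<^sup>2) ^ n * B" if "i + n <= r + j + 2" for i a l n
 proof (rule D2_IJ[OF S.SM_Dl_pow[OF ph] t x])
  fix s
  have y: "tr d s l x : US" "!!i. d <= i ==> tr d s l x i = x i" using S.tr_mem[OF x] by (auto simp: tr_def)
  have "D2 d i (Dn l n (ph t)) (tr d s l x) <= ((vnorm d l)\<^sup>2) ^ n * D2 d (i + n) (ph t) (tr d s l x)"
   by (rule S.D2_Dl_pow[OF ph t y(1)])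
  also have "... <= ((vnorm d l)\<^sup>2) ^ n * B" by (intro mult_left_mono B that y) auto
  finally show "D2 d i (Dn l n (ph t)) (tr d s l x) <= ((vnorm d l)\<^sup>2) ^ n * B" .
 qed
 have "D2 d r (EQ j t (ph t)) x <= 4 ^ r * (Mb * ((nL\<^sup>2) ^ (j + 2) * B))"
  unfolding EQ_def[abs_def]
 proof (rule S.D2_sum_mult[OF fin qU SU_IJ[OF S.SM_Dl_pow[OF ph]] t x])
  show "(SUM l:La. D2 d i (q l t) x) <= Mb" if "i <= r" for i using coefU[of i t x] that r t x by simp
  show "(SUM l:La. D2 d i (IJ 2 j l (Dn l (j + 2) (ph t))) x) <= (nL\<^sup>2) ^ (j + 2) * B" if "i <= r" for i
   using sum_mono[OF tb[of i "j + 2" 2], of La "%l. l"] sum_vnorm_pow[OF B0, of "Suc j"] that by simp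
 qed auto
 also have "... <= 4 ^ r * (Mb * (1 + nL\<^sup>2) ^ (m + 3) * B)" using j by (intro nL_pow B0) auto
 finally have 1: "D2 d r (EQ j t (ph t)) x <= 4 ^ r * (Mb * (1 + nL\<^sup>2) ^ (m + 3) * B)" .
 have "D2 d r (EP j t (ph t)) x <= 4 ^ r * (Mb * ((nL\<^sup>2) ^ (j + 1) * B))"
  unfolding EP_def[abs_def]
 proof (rule S.D2_sum_mult[OF fin pU SU_IJ[OF S.SM_Dl_pow[OF ph]] t x])
  show "(SUM l:La. D2 d i (p l t) x) <= Mb" if "i <= r" for i using coefU[of i t x] that r t x by simp
  show "(SUM l:La. D2 d i (IJ 1 j l (Dn l (j + 1) (ph t))) x) <= (nL\<^sup>2) ^ (j + 1) * B" if "i <= r" for i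
   using sum_mono[OF tb[of i "j + 1" 1], of La "%l. l"] sum_vnorm_pow[OF B0, of j] that by simp
 qed auto
 also have "... <= 4 ^ r * (Mb * (1 + nL\<^sup>2) ^ (m + 3) * B)" using j by (intro nL_pow B0) auto
 finally have 2: "D2 d r (EP j t (ph t)) x <= 4 ^ r * (Mb * (1 + nL\<^sup>2) ^ (m + 3) * B)" .
 have "D2 d r (Ej j t (ph t)) x = D2 d r (%x. EQ j t (ph t) x + EP j t (ph t) x) x"
  using j by (simp add: Ej_def[abs_def])
 also have "... <= 2 * D2 d r (EQ j t (ph t)) x + 2 * D2 d r (EP j t (ph t)) x"
  by (rule S.D2_add_le[OF SU_EQ[OF ph] SU_EP[OF ph] t x])
 also have "... <= 4 * (4 ^ r * (Mb * (1 + nL\<^sup>2) ^ (m + 3) * B))" using 1 2 by simp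
 also have "... <= 4 ^ (m + 2) * (Mb * (1 + nL\<^sup>2) ^ (m + 3) * B)"
 proof -
  have "(4::real) * 4 ^ r <= 4 ^ (m + 2)" using r power_increasing[of "Suc r" "m + 2" "4::real"] by simp
  hence "4 * 4 ^ r * (Mb * (1 + nL\<^sup>2) ^ (m + 3) * B) <= 4 ^ (m + 2) * (Mb * (1 + nL\<^sup>2) ^ (m + 3) * B)"
   using B0 Mb0 by (intro mult_right_mono) auto
  thus ?thesis by (simp add: mult.assoc)
 qed
 finally show ?thesis by (simp add: cE_def mult.assoc)
qed

text \<open>For odd \<open>j\<close> the leading term cancels by the symmetry of the coefficients, which gains a factor \<open>h\<close>.\<close>

lemma D2_Ej_odd:
 assumes ph: "SU {0..T} ph" and t: "t : {0..T}" and x: "x : US" and r: "r <= m" and j: "odd j" "j <= m"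
  and B: "!!s y. s <= r + j + 3 ==> y : US ==> (!!i. d <= i ==> y i = x i) ==> D2 d s (ph t) y <= B"
 shows "D2 d r (Ej j t (ph t)) x <= cE * ((x d)^2 * B)"
proof -
 have B0: "0 <= B" using B[of 0 x] x D2_nonneg order_trans by blast
 have B1: "0 <= (x d)^2 * B" using B0 by simp
 let ?I = "%a n l t x. IJ a j l (Dn l n (ph t)) x - omI a j * Dn l n (ph t) x"
 have SI: "SU {0..T} (?I a n l)" for a n l
  by (intro S.SM_diff SU_IJ S.SM_cmult S.SM_Dl_pow ph)
 have tb: "D2 d i (?I a n l t) x <= ((vnorm d l)\<^sup>2) ^ Suc n * ((x d)^2 * B)" if "i + n <= r + j + 2" for i a l n
 proof -
  have "D2 d i (?I a n l t) x <= (x d)^2 * (vnorm d l)^2 * (((vnorm d l)\<^sup>2) ^ n * B)"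
  proof (rule D2_IJ_diff[OF S.SM_Dl_pow[OF ph] t x])
   fix s
   have y: "tr d s l x : US" "!!i. d <= i ==> tr d s l x i = x i" using S.tr_mem[OF x] by (auto simp: tr_def)
   have "D2 d (Suc i) (Dn l n (ph t)) (tr d s l x) <= ((vnorm d l)\<^sup>2) ^ n * D2 d (Suc i + n) (ph t) (tr d s l x)"
    by (rule S.D2_Dl_pow[OF ph t y(1)])
   also have "... <= ((vnorm d l)\<^sup>2) ^ n * B" by (intro mult_left_mono B y) (use that in auto)
   finally show "D2 d (Suc i) (Dn l n (ph t)) (tr d s l x) <= ((vnorm d l)\<^sup>2) ^ n * B" .
  qed
  thus ?thesis by (simp add: mult_ac)
 qed
 have eq: "Ej j t (ph t) y = (SUM l:La. q l t y * ?I 2 (j + 2) l t y) + (SUM l:La. p l t y * ?I 1 (j + 1) l t y)" if y: "y : US" for y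
 proof -
  have "(SUM l:La. q l t y * ?I 2 (j + 2) l t y) = EQ j t (ph t) y - omI 2 j * (SUM l:La. q l t y * Dn l (j + 2) (ph t) y)"
   by (simp add: EQ_def right_diff_distrib sum_subtractf sum_distrib_left mult_ac)
  moreover have "(SUM l:La. p l t y * ?I 1 (j + 1) l t y) = EP j t (ph t) y - omI 1 j * (SUM l:La. p l t y * Dn l (j + 1) (ph t) y)"
   by (simp add: EP_def right_diff_distrib sum_subtractf sum_distrib_left mult_ac)
  moreover have "(SUM l:La. q l t y * Dn l (j + 2) (ph t) y) = 0" by (rule sym_sum_q[OF ph t y]) (use j in simp)
  moreover have "(SUM l:La. p l t y * Dn l (j + 1) (ph t) y) = 0" by (rule sym_sum_p[OF ph t y]) (use j in simp)
  ultimately show ?thesis using j by (cases j) (simp_all add: Ej_def)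
 qed
 have SQ: "SU {0..T} (%t y. SUM l:La. q l t y * ?I 2 (j + 2) l t y)" by (intro S.SM_sum fin S.SM_mult qU SI)
 have SP: "SU {0..T} (%t y. SUM l:La. p l t y * ?I 1 (j + 1) l t y)" by (intro S.SM_sum fin S.SM_mult pU SI)
 have "D2 d r (%y. SUM l:La. q l t y * ?I 2 (j + 2) l t y) x <= 4 ^ r * (Mb * ((nL\<^sup>2) ^ (j + 3) * ((x d)^2 * B)))"
 proof (rule S.D2_sum_mult[OF fin qU SI t x])
  show "(SUM l:La. D2 d i (q l t) x) <= Mb" if "i <= r" for i using coefU[of i t x] that r t x by simp
  show "(SUM l:La. D2 d i (?I 2 (j + 2) l t) x) <= (nL\<^sup>2) ^ (j + 3) * ((x d)^2 * B)" if "i <= r" for i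
  proof -
   have "(SUM l:La. D2 d i (?I 2 (j + 2) l t) x) <= (SUM l:La. ((vnorm d l)\<^sup>2) ^ Suc (j + 2) * ((x d)^2 * B))"
    by (intro sum_mono tb) (use that in simp)
   also have "... <= (nL\<^sup>2) ^ Suc (j + 2) * ((x d)^2 * B)" by (rule sum_vnorm_pow[OF B1])
   finally show ?thesis by (simp add: eval_nat_numeral)
  qed
 qed auto
 also have "... <= 4 ^ r * (Mb * (1 + nL\<^sup>2) ^ (m + 3) * ((x d)^2 * B))" using j by (intro nL_pow B1) auto
 finally have 1: "D2 d r (%y. SUM l:La. q l t y * ?I 2 (j + 2) l t y) x <= 4 ^ r * (Mb * (1 + nL\<^sup>2) ^ (m + 3) * ((x d)^2 * B))" .
 have "D2 d r (%y. SUM l:La. p l t y * ?I 1 (j + 1) l t y) x <= 4 ^ r * (Mb * ((nL\<^sup>2) ^ (j + 2) * ((x d)^2 * B)))"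
 proof (rule S.D2_sum_mult[OF fin pU SI t x])
  show "(SUM l:La. D2 d i (p l t) x) <= Mb" if "i <= r" for i using coefU[of i t x] that r t x by simp
  show "(SUM l:La. D2 d i (?I 1 (j + 1) l t) x) <= (nL\<^sup>2) ^ (j + 2) * ((x d)^2 * B)" if "i <= r" for i
  proof -
   have "(SUM l:La. D2 d i (?I 1 (j + 1) l t) x) <= (SUM l:La. ((vnorm d l)\<^sup>2) ^ Suc (j + 1) * ((x d)^2 * B))"
    by (intro sum_mono tb) (use that in simp)
   also have "... <= (nL\<^sup>2) ^ Suc (j + 1) * ((x d)^2 * B)" by (rule sum_vnorm_pow[OF B1])
   finally show ?thesis by (simp add: eval_nat_numeral)
  qed
 qed auto
 also have "... <= 4 ^ r * (Mb * (1 + nL\<^sup>2) ^ (m + 3) * ((x d)^2 * B))" using j by (intro nL_pow B1) auto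
 finally have 2: "D2 d r (%y. SUM l:La. p l t y * ?I 1 (j + 1) l t y) x <= 4 ^ r * (Mb * (1 + nL\<^sup>2) ^ (m + 3) * ((x d)^2 * B))" .
 have "D2 d r (Ej j t (ph t)) x = D2 d r (%y. (SUM l:La. q l t y * ?I 2 (j + 2) l t y) + (SUM l:La. p l t y * ?I 1 (j + 1) l t y)) x"
  by (rule S.D2_cong[OF eq x])
 also have "... <= 2 * D2 d r (%y. SUM l:La. q l t y * ?I 2 (j + 2) l t y) x + 2 * D2 d r (%y. SUM l:La. p l t y * ?I 1 (j + 1) l t y) x"
  by (rule S.D2_add_le[OF SQ SP t x])
 also have "... <= 4 * (4 ^ r * (Mb * (1 + nL\<^sup>2) ^ (m + 3) * ((x d)^2 * B)))" using 1 2 by simp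
 also have "... <= 4 ^ (m + 2) * (Mb * (1 + nL\<^sup>2) ^ (m + 3) * ((x d)^2 * B))"
 proof -
  have "(4::real) * 4 ^ r <= 4 ^ (m + 2)" using r power_increasing[of "Suc r" "m + 2" "4::real"] by simp
  hence "4 * 4 ^ r * (Mb * (1 + nL\<^sup>2) ^ (m + 3) * ((x d)^2 * B)) <= 4 ^ (m + 2) * (Mb * (1 + nL\<^sup>2) ^ (m + 3) * ((x d)^2 * B))"
   using B1 Mb0 by (intro mult_right_mono) auto
  thus ?thesis by (simp add: mult.assoc)
 qed
 finally show ?thesis by (simp add: cE_def mult.assoc)
qed

text \<open>A bound on \<open>Ej 1\<close> that costs one derivative only, but degenerates as \<open>h \<rightarrow> 0\<close>.\<close>

definition cC :: real where
 "cC = (real (card La) * ((Mb + 1) * (1 + 1 / et) ^ 3 * (6 + 2 * \<bar>nL\<bar>)))^2"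

lemma E1_crude:
 assumes ph: "SU {0..T} ph" and t: "t : {0..T}" and x: "x : US"
  and B: "!!s y. s <= 1 ==> y : US ==> (!!i. d <= i ==> y i = x i) ==> D2 d s (ph t) y <= B"
 shows "(Ej 1 t (ph t) x)^2 <= cC * B"
proof -
 have hp: "0 < x d" by (rule US_pos[OF x])
 have B0: "0 <= B" using B[of 0 x] x D2_nonneg order_trans by blast
 let ?a = "%l. q l t x * (1 / x d)^2 + p l t x * (1 / x d)"
 let ?b = "%l. - 2 * q l t x * (1 / x d) ^ 3 - p l t x * (1 / x d)^2"
 have dal: "pd d (al l t) x = ?b l" for l
 proof (rule S.pd_eqI)
  have d: "((%s. 1 / s) has_real_derivative - ((1 / x d)^2)) (at (x d))"
   using hp by (auto intro!: derivative_eq_intros simp: power2_eq_square)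
  have "((%s. q l t x * (1 / s * (1 / s)) + p l t x * (1 / s)) has_real_derivative ?b l) (at (x d))"
   by (rule DERIV_cong[OF DERIV_add[OF DERIV_cmult[OF DERIV_mult[OF d d]] DERIV_cmult[OF d]]])
    (simp add: power2_eq_square power3_eq_cube mult_ac)
  thus "((%s. al l t (x(d := s))) has_real_derivative ?b l) (at (x d))" by (simp add: al_def q_inv p_inv)
 qed
 have S: "SU {0..T} (%t x. sg l (ph t) x - ph t x)" for l by (intro S.SM_diff SU_sg ph)
 have pS: "pd d (%x. sg l (ph t) x - ph t x) x = sg l (pd d (ph t)) x + sg l (Dl d l (ph t)) x - pd d (ph t) x" for l
  using S.pd_diff[OF SU_sg[OF ph, where l = l] ph t x, of d] pd_sg_d[OF ph t x] by simp
 have SL: "SU {0..T} (%t x. SUM l:La. al l t x * (sg l (ph t) x - ph t x))" by (intro S.SM_sum fin S.SM_mult alU S)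
 \<comment> \<open>\<open>Ej 1\<close> is the commutator of the h-derivative with
   \<open>Lop\<close>. It is computed here from the original form with explicit powers of 1/h, where
   only differences and one first derivative of the function appear, instead of the third
   derivatives in the Taylor form.\<close>
 have "pd d (Lop t (ph t)) x = pd d (%x. SUM l:La. al l t x * (sg l (ph t) x - ph t x)) x - pd d (%x. c t x * ph t x) x"
  unfolding Lop_def[abs_def] by (rule S.pd_diff[OF SL S.SM_mult[OF cU ph] t x]) simp
 also have "pd d (%x. c t x * ph t x) x = c t x * pd d (ph t) x"
  using S.pd_mult[OF cU ph t x, of d] pd_inv0[of "c t" x] c_inv by simp
 also have "pd d (%x. SUM l:La. al l t x * (sg l (ph t) x - ph t x)) x = (SUM l:La. pd d (%x. al l t x * (sg l (ph t) x - ph t x)) x)"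
  by (rule S.pd_sum[OF fin S.SM_mult[OF alU S] t x]) auto
 also have "... = (SUM l:La. ?b l * (sg l (ph t) x - ph t x) + al l t x * (sg l (pd d (ph t)) x + sg l (Dl d l (ph t)) x - pd d (ph t) x))"
  by (intro sum.cong refl) (use S.pd_mult[OF alU S t x, where i = d] dal pS in simp)
 finally have "pd d (Lop t (ph t)) x = Lop t (pd d (ph t)) x + (SUM l:La. ?b l * (sg l (ph t) x - ph t x) + ?a l * sg l (Dl d l (ph t)) x)"
  unfolding Lop_def by (simp add: al_def power2_eq_square algebra_simps sum.distrib sum_subtractf)
 moreover have "pd d (Lop t (ph t)) x = pd d (Ej 0 t (ph t)) x"
  by (rule S.pd_cong[OF Lop_Ej[OF ph t] x]) simp_all
 ultimately have E: "Ej 1 t (ph t) x = (SUM l:La. ?b l * (sg l (ph t) x - ph t x) + ?a l * sg l (Dl d l (ph t)) x)"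
  using pd_Ej[OF ph t x, of 0] Lop_Ej[OF S.SM_pd[OF ph UNIV_I, where i = d] t x] by simp
 define e where "e = (1 + 1 / et) ^ 3"
 have ie: "(1 / x d) ^ n <= e" if "n <= 3" for n
 proof -
  have "1 / x d <= 1 / et" using x et0 by (intro frac_le) (auto simp: US_def)
  hence "1 / x d <= 1 + 1 / et" by simp
  hence "(1 / x d) ^ n <= (1 + 1 / et) ^ n" using hp by (intro power_mono) auto
  also have "... <= e" unfolding e_def using that et0 by (intro power_increasing) auto
  finally show ?thesis .
 qed
 have e0: "0 <= e" unfolding e_def using et0 by simp
 have qp: "\<bar>q l t x\<bar> <= Mb + 1" "\<bar>p l t x\<bar> <= Mb + 1" if "l : La" for l
 proof -
  have *: "\<bar>a\<bar> <= Mb + 1" if "a^2 <= Mb" for a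
  proof -
   have "0 <= (\<bar>a\<bar> - 1)^2" by simp
   thus ?thesis using that by (simp add: power2_diff)
  qed
  have "D2 d 0 (q l t) x <= (SUM l:La. D2 d 0 (q l t) x)" "D2 d 0 (p l t) x <= (SUM l:La. D2 d 0 (p l t) x)"
   using that fin D2_nonneg by (auto intro!: member_le_sum)
  hence "(q l t x)^2 <= Mb" "(p l t x)^2 <= Mb" using coefU[of 0 t x] t x by (auto simp: D2_0)
  thus "\<bar>q l t x\<bar> <= Mb + 1" "\<bar>p l t x\<bar> <= Mb + 1" using * by auto
 qed
 have sb: "\<bar>ph t y\<bar> <= sqrt B" if "y : US" "!!i. d <= i ==> y i = x i" for y
  using B[of 0 y] that by (simp add: D2_0 real_le_rsqrt)
 have trm: "\<bar>?b l * (sg l (ph t) x - ph t x) + ?a l * sg l (Dl d l (ph t)) x\<bar> <= (Mb + 1) * e * (6 + 2 * \<bar>nL\<bar>) * sqrt B"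
  if l: "l : La" for l
 proof -
  let ?y = "tr d (x d) l x"
  have y: "?y : US" "!!i. d <= i ==> ?y i = x i" using S.tr_mem[OF x] by (auto simp: tr_def)
  have M1: "0 <= Mb + 1" using Mb0 by simp
  have 1: "\<bar>sg l (ph t) x - ph t x\<bar> <= 2 * sqrt B" using sb[OF y] sb[OF x] unfolding sg_def by simp
  have b1: "\<bar>?b l\<bar> <= 3 * ((Mb + 1) * e)"
  proof -
   have "\<bar>?b l\<bar> <= 2 * (\<bar>q l t x\<bar> * (1 / x d) ^ 3) + \<bar>p l t x\<bar> * (1 / x d)^2"
   proof -
    have "\<bar>- 2 * q l t x * (1 / x d) ^ 3\<bar> = 2 * (\<bar>q l t x\<bar> * (1 / x d) ^ 3)" "\<bar>p l t x * (1 / x d)\<^sup>2\<bar> = \<bar>p l t x\<bar> * (1 / x d)^2"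
     using hp by (simp_all add: abs_mult)
    thus ?thesis by linarith
   qed
   also have "... <= 2 * ((Mb + 1) * e) + (Mb + 1) * e"
    using hp by (intro add_mono mult_left_mono mult_mono qp l ie M1) auto
   finally show ?thesis by linarith
  qed
  have a1: "\<bar>?a l\<bar> <= 2 * ((Mb + 1) * e)"
  proof -
   have "\<bar>?a l\<bar> <= \<bar>q l t x\<bar> * (1 / x d)^2 + \<bar>p l t x\<bar> * (1 / x d) ^ 1"
   proof -
    have "\<bar>q l t x * (1 / x d)\<^sup>2\<bar> = \<bar>q l t x\<bar> * (1 / x d)^2" "\<bar>p l t x * (1 / x d)\<bar> = \<bar>p l t x\<bar> * (1 / x d) ^ 1"
     using hp by (simp_all add: abs_mult)
    thus ?thesis by linarith
   qed
   also have "... <= (Mb + 1) * e + (Mb + 1) * e"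
    using hp by (intro add_mono mult_mono qp l ie M1) auto
   finally show ?thesis by linarith
  qed
  have D1: "\<bar>sg l (Dl d l (ph t)) x\<bar> <= \<bar>nL\<bar> * sqrt B"
  proof -
   have "(Dl d l (ph t) ?y)^2 <= (vnorm d l)^2 * D2 d (Suc 0) (ph t) ?y"
    using Dl_sq[of d l "ph t" ?y] by (simp add: D2_snoc D2_0)
   also have "... <= nL^2 * B"
   proof (intro mult_mono)
    show "(vnorm d l)^2 <= nL^2" unfolding nL[symmetric] using l fin by (intro member_le_sum) auto
   qed (use B y D2_nonneg in auto)
   finally have "(Dl d l (ph t) ?y)^2 <= nL^2 * B" .
   hence "sqrt ((Dl d l (ph t) ?y)^2) <= sqrt (nL^2 * B)" by (rule real_sqrt_le_mono)
   thus ?thesis by (simp add: sg_def real_sqrt_mult)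
  qed
  have "\<bar>?b l * (sg l (ph t) x - ph t x)\<bar> <= 3 * ((Mb + 1) * e) * (2 * sqrt B)"
   unfolding abs_mult using M1 e0 by (intro mult_mono b1 1) auto
  moreover have "\<bar>?a l * sg l (Dl d l (ph t)) x\<bar> <= 2 * ((Mb + 1) * e) * (\<bar>nL\<bar> * sqrt B)"
   unfolding abs_mult using M1 e0 by (intro mult_mono a1 D1) auto
  moreover have "3 * ((Mb + 1) * e) * (2 * sqrt B) + 2 * ((Mb + 1) * e) * (\<bar>nL\<bar> * sqrt B) = (Mb + 1) * e * (6 + 2 * \<bar>nL\<bar>) * sqrt B"
   by (simp add: algebra_simps)
  ultimately show ?thesis by linarith
 qed
 have "\<bar>Ej 1 t (ph t) x\<bar> <= (SUM l:La. (Mb + 1) * e * (6 + 2 * \<bar>nL\<bar>) * sqrt B)"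
  unfolding E by (rule order_trans[OF sum_abs sum_mono[OF trm]])
 hence "\<bar>Ej 1 t (ph t) x\<bar> <= (real (card La) * ((Mb + 1) * e * (6 + 2 * \<bar>nL\<bar>))) * sqrt B" by (simp add: mult.assoc)
 hence "\<bar>Ej 1 t (ph t) x\<bar>\<^sup>2 <= ((real (card La) * ((Mb + 1) * e * (6 + 2 * \<bar>nL\<bar>))) * sqrt B)^2" by (rule power_mono) simp
 thus ?thesis using B0 by (simp add: cC_def e_def power_mult_distrib)
qed

end

section \<open>Uniform estimates for the derivatives in h\<close>

definition cA :: "nat => real => real => real => real => real => real => real => real" where
 "cA m de K c0 \<tau>0 nL nL\<tau> Mb = 1 + (SUM N<=m. fst (cXR de K c0 Mb (cS m de c0 \<tau>0 nL nL\<tau> Mb) N) * (1 + (nL\<tau>^2 + \<tau>0^2)) ^ m / \<tau>0 ^ (2 * N))"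

text \<open>The factor lost with each derivative in h: the a priori constant times the bound for the
  inhomogeneity, where \<open>m\<close> bounds the number of its terms, 4^m the sum of the squared
  binomial weights, and the last bracket is \<open>cE\<close>. The summand 1 makes it dominate
  \<open>cA\<close> as well.\<close>

definition cQ :: "nat => real => real => real => real => real => real => real => real" where
 "cQ m de K c0 \<tau>0 nL nL\<tau> Mb = cA m de K c0 \<tau>0 nL nL\<tau> Mb * (1 + real m * 4 ^ m * (4 ^ (m + 2) * Mb * (1 + nL\<^sup>2) ^ (m + 3)))"

lemma (in energy) apriori_cA:
 assumes v: "SR v" and F: "SR F" and p: "!!x. x : Rd d ==> prim T (%t. v t x) (%t. Lh h t (v t) x + F t x)"
  and Y: "0 <= Y" and N: "N <= m"
  and FY: "!!j t x. j <= N ==> t : {0..T} ==> x : Rd d ==> D2 d j (F t) x <= Y"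
  and GY: "!!j x. j <= N ==> x : Rd d ==> D2 d j (v 0) x <= Y"
  and tx: "t : {0..T}" "x : Rd d"
 shows "D2 d N (v t) x <= cA m de K c0 \<tau>0 nL nL\<tau> Mb * Y"
proof -
 have nn: "0 <= cX n * (1 + ga) ^ m / \<tau>0 ^ (2 * n)" for n
  using cX_cR[of n] ga_nonneg \<tau>0 by (intro divide_nonneg_nonneg mult_nonneg_nonneg) auto
 have "cX N * (1 + ga) ^ m / \<tau>0 ^ (2 * N) <= (SUM N<=m. cX N * (1 + ga) ^ m / \<tau>0 ^ (2 * N))"
  using N nn by (intro member_le_sum) auto
 also have "... <= cA m de K c0 \<tau>0 nL nL\<tau> Mb" by (simp add: cA_def ga_def)
 finally have "cX N * (1 + ga) ^ m / \<tau>0 ^ (2 * N) * Y <= cA m de K c0 \<tau>0 nL nL\<tau> Mb * Y"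
  using Y by (rule mult_right_mono)
 thus ?thesis using apriori[OF assms] by linarith
qed

lemma (in energy) cA_ge_1: "1 <= cA m de K c0 \<tau>0 nL nL\<tau> Mb"
proof -
 have "0 <= cX n * (1 + ga) ^ m / \<tau>0 ^ (2 * n)" for n
  using cX_cR[of n] ga_nonneg \<tau>0 by (intro divide_nonneg_nonneg mult_nonneg_nonneg) auto
 hence "0 <= (SUM N<=m. cX N * (1 + ga) ^ m / \<tau>0 ^ (2 * N))" by (rule sum_nonneg)
 thus ?thesis by (simp add: cA_def ga_def)
qed

definition sl :: "nat => real => (vec => real) => vec => real" where
 "sl d h ph x = ph (x(d := h))"

lemma pd_sl: "i ~= d ==> pd i (sl d h ph) = sl d h (pd i ph)"
 unfolding sl_def pd_def by (auto simp: fun_upd_twist)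

lemma foldr_sl: "set is \<subseteq> {..<d} ==> foldr pd is (sl d h ph) = sl d h (foldr pd is ph)"
 by (induction "is") (auto simp: pd_sl)

lemma D2_sl: "D2 d n (sl d h ph) x = D2 d n ph (x(d := h))"
 unfolding D2_def by (intro sum.cong refl) (simp add: nl_def foldr_sl, simp add: sl_def)

context slab
begin

lemma upd_US: "et < h ==> h < H ==> x(d := h) : US" by (simp add: US_def)

lemma BD_sl:
 assumes "et < h" "h < H"
 shows "BU N C ph ==> BD {..<d} (Rd d) N C (sl d h ph)"
proof (induction N arbitrary: ph)
 case 0 thus ?case using upd_US[OF assms] by (simp add: sl_def)
next
 case (Suc N)
 interpret R: domR "{..<d}" "Rd d" "%_. UNIV" d by (rule domR_Rd)
 show ?case
 proof (rule R.BD_SucI[where ps = "%i. sl d h (pd i ph)"])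
  show "\<bar>sl d h ph x\<bar> <= C" for x using S.BD_bound[OF Suc.prems upd_US[OF assms]] by (simp add: sl_def del: fun_upd_apply)
  show "((%s. sl d h ph (x(i := s))) has_real_derivative sl d h (pd i ph) x) (at (x i))" if "i : {..<d}" for i x
  proof -
   have "i ~= d" using that by auto
   hence e: "(x(i := s))(d := h) = (x(d := h))(i := s)" for s by (rule fun_upd_twist)
   have "((%s. ph ((x(d := h))(i := s))) has_real_derivative pd i ph (x(d := h))) (at ((x(d := h)) i))"
    by (rule S.BD_DERIV[OF Suc.prems upd_US[OF assms]]) simp
   thus ?thesis unfolding sl_def e fun_upd_other[OF \<open>i ~= d\<close>] .
  qed
  show "BD {..<d} (Rd d) N C (sl d h (pd i ph))" for i by (rule Suc.IH[OF S.BD_pd[OF Suc.prems]]) simp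
 qed
qed

lemma SM_sl: "et < h ==> h < H ==> SU I ph ==> SM {..<d} (Rd d) I (%t. sl d h (ph t))"
 unfolding SM_def using BD_sl by blast

end

lemma (in slab_sym) Lop_sl:
 assumes "x : Rd d" "0 < h"
 shows "Lop t ph (x(d := h)) = scheme.Lh d La q p c h t (sl d h ph) x"
proof -
 have s: "sg l ph (x(d := h)) = sl d h ph (tr d h l x)" for l
  unfolding sg_def sl_def by (rule arg_cong[where f = ph]) (auto simp: tr_def)
 have "al l t (x(d := h)) * (sg l ph (x(d := h)) - ph (x(d := h))) =
   1 / h * (q l t x * scheme.\<delta>d d h l (sl d h ph) x) + p l t x * scheme.\<delta>d d h l (sl d h ph) x" for l
  unfolding s al_def q_inv p_inv scheme.\<delta>d_def shift_tr[OF assms(1)] using assms(2)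
  by (simp add: sl_def field_simps)
 thus ?thesis unfolding Lop_def scheme.Lh_def
  by (simp add: c_inv sum.distrib sum_distrib_left sl_def)
qed

lemma (in domR) D2_sum_le:
 assumes fin: "finite S" and b: "!!l. l : S ==> SM E U I (b l)" and t: "t : I" and x: "x : U"
 shows "D2 d n (%x. SUM l:S. a l * b l t x) x <= (SUM l:S. (a l)\<^sup>2) * (SUM l:S. D2 d n (b l t) x)"
proof -
 have "D2 d n (%x. SUM l:S. a l * b l t x) x = (SUM is:nl {..<d} n. (SUM l:S. a l * foldr pd is (b l t) x)\<^sup>2)"
  unfolding D2_def
 proof (intro sum.cong refl)
  fix "is" assume i: "is : nl {..<d} n"
  have "foldr pd is (%x. SUM l:S. a l * b l t x) x = (SUM l:S. foldr pd is (%x. a l * b l t x) x)"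
   by (rule foldr_pd_sum[where a = "%l t x. a l * b l t x", OF fin SM_cmult[OF b] t x nl_low[OF i]])
  thus "(foldr pd is (%x. SUM l:S. a l * b l t x) x)^2 = (SUM l:S. a l * foldr pd is (b l t) x)^2"
   using foldr_pd_cmult[OF b t x nl_low[OF i]] by simp
 qed
 also have "... <= (SUM is:nl {..<d} n. (SUM l:S. (a l)\<^sup>2) * (SUM l:S. (foldr pd is (b l t) x)\<^sup>2))"
  by (intro sum_mono Cauchy_Schwarz_ineq_sum)
 also have "... = (SUM l:S. (a l)\<^sup>2) * (SUM l:S. D2 d n (b l t) x)"
  unfolding D2_def sum_distrib_left[symmetric] by (simp add: sum.swap[of _ S])
 finally show ?thesis .
qed

lemma sum_binom_sq: "(SUM j:{1..k}. (real (k choose j))\<^sup>2) <= 4 ^ k"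
proof -
 have "(SUM j:{1..k}. (real (k choose j))\<^sup>2) <= (SUM j<=k. (real (k choose j))\<^sup>2)" by (rule sum_mono2) auto
 also have "... <= (SUM j<=k. real (k choose j))^2"
  unfolding power2_eq_square[of "sum _ _"] sum_distrib_right power2_eq_square[of "real _"]
  by (intro sum_mono mult_left_mono member_le_sum) auto
 also have "(SUM j<=k. real (k choose j)) = 2 ^ k" using choose_row_sum[of k] by (simp flip: of_nat_sum)
 finally show ?thesis by (simp flip: power_mult power_mult_distrib power2_eq_square) (simp add: power_mult power_mult_distrib[symmetric] power2_eq_square)
qed

text \<open>Here the two views meet: smoothness on the slab jointly in h and x, and on every slice
  the energy estimates with constants common to all h. The slab extends beyond \<open>h0\<close>, so
  that \<open>h0\<close> itself is an interior value of h.\<close>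

locale evol = slab_sym d et H La q p c T nL Mb m
 for d et H La q p c T nL Mb m +
 fixes ell \<tau>0 \<tau> h0 de K c0 nL\<tau>
 assumes en: "!!h. et < h ==> h <= h0 ==> energy d La ell \<tau>0 \<tau> q p c h T de K c0 nL nL\<tau> Mb m"
  and eth0: "et < h0" and h0H: "h0 < H"
 fixes f :: "real => vec => real" and g :: "vec => real" and Y :: real
 assumes fU: "SM UNIV US {0..T} f" and gU: "SM UNIV US {0..T} (%_. g)"
  and f_meas: "!!x. x : US ==> (%t. f t x) : time_measurable T"
  and f_inv: "!!t x r. f t (x(d := r)) = f t x" and g_inv: "!!x r. g (x(d := r)) = g x"
  and Y0: "0 <= Y"
  and fY: "!!j t x. j <= m ==> t : {0..T} ==> x : US ==> D2 d j (f t) x <= Y"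
  and gY: "!!j x. j <= m ==> x : US ==> D2 d j g x <= Y"
begin

abbreviation "CA \<equiv> cA m de K c0 \<tau>0 nL nL\<tau> Mb"
abbreviation "CQ \<equiv> cQ m de K c0 \<tau>0 nL nL\<tau> Mb"

lemma CA1: "1 <= CA"
 using energy.cA_ge_1[OF en[OF eth0 order_refl]] .

lemma CQ_eq: "CQ = CA * (1 + real m * 4 ^ m * cE)" by (simp add: cQ_def cE_def)

lemma CQ1: "1 <= CQ" "CA <= CQ"
proof -
 have "0 <= CA * (real m * 4 ^ m * cE)" using CA1 cE_nonneg by simp
 thus "CA <= CQ" "1 <= CQ" unfolding CQ_eq using CA1 by (simp_all add: distrib_left)
qed

lemma pdd_inv0:
 assumes "!!x r. a (x(d := r)) = a x"
 shows "(pd d ^^ Suc k) a = (%_. 0)"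
proof (induction k)
 case 0 show ?case using pd_inv0[of a] assms by auto
next
 case (Suc k)
 have "pd d (%_. 0) = (%_. 0)" using pd_inv0[of "%_. 0"] by auto
 thus ?case using Suc by simp
qed

text \<open>The terms of the Leibniz rule in which at least one h-derivative falls on the operator.
  The remaining term j = 0 is L_h applied to the k-th derivative, so this sum acts as an
  inhomogeneity made of lower derivatives.\<close>

definition Sk :: "(real => vec => real) => nat => real => vec => real" where
 "Sk u k t x = (SUM j:{1..k}. real (k choose j) * Ej j t ((pd d ^^ (k - j)) (u t)) x)"

definition Fk :: "(real => vec => real) => nat => real => vec => real" where
 "Fk u k t x = Sk u k t x + (pd d ^^ k) (f t) x"

lemma SU_Sk: "SU {0..T} u ==> SU {0..T} (Sk u k)"
 unfolding Sk_def[abs_def] by (intro S.SM_sum S.SM_cmult SU_Ej SU_pdd) auto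

lemma SU_Fk: "SU {0..T} u ==> SU {0..T} (Fk u k)"
 unfolding Fk_def[abs_def] by (intro S.SM_add SU_Sk SU_pdd fU)

lemma Fk_Suc: "Fk u (Suc k) t = Sk u (Suc k) t"
 by (rule ext) (simp add: Fk_def pdd_inv0[of "f t" k, OF f_inv] del: funpow.simps)

lemma Fk_0: "Fk u 0 t = f t" by (rule ext) (simp add: Fk_def Sk_def)

context
 fixes u :: "real => vec => real"
 assumes u: "SM UNIV US {0..T} u" and u0: "!!x. x : US ==> u 0 x = g x"
  and pu: "!!x. x : US ==> prim T (%t. u t x) (%t. Lop t (u t) x + f t x)"
begin

abbreviation "V k t \<equiv> (pd d ^^ k) (u t)"

lemma VU: "SU {0..T} (%t. V k t)" by (rule SU_pdd[OF u])

lemma prim_V: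
 assumes x: "x : US"
 shows "prim T (%t. V k t x) (%t. Lop t (V k t) x + Fk u k t x)"
proof -
 have r: "SU {0..T} (%t x. Lop t (u t) x + f t x)" by (intro S.SM_add SU_Lop u fU)
 have "prim T (%t. foldr pd (replicate k d) (u t) x) (%t. foldr pd (replicate k d) (%x. Lop t (u t) x + f t x) x)"
  by (rule S.prim_foldr_pd[OF T0 u r pu x]) auto
 hence "prim T (%t. V k t x) (%t. (pd d ^^ k) (%x. Lop t (u t) x + f t x) x)" by (simp add: foldr_replicate)
 thus ?thesis
 proof (rule prim_cong)
  fix t assume t: "t : {0..T}"
  have "(pd d ^^ k) (%x. Lop t (u t) x + f t x) x = (pd d ^^ k) (%x. Ej 0 t (u t) x + f t x) x"
   by (rule pdd_cong[OF _ x]) (simp add: Lop_Ej[OF u t])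
  also have "... = (pd d ^^ k) (Ej 0 t (u t)) x + (pd d ^^ k) (f t) x"
   using S.foldr_pd_add[OF SU_Ej[OF u] fU t x, of "replicate k d" 0] by (simp add: foldr_replicate)
  also have "(pd d ^^ k) (Ej 0 t (u t)) x = (SUM j:insert 0 {1..k}. real (k choose j) * Ej j t (V (k - j) t) x)"
   unfolding pdd_Ej[OF u t x] by (rule sum.cong) auto
  also have "... = Ej 0 t (V k t) x + Sk u k t x" by (subst sum.insert) (auto simp: Sk_def)
  finally show "(pd d ^^ k) (%x. Lop t (u t) x + f t x) x = Lop t (V k t) x + Fk u k t x"
   using Lop_Ej[OF VU t x] by (simp add: Fk_def)
 qed simp
qed

lemma V_step:
 assumes h: "et < h" "h <= h0" and N: "N <= m" and B: "0 <= B"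
  and FB: "!!j t z. j <= N ==> t : {0..T} ==> z : Rd d ==> D2 d j (Fk u k t) (z(d := h)) <= B"
  and GB: "!!j z. j <= N ==> z : Rd d ==> D2 d j (V k 0) (z(d := h)) <= B"
  and t: "t : {0..T}" and z: "z : Rd d"
 shows "D2 d N (V k t) (z(d := h)) <= CA * B"
proof -
 interpret e: energy d La ell \<tau>0 \<tau> q p c h T de K c0 nL nL\<tau> Mb m by (rule en[OF h])
 have hH: "h < H" using h h0H by simp
 have "D2 d N (sl d h (V k t)) z <= CA * B"
 proof (rule e.apriori_cA[where F = "%t. sl d h (Fk u k t)"])
  show "e.SR (%t. sl d h (V k t))" "e.SR (%t. sl d h (Fk u k t))"
   using SM_sl[OF h(1) hH] VU SU_Fk[OF u] by blast+
  fix x assume x: "x : Rd d"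
  have "prim T (%t. V k t (x(d := h))) (%t. Lop t (V k t) (x(d := h)) + Fk u k t (x(d := h)))"
   by (rule prim_V[OF upd_US[OF h(1) hH]])
  thus "prim T (%t. sl d h (V k t) x) (%t. e.Lh h t (sl d h (V k t)) x + sl d h (Fk u k t) x)"
   using Lop_sl[OF x e.h0] by (simp add: sl_def)
 qed (use FB GB B N t z in "auto simp: D2_sl")
 thus ?thesis by (simp add: D2_sl)
qed

lemma V0_zero: "x : US ==> D2 d j (V (Suc k) 0) x = 0"
proof -
 assume x: "x : US"
 have "V (Suc k) 0 y = 0" if "y : US" for y
  using pdd_cong[where n = "Suc k", OF u0 that] pdd_inv0[of g k, OF g_inv] by (simp del: funpow.simps)
 hence "D2 d j (V (Suc k) 0) x = D2 d j (%_. 0) x" by (rule S.D2_cong[OF _ x])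
 also have "... = 0 * D2 d j (%_. 0) x"
  using S.D2_cmult[OF S.SM_const[of "{0::nat}" 0], of 0 x j 0] x by simp
 finally show ?thesis by simp
qed

lemma D2_Sk_le:
 assumes t: "t : {0..T}" and x: "x : US" and k: "k <= m" "1 <= k" and B: "0 <= B"
  and E: "!!j. j : {1..k} ==> D2 d r (Ej j t (V (k - j) t)) x <= B"
 shows "D2 d r (Sk u k t) x <= real m * 4 ^ m * B"
proof -
 have "D2 d r (Sk u k t) x <= (SUM j:{1..k}. (real (k choose j))\<^sup>2) * (SUM j:{1..k}. D2 d r (Ej j t (V (k - j) t)) x)"
  unfolding Sk_def[abs_def] by (rule S.D2_sum_le[OF _ SU_Ej[OF VU] t x]) auto
 also have "... <= 4 ^ m * (SUM j:{1..k}. B)"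
 proof (intro mult_mono sum_mono E)
  have "(4::real) ^ k <= 4 ^ m" using k by (intro power_increasing) auto
  thus "(SUM j:{1..k}. (real (k choose j))\<^sup>2) <= 4 ^ m" using sum_binom_sq[of k] by linarith
 qed (auto intro: sum_nonneg D2_nonneg)
 also have "... = 4 ^ m * (real k * B)" by simp
 also have "... <= 4 ^ m * (real m * B)" using k B by (intro mult_left_mono mult_right_mono) auto
 finally show ?thesis by (simp add: mult_ac)
qed

lemma slice_point:
 assumes "y : US" "!!i. d <= i ==> y i = (z(d := h)) i" "z : Rd d"
 obtains z' where "z' : Rd d" "y = z'(d := h)"
proof
 show "y(d := undefined) : Rd d"
  using assms(2)[of _] assms(3) by (fastforce simp: Rd_def PiE_iff extensional_def split: if_splits)
 show "y = (y(d := undefined))(d := h)" using assms(2)[of d] by auto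
qed

text \<open>The plain and the improved estimate are proved in one induction, since the improved one
  draws on both for smaller k. The energies are squares, hence \<open>h^2\<close> for a gain of one
  factor h; the initial data and f do not depend on h, so only the commutator terms drive the
  equation when k > 0.\<close>

lemma V_bounds:
 "(ALL r t z h. 3 * k + r <= m --> t : {0..T} --> z : Rd d --> et < h --> h <= h0 -->
  D2 d r (V k t) (z(d := h)) <= CQ ^ (k + 1) * Y &
  (odd k --> 3 * k + r + 1 <= m --> D2 d r (V k t) (z(d := h)) <= CQ ^ (k + 1) * (h^2 * Y)))"
proof (induction k rule: less_induct)
 case (less k)
 have CA0: "0 <= CA" and CQ0: "0 <= CQ" using CA1 CQ1 by auto
 show ?case
 proof (cases k)
  case 0
  have "D2 d r (V 0 t) (z(d := h)) <= CQ ^ (0 + 1) * Y"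
   if r: "r <= m" and t: "t : {0..T}" and z: "z : Rd d" and h: "et < h" "h <= h0" for r t z h
  proof -
   have US: "z(d := h) : US" for z :: vec using upd_US h h0H by simp
   have "D2 d r (V 0 t) (z(d := h)) <= CA * Y"
   proof (rule V_step[OF h r Y0 _ _ t z])
    show "D2 d j (Fk u 0 t) (z(d := h)) <= Y" if "j <= r" "t : {0..T}" for j t z
     unfolding Fk_0 using fY US that r by simp
    show "D2 d j (V 0 0) (z(d := h)) <= Y" if "j <= r" for j z
     using S.D2_cong[of "u 0" g, OF u0 US] gY[OF _ US] that r by simp
   qed
   also have "... <= CQ * Y" using CQ1(2) Y0 by (rule mult_right_mono)
   finally show ?thesis by simp
  qed
  thus ?thesis using 0 by (auto simp del: fun_upd_apply)
 next
  case (Suc k')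
  \<comment> \<open>The part common to both estimates: \<open>Y'\<close> stands for \<open>Y\<close>
    or for \<open>h^2 * Y\<close>.\<close>
  have gen: "D2 d r (V k t) (z(d := h)) <= CQ ^ (k + 1) * Y'"
   if r: "3 * k + r <= m" and t: "t : {0..T}" and z: "z : Rd d" and h: "et < h" "h <= h0" and Y': "0 <= Y'"
    and E: "!!j i t z. j : {1..k} ==> i <= r ==> t : {0..T} ==> z : Rd d ==> D2 d i (Ej j t (V (k - j) t)) (z(d := h)) <= cE * (CQ ^ k * Y')"
   for r t z h Y'
  proof -
   have US: "z(d := h) : US" for z :: vec using upd_US h h0H by simp
   have B0: "0 <= cE * (CQ ^ k * Y')" using cE_nonneg CQ0 Y' by simp
   have "D2 d r (V k t) (z(d := h)) <= CA * (real m * 4 ^ m * (cE * (CQ ^ k * Y')))"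
   proof (rule V_step[OF h _ _ _ _ t z])
    show "r <= m" using r by simp
    show "0 <= real m * 4 ^ m * (cE * (CQ ^ k * Y'))" using B0 by simp
    show "D2 d j (Fk u k t) (z(d := h)) <= real m * 4 ^ m * (cE * (CQ ^ k * Y'))" if "j <= r" "t : {0..T}" "z : Rd d" for j t z
     unfolding Suc Fk_Suc unfolding Suc[symmetric]
     by (rule D2_Sk_le[OF that(2) US _ _ B0 E]) (use r Suc that in auto)
    show "D2 d j (V k 0) (z(d := h)) <= real m * 4 ^ m * (cE * (CQ ^ k * Y'))" for j z
     unfolding Suc V0_zero[OF US] unfolding Suc[symmetric] using B0 by simp
   qed
   also have "... = (CA * (real m * 4 ^ m * cE)) * (CQ ^ k * Y')" by (simp add: mult_ac)
   also have "... <= CQ * (CQ ^ k * Y')"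
    using CA0 CQ0 Y' by (intro mult_right_mono) (auto simp: CQ_eq distrib_left)
   finally show ?thesis by (simp add: mult_ac)
  qed
  have pw: "CQ ^ (k - j + 1) * X <= CQ ^ k * X" if "j : {1..k}" "0 <= X" for j X
   using that CQ1 by (intro mult_right_mono power_increasing) auto
  have IH: "D2 d s (V (k - j) t) (z(d := h)) <= CQ ^ k * Y"
   if "j : {1..k}" "3 * (k - j) + s <= m" "t : {0..T}" "z : Rd d" "et < h" "h <= h0" for j s t z h
   using less[of "k - j"] that pw[OF that(1) Y0] by fastforce
  have IHo: "D2 d s (V (k - j) t) (z(d := h)) <= CQ ^ k * (h^2 * Y)"
   if "j : {1..k}" "odd (k - j)" "3 * (k - j) + s + 1 <= m" "t : {0..T}" "z : Rd d" "et < h" "h <= h0" for j s t z h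
  proof -
   have "0 <= h^2 * Y" using Y0 by simp
   hence "CQ ^ (k - j + 1) * (h^2 * Y) <= CQ ^ k * (h^2 * Y)" by (rule pw[OF that(1)])
   moreover have "D2 d s (V (k - j) t) (z(d := h)) <= CQ ^ (k - j + 1) * (h^2 * Y)"
    using less[of "k - j", THEN spec, THEN spec, THEN spec, THEN spec, of s t z h] that by (auto simp del: fun_upd_apply)
   ultimately show ?thesis by linarith
  qed
  show ?thesis
  proof (intro allI impI conjI)
   fix r t z h
   assume r: "3 * k + r <= m" and t: "t : {0..T}" and z: "z : Rd d" and h: "et < h" "h <= h0"
   have US: "z(d := h) : US" for z :: vec using upd_US h h0H by simp
   show "D2 d r (V k t) (z(d := h)) <= CQ ^ (k + 1) * Y"
   proof (rule gen[OF r t z h Y0])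
    fix j i t z assume j: "j : {1..k}" and i: "i <= r" and t: "t : {0..T}" and z: "z : Rd d"
    show "D2 d i (Ej j t (V (k - j) t)) (z(d := h)) <= cE * (CQ ^ k * Y)"
    proof (rule D2_Ej_bound[OF VU t US])
     fix s y assume s: "s <= i + j + 2" and y: "y : US" "!!n. d <= n ==> y n = (z(d := h)) n"
     obtain z' where "z' : Rd d" "y = z'(d := h)" using slice_point[OF y z] .
     thus "D2 d s (V (k - j) t) y <= CQ ^ k * Y" using IH[OF j _ t _ h, of s z'] s i r j by auto
    qed (use i j r in auto)
   qed
   assume o: "odd k" and r1: "3 * k + r + 1 <= m"
   have hY: "0 <= h^2 * Y" using Y0 by simp
   show "D2 d r (V k t) (z(d := h)) <= CQ ^ (k + 1) * (h^2 * Y)"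
   proof (rule gen[OF r t z h hY])
    fix j i t z assume j: "j : {1..k}" and i: "i <= r" and t: "t : {0..T}" and z: "z : Rd d"
    show "D2 d i (Ej j t (V (k - j) t)) (z(d := h)) <= cE * (CQ ^ k * (h^2 * Y))"
    proof (cases "odd j")
     \<comment> \<open>For j = 1 the count of derivatives is exact: 3 (k - 1) + r + 4 = 3k + r +
       1.\<close>
     case True
     have "D2 d i (Ej j t (V (k - j) t)) (z(d := h)) <= cE * (((z(d := h)) d)^2 * (CQ ^ k * Y))"
     proof (rule D2_Ej_odd[OF VU t US _ True])
      fix s y assume s: "s <= i + j + 3" and y: "y : US" "!!n. d <= n ==> y n = (z(d := h)) n"
      obtain z' where "z' : Rd d" "y = z'(d := h)" using slice_point[OF y z] .
      thus "D2 d s (V (k - j) t) y <= CQ ^ k * Y" using IH[OF j _ t _ h, of s z'] s i r1 j by auto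
     qed (use i j r in auto)
     thus ?thesis by (simp add: mult_ac)
    next
     case False
     \<comment> \<open>The improved hypothesis for k - j asks for one derivative more, j + 3 in all;
       an even j is at least 2, and then j + 3 \<le> 3j.\<close>
     hence j2: "2 <= j" "odd (k - j)" using j o by presburger+
     show ?thesis
     proof (rule D2_Ej_bound[OF VU t US])
      fix s y assume s: "s <= i + j + 2" and y: "y : US" "!!n. d <= n ==> y n = (z(d := h)) n"
      obtain z' where "z' : Rd d" "y = z'(d := h)" using slice_point[OF y z] .
      thus "D2 d s (V (k - j) t) y <= CQ ^ k * (h^2 * Y)" using IHo[OF j j2(2) _ t _ h, of s z'] s i r1 j j2 by auto
     qed (use i j r in auto)
    qed
   qed
  qed
 qed
qed

text \<open>For order k + 1 the commutator terms with j \<ge> 2 need 3k + 5 - 2j \<le> 3k + 1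
  derivatives, which the budget allows. Only j = 1 would need 3k + 3; there the crude bound takes
  over and gets by with 3k + 1.\<close>

lemma V_crude:
 assumes k: "3 * k + 1 <= m" and t: "t : {0..T}" and z: "z : Rd d" and h: "et < h" "h <= h0"
 shows "(V (Suc k) t (z(d := h)))^2 <= CA * (real m * 4 ^ m * ((cE + cC) * (CQ ^ (k + 1) * Y)))"
proof -
 have US: "z(d := h) : US" for z :: vec using upd_US h h0H by simp
 have CQ0: "0 <= CQ" using CQ1 by auto
 have cC0: "0 <= cC" by (simp add: cC_def)
 have Y': "0 <= CQ ^ (k + 1) * Y" using CQ0 Y0 by simp
 have B0: "0 <= (cE + cC) * (CQ ^ (k + 1) * Y)" using cE_nonneg cC0 Y' by simp
 have IH: "D2 d s (V (Suc k - j) t) (z(d := h)) <= CQ ^ (k + 1) * Y"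
  if "j : {1..Suc k}" "3 * (Suc k - j) + s <= m" "t : {0..T}" "z : Rd d" for j s t z
 proof -
  have "D2 d s (V (Suc k - j) t) (z(d := h)) <= CQ ^ (Suc k - j + 1) * Y" using V_bounds[of "Suc k - j"] that h by blast
  also have "... <= CQ ^ (k + 1) * Y" using that CQ1 Y0 by (intro mult_right_mono power_increasing) auto
  finally show ?thesis .
 qed
 have "D2 d 0 (V (Suc k) t) (z(d := h)) <= CA * (real m * 4 ^ m * ((cE + cC) * (CQ ^ (k + 1) * Y)))"
 proof (rule V_step[OF h _ _ _ _ t z])
  show "0 <= real m * 4 ^ m * ((cE + cC) * (CQ ^ (k + 1) * Y))" using B0 by simp
  show "D2 d j (V (Suc k) 0) (z(d := h)) <= real m * 4 ^ m * ((cE + cC) * (CQ ^ (k + 1) * Y))" for j z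
   unfolding V0_zero[OF US] using B0 by simp
  fix i t z assume i: "i <= (0::nat)" and t: "t : {0..T}" and z: "z : Rd d"
  show "D2 d i (Fk u (Suc k) t) (z(d := h)) <= real m * 4 ^ m * ((cE + cC) * (CQ ^ (k + 1) * Y))"
   unfolding Fk_Suc
  proof (rule D2_Sk_le[OF t US _ _ B0])
   fix j assume j: "j : {1..Suc k}"
   show "D2 d i (Ej j t (V (Suc k - j) t)) (z(d := h)) <= (cE + cC) * (CQ ^ (k + 1) * Y)"
   proof (cases "j = 1")
    case True
    have "(Ej 1 t (V k t) (z(d := h)))^2 <= cC * (CQ ^ (k + 1) * Y)"
    proof (rule E1_crude[OF VU t US])
     fix s y assume s: "s <= (1::nat)" and y: "y : US" "!!n. d <= n ==> y n = (z(d := h)) n"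
     obtain z' where "z' : Rd d" "y = z'(d := h)" using slice_point[OF y z] .
     thus "D2 d s (V k t) y <= CQ ^ (k + 1) * Y" using IH[of 1 s t z'] t s k by auto
    qed
    moreover have "cC * (CQ ^ (k + 1) * Y) <= (cE + cC) * (CQ ^ (k + 1) * Y)" using cE_nonneg Y' by (intro mult_right_mono) auto
    ultimately show ?thesis using True i by (simp add: D2_0)
   next
    case False
    have "D2 d i (Ej j t (V (Suc k - j) t)) (z(d := h)) <= cE * (CQ ^ (k + 1) * Y)"
    proof (rule D2_Ej_bound[OF VU t US])
     fix s y assume s: "s <= i + j + 2" and y: "y : US" "!!n. d <= n ==> y n = (z(d := h)) n"
     obtain z' where "z' : Rd d" "y = z'(d := h)" using slice_point[OF y z] .
     thus "D2 d s (V (Suc k - j) t) y <= CQ ^ (k + 1) * Y" using IH[of j s t z'] t s i j False k by auto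
    qed (use i j k in auto)
    moreover have "cE * (CQ ^ (k + 1) * Y) <= (cE + cC) * (CQ ^ (k + 1) * Y)" using cC0 Y' by (intro mult_right_mono) auto
    ultimately show ?thesis by linarith
   qed
  qed (use k in auto)
 qed simp
 thus ?thesis by (simp add: D2_0)
qed

end

end

section \<open>Mollification\<close>

text \<open>s^(-n) e^(-1/s) on the positive axis. Carrying the power along makes the derivatives
  linear combinations of members of the same family, so smoothness at 0 needs only one
  limit.\<close>

definition flat :: "nat => real => real" where
 "flat n s = (if 0 < s then inverse s ^ n / exp (inverse s) else 0)"

lemma flat_nonneg: "0 <= flat n s" by (simp add: flat_def)

lemma DERIV_flat: "(flat n has_real_derivative flat (n + 2) s - real n * flat (n + 1) s) (at s)"
proof -
 consider "0 < s" | "s < 0" | "s = 0" by linarith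
 thus ?thesis
 proof cases
  case 1
  have "((%s. inverse s ^ n / exp (inverse s)) has_real_derivative
    ((real n * inverse s ^ (n - Suc 0) * - (inverse s * inverse s)) * exp (inverse s)
    - inverse s ^ n * (exp (inverse s) * - (inverse s * inverse s))) / (exp (inverse s) * exp (inverse s))) (at s)"
   using 1 by (auto intro!: derivative_eq_intros simp: power2_eq_square numeral_2_eq_2)
  moreover have "((real n * u ^ (n - Suc 0) * - (u * u)) * E - u ^ n * (E * - (u * u))) / (E * E) = u ^ (n + 2) / E - real n * (u ^ (n + 1) / E)"
   if "0 < E" for u E :: real
   using that by (cases n) (simp_all add: field_simps)
  ultimately have "((%s. inverse s ^ n / exp (inverse s)) has_real_derivative flat (n + 2) s - real n * flat (n + 1) s) (at s)"
   using 1 by (simp add: flat_def)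
  thus ?thesis
   by (rule has_field_derivative_transform_within_open[where S = "{0<..}"]) (use 1 in "auto simp: flat_def")
 next
  case 2
  have "((%s. 0) has_real_derivative flat (n + 2) s - real n * flat (n + 1) s) (at s)"
   using 2 by (simp add: flat_def)
  thus ?thesis
   by (rule has_field_derivative_transform_within_open[where S = "{..<0}"]) (use 2 in "auto simp: flat_def")
 next
  case 3
  have "((%h. flat n h / h) \<longlongrightarrow> 0) (at_right 0)"
  proof (rule Lim_transform_eventually)
   show "((%h::real. inverse h ^ (Suc n) / exp (inverse h)) \<longlongrightarrow> 0) (at_right 0)"
    by (rule filterlim_compose[OF tendsto_power_div_exp_0 filterlim_inverse_at_top_right])
   show "\<forall>\<^sub>F h in at_right 0. inverse h ^ (Suc n) / exp (inverse h) = flat n h / h"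
    unfolding eventually_at_filter by (rule always_eventually) (auto simp: flat_def field_simps)
  qed
  moreover have "((%h. flat n h / h) \<longlongrightarrow> 0) (at_left 0)"
   by (rule Lim_transform_eventually[OF tendsto_const]) (auto simp: eventually_at_filter flat_def)
  ultimately have "((%h. flat n h / h) \<longlongrightarrow> 0) (at 0)" by (simp add: filterlim_split_at)
  thus ?thesis using 3 by (simp add: has_field_derivative_iff flat_def)
 qed
qed

text \<open>The span of products of two flat functions glued at -e and e. It is closed under
  differentiation and all its members vanish outside the interval, so no formula for the higher
  derivatives of a bump is required.\<close>

inductive bumpy :: "real => (real => real) => bool" for e where
 base: "bumpy e (%s. flat n (e + s) * flat j (e - s))"
| lin: "bumpy e f ==> bumpy e g ==> bumpy e (%s. a * f s + b * g s)"

lemma bumpy_DERIV: "bumpy e f ==> EX f'. bumpy e f' & (ALL s. (f has_real_derivative f' s) (at s))"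
proof (induction rule: bumpy.induct)
 case (base n j)
 have a: "((%s. flat n (e + s)) has_real_derivative flat (n + 2) (e + s) - real n * flat (n + 1) (e + s)) (at s)" for n s
  using DERIV_shift[of "flat n" _ s e] DERIV_flat[of n "s + e"] by (simp add: add.commute)
 have "((%s. flat j (e - s)) has_real_derivative (flat (j + 2) (e - s) - real j * flat (j + 1) (e - s)) * (- 1)) (at s)" for s
  by (rule DERIV_chain2[OF DERIV_flat]) (auto intro!: derivative_eq_intros)
 from DERIV_mult[OF a this]
 have "((%s. flat n (e + s) * flat j (e - s)) has_real_derivative
  1 * (1 * (flat (n + 2) (e + s) * flat j (e - s)) + (- real n) * (flat (n + 1) (e + s) * flat j (e - s))) +
  1 * ((-1) * (flat n (e + s) * flat (j + 2) (e - s)) + real j * (flat n (e + s) * flat (j + 1) (e - s)))) (at s)" for s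
  by (rule DERIV_cong) (simp add: algebra_simps)
 moreover have "bumpy e (%s. 1 * (1 * (flat (n + 2) (e + s) * flat j (e - s)) + (- real n) * (flat (n + 1) (e + s) * flat j (e - s))) +
  1 * ((-1) * (flat n (e + s) * flat (j + 2) (e - s)) + real j * (flat n (e + s) * flat (j + 1) (e - s))))"
  by (intro bumpy.lin bumpy.base)
 ultimately show ?case by blast
next
 case (lin f g a b)
 then obtain f' g' where "bumpy e f'" "bumpy e g'" "!!s. (f has_real_derivative f' s) (at s)" "!!s. (g has_real_derivative g' s) (at s)"
  by blast
 hence "bumpy e (%s. a * f' s + b * g' s)" "((%s. a * f s + b * g s) has_real_derivative a * f' s + b * g' s) (at s)" for s
  by (auto intro: bumpy.lin intro!: derivative_eq_intros)
 thus ?case by blast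
qed

lemma bumpy_support: "bumpy e f ==> e < \<bar>s\<bar> ==> f s = 0"
 by (induction rule: bumpy.induct) (auto simp: flat_def abs_if split: if_splits)

lemma integrable_compact_support:
 fixes f :: "real => real"
 assumes "continuous_on UNIV f" "!!s. e < \<bar>s\<bar> ==> f s = 0"
 shows "integrable lborel f"
proof -
 have "set_integrable lborel {-e..e} f"
  by (rule borel_integrable_atLeastAtMost') (use assms(1) continuous_on_subset in blast)
 moreover have "(%s. indicator {-e..e} s *\<^sub>R f s) = f"
 proof
  show "indicator {-e..e} s *\<^sub>R f s = f s" for s using assms(2)[of s] by (cases "s : {-e..e}") auto
 qed
 ultimately show ?thesis by (simp add: set_integrable_def)
qed

lemma mollifier_exists:
 assumes e: "0 < e"
 obtains ka :: "nat => real => real"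
 where "!!n s. (ka n has_real_derivative ka (Suc n) s) (at s)" "!!n s. e < \<bar>s\<bar> ==> ka n s = 0"
  "!!s. 0 <= ka 0 s" "has_bochner_integral lborel (ka 0) 1"
proof -
 define b where "b s = flat 0 (e + s) * flat 0 (e - s)" for s
 have "ALL f. EX f'. bumpy e f --> bumpy e f' & (ALL s. (f has_real_derivative f' s) (at s))" using bumpy_DERIV by blast
 then obtain D where D: "!!f. bumpy e f ==> bumpy e (D f)" "!!f s. bumpy e f ==> (f has_real_derivative D f s) (at s)" by metis
 define B where "B n = (D ^^ n) b" for n
 have B: "bumpy e (B n)" for n
  by (induction n) (use D(1) bumpy.base[of e 0 0] in "auto simp: B_def b_def[abs_def]")
 have dB: "(B n has_real_derivative B (Suc n) s) (at s)" for n s using D(2)[OF B] by (simp add: B_def)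
 have sB: "e < \<bar>s\<bar> ==> B n s = 0" for n s by (rule bumpy_support[OF B])
 have cB: "continuous_on UNIV (B n)" for n using dB DERIV_continuous_on by blast
 have B0: "B 0 = b" by (simp add: B_def)
 have iB: "integrable lborel b" using integrable_compact_support[where f = b and e = e] cB[of 0] sB[of _ 0] B0 by simp
 define Z where "Z = (\<integral>s. b s \<partial>lborel)"
 have b0: "0 <= b s" for s by (simp add: b_def flat_nonneg)
 \<comment> \<open>A positive lower bound on the middle half of the support makes the total mass
   \<open>Z\<close> positive.\<close>
 have low: "exp (- 2 / e) <= flat 0 r" if "e / 2 <= r" for r
 proof -
  have "inverse r <= 2 / e" using that e by (simp add: field_simps)
  hence "exp (- (2 / e)) <= exp (- inverse r)" by simp
  also have "exp (- inverse r) = flat 0 r" using that e by (simp add: flat_def exp_minus inverse_eq_divide)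
  finally show ?thesis by simp
 qed
 have "(\<integral>s. (exp (- 2 / e))\<^sup>2 * indicator {- (e / 2)..e / 2} s \<partial>lborel) <= Z"
  unfolding Z_def
 proof (rule integral_mono)
  fix s show "(exp (- 2 / e))^2 * indicator {- (e / 2)..e / 2} s <= b s"
  proof (cases "s : {- (e / 2)..e / 2}")
   case True
   hence "exp (- 2 / e) * exp (- 2 / e) <= flat 0 (e + s) * flat 0 (e - s)"
    using e flat_nonneg by (intro mult_mono low) auto
   thus ?thesis using True by (simp add: b_def power2_eq_square)
  qed (simp add: b0)
 qed (use iB e in "auto intro!: integrable_mult_right")
 moreover have "0 < (\<integral>s. (exp (- 2 / e))\<^sup>2 * indicator {- (e / 2)..e / 2} s \<partial>lborel)" using e by simp
 ultimately have Z: "0 < Z" by linarith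
 show ?thesis
 proof (rule that[of "%n s. B n s / Z"])
  show "((%s. B n s / Z) has_real_derivative B (Suc n) s / Z) (at s)" for n s by (rule DERIV_cdivide[OF dB])
  show "e < \<bar>s\<bar> ==> B n s / Z = 0" for n s using sB by simp
  show "0 <= B 0 s / Z" for s using Z b0 B0 by simp
  show "has_bochner_integral lborel (%s. B 0 s / Z) 1"
   using iB Z unfolding B0 has_bochner_integral_iff by (simp add: Z_def[symmetric])
 qed
qed

lemma space_Leb: "space (Leb d) = Rd d" by (simp add: Leb_def space_PiM Rd_def)

lemma sets_Leb: "sets (Leb d) = sets (PiM {..<d} (%_. borel))"
 unfolding Leb_def by (rule sets_PiM_cong) auto

lemma sigma_finite_Leb: "sigma_finite_measure (Leb d)"
proof -
 interpret product_sigma_finite "%_::nat. lborel :: real measure" ..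
 show ?thesis unfolding Leb_def by (rule sigma_finite) simp
qed

lemma Leb_coord: "(%y. y i) : borel_measurable (Leb d)"
proof (cases "i < d")
 case True
 have "(%y. y i) : measurable (Leb d) lborel" unfolding Leb_def by (rule measurable_component_singleton) (use True in auto)
 thus ?thesis by simp
next
 case False
 have "(%y. y i) : borel_measurable (Leb d) \<longleftrightarrow> (%y. undefined::real) : borel_measurable (Leb d)"
  by (rule measurable_cong) (use False in "auto simp: space_Leb Rd_def PiE_iff extensional_def")
 thus ?thesis by simp
qed

lemma continuous_Leb: "continuous_on (Rd d) ps ==> ps : borel_measurable (Leb d)"
proof -
 assume c: "continuous_on (Rd d) ps"
 have "(%y. y) : measurable (Leb d) borel" by (rule measurable_coordinatewise_then_product) (rule Leb_coord)
 hence "(%y. y) : measurable (Leb d) (restrict_space borel (Rd d))"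
  by (rule measurable_restrict_space2[rotated]) (simp add: space_Leb)
 from measurable_compose[OF this borel_measurable_continuous_on_restrict[OF c]] show ?thesis by simp
qed

lemma tendsto_coordinates:
 fixes y :: "nat => vec"
 assumes "x : Rd d" "!!n. y n : Rd d" "!!i. i < d ==> (%n. y n i) \<longlonglongrightarrow> x i"
 shows "y \<longlonglongrightarrow> x"
proof -
 have "(%n. y n i) \<longlonglongrightarrow> x i" for i
 proof (cases "i < d")
  case False
  hence "y n i = x i" for n using assms(1) assms(2)[of n] by (auto simp: Rd_def PiE_iff extensional_def)
  thus ?thesis by simp
 qed (use assms(3) in auto)
 hence "limitin (product_topology (%_. euclidean) UNIV) y x sequentially"
  unfolding limitin_componentwise by (auto simp: limitin_canonical_iff)
 thus ?thesis by (simp add: euclidean_product_topology limitin_canonical_iff)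
qed

lemma BD_continuous:
 assumes "BD {..<d} (Rd d) (Suc N) C ph"
 shows "continuous_on (Rd d) ph"
proof -
 interpret R: domR "{..<d}" "Rd d" "%_. UNIV" d by (rule domR_Rd)
 show ?thesis unfolding continuous_on_def
 proof
  fix x assume x: "x : Rd d"
  have lim: "((%z. C * (SUM i<d. \<bar>z i - x i\<bar>)) \<longlongrightarrow> C * (SUM i<d. \<bar>x i - x i\<bar>)) (at x within Rd d)"
  proof (intro tendsto_intros)
   show "((%z. z i) \<longlongrightarrow> x i) (at x within Rd d)" for i
    using continuous_on_subset[OF continuous_on_product_coordinates[of i] subset_UNIV[of "Rd d"]] x
    unfolding continuous_on_def by blast
  qed
  have b: "dist (ph z) (ph x) <= C * (SUM i<d. \<bar>z i - x i\<bar>)" if z: "z : Rd d" for z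
  proof -
   have "(%i. if i < d then z i else x i) = z" using x z by (auto simp: Rd_def PiE_iff extensional_def)
   thus ?thesis using R.BD_lip_multi[OF assms x, where z = z and k = d] by (simp add: dist_real_def)
  qed
  have "((%z. dist (ph z) (ph x)) \<longlongrightarrow> 0) (at x within Rd d)"
  proof (rule Lim_null_comparison[where g = "%z. C * (SUM i<d. \<bar>z i - x i\<bar>)"])
   show "\<forall>\<^sub>F z in at x within Rd d. norm (dist (ph z) (ph x)) <= C * (SUM i<d. \<bar>z i - x i\<bar>)"
    unfolding eventually_at_filter by (rule always_eventually) (use b in auto)
  qed (use lim in simp)
  thus "(ph \<longlongrightarrow> ph x) (at x within Rd d)" by (rule tendsto_dist_iff[THEN iffD2])
 qed
qed

lemma BD_subset: "BD E U N C ph ==> E' \<subseteq> E ==> U' \<subseteq> U ==> BD E' U' N C ph"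
proof (induction N arbitrary: ph)
 case (Suc N)
 have "BD E' U' N C (pd i ph)" if "i : E'" for i
  by (rule Suc.IH) (use Suc.prems that in auto)
 moreover have "(%s. ph (x(i := s))) differentiable (at (x i))" if "i : E'" "x : U'" for i x
  using Suc.prems that unfolding BD.simps by blast
 ultimately show ?case using Suc.prems unfolding BD.simps by blast
qed auto

lemma SM_subset: "SM E U I ph ==> E' \<subseteq> E ==> U' \<subseteq> U ==> SM E' U' I ph"
 unfolding SM_def using BD_subset by meson

definition cnt :: "nat => nat list => nat => nat" where
 "cnt d is = (\<lambda>i\<in>{..<d}. count_list is i)"

lemma finite_multi_index: "finite (multi_index d n)"
 by (rule finite_subset[of _ "{..<d} \<rightarrow>\<^sub>E {..n}"]) (auto simp: multi_index_def intro: finite_PiE)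

lemma cnt_multi_index: "is : nl {..<d} n ==> cnt d is : multi_index d n"
proof -
 assume i: "is : nl {..<d} n"
 hence "(SUM i<d. count_list is i) = n"
  using sum_count_set[of "is" "{..<d}"] by (auto simp: nl_def)
 moreover have "count_list is i <= n" for i using i count_le_length[of "is" i] by (simp add: nl_def)
 ultimately show ?thesis by (auto simp: multi_index_def cnt_def)
qed

text \<open>Each multi-index of order \<open>n\<close> comes from at most \<open>n!\<close> index lists.\<close>

lemma sum_nl_multi_index:
 fixes F :: "(nat => nat) => real"
 assumes F: "!!\<alpha>. 0 <= F \<alpha>"
 shows "(SUM is:nl {..<d} n. F (cnt d is)) <= fact n * (SUM \<alpha>:multi_index d n. F \<alpha>)"
proof -
 have "(SUM is:nl {..<d} n. F (cnt d is)) = (SUM \<alpha>:multi_index d n. SUM is:{is:nl {..<d} n. cnt d is = \<alpha>}. F (cnt d is))"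
  by (rule sum.group[symmetric]) (auto simp: finite_nl finite_multi_index cnt_multi_index)
 also have "... <= (SUM \<alpha>:multi_index d n. fact n * F \<alpha>)"
 proof (rule sum_mono)
  fix \<alpha>
  let ?S = "{is:nl {..<d} n. cnt d is = \<alpha>}"
  have "card ?S <= fact n"
  proof (cases "?S = {}")
   case False
   then obtain a where a: "a : ?S" by blast
   have "?S \<subseteq> permutations_of_multiset (mset a)"
   proof
    fix b assume b: "b : ?S"
    have "count_list b i = count_list a i" for i
    proof (cases "i < d")
     case True
     thus ?thesis using a b fun_cong[of "cnt d b" "cnt d a" i] unfolding cnt_def restrict_def mem_Collect_eq by auto
    next
     case False
     hence "i ~: set a" "i ~: set b" using a b by (auto simp: nl_def)
     thus ?thesis by (simp add: count_list_0_iff)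
    qed
    hence "mset b = mset a" by (intro multiset_eqI) (simp add: count_mset)
    thus "b : permutations_of_multiset (mset a)" by (simp add: permutations_of_multiset_def)
   qed
   hence "card ?S <= card (permutations_of_multiset (mset a))" by (intro card_mono) auto
   also have "... <= fact (length a)" by (simp add: card_permutations_of_multiset)
   finally show ?thesis using a by (simp add: nl_def)
  qed (auto simp del: Collect_empty_eq)
  hence "real (card ?S) <= fact n" by (metis of_nat_fact of_nat_le_iff)
  hence "real (card ?S) * F \<alpha> <= fact n * F \<alpha>" using F by (rule mult_right_mono)
  thus "(SUM is:?S. F (cnt d is)) <= fact n * F \<alpha>" by simp
 qed
 finally show ?thesis by (simp add: sum_distrib_left)
qed

section \<open>Convolution with a product kernel\<close>

definition mn :: "nat => vec => vec => vec" where
 "mn d x y = (\<lambda>i\<in>{..<d}. x i - y i)"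

lemma mn_Rd: "mn d x y : Rd d" by (simp add: mn_def Rd_def)

locale moll =
 fixes d :: nat and e :: real and ka :: "nat => real => real"
 assumes e0: "0 < e" and e1: "e <= 1"
  and ka_DERIV: "!!n s. (ka n has_real_derivative ka (Suc n) s) (at s)"
  and ka_supp: "!!n s. e < \<bar>s\<bar> ==> ka n s = 0"
  and ka_nonneg: "!!s. 0 <= ka 0 s"
  and ka_int: "has_bochner_integral lborel (ka 0) 1"
begin

sublocale L: product_sigma_finite "%_::nat. lborel :: real measure" ..

lemma ka_cont: "continuous_on A (ka n)"
 by (rule DERIV_continuous_on[OF has_field_derivative_at_within[OF ka_DERIV]])

lemma ka_meas: "ka n : borel_measurable borel"
 using ka_cont borel_measurable_continuous_onI by blast

definition be :: "nat => real" where "be n = (SOME B. ALL s. \<bar>ka n s\<bar> <= B)"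

lemma be: "\<bar>ka n s\<bar> <= be n"
proof -
 have "compact (ka n ` {-e..e})" by (intro compact_continuous_image ka_cont compact_Icc)
 then obtain B where B: "!!s. s : {-e..e} ==> \<bar>ka n s\<bar> <= B" using compact_imp_bounded by (fastforce simp: bounded_iff)
 have "\<bar>ka n s\<bar> <= \<bar>B\<bar>" for s
 proof (cases "s : {-e..e}")
  case True thus ?thesis using B[OF True] by linarith
 next
  case False
  hence "e < \<bar>s\<bar>" by auto
  thus ?thesis using ka_supp by simp
 qed
 hence "EX B. ALL s. \<bar>ka n s\<bar> <= B" by blast
 from someI_ex[OF this] show ?thesis unfolding be_def by blast
qed

lemma be_nonneg: "0 <= be n" using be[of n 0] by linarith

text \<open>The derivative of multi-index \<open>a\<close> of the product kernel, taken at x - y;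
  only the first \<open>d\<close> coordinates of x matter, so convolutions do not depend on the mesh
  size coordinate.\<close>

definition R :: "(nat => nat) => vec => vec => real" where
 "R a x y = (PROD i<d. ka (a i) (x i - y i))"

abbreviation "R0 \<equiv> R (%_. 0)"

text \<open>An integrable majorant for the kernels centred at all x' within distance 1 of x in each
  coordinate: half-width 2 is this displacement plus the radius e \<le> 1 of the support.\<close>

definition W :: "(nat => nat) => vec => vec => real" where
 "W a x y = (PROD i<d. be (a i) * indicator {x i - 2..x i + 2} (y i))"

lemma R_cong: "(!!i. i < d ==> a i = b i) ==> R a x y = R b x y" by (simp add: R_def)

lemma R_le:
 assumes "!!i. i < d ==> \<bar>x' i - x i\<bar> <= 1"
 shows "\<bar>R a x' y\<bar> <= W a x y"
 unfolding R_def W_def abs_prod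
proof (intro prod_mono conjI)
 fix i assume "i : {..<d}"
 hence i: "\<bar>x' i - x i\<bar> <= 1" using assms by simp
 show "\<bar>ka (a i) (x' i - y i)\<bar> <= be (a i) * indicator {x i - 2..x i + 2} (y i)"
 proof (cases "y i : {x i - 2..x i + 2}")
  case False
  hence "e < \<bar>x' i - y i\<bar>" using i e1 by (auto simp: abs_if split: if_splits)
  thus ?thesis using ka_supp False by simp
 qed (use be in simp)
qed simp

lemma integrable_W: "integrable (Leb d) (W a x)" and integral_W: "(\<integral>y. W a x y \<partial>Leb d) = (PROD i<d. be (a i) * 4)"
proof -
 have i: "integrable lborel (%s::real. be (a i) * indicator {x i - 2..x i + 2} s)" for i by (intro integrable_mult_right) simp
 show "integrable (Leb d) (W a x)"
  unfolding W_def[abs_def] Leb_def by (rule L.product_integrable_prod[OF _ i]) simp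
 have "(\<integral>y. W a x y \<partial>Leb d) = (PROD i<d. \<integral>s. be (a i) * indicator {x i - 2..x i + 2} s \<partial>lborel)"
  unfolding W_def[abs_def] Leb_def by (rule L.product_integral_prod[OF _ i]) simp
 thus "(\<integral>y. W a x y \<partial>Leb d) = (PROD i<d. be (a i) * 4)" by simp
qed

lemma R_meas [measurable]: "R a x : borel_measurable (Leb d)"
 unfolding R_def[abs_def]
proof (rule borel_measurable_prod)
 show "(%y. ka (a i) (x i - y i)) : borel_measurable (Leb d)" for i
  by (rule measurable_compose[OF _ ka_meas]) (intro borel_measurable_diff borel_measurable_const Leb_coord)
qed

lemma R0_nonneg: "0 <= R0 x y" by (auto simp: R_def intro!: prod_nonneg ka_nonneg)

lemma R0_int: "has_bochner_integral (Leb d) (R0 x) 1"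
proof -
 have s: "has_bochner_integral lborel (%s. ka 0 (x i - s)) 1" for i
  using lborel_has_bochner_integral_real_affine_iff[of "-1" "ka 0" 1 "x i"] ka_int by simp
 hence i: "integrable lborel (%s. ka 0 (x i - s))" "(\<integral>s. ka 0 (x i - s) \<partial>lborel) = 1" for i
  by (auto simp: has_bochner_integral_iff)
 show ?thesis unfolding has_bochner_integral_iff R_def[abs_def] Leb_def
  using L.product_integrable_prod[of "{..<d}" "%i s. ka 0 (x i - s)"] L.product_integral_prod[of "{..<d}" "%i s. ka 0 (x i - s)"] i
  by simp
qed

text \<open>Boundedness almost everywhere, because the functions to be convolved include generalized
  derivatives, which are determined only up to null sets.\<close>

definition gb :: "real => (vec => real) => bool" where
 "gb C ps \<longleftrightarrow> ps : borel_measurable (Leb d) & (AE y in Leb d. \<bar>ps y\<bar> <= C)"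

lemma gbI: "ps : borel_measurable (Leb d) ==> (!!y. y : Rd d ==> \<bar>ps y\<bar> <= C) ==> gb C ps"
 unfolding gb_def by (auto simp: space_Leb intro!: AE_I2)

lemma integrable_R:
 assumes "gb C ps" shows "integrable (Leb d) (%y. ps y * R a x y)"
proof (rule Bochner_Integration.integrable_bound[of _ "%y. C * W a x y"])
 show "AE y in Leb d. norm (ps y * R a x y) <= norm (C * W a x y)"
  using assms[unfolded gb_def, THEN conjunct2]
 proof eventually_elim
  fix y assume y: "\<bar>ps y\<bar> <= C"
  have "\<bar>R a x y\<bar> <= W a x y" by (rule R_le) simp
  hence "\<bar>ps y\<bar> * \<bar>R a x y\<bar> <= C * W a x y" using y by (intro mult_mono) auto
  hence "\<bar>ps y * R a x y\<bar> <= C * W a x y" by (simp add: abs_mult)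
  thus "norm (ps y * R a x y) <= norm (C * W a x y)" unfolding real_norm_def by linarith
 qed
qed (use assms integrable_W in "auto simp: gb_def")

definition cv :: "(nat => nat) => (vec => real) => vec => real" where
 "cv a ps x = (\<integral>y. ps y * R a x y \<partial>Leb d)"

abbreviation "cv0 \<equiv> cv (%_. 0)"

lemma cv_cong: "(!!i. i < d ==> a i = b i) ==> cv a ps x = cv b ps x"
 unfolding cv_def using R_cong[of a b] by simp

lemma cv_upd: "cv a ps (x(d := h)) = cv a ps x" by (simp add: cv_def R_def)

lemma cv_fun_cong: "(!!y. y : Rd d ==> ps y = \<xi> y) ==> cv a ps x = cv a \<xi> x"
 unfolding cv_def by (rule Bochner_Integration.integral_cong) (auto simp: space_Leb)

lemma cv_uminus: "cv a (%y. - ps y) x = - cv a ps x" by (simp add: cv_def)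

lemma cv_mono:
 assumes "gb C ps" "!!y. y : Rd d ==> A <= ps y"
 shows "A <= cv0 ps x"
proof -
 have "(\<integral>y. A * R0 x y \<partial>Leb d) <= cv0 ps x" unfolding cv_def
  by (rule integral_mono) (use R0_int integrable_R[OF assms(1)] assms(2) R0_nonneg in "auto simp: has_bochner_integral_iff space_Leb intro!: mult_right_mono")
 thus ?thesis using R0_int by (simp add: has_bochner_integral_iff)
qed

lemma cv_lin:
 assumes "gb C ps" "gb C' \<xi>"
 shows "cv a (%y. s * ps y + r * \<xi> y) x = s * cv a ps x + r * cv a \<xi> x"
proof -
 have "cv a (%y. s * ps y + r * \<xi> y) x = (\<integral>y. s * (ps y * R a x y) + r * (\<xi> y * R a x y) \<partial>Leb d)"
  unfolding cv_def by (simp add: algebra_simps)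
 thus ?thesis unfolding cv_def using integrable_R[OF assms(1)] integrable_R[OF assms(2)] by simp
qed

lemma cv_close:
 assumes g: "gb C ps" and c: "!!y. y : Rd d ==> (!!i. i < d ==> \<bar>y i - x i\<bar> <= e) ==> \<bar>ps y - s\<bar> <= et"
 shows "\<bar>cv0 ps x - s\<bar> <= et"
proof -
 have i: "integrable (Leb d) (R0 x)" "(\<integral>y. R0 x y \<partial>Leb d) = 1" using R0_int by (auto simp: has_bochner_integral_iff)
 have eq: "cv0 ps x - s = (\<integral>y. ps y * R0 x y - s * R0 x y \<partial>Leb d)" unfolding cv_def using integrable_R[OF g] i by simp
 have "\<bar>cv0 ps x - s\<bar> <= (\<integral>y. \<bar>ps y * R0 x y - s * R0 x y\<bar> \<partial>Leb d)" unfolding eq by (rule integral_abs_bound)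
 also have "... <= (\<integral>y. et * R0 x y \<partial>Leb d)"
 proof (rule integral_mono)
  fix y assume "y : space (Leb d)"
  hence y: "y : Rd d" by (simp add: space_Leb)
  show "\<bar>ps y * R0 x y - s * R0 x y\<bar> <= et * R0 x y"
  proof (cases "ALL i<d. \<bar>y i - x i\<bar> <= e")
   case True
   hence "\<bar>ps y - s\<bar> * R0 x y <= et * R0 x y" using c[OF y] R0_nonneg by (intro mult_right_mono) auto
   thus ?thesis using R0_nonneg[of x y] by (simp add: abs_mult left_diff_distrib[symmetric])
  next
   case False
   then obtain j where "j < d" "e < \<bar>x j - y j\<bar>" by (auto simp: abs_minus_commute)
   hence "R0 x y = 0" unfolding R_def using ka_supp by (intro prod_zero) auto
   thus ?thesis by simp
  qed
 qed (use integrable_R[OF g] i in auto)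
 finally show ?thesis using i by simp
qed

lemma R_DERIV:
 assumes i: "i < d"
 shows "((%s. R a (x(i := s)) y) has_real_derivative R (a(i := Suc (a i))) (x(i := s0)) y) (at s0)"
  and "((%s. R a x (y(i := s))) has_real_derivative - R (a(i := Suc (a i))) x (y(i := s0))) (at s0)"
proof -
 let ?r = "PROD j:{..<d} - {i}. ka (a j) (x j - y j)"
 have *: "R a' (x(i := s)) y = ka (a' i) (s - y i) * (PROD j:{..<d} - {i}. ka (a' j) (x j - y j))"
  "R a' x (y(i := s)) = ka (a' i) (x i - s) * (PROD j:{..<d} - {i}. ka (a' j) (x j - y j))" for a' s
  unfolding R_def using i by (subst prod.remove[of _ i]; auto)+
 have r: "(PROD j:{..<d} - {i}. ka ((a(i := Suc (a i))) j) (x j - y j)) = ?r" by (rule prod.cong) auto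
 have "((%s. ka (a i) (s - y i)) has_real_derivative ka (Suc (a i)) (s0 - y i) * 1) (at s0)"
  by (rule DERIV_chain2[OF ka_DERIV]) (auto intro!: derivative_eq_intros)
 from DERIV_cmult_right[OF this, of ?r]
 show "((%s. R a (x(i := s)) y) has_real_derivative R (a(i := Suc (a i))) (x(i := s0)) y) (at s0)"
  unfolding * r by simp
 have "((%s. ka (a i) (x i - s)) has_real_derivative ka (Suc (a i)) (x i - s0) * - 1) (at s0)"
  by (rule DERIV_chain2[OF ka_DERIV]) (auto intro!: derivative_eq_intros)
 from DERIV_cmult_right[OF this, of ?r]
 show "((%s. R a x (y(i := s))) has_real_derivative - R (a(i := Suc (a i))) x (y(i := s0))) (at s0)"
  unfolding * r by simp
qed

lemma cv_DERIV:
 assumes i: "i < d" and g: "gb C ps" and b: "!!y. y : Rd d ==> \<bar>ps y\<bar> <= C"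
 shows "((%s. cv a ps (x(i := s))) has_real_derivative cv (a(i := Suc (a i))) ps x) (at (x i))"
proof -
 let ?a = "a(i := Suc (a i))"
 have "((%s. \<integral>y. ps y * R a (x(i := s)) y \<partial>Leb d) has_real_derivative (\<integral>y. ps y * R ?a (x(i := x i)) y \<partial>Leb d)) (at (x i))"
 proof (rule deriv_under_integral(2)[where S = "{x i - 1<..<x i + 1}" and w = "%y. C * W ?a x y"])
  show "((%s. ps y * R a (x(i := s)) y) has_real_derivative ps y * R ?a (x(i := s)) y) (at s)" for y s
   by (rule DERIV_cmult[OF R_DERIV(1)[OF i]])
  fix y s assume y: "y : space (Leb d)" and s: "s : {x i - 1<..<x i + 1}"
  have "\<bar>R ?a (x(i := s)) y\<bar> <= W ?a x y" by (rule R_le) (use s in auto)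
  thus "\<bar>ps y * R ?a (x(i := s)) y\<bar> <= C * W ?a x y"
   unfolding abs_mult using b[of y] y by (intro mult_mono) (auto simp: space_Leb)
 qed (use integrable_W integrable_R[OF g] in auto)
 thus ?thesis by (simp add: cv_def)
qed

lemma cv_bound:
 assumes g: "gb C ps" and b: "!!y. y : Rd d ==> \<bar>ps y\<bar> <= C" and C: "0 <= C"
 shows "\<bar>cv a ps x\<bar> <= (PROD i<d. be (a i) * 4) * C"
proof -
 have "\<bar>cv a ps x\<bar> <= (\<integral>y. \<bar>ps y * R a x y\<bar> \<partial>Leb d)" unfolding cv_def by (rule integral_abs_bound)
 also have "... <= (\<integral>y. C * W a x y \<partial>Leb d)"
 proof (rule integral_mono)
  fix y assume y: "y : space (Leb d)"
  have "\<bar>R a x y\<bar> <= W a x y" by (rule R_le) simp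
  thus "\<bar>ps y * R a x y\<bar> <= C * W a x y"
   unfolding abs_mult using b[of y] y C by (intro mult_mono) (auto simp: space_Leb)
 qed (use integrable_W integrable_R[OF g] in auto)
 finally show ?thesis by (simp add: integral_W mult.commute)
qed

lemma domain_UNIV: "domR UNIV UNIV (%_. UNIV) d"
 by unfold_locales auto

text \<open>The factor depends on the kernel and on \<open>d\<close> and serves smoothness only; the
  quantitative bounds come from \<open>D2_cv_le\<close>.\<close>

lemma BD_cv: "EX B>=0. ALL C ps. ps : borel_measurable (Leb d) --> (ALL y:Rd d. \<bar>ps y\<bar> <= C) --> 0 <= C --> BD UNIV UNIV N (B * C) (cv a ps)"
proof (induction N arbitrary: a)
 case 0
 have "BD UNIV UNIV 0 ((PROD i<d. be (a i) * 4) * C) (cv a ps)"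
  if "ps : borel_measurable (Leb d)" "ALL y:Rd d. \<bar>ps y\<bar> <= C" "0 <= C" for C ps
  using cv_bound[OF gbI, of ps C] that by auto
 moreover have "0 <= (PROD i<d. be (a i) * 4)" by (intro prod_nonneg) (use be_nonneg in auto)
 ultimately show ?case by blast
next
 case (Suc N)
 interpret U: domR UNIV UNIV "%_. UNIV" d by (rule domain_UNIV)
 let ?a = "%i. a(i := Suc (a i))"
 have "ALL i. EX B>=0. ALL C ps. ps : borel_measurable (Leb d) --> (ALL y:Rd d. \<bar>ps y\<bar> <= C) --> 0 <= C --> BD UNIV UNIV N (B * C) (cv (?a i) ps)"
  using Suc.IH by blast
 then obtain Bf where Bf: "!!i. 0 <= Bf i" "!!i C ps. ps : borel_measurable (Leb d) ==> (ALL y:Rd d. \<bar>ps y\<bar> <= C) ==> 0 <= C ==> BD UNIV UNIV N (Bf i * C) (cv (?a i) ps)"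
  by metis
 define B where "B = (PROD i<d. be (a i) * 4) + (SUM i<d. Bf i)"
 have p: "0 <= (PROD i<d. be (a i) * 4)" by (intro prod_nonneg) (use be_nonneg in auto)
 have s: "0 <= (SUM i<d. Bf i)" using Bf(1) by (simp add: sum_nonneg)
 have "BD UNIV UNIV (Suc N) (B * C) (cv a ps)"
  if m: "ps : borel_measurable (Leb d)" and b: "ALL y:Rd d. \<bar>ps y\<bar> <= C" and C: "0 <= C" for C ps
 proof (rule U.BD_SucI[where ps = "%i. if i < d then cv (?a i) ps else (%_. 0)"])
  have g: "gb C ps" by (rule gbI[OF m]) (use b in auto)
  have "(PROD i<d. be (a i) * 4) * C <= B * C" using C s by (intro mult_right_mono) (auto simp: B_def)
  thus "\<bar>cv a ps x\<bar> <= B * C" for x using cv_bound[OF g _ C, of a x] b by fastforce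
  show "((%s. cv a ps (x(i := s))) has_real_derivative (if i < d then cv (?a i) ps else (%_. 0)) x) (at (x i))" for i x
  proof (cases "i < d")
   case True thus ?thesis using cv_DERIV[OF True g, of a x] b by simp
  next
   case False
   hence "cv a ps (x(i := s)) = cv a ps x" for s unfolding cv_def R_def by (intro Bochner_Integration.integral_cong refl) auto
   thus ?thesis using False by simp
  qed
  fix i
  show "BD UNIV UNIV N (B * C) (if i < d then cv (?a i) ps else (%_. 0))"
  proof (cases "i < d")
   case True
   have "Bf i <= (SUM i<d. Bf i)" using True Bf(1) by (intro member_le_sum) auto
   hence "Bf i * C <= B * C" using C p by (intro mult_right_mono) (auto simp: B_def)
   thus ?thesis using True U.BD_mono[OF Bf(2)[OF m b C, of i]] by auto
  next
   case False
   have "0 <= B * C" using p s C by (simp add: B_def)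
   thus ?thesis using False U.BD_const[of 0 "B * C" N] by simp
  qed
 qed
 moreover have "0 <= B" using p s by (simp add: B_def)
 ultimately show ?case by blast
qed

lemma SM_cv:
 assumes "!!t. t : I ==> ps t : borel_measurable (Leb d)" "!!t y. t : I ==> y : Rd d ==> \<bar>ps t y\<bar> <= C"
 shows "SM UNIV UNIV I (%t. cv a (ps t))"
 unfolding SM_def
proof
 fix N
 obtain B where B: "!!C ps. ps : borel_measurable (Leb d) ==> (ALL y:Rd d. \<bar>ps y\<bar> <= C) ==> 0 <= C ==> BD UNIV UNIV N (B * C) (cv a ps)"
  using BD_cv[of N a] by blast
 have "BD UNIV UNIV N (B * \<bar>C\<bar>) (cv a (ps t))" if "t : I" for t
  by (rule B) (use assms that in "auto intro: order_trans[OF _ abs_ge_self]")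
 thus "EX C. ALL t:I. BD UNIV UNIV N C (cv a (ps t))" by blast
qed

lemma foldr_cv:
 assumes "ps : borel_measurable (Leb d)" "!!y. y : Rd d ==> \<bar>ps y\<bar> <= C"
 shows "set is \<subseteq> {..<d} ==> foldr pd is (cv0 ps) = cv (cnt d is) ps"
proof (induction "is")
 case Nil show ?case by (simp, rule ext, rule cv_cong) (simp add: cnt_def)
next
 case (Cons i "is")
 have "pd i (cv (cnt d is) ps) x = cv (cnt d (i # is)) ps x" for x
 proof -
  have "pd i (cv (cnt d is) ps) x = cv ((cnt d is)(i := Suc (cnt d is i))) ps x"
   unfolding pd_def by (rule DERIV_imp_deriv, rule cv_DERIV[OF _ gbI]) (use Cons.prems assms in auto)
  also have "... = cv (cnt d (i # is)) ps x" by (rule cv_cong) (use Cons.prems in "auto simp: cnt_def")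
  finally show ?thesis .
 qed
 moreover have "foldr pd is (cv0 ps) = cv (cnt d is) ps" using Cons by simp
 ultimately show ?case by auto
qed

lemma pd_R: "i < d ==> pd i (%y. s * R a x y) = (%y. - s * R (a(i := Suc (a i))) x y)"
proof
 fix y assume "i < d"
 from DERIV_cmult[OF R_DERIV(2)[OF this], of s a x y "y i"]
 show "pd i (%y. s * R a x y) y = - s * R (a(i := Suc (a i))) x y" unfolding pd_def by (intro DERIV_imp_deriv) simp
qed

lemma pdn_R: "i < d ==> (pd i ^^ n) (%y. s * R a x y) = (%y. (- 1) ^ n * s * R (a(i := a i + n)) x y)"
 by (induction n) (simp_all add: pd_R)

lemma foldr_R: "distinct is ==> set is \<subseteq> {..<d} ==>
 foldr (%i. pd i ^^ \<alpha> i) is (%y. R0 x y) = (%y. (- 1) ^ (SUM i:set is. \<alpha> i) * R (%j. if j : set is then \<alpha> j else 0) x y)"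
proof (induction "is")
 case (Cons i "is")
 have "(%j. if j : set is then \<alpha> j else 0)(i := (if i : set is then \<alpha> i else 0) + \<alpha> i) = (%j. if j : set (i # is) then \<alpha> j else 0)"
  using Cons.prems by auto
 thus ?case using Cons by (simp add: pdn_R power_add mult_ac)
qed simp

lemma SM_R: "EX B. BD UNIV UNIV N B (%y. s * R a x y)"
proof (induction N arbitrary: s a)
 case 0
 have "\<bar>R a x y\<bar> <= (PROD i<d. be (a i))" for y unfolding R_def abs_prod by (intro prod_mono) (use be in auto)
 hence "BD UNIV UNIV 0 (\<bar>s\<bar> * (PROD i<d. be (a i))) (%y. s * R a x y)" by (auto simp: abs_mult intro: mult_left_mono)
 thus ?case by blast
next
 case (Suc N)
 interpret U: domR UNIV UNIV "%_. UNIV" d by (rule domain_UNIV)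
 let ?f = "%i y. - s * R (a(i := Suc (a i))) x y"
 have "ALL i. EX B. BD UNIV UNIV N B (?f i)" by (intro allI Suc.IH)
 from choice[OF this] obtain Bf where Bf: "!!i. BD UNIV UNIV N (Bf i) (?f i)" by blast
 have "\<bar>R a x y\<bar> <= (PROD i<d. be (a i))" for y unfolding R_def abs_prod by (intro prod_mono) (use be in auto)
 hence b: "\<bar>s * R a x y\<bar> <= \<bar>s\<bar> * (PROD i<d. be (a i))" for y by (auto simp: abs_mult intro: mult_left_mono)
 define B where "B = \<bar>s\<bar> * (PROD i<d. be (a i)) + (SUM i<d. \<bar>Bf i\<bar>)"
 have B1: "\<bar>s\<bar> * (PROD i<d. be (a i)) <= B" by (simp add: B_def sum_nonneg)
 hence B0: "0 <= B" using b[of undefined] by linarith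
 have "BD UNIV UNIV (Suc N) B (%y. s * R a x y)"
 proof (rule U.BD_SucI[where ps = "%i. if i < d then ?f i else (%_. 0)"])
  show "\<bar>s * R a x y\<bar> <= B" for y using b[of y] B1 by linarith
  show "((%r. s * R a x (y(i := r))) has_real_derivative (if i < d then ?f i else (%_. 0)) y) (at (y i))" for i y
  proof (cases "i < d")
   case True
   thus ?thesis using DERIV_cmult[OF R_DERIV(2)[OF True], of s a x y "y i"] by simp
  qed (simp add: R_def)
  show "BD UNIV UNIV N B (if i < d then ?f i else (%_. 0))" for i
  proof (cases "i < d")
   case True
   have "\<bar>Bf i\<bar> <= (SUM i<d. \<bar>Bf i\<bar>)" using True by (intro member_le_sum) auto
   moreover have "0 <= \<bar>s\<bar> * (PROD i<d. be (a i))" using be_nonneg by (simp add: prod_nonneg)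
   ultimately have "Bf i <= B" unfolding B_def by linarith
   thus ?thesis using True U.BD_mono[OF Bf] by auto
  qed (use U.BD_const B0 in auto)
 qed
 thus ?case by blast
qed

end

lemma BD_all_smooth:
 assumes "!!N. EX C. BD {..<d} (Rd d) N C ph"
 shows "smooth d ph"
proof -
 interpret R: domR "{..<d}" "Rd d" "%_. UNIV" d by (rule domR_Rd)
 have b: "EX C. BD {..<d} (Rd d) (Suc 0) C (foldr pd is ph)" if "set is \<subseteq> {..<d}" for "is"
  using assms[of "Suc 0 + length is"] R.BD_foldr[OF _ that] by blast
 hence "(%s. foldr pd is ph (x(i := s))) differentiable (at (x i))" if "set is \<subseteq> {..<d}" "i < d" "x : Rd d" for "is" i x
  using that b[of "is"] by auto
 thus ?thesis unfolding smooth_def has_partials_def using b BD_continuous by blast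
qed

context moll
begin

lemma test_function_R: "test_function d (R0 x)"
 unfolding test_function_def
proof
 have "EX C. BD {..<d} (Rd d) N C (R0 x)" for N
  using SM_R[of N 1 "%_. 0" x] BD_subset[of UNIV UNIV N _ "R0 x" "{..<d}" "Rd d"] by auto
 thus "smooth d (R0 x)" by (rule BD_all_smooth)
 let ?X = "product_topology (%i. euclidean :: real topology) UNIV"
 let ?S = "%i. if i < d then {x i - e..x i + e} else {undefined}"
 have "compactin ?X (PiE UNIV ?S)" unfolding compactin_PiE by (auto simp: compactin_euclidean_iff)
 hence c: "compact (PiE UNIV ?S)" by (simp add: euclidean_product_topology)
 show "EX C. compact C & C \<subseteq> Rd d & (ALL y:Rd d - C. R0 x y = 0)"
 proof (intro exI conjI ballI)
  show "compact (PiE UNIV ?S)" by (rule c)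
  show "PiE UNIV ?S \<subseteq> Rd d" by (force simp: Rd_def PiE_iff extensional_def split: if_splits)
  fix y assume y: "y : Rd d - PiE UNIV ?S"
  then obtain j where j: "y j ~: ?S j" by (auto simp: PiE_iff)
  hence "j < d" using y by (auto simp: Rd_def PiE_iff extensional_def split: if_splits)
  hence "ka 0 (x j - y j) = 0" using j by (intro ka_supp) auto
  thus "R0 x y = 0" unfolding R_def using \<open>j < d\<close> by (intro prod_zero) auto
 qed
qed

text \<open>The kernel, as a function of y, is itself a test function. Differentiating it in y
  instead of x produces the sign that cancels the one in the definition of the generalized
  derivative.\<close>

lemma cv_gderiv:
 assumes "has_gderiv d \<alpha> ps w"
 shows "cv \<alpha> ps x = cv0 w x"
proof -
 have "Dmulti d \<alpha> (R0 x) = (%y. (- 1) ^ (SUM i<d. \<alpha> i) * R (%j. if j : set [0..<d] then \<alpha> j else 0) x y)"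
  unfolding Dmulti_def using foldr_R[of "[0..<d]" \<alpha> x] by (simp add: lessThan_atLeast0)
 also have "... = (%y. (- 1) ^ (SUM i<d. \<alpha> i) * R \<alpha> x y)"
  by (intro ext arg_cong2[where f = "(*)"] refl R_cong) auto
 finally have D: "Dmulti d \<alpha> (R0 x) = (%y. (- 1) ^ (SUM i<d. \<alpha> i) * R \<alpha> x y)" .
 have "(- 1) ^ (SUM i<d. \<alpha> i) * cv \<alpha> ps x = (\<integral>y. (- 1) ^ (SUM i<d. \<alpha> i) * (ps y * R \<alpha> x y) \<partial>Leb d)"
  unfolding cv_def by simp
 also have "... = (\<integral>y. ps y * Dmulti d \<alpha> (R0 x) y \<partial>Leb d)" unfolding D by (simp only: mult.left_commute)
 also have "... = (- 1) ^ (SUM i<d. \<alpha> i) * cv0 w x"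
  using assms test_function_R[of x] unfolding has_gderiv_def cv_def by blast
 finally show ?thesis by simp
qed

text \<open>Jensen's inequality: the variance of \<open>w\<close> with respect to the probability
  density \<open>R0 x\<close> is nonnegative.\<close>

lemma cv_square_le:
 assumes w: "gb C w"
 shows "(cv0 w x)^2 <= cv0 (%y. (w y)\<^sup>2) x" "gb (C^2) (%y. (w y)\<^sup>2)"
proof -
 have C: "AE y in Leb d. (w y)\<^sup>2 <= C^2"
  using w[unfolded gb_def, THEN conjunct2] by eventually_elim (simp add: abs_le_square_iff[symmetric])
 show g: "gb (C^2) (%y. (w y)\<^sup>2)" using w C unfolding gb_def by auto
 define c where "c = cv0 w x"
 have i: "integrable (Leb d) (R0 x)" "(\<integral>y. R0 x y \<partial>Leb d) = 1" using R0_int by (auto simp: has_bochner_integral_iff)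
 have "0 <= (\<integral>y. (w y - c)\<^sup>2 * R0 x y \<partial>Leb d)" using R0_nonneg by (intro Bochner_Integration.integral_nonneg) auto
 also have "... = (\<integral>y. (w y)\<^sup>2 * R0 x y - 2 * c * (w y * R0 x y) + c^2 * R0 x y \<partial>Leb d)"
  by (simp add: power2_eq_square algebra_simps)
 also have "... = cv0 (%y. (w y)\<^sup>2) x - 2 * c * c + c^2"
  using integrable_R[OF w] integrable_R[OF g] i by (simp add: cv_def c_def)
 finally show "(cv0 w x)^2 <= cv0 (%y. (w y)\<^sup>2) x" by (simp add: c_def power2_eq_square)
qed

lemma D2_cv_le:
 assumes ps: "ps : borel_measurable (Leb d)" "!!y. y : Rd d ==> \<bar>ps y\<bar> <= C"
  and g: "!!\<alpha>. \<alpha> : multi_index d n ==> has_gderiv d \<alpha> ps (gderiv d \<alpha> ps) & gb B (gderiv d \<alpha> ps)"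
 shows "D2 d n (cv0 ps) x <= fact n * cv0 (gDnorm_sq d n ps) x"
  and "gDnorm_sq d n ps : borel_measurable (Leb d)" and "integrable (Leb d) (%y. gDnorm_sq d n ps y * R0 x y)"
proof -
 let ?w = "%\<alpha>. gderiv d \<alpha> ps"
 have "D2 d n (cv0 ps) x = (SUM is:nl {..<d} n. (cv (cnt d is) ps x)\<^sup>2)"
  unfolding D2_def by (intro sum.cong refl) (simp add: nl_def foldr_cv[OF ps])
 also have "... <= fact n * (SUM \<alpha>:multi_index d n. (cv \<alpha> ps x)\<^sup>2)" by (rule sum_nl_multi_index) simp
 also have "(SUM \<alpha>:multi_index d n. (cv \<alpha> ps x)\<^sup>2) <= (SUM \<alpha>:multi_index d n. cv0 (%y. (?w \<alpha> y)\<^sup>2) x)"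
  by (intro sum_mono) (use g cv_gderiv cv_square_le(1) in fastforce)
 also have "... = cv0 (gDnorm_sq d n ps) x"
  unfolding cv_def gDnorm_sq_def sum_distrib_right
  by (rule Bochner_Integration.integral_sum[symmetric]) (use integrable_R[OF cv_square_le(2)] g in blast)
 finally show "D2 d n (cv0 ps) x <= fact n * cv0 (gDnorm_sq d n ps) x" by simp
 show "gDnorm_sq d n ps : borel_measurable (Leb d)"
  unfolding gDnorm_sq_def[abs_def] using g by (intro borel_measurable_sum borel_measurable_power) (auto simp: gb_def)
 show "integrable (Leb d) (%y. gDnorm_sq d n ps y * R0 x y)"
  unfolding gDnorm_sq_def sum_distrib_right
  by (rule Bochner_Integration.integrable_sum) (use integrable_R[OF cv_square_le(2)] g in blast)
qed

lemma integral_R0_le: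
 assumes "integrable (Leb d) (%y. G y * R0 x y)" "AE y in Leb d. G y <= S"
 shows "cv0 G x <= S"
proof -
 have i: "integrable (Leb d) (R0 x)" "(\<integral>y. R0 x y \<partial>Leb d) = 1" using R0_int by (auto simp: has_bochner_integral_iff)
 have "cv0 G x <= (\<integral>y. S * R0 x y \<partial>Leb d)"
  unfolding cv_def
 proof (rule integral_mono_AE)
  show "AE y in Leb d. G y * R0 x y <= S * R0 x y" using assms(2) by eventually_elim (use R0_nonneg in "auto intro: mult_right_mono")
 qed (use assms(1) i in auto)
 thus ?thesis using i by simp
qed

lemma cv_time_meas:
 assumes "borel_on d {0..T} ps"
 shows "(%t. cv a (ps t) x) : time_measurable T"
proof -
 interpret sigma_finite_measure "Leb d" by (rule sigma_finite_Leb)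
 have "case_prod ps : borel_measurable (restrict_space borel {0..T} \<Otimes>\<^sub>M Leb d)"
  using assms measurable_cong_sets[OF sets_pair_measure_cong[OF refl sets_Leb] refl] unfolding borel_on_def by blast
 hence "(%z. case_prod ps z * R a x (snd z)) : borel_measurable (restrict_space borel {0..T} \<Otimes>\<^sub>M Leb d)"
  using measurable_compose[OF measurable_snd R_meas] by (intro borel_measurable_times) auto
 hence "(%(t, y). ps t y * R a x y) : borel_measurable (restrict_space borel {0..T} \<Otimes>\<^sub>M Leb d)"
  by (simp add: case_prod_beta')
 from borel_measurable_lebesgue_integral[OF this] show ?thesis by (simp add: cv_def)
qed

end

lemma borel_on_section:
 assumes "borel_on d I ps" "t : I"
 shows "ps t : borel_measurable (Leb d)"
proof -
 have "t : space (restrict_space borel I)" using assms(2) by (simp add: space_restrict_space)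
 from measurable_compose[OF measurable_Pair1'[OF this] assms(1)[unfolded borel_on_def]]
 show ?thesis by (subst measurable_cong_sets[OF sets_Leb refl]) simp
qed

lemma distr_mn: "distr (Leb d) (Leb d) (mn d x) = Leb d"
proof -
 interpret product_sigma_finite "%_::nat. lborel :: real measure" ..
 have m: "mn d x : measurable (Leb d) (Leb d)"
  unfolding mn_def[abs_def] Leb_def
 proof (rule measurable_restrict)
  fix i assume "i : {..<d}"
  have "(%y. x i - y i) : borel_measurable (Leb d)" by (intro borel_measurable_diff borel_measurable_const Leb_coord)
  thus "(%y. x i - y i) : measurable (PiM {..<d} (%_. lborel)) lborel" by (simp add: Leb_def)
 qed
 show ?thesis unfolding Leb_def
 proof (rule PiM_eqI)
  fix A :: "nat => real set" assume A: "!!i. i : {..<d} ==> A i : sets lborel"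
  have v: "mn d x -` (PiE {..<d} A) \<inter> space (Leb d) = PiE {..<d} (%i. (%s. x i - s) -` A i)"
   by (auto simp: space_Leb Rd_def mn_def PiE_iff extensional_def)
  have ms: "(%s. x i - s) -` A i : sets lborel" if "i < d" for i
   using measurable_sets[of "%s. x i - s" borel borel "A i"] A that by simp
  have em: "emeasure lborel ((%s. x i - s) -` A i) = emeasure lborel (A i)" if "i < d" for i
  proof -
   have "emeasure lborel (A i) = emeasure (density (distr lborel borel (%s. x i + (-1) * s)) (%_. ennreal \<bar>-1\<bar>)) (A i)"
    using lborel_real_affine[of "-1" "x i"] by simp
   also have "... = emeasure (distr lborel borel (%s. x i - s)) (A i)" by (simp add: density_1)
   also have "... = emeasure lborel ((%s. x i - s) -` A i)" using A that by (subst emeasure_distr) auto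
   finally show ?thesis by simp
  qed
  have "emeasure (distr (Leb d) (Leb d) (mn d x)) (PiE {..<d} A) = emeasure (Leb d) (PiE {..<d} (%i. (%s. x i - s) -` A i))"
   unfolding v[symmetric] using A by (subst emeasure_distr[OF m]) (auto simp: Leb_def intro!: sets_PiM_I_finite)
  also have "... = (PROD i<d. emeasure lborel (A i))"
   unfolding Leb_def using ms em by (subst emeasure_PiM) auto
  finally show "emeasure (distr (PiM {..<d} (%_. lborel)) (PiM {..<d} (%_. lborel)) (mn d x)) (PiE {..<d} A) = (PROD i:{..<d}. emeasure lborel (A i))"
   by (simp add: Leb_def)
 qed auto
qed

lemma mn_meas: "mn d x : measurable (Leb d) (Leb d)"
proof -
 have "(%y. x i - y i) : borel_measurable (Leb d)" for i by (intro borel_measurable_diff borel_measurable_const Leb_coord)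
 thus ?thesis unfolding mn_def[abs_def] by (subst (2) Leb_def) (rule measurable_restrict, simp)
qed

context moll
begin

definition \<rho> :: "vec => real" where "\<rho> y = R0 (%_. 0) (%i. - y i)"

lemma \<rho>_nonneg: "0 <= \<rho> y" by (simp add: \<rho>_def R0_nonneg)

lemma R0_mn: "R0 x (mn d x y) = \<rho> y" by (auto simp: \<rho>_def R_def mn_def intro!: prod.cong)

text \<open>After the substitution of x - y for y, mollification is an average of translates with
  weights independent of x. In this form it can be applied to an inequality that holds at every
  point x - y.\<close>

lemma cv_mn:
 assumes "gb C ps"
 shows "has_bochner_integral (Leb d) (%y. \<rho> y * ps (mn d x y)) (cv0 ps x)"
proof -
 have m: "(%y. ps y * R0 x y) : borel_measurable (Leb d)" using assms R_meas by (auto simp: gb_def)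
 have "has_bochner_integral (distr (Leb d) (Leb d) (mn d x)) (%y. ps y * R0 x y) (cv0 ps x)"
  unfolding distr_mn using integrable_R[OF assms] by (simp add: cv_def has_bochner_integral_iff)
 thus ?thesis unfolding has_bochner_integral_iff
  using integrable_distr_eq[OF mn_meas m] integral_distr[OF mn_meas m] by (simp add: R0_mn mult.commute)
qed

lemma \<rho>_int: "has_bochner_integral (Leb d) \<rho> 1"
proof -
 have "gb 1 (%_. 1)" by (rule gbI) auto
 from cv_mn[OF this, of undefined] R0_int[of undefined] show ?thesis by (simp add: cv_def has_bochner_integral_iff)
qed

end

text \<open>The operator is applied to the sum of the \<open>G u\<close>, which is at most the
  constant B, and positivity together with P 1 \<le> 1 finishes. Bounding the terms one by one would
  bring in the number of tuples.\<close>

lemma K_ops_sum_le: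
 assumes P: "P : K_ops d" and F: "finite F" and G: "!!u. u : F ==> bounded_borel d (G u)"
  and le: "!!y. y : Rd d ==> (SUM u:F. G u y) <= B" and B: "0 <= B" and x: "x : Rd d"
 shows "(SUM u:F. P (G u) x) <= B"
proof -
 have lin: "P (%y. a * ps y + b * \<xi> y) x = a * P ps x + b * P \<xi> x" if "bounded_borel d ps" "bounded_borel d \<xi>" for a b ps \<xi>
  using P that x unfolding K_ops_def by blast
 have one: "bounded_borel d (%_. a)" for a by (auto simp: bounded_borel_def bounded_iff)
 have add: "bounded_borel d (%y. ps y + \<xi> y)" if "bounded_borel d ps" "bounded_borel d \<xi>" for ps \<xi>
  using that bounded_plus_comp[of ps "Rd d" \<xi>] by (auto simp: bounded_borel_def)
 have s: "bounded_borel d (%y. SUM u:F. G u y) & P (%y. SUM u:F. G u y) x = (SUM u:F. P (G u) x)"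
  using F G
 proof (induction F rule: finite_induct)
  case empty
  thus ?case using lin[OF one one, of 0 0 0 0] one by simp
 next
  case (insert u F)
  hence i: "bounded_borel d (G u)" "bounded_borel d (%y. SUM u:F. G u y)" "P (%y. SUM u:F. G u y) x = (SUM u:F. P (G u) x)" by auto
  show ?case using lin[OF i(1,2), of 1 1] add[OF i(1,2)] i(3) insert.hyps by simp
 qed
 let ?S = "%y. SUM u:F. G u y"
 have d: "P (%y. B * 1 + (-1) * ?S y) x = B * P (%_. 1) x + (-1) * P ?S x" using lin[OF one] s by blast
 have nb: "bounded_borel d (%y. - ?S y)" using s by (auto simp: bounded_borel_def bounded_iff)
 have "bounded_borel d (%y. B * 1 + (-1) * ?S y)" using add[OF one nb, of B] by simp
 hence "0 <= P (%y. B * 1 + (-1) * ?S y) x" using P x le unfolding K_ops_def by fastforce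
 moreover have "B * P (%_. 1) x <= B" using P x B unfolding K_ops_def by (auto intro: mult_left_le)
 ultimately show ?thesis using d s by linarith
qed

section \<open>The structural inequalities for mollified coefficients\<close>

definition tsl :: "nat => vec => (vec => real) => vec => real" where
 "tsl d y ph = (%w. ph (tr d 1 y w))"

lemma tl_mn: "x : Rd d ==> tsl d y ph (mn d x y) = ph x"
 unfolding tsl_def by (rule arg_cong[where f = ph]) (auto simp: tr_def mn_def Rd_def PiE_iff extensional_def)

lemma pd_tl: "i < d ==> pd i (tsl d y ph) = tsl d y (pd i ph)"
proof
 fix w assume i: "i < d"
 have u: "tr d 1 y (w(i := s)) = (tr d 1 y w)(i := s + y i)" for s using i by (auto simp: tr_def)
 have "deriv (%s. f (s + b)) a = deriv f (a + b)" for f :: "real => real" and a b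
  unfolding deriv_def DERIV_shift ..
 from this[of "%r. ph ((tr d 1 y w)(i := r))" "y i" "w i"]
 show "pd i (tsl d y ph) w = tsl d y (pd i ph) w" unfolding pd_def tsl_def u using i by (simp add: tr_def)
qed

locale structured = S: scheme d La ell \<tau>0 \<tau> q p c for d La ell \<tau>0 \<tau> q p c +
 fixes h0 T de K :: real and m :: nat
 assumes fin: "finite La" and de1: "de <= 1" and K1: "1 <= K" and m1: "1 <= m"
  and qp: "h : {0<..h0} ==> l : La ==> t : {0..T} ==> x : Rd d ==> 0 <= q l t x + h * p l t x"
  and c: "t : {0..T} ==> x : Rd d ==> 0 <= c t x"
  and first: "S.first_structural h0 T de K m" and second: "S.second_structural h0 T de K m"
begin

sublocale D: domR "{..<d}" "Rd d" "%_. UNIV" d by (rule domR_Rd)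

abbreviation S1 :: "(vec => real) => bool" where "S1 ph \<equiv> SM {..<d} (Rd d) (UNIV :: unit set) (%_. ph)"

lemma S1_BD: "S1 ph \<longleftrightarrow> (ALL N. EX C. BD {..<d} (Rd d) N C ph)" by (simp add: SM_def)

lemma fin_nl: "finite (nl S.\<Lambda> n)" using fin by (simp add: S.\<Lambda>_def finite_nl)

lemma tuples_nl: "tuples S.\<Lambda> n = nl S.\<Lambda> n" by (simp add: tuples_def nl_def)

lemma dbar_append: "S.dbar h (mu @ mu') ph = S.dbar h mu (S.dbar h mu' ph)" by (simp add: S.dbar_def)

lemma ell_inv: "nu : S.\<Lambda> ==> nu ~: La ==> inv_into {..<d} ell nu < d"
 using inv_into_into[of nu ell "{..<d}"] by (auto simp: S.\<Lambda>_def)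

lemma BD_dbar1:
 assumes nu: "nu : S.\<Lambda>" and B: "BD {..<d} (Rd d) (Suc N) C ph"
 shows "EX C. BD {..<d} (Rd d) N C (S.dbar1 h nu ph)"
proof (cases "nu : La")
 case True
 have b: "BD {..<d} (Rd d) N C ph" using D.BD_mono[OF B] by simp
 have "BD {..<d} (Rd d) N (\<bar>\<tau> nu / h\<bar> * C + \<bar>- (\<tau> nu / h)\<bar> * C) (%x. \<tau> nu / h * ph (tr d h nu x) + - (\<tau> nu / h) * ph x)"
  by (intro D.BD_add D.BD_cmult D.BD_tr b)
 hence "BD {..<d} (Rd d) N (\<bar>\<tau> nu / h\<bar> * C + \<bar>- (\<tau> nu / h)\<bar> * C) (S.dbar1 h nu ph)"
  by (rule D.BD_cong[THEN iffD1, rotated]) (simp add: S.dbar1_def True shift_tr algebra_simps)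
 thus ?thesis by blast
next
 case False
 have "BD {..<d} (Rd d) N (\<bar>\<tau>0\<bar> * C) (%x. \<tau>0 * pd (inv_into {..<d} ell nu) ph x)"
  by (intro D.BD_cmult D.BD_pd[OF B]) (use ell_inv[OF nu False] in simp)
 thus ?thesis unfolding S.dbar1_def[abs_def] using False by auto
qed

lemma BD_dbar: "set mu \<subseteq> S.\<Lambda> ==> BD {..<d} (Rd d) (N + length mu) C ph ==> EX C. BD {..<d} (Rd d) N C (S.dbar h mu ph)"
proof (induction mu arbitrary: N)
 case Nil thus ?case by (auto simp: S.dbar_def)
next
 case (Cons nu mu)
 then obtain C' where "BD {..<d} (Rd d) (Suc N) C' (S.dbar h mu ph)" using Cons.IH[of "Suc N"] by auto
 thus ?case using BD_dbar1[of nu N C'] Cons.prems by (simp add: S.dbar_def)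
qed

lemma S1_dbar: "set mu \<subseteq> S.\<Lambda> ==> S1 ph ==> S1 (S.dbar h mu ph)"
 unfolding S1_BD using BD_dbar by blast

lemma smooth_S1: "S1 ph ==> smooth d ph"
 unfolding S1_BD by (rule BD_all_smooth) blast

lemma bounded_borel_dbar_sq: "S1 ph ==> bounded_borel d (S.dbar_sq h n ph)"
proof -
 assume ph: "S1 ph"
 have "S1 (%x. SUM mu:nl S.\<Lambda> n. S.dbar h mu ph x * S.dbar h mu ph x)"
  by (intro D.SM_sum D.SM_mult fin_nl S1_dbar ph) (simp_all add: nl_def)
 then obtain C where C: "BD {..<d} (Rd d) (Suc 0) C (%x. SUM mu:nl S.\<Lambda> n. S.dbar h mu ph x * S.dbar h mu ph x)" unfolding S1_BD by blast
 have "S.dbar_sq h n ph = (%x. SUM mu:nl S.\<Lambda> n. S.dbar h mu ph x * S.dbar h mu ph x)"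
  by (rule ext) (simp add: S.dbar_sq_def tuples_nl power2_eq_square)
 thus ?thesis
  using continuous_Leb[OF BD_continuous[OF C]] D.BD_bound[OF C] by (auto simp: bounded_borel_def bounded_iff)
qed

lemma dbar_sq_nl: "S.dbar_sq h n ph x = (SUM mu:nl S.\<Lambda> n. (S.dbar h mu ph x)\<^sup>2)"
 by (simp add: S.dbar_sq_def tuples_nl)

lemma dbar_sq_split: "(SUM u:nl S.\<Lambda> j. S.dbar_sq h n (S.dbar h u ph) x) = S.dbar_sq h (n + j) ph x"
 unfolding dbar_sq_nl sum_nl_append dbar_append by (rule sum.swap)

lemma Qform_nonneg: "h : {0<..h0} ==> t : {0..T} ==> x : Rd d ==> 0 <= S.Qform h t ph x"
 unfolding S.Qform_def by (intro sum_nonneg mult_nonneg_nonneg qp) auto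

text \<open>For n = 1 this comes from the first structural inequality. For n \<ge> 2 the second one
  is applied to \<open>dbar h u ph\<close> for all u of length n - 2 and summed over u;
  concatenation of tuples then produces the sums over lengths n - 1 and n, and
  \<open>K_ops_sum_le\<close> bounds the nonlocal terms.\<close>

lemma struct_orig:
 assumes h: "h : {0<..h0}" and n: "1 <= n" "n <= m" and t: "t : {0..T}" and x: "x : Rd d" and ph: "S1 ph"
  and B: "!!y. y : Rd d ==> S.dbar_sq h n ph y <= B" and B': "!!y. y : Rd d ==> S.dbar_sq h (n - 1) ph y <= B'"
 shows "real n * (SUM u:nl S.\<Lambda> (n - 1). S.Ah h t (S.dbar h u ph) x)
   + real n * (real n - 1) * (SUM u:nl S.\<Lambda> (n - 2). SUM s:nl S.\<Lambda> 2. S.dbar h s (S.dbar h u ph) x * S.Qmu h t s (S.Th h s (S.dbar h u ph)) x)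
   <= (1 - de) * (SUM mu:nl S.\<Lambda> n. S.Qform h t (S.dbar h mu ph) x) + K * (SUM mu:nl S.\<Lambda> (n - 1). S.Qform h t (S.dbar h mu ph) x)
    + 2 * (1 - de) * c t x * B + K * B'"
proof -
 have nn: "0 <= S.dbar_sq h n ph y" for n y by (simp add: dbar_sq_nl sum_nonneg)
 have B0: "0 <= B" "0 <= B'" using nn[of n x] nn[of "n - 1" x] B[OF x] B'[OF x] by linarith+
 have cB: "2 * (1 - de) * c t x * Pv <= 2 * (1 - de) * c t x * B" if "Pv <= B" for Pv
  using that de1 c[OF t x] by (intro mult_left_mono) auto
 show ?thesis
 proof (cases "n = 1")
  case True
  obtain P where P: "P : K_ops d" and ineq: "real m * S.Ah h t ph x
     <= (1 - de) * (SUM mu:nl S.\<Lambda> 1. S.Qform h t (S.dbar h mu ph) x) + K * S.Qform h t ph x + 2 * (1 - de) * c t x * P (S.dbar_sq h 1 ph) x"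
   using first h t x smooth_S1[OF ph] bounded_borel_dbar_sq[OF ph, of h 1] unfolding S.first_structural_def tuples_nl by blast
  have "(SUM u:{0::nat}. P (S.dbar_sq h 1 ph) x) <= B"
   by (rule K_ops_sum_le[OF P _ bounded_borel_dbar_sq[OF ph] _ B0(1) x]) (use B True in auto)
  hence le: "real m * S.Ah h t ph x <= (1 - de) * (SUM mu:nl S.\<Lambda> 1. S.Qform h t (S.dbar h mu ph) x) + K * S.Qform h t ph x + 2 * (1 - de) * c t x * B"
   (is "_ <= ?r") using ineq cB[of "P (S.dbar_sq h 1 ph) x"] by simp
  \<comment> \<open>Since the right-hand side is nonnegative, the factor \<open>m\<close> of the
    first structural inequality may be lowered to n = 1, whatever the sign of
    \<open>Ah\<close>.\<close>
  have "0 <= ?r" using de1 K1 c[OF t x] B0 Qform_nonneg[OF h t x] by (intro add_nonneg_nonneg mult_nonneg_nonneg sum_nonneg) auto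
  have "S.Ah h t ph x <= ?r"
  proof (cases "S.Ah h t ph x <= 0")
   case False
   hence "1 * S.Ah h t ph x <= real m * S.Ah h t ph x" using m1 by (intro mult_right_mono) auto
   thus ?thesis using le by simp
  qed (use \<open>0 <= ?r\<close> in linarith)
  moreover have "0 <= K * B'" using K1 B0 by simp
  ultimately show ?thesis using True by (simp add: nl_0 S.dbar_def)
 next
  case False
  then obtain j where j: "n = 2 + j" using n by (metis add.commute le_Suc_ex nat_less_le Suc_1 Suc_leI)
  obtain P where P: "P : K_ops d" and ineq: "!!ph. S1 ph ==>
     real n * (SUM nu:nl S.\<Lambda> 1. S.Ah h t (S.dbar h nu ph) x)
     + real n * (real n - 1) * (SUM mu:nl S.\<Lambda> 2. S.dbar h mu ph x * S.Qmu h t mu (S.Th h mu ph) x)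
     <= (1 - de) * (SUM mu:nl S.\<Lambda> 2. S.Qform h t (S.dbar h mu ph) x)
      + K * (SUM mu:nl S.\<Lambda> 1. S.Qform h t (S.dbar h mu ph) x)
      + 2 * (1 - de) * c t x * P (S.dbar_sq h 2 ph) x + K * P (S.dbar_sq h 1 ph) x"
  proof -
   obtain P where P: "!!t. t : {0..T} ==> P t : K_ops d" and ineq: "!!t x ph. t : {0..T} ==> x : Rd d ==> smooth d ph ==>
     bounded_borel d (S.dbar_sq h 1 ph) ==> bounded_borel d (S.dbar_sq h 2 ph) ==>
     real n * (SUM nu:nl S.\<Lambda> 1. S.Ah h t (S.dbar h nu ph) x)
     + real n * (real n - 1) * (SUM mu:nl S.\<Lambda> 2. S.dbar h mu ph x * S.Qmu h t mu (S.Th h mu ph) x)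
     <= (1 - de) * (SUM mu:nl S.\<Lambda> 2. S.Qform h t (S.dbar h mu ph) x)
      + K * (SUM mu:nl S.\<Lambda> 1. S.Qform h t (S.dbar h mu ph) x)
      + 2 * (1 - de) * c t x * P t (S.dbar_sq h 2 ph) x + K * P t (S.dbar_sq h 1 ph) x"
   proof -
    have nm: "n : {1..m}" using n by simp
    from second[unfolded S.second_structural_def tuples_nl, THEN bspec, OF h, THEN bspec, OF nm] show ?thesis
     by (elim exE conjE) (rule that, blast, blast)
   qed
   show ?thesis by (rule that[OF P[OF t]], rule ineq[OF t x smooth_S1 bounded_borel_dbar_sq bounded_borel_dbar_sq])
  qed
  have Pb: "(SUM u:nl S.\<Lambda> j. P (S.dbar_sq h i (S.dbar h u ph)) x) <= b"
   if "!!y. y : Rd d ==> S.dbar_sq h (i + j) ph y <= b" "0 <= b" for i b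
  proof (rule K_ops_sum_le[OF P fin_nl _ _ that(2) x])
   show "bounded_borel d (S.dbar_sq h i (S.dbar h u ph))" if "u : nl S.\<Lambda> j" for u
    by (intro bounded_borel_dbar_sq S1_dbar ph) (use that in "simp add: nl_def")
  qed (use that(1) in "simp add: dbar_sq_split")
  have "(SUM u:nl S.\<Lambda> j. real n * (SUM nu:nl S.\<Lambda> 1. S.Ah h t (S.dbar h nu (S.dbar h u ph)) x)
     + real n * (real n - 1) * (SUM mu:nl S.\<Lambda> 2. S.dbar h mu (S.dbar h u ph) x * S.Qmu h t mu (S.Th h mu (S.dbar h u ph)) x))
    <= (SUM u:nl S.\<Lambda> j. (1 - de) * (SUM mu:nl S.\<Lambda> 2. S.Qform h t (S.dbar h mu (S.dbar h u ph)) x)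
      + K * (SUM mu:nl S.\<Lambda> 1. S.Qform h t (S.dbar h mu (S.dbar h u ph)) x)
      + 2 * (1 - de) * c t x * P (S.dbar_sq h 2 (S.dbar h u ph)) x + K * P (S.dbar_sq h 1 (S.dbar h u ph)) x)"
   by (intro sum_mono ineq S1_dbar ph) (simp add: nl_def)
  moreover have "2 * (1 - de) * c t x * (SUM u:nl S.\<Lambda> j. P (S.dbar_sq h 2 (S.dbar h u ph)) x) <= 2 * (1 - de) * c t x * B"
   by (rule cB, rule Pb) (use B B0 j in auto)
  moreover have "K * (SUM u:nl S.\<Lambda> j. P (S.dbar_sq h 1 (S.dbar h u ph)) x) <= K * B'"
   using K1 B' B0 j by (intro mult_left_mono Pb) auto
  moreover have ap: "(SUM u:nl S.\<Lambda> j. SUM nu:nl S.\<Lambda> i. f (S.dbar h nu (S.dbar h u ph))) = (SUM mu:nl S.\<Lambda> (i + j). f (S.dbar h mu ph))"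
   for i and f :: "_ => real"
   unfolding sum_nl_append dbar_append by (rule sum.swap)
  moreover have "n - 1 = 1 + j" "n - 2 = j" using j by auto
  ultimately show ?thesis
   unfolding sum.distrib sum_distrib_left[symmetric] ap[where f = "%ps. S.Ah h t ps x"] ap[where f = "%ps. S.Qform h t ps x"] j[symmetric]
   by (simp del: One_nat_def)
 qed
qed

lemma shift_mn: "shift d h l (mn d x y) = mn d (shift d h l x) y"
 by (auto simp: shift_def mn_def)

lemma \<delta>d_tl: "S.\<delta>d h l (tsl d y ph) = tsl d y (S.\<delta>d h l ph)"
proof -
 have "tr d 1 y (shift d h l w) = shift d h l (tr d 1 y w)" for w by (auto simp: tr_def shift_def)
 thus ?thesis by (auto simp: S.\<delta>d_def tsl_def)
qed

lemma dbar_tl: "set mu \<subseteq> S.\<Lambda> ==> S.dbar h mu (tsl d y ph) = tsl d y (S.dbar h mu ph)"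
 and Th_tl: "set mu \<subseteq> S.\<Lambda> ==> S.Th h mu (tsl d y ph) = tsl d y (S.Th h mu ph)"
proof -
 have s: "tr d 1 y (shift d h l w) = shift d h l (tr d 1 y w)" for l w by (auto simp: tr_def shift_def)
 have "S.dbar1 h nu (tsl d y ph) = tsl d y (S.dbar1 h nu ph)" if "nu : S.\<Lambda>" for nu ph
 proof (cases "nu : La")
  case False
  thus ?thesis using pd_tl[OF ell_inv[OF that False], of y ph] by (intro ext) (simp add: S.dbar1_def, simp add: tsl_def S.dbar1_def)
 qed (auto simp: S.dbar1_def tsl_def s)
 thus "set mu \<subseteq> S.\<Lambda> ==> S.dbar h mu (tsl d y ph) = tsl d y (S.dbar h mu ph)"
  by (induction mu) (auto simp: S.dbar_def)
 have "S.Th1 h nu (tsl d y ph) = tsl d y (S.Th1 h nu ph)" for nu ph by (auto simp: S.Th1_def tsl_def s)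
 thus "set mu \<subseteq> S.\<Lambda> ==> S.Th h mu (tsl d y ph) = tsl d y (S.Th h mu ph)"
  by (induction mu) (auto simp: S.Th_def)
qed

end

text \<open>Third order bounds: the coefficients are differenced along tuples of length at most 2,
  and one order more gives continuity and the domination for differentiating under the averaging
  integral.\<close>

locale transfer = structured d La ell \<tau>0 \<tau> q p c h0 T de K m + moll d e ka
 for d La ell \<tau>0 \<tau> q p c h0 T de K m e ka +
 assumes qB: "l : La ==> t : {0..T} ==> EX C. BD {..<d} (Rd d) 3 C (q l t)"
  and pB: "l : La ==> t : {0..T} ==> EX C. BD {..<d} (Rd d) 3 C (p l t)"
  and cB: "t : {0..T} ==> EX C. BD {..<d} (Rd d) 3 C (c t)"
begin

abbreviation "q' \<equiv> %l t. cv0 (q l t)"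
abbreviation "p' \<equiv> %l t. cv0 (p l t)"
abbreviation "c' \<equiv> %t. cv0 (c t)"

sublocale S': scheme d La ell \<tau>0 \<tau> q' p' c' .

text \<open>\<open>s\<close> is the average of \<open>G\<close> over displacements y, weighted with
  the kernel. Every ingredient of the structural inequalities is linear in the coefficients, so
  these averages can be computed piece by piece.\<close>

definition mo :: "(vec => real) => real => bool" where
 "mo G s \<longleftrightarrow> has_bochner_integral (Leb d) (%y. \<rho> y * G y) s"

lemma mo_add: "mo G s ==> mo G' s' ==> mo (%y. G y + G' y) (s + s')"
 unfolding mo_def distrib_left by (rule has_bochner_integral_add)

lemma mo_cmult: "mo G s ==> mo (%y. a * G y) (a * s)"
 unfolding mo_def mult.left_commute[of _ a] by (rule has_bochner_integral_mult_right)

lemma mo_mult: "mo G s ==> mo (%y. G y * a) (s * a)"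
 using mo_cmult[of G s a] by (simp add: mult.commute)

lemma mo_sum: "(!!i. i : F ==> mo (G i) (s i)) ==> mo (%y. SUM i:F. G i y) (SUM i:F. s i)"
 unfolding mo_def sum_distrib_left by (rule has_bochner_integral_sum)

lemma mo_const: "mo (%_. a) a"
 unfolding mo_def using has_bochner_integral_mult_left[OF \<rho>_int, of a] by simp

lemma mo_mono:
 assumes "mo G s" "mo G' s'" "!!y. y : Rd d ==> G y <= G' y"
 shows "s <= s'"
proof -
 have "(\<integral>y. \<rho> y * G y \<partial>Leb d) <= (\<integral>y. \<rho> y * G' y \<partial>Leb d)"
  using assms \<rho>_nonneg by (intro integral_mono) (auto simp: mo_def has_bochner_integral_iff space_Leb intro: mult_left_mono)
 thus ?thesis using assms by (simp add: mo_def has_bochner_integral_iff)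
qed

lemma BD_gb: "BD {..<d} (Rd d) (Suc N) C ps ==> gb C ps"
 using D.BD_bound by (intro gbI continuous_Leb BD_continuous) auto

lemma mo_dbar:
 assumes ps: "BD {..<d} (Rd d) (Suc (length mu)) C ps"
 shows "set mu \<subseteq> S.\<Lambda> ==> x : Rd d ==> mo (%y. S.dbar h mu ps (mn d x y)) (S.dbar h mu (cv0 ps) x)"
 using ps
proof (induction mu arbitrary: x)
 case Nil
 thus ?case using cv_mn[OF BD_gb[of "length []"]] by (simp add: S.dbar_def mo_def)
next
 case (Cons nu mu)
 let ?\<xi> = "S.dbar h mu ps" and ?\<Xi> = "S.dbar h mu (cv0 ps)"
 have IH: "mo (%y. ?\<xi> (mn d x y)) (?\<Xi> x)" if "x : Rd d" for x
  by (rule Cons.IH) (use Cons.prems that D.BD_mono[OF Cons.prems(3), of C "Suc (length mu)"] in auto)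
 have e: "S.dbar h (nu # mu) ph = S.dbar1 h nu (S.dbar h mu ph)" for ph by (simp add: S.dbar_def)
 show ?case
 proof (cases "nu : La")
  case True
  have sx: "shift d h nu x : Rd d" by (simp add: shift_def Rd_def)
  show ?thesis unfolding e S.dbar1_def using True
   mo_cmult[OF mo_add[OF IH[OF sx] mo_cmult[OF IH[OF Cons.prems(2)], of "-1"]], of "\<tau> nu / h"] by (simp add: shift_mn)
 next
  case False
  let ?i = "inv_into {..<d} ell nu"
  have i: "?i < d" using ell_inv False Cons.prems by simp
  obtain C' where C': "BD {..<d} (Rd d) (Suc 0) C' ?\<xi>"
   using BD_dbar[of mu "Suc 0" C ps h] Cons.prems D.BD_mono[OF Cons.prems(3), of C "Suc 0 + length mu"] by auto
  have u: "mn d (x(?i := s)) y = (mn d x y)(?i := s - y ?i)" for s y using i by (auto simp: mn_def)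
  have dv: "((%s. \<rho> y * ?\<xi> (mn d (x(?i := s)) y)) has_real_derivative \<rho> y * pd ?i ?\<xi> (mn d (x(?i := s0)) y)) (at s0)" for s0 y
  proof -
   have "((%s. ?\<xi> ((mn d x y)(?i := s))) has_real_derivative pd ?i ?\<xi> ((mn d x y)(?i := s0 - y ?i))) (at (s0 + - y ?i))"
    using D.BD_DERIV_line[OF C' mn_Rd, of ?i "s0 - y ?i" x y] i by simp
   from DERIV_shift[THEN iffD1, OF this]
   show ?thesis unfolding u by (intro DERIV_cmult) simp
  qed
  have xi: "x(?i := s) : Rd d" for s using Rd_upd[OF Cons.prems(2) i] .
  have I: "integrable (Leb d) (%y. \<rho> y * ?\<xi> (mn d (x(?i := s)) y))" "?\<Xi> (x(?i := s)) = (\<integral>y. \<rho> y * ?\<xi> (mn d (x(?i := s)) y) \<partial>Leb d)" for s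
   using IH[OF xi, of s] by (auto simp: mo_def has_bochner_integral_iff)
  have bd: "\<bar>\<rho> y * pd ?i ?\<xi> (mn d (x(?i := s)) y)\<bar> <= \<rho> y * C'" for y s
   using D.BD_bound[OF D.BD_pd[OF C'] mn_Rd, of ?i "x(?i := s)" y] i \<rho>_nonneg[of y] by (auto simp: abs_mult intro: mult_left_mono)
  have w: "integrable (Leb d) (%y. \<rho> y * C')" using \<rho>_int by (simp add: has_bochner_integral_iff)
  note du = deriv_under_integral[where S = UNIV and s = "x ?i" and M = "Leb d" and w = "%y. \<rho> y * C'"
    and f = "%y s. \<rho> y * ?\<xi> (mn d (x(?i := s)) y)" and f' = "%y s. \<rho> y * pd ?i ?\<xi> (mn d (x(?i := s)) y)",
    OF open_UNIV convex_UNIV UNIV_I dv bd w I(1)]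
  have "pd ?i ?\<Xi> x = (\<integral>y. \<rho> y * pd ?i ?\<xi> (mn d x y) \<partial>Leb d)"
   unfolding pd_def I(2) by (rule DERIV_imp_deriv) (use du(2) in "simp add: pd_def")
  moreover have "integrable (Leb d) (%y. \<rho> y * pd ?i ?\<xi> (mn d x y))"
   by (rule Bochner_Integration.integrable_bound[OF w]) (use du(1) bd[of _ "x ?i"] in "auto intro!: AE_I2 intro: order_trans[OF _ abs_ge_self]")
  ultimately have "mo (%y. pd ?i ?\<xi> (mn d x y)) (pd ?i ?\<Xi> x)" by (simp add: mo_def has_bochner_integral_iff)
  from mo_cmult[OF this, of \<tau>0] show ?thesis unfolding e S.dbar1_def using False by simp
 qed
qed

lemma mo_coef:
 assumes "t : {0..T}" "x : Rd d" "set mu \<subseteq> S.\<Lambda>" "length mu <= 2"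
 shows "l : La ==> mo (%y. S.dbar h mu (q l t) (mn d x y)) (S.dbar h mu (q' l t) x)"
  and "l : La ==> mo (%y. S.dbar h mu (p l t) (mn d x y)) (S.dbar h mu (p' l t) x)"
  and "mo (%y. c t (mn d x y)) (c' t x)"
proof -
 have *: "BD {..<d} (Rd d) (Suc (length mu)) C ps" if "BD {..<d} (Rd d) 3 C ps" for C ps
  using D.BD_mono[OF that, of C "Suc (length mu)"] assms(4) by simp
 show "l : La ==> mo (%y. S.dbar h mu (q l t) (mn d x y)) (S.dbar h mu (q' l t) x)"
  using qB[of l t] mo_dbar[OF * assms(3,2)] assms(1) by blast
 show "l : La ==> mo (%y. S.dbar h mu (p l t) (mn d x y)) (S.dbar h mu (p' l t) x)"
  using pB[of l t] mo_dbar[OF * assms(3,2)] assms(1) by blast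
 obtain C where "BD {..<d} (Rd d) (Suc 2) C (c t)" using cB[OF assms(1)] by (auto simp del: BD.simps simp: eval_nat_numeral)
 from cv_mn[OF BD_gb[OF this]] show "mo (%y. c t (mn d x y)) (c' t x)" by (simp add: mo_def)
qed

context
 fixes t x ph assumes t: "t : {0..T}" and x: "x : Rd d"
begin

lemma tl_point [simp]: "S.\<delta>d h l (tsl d y ps) (mn d x y) = S.\<delta>d h l ps x"
 by (simp add: \<delta>d_tl tl_mn[OF x])

lemma mo_Qmu: "set mu \<subseteq> S.\<Lambda> ==> length mu <= 2 ==> mo (%y. S.Qmu h t mu (tsl d y ps) (mn d x y)) (S'.Qmu h t mu ps x)"
 unfolding S.Qmu_def S'.Qmu_def tl_point by (intro mo_cmult mo_sum mo_mult mo_coef t x)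

lemma mo_L0mu: "set mu \<subseteq> S.\<Lambda> ==> length mu <= 2 ==> mo (%y. S.L0mu h t mu (tsl d y ps) (mn d x y)) (S'.L0mu h t mu ps x)"
 unfolding S.L0mu_def S'.L0mu_def tl_point by (intro mo_add mo_Qmu mo_sum mo_mult mo_coef t x)

lemma mo_Ah: "mo (%y. S.Ah h t (tsl d y ps) (mn d x y)) (S'.Ah h t ps x)"
proof -
 have s: "set mu \<subseteq> S.\<Lambda>" "length mu <= 2" if "mu : nl S.\<Lambda> 1" for mu using that by (auto simp: nl_def)
 have "S.Ah h t (tsl d y ps) (mn d x y) = 2 * (SUM mu:nl S.\<Lambda> 1. S.dbar h mu ps x * S.L0mu h t mu (tsl d y (S.Th h mu ps)) (mn d x y))" for y
  unfolding S.Ah_def tuples_nl by (simp add: dbar_tl Th_tl s tl_mn[OF x] cong: sum.cong)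
 thus ?thesis unfolding S'.Ah_def tuples_nl by (simp only:) (intro mo_cmult mo_sum mo_L0mu s)
qed

lemma mo_Qform: "mo (%y. S.Qform h t (tsl d y ps) (mn d x y)) (S'.Qform h t ps x)"
proof -
 have "mo (%y. q l t (mn d x y)) (q' l t x)" "mo (%y. p l t (mn d x y)) (p' l t x)" if "l : La" for l
  using mo_coef(1,2)[OF t x, of "[]" l] that by (auto simp: S.dbar_def)
 thus ?thesis unfolding S.Qform_def S'.Qform_def tl_point by (intro mo_sum mo_mult mo_add mo_cmult)
qed

end

text \<open>The original inequality is used at x - y with the test function translated by y. All
  differences of the test function there have the values they have at x, so only the coefficients
  vary with y, and averaging mollifies them. The sup bounds B and B' are invariant under
  translation, which the operators of \<open>K_ops\<close> need not respect; this is why they were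
  eliminated first.\<close>

lemma struct_moll:
 assumes h: "h : {0<..h0}" and n: "1 <= n" "n <= m" and t: "t : {0..T}" and x: "x : Rd d" and ph: "S1 ph"
  and B: "!!y. y : Rd d ==> S.dbar_sq h n ph y <= B" and B': "!!y. y : Rd d ==> S.dbar_sq h (n - 1) ph y <= B'"
 shows "real n * (SUM u:nl S.\<Lambda> (n - 1). S'.Ah h t (S.dbar h u ph) x)
   + real n * (real n - 1) * (SUM u:nl S.\<Lambda> (n - 2). SUM s:nl S.\<Lambda> 2. S.dbar h s (S.dbar h u ph) x * S'.Qmu h t s (S.Th h s (S.dbar h u ph)) x)
   <= (1 - de) * (SUM mu:nl S.\<Lambda> n. S'.Qform h t (S.dbar h mu ph) x) + K * (SUM mu:nl S.\<Lambda> (n - 1). S'.Qform h t (S.dbar h mu ph) x)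
    + 2 * (1 - de) * c' t x * B + K * B'"
proof (rule mo_mono)
 have s: "set u \<subseteq> S.\<Lambda>" if "u : nl S.\<Lambda> j" for u j using that by (simp add: nl_def)
 show "mo (%y. real n * (SUM u:nl S.\<Lambda> (n - 1). S.Ah h t (tsl d y (S.dbar h u ph)) (mn d x y))
   + real n * (real n - 1) * (SUM u:nl S.\<Lambda> (n - 2). SUM s:nl S.\<Lambda> 2. S.dbar h s (S.dbar h u ph) x * S.Qmu h t s (tsl d y (S.Th h s (S.dbar h u ph))) (mn d x y)))
  (real n * (SUM u:nl S.\<Lambda> (n - 1). S'.Ah h t (S.dbar h u ph) x)
   + real n * (real n - 1) * (SUM u:nl S.\<Lambda> (n - 2). SUM s:nl S.\<Lambda> 2. S.dbar h s (S.dbar h u ph) x * S'.Qmu h t s (S.Th h s (S.dbar h u ph)) x))"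
  by (intro mo_add mo_cmult mo_sum mo_Ah mo_Qmu t x) (auto simp: nl_def)
 show "mo (%y. (1 - de) * (SUM mu:nl S.\<Lambda> n. S.Qform h t (tsl d y (S.dbar h mu ph)) (mn d x y)) + K * (SUM mu:nl S.\<Lambda> (n - 1). S.Qform h t (tsl d y (S.dbar h mu ph)) (mn d x y))
    + 2 * (1 - de) * c t (mn d x y) * B + K * B')
   ((1 - de) * (SUM mu:nl S.\<Lambda> n. S'.Qform h t (S.dbar h mu ph) x) + K * (SUM mu:nl S.\<Lambda> (n - 1). S'.Qform h t (S.dbar h mu ph) x)
    + 2 * (1 - de) * c' t x * B + K * B')"
  by (intro mo_add mo_mult mo_const) (intro mo_cmult mo_sum mo_Qform mo_coef(3)[where mu = "[]"] t x; simp)+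
 fix y
 have q: "S.dbar_sq h j (tsl d y ph) w = S.dbar_sq h j ph (tr d 1 y w)" for j w
  unfolding dbar_sq_nl by (intro sum.cong refl) (simp only: dbar_tl[OF s], simp only: tsl_def)
 have m: "w : Rd d ==> tr d 1 y w : Rd d" for w by (rule D.tr_mem)
 have phy: "S1 (tsl d y ph)" unfolding tsl_def by (rule D.SM_tr[OF ph])
 have "S.Qmu h t mu (S.Th h mu (S.dbar h u (tsl d y ph))) = S.Qmu h t mu (tsl d y (S.Th h mu (S.dbar h u ph)))"
  if "mu : nl S.\<Lambda> 2" "u : nl S.\<Lambda> j" for mu u j by (simp add: dbar_tl[OF s[OF that(2)]] Th_tl[OF s[OF that(1)]])
 moreover have "S.dbar h mu (S.dbar h u (tsl d y ph)) (mn d x y) = S.dbar h mu (S.dbar h u ph) x"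
  if "mu : nl S.\<Lambda> 2" "u : nl S.\<Lambda> j" for mu u j
  by (simp add: dbar_tl[OF s[OF that(2)]] dbar_tl[OF s[OF that(1)]] tl_mn[OF x])
 moreover have "S.dbar h u (tsl d y ph) = tsl d y (S.dbar h u ph)" if "u : nl S.\<Lambda> j" for u j by (rule dbar_tl[OF s[OF that]])
 ultimately show "real n * (SUM u:nl S.\<Lambda> (n - 1). S.Ah h t (tsl d y (S.dbar h u ph)) (mn d x y))
   + real n * (real n - 1) * (SUM u:nl S.\<Lambda> (n - 2). SUM s:nl S.\<Lambda> 2. S.dbar h s (S.dbar h u ph) x * S.Qmu h t s (tsl d y (S.Th h s (S.dbar h u ph))) (mn d x y))
  <= (1 - de) * (SUM mu:nl S.\<Lambda> n. S.Qform h t (tsl d y (S.dbar h mu ph)) (mn d x y)) + K * (SUM mu:nl S.\<Lambda> (n - 1). S.Qform h t (tsl d y (S.dbar h mu ph)) (mn d x y))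
    + 2 * (1 - de) * c t (mn d x y) * B + K * B'"
  using struct_orig[OF h n t mn_Rd phy, of B B' x y] B B' m by (simp add: q cong: sum.cong)
qed

end

section \<open>Passage to the limit\<close>

lemma sup_H_AE:
 assumes "sup_H d T F <= ereal S" "t : {0..T}"
 shows "AE x in Leb d. F t x <= S"
proof -
 have "esssup (Leb d) (%x. ereal (F t x)) <= sup_H d T F"
  unfolding sup_H_def by (rule SUP_upper[OF assms(2)])
 hence "esssup (Leb d) (%x. ereal (F t x)) <= ereal S" using assms(1) by (rule order_trans)
 with esssup_AE[of "%x. ereal (F t x)" "Leb d"] show ?thesis
  by (auto elim!: eventually_mono dest: order_trans)
qed

lemma B_space_bounded: "ps : B_space d T m ==> EX C. ALL t:{0..T}. ALL x:Rd d. \<bar>ps t x\<bar> <= C"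
 by (simp add: B_space_def)

lemma B_space_meas: "ps : B_space d T m ==> t : {0..T} ==> ps t : borel_measurable (Leb d)"
 using borel_on_section[of d "{0..T}" ps t] by (simp add: B_space_def)

lemma B_space_gderiv:
 assumes "ps : B_space d T m" "k <= m" "\<alpha> : multi_index d k" "t : {0..T}"
 shows "has_gderiv d \<alpha> (ps t) (gderiv d \<alpha> (ps t))"
proof -
 have "EX w. has_gderiv d \<alpha> (ps t) w" using assms unfolding B_space_def by blast
 thus ?thesis unfolding gderiv_def by (rule someI_ex)
qed

lemma B_space_gderiv_bound:
 assumes ps: "ps : B_space d T m"
 obtains B where "!!k \<alpha> t. k <= m ==> \<alpha> : multi_index d k ==> t : {0..T} ==> AE y in Leb d. \<bar>gderiv d \<alpha> (ps t) y\<bar> <= B"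
proof -
 let ?A = "UN k<=m. multi_index d k"
 have "EX B. sup_H d T (%t x. \<bar>gderiv d \<alpha> (ps t) x\<bar>) <= ereal B" if "\<alpha> : ?A" for \<alpha>
 proof -
  have "sup_H d T (%t x. \<bar>gderiv d \<alpha> (ps t) x\<bar>) < \<infinity>" using ps that unfolding B_space_def by blast
  thus ?thesis by (cases "sup_H d T (%t x. \<bar>gderiv d \<alpha> (ps t) x\<bar>)") auto
 qed
 then obtain b where b: "!!\<alpha>. \<alpha> : ?A ==> sup_H d T (%t x. \<bar>gderiv d \<alpha> (ps t) x\<bar>) <= ereal (b \<alpha>)" by metis
 show ?thesis
 proof (rule that[of "SUM \<alpha>:?A. \<bar>b \<alpha>\<bar>"])
  fix k \<alpha> t assume k: "k <= m" and a: "\<alpha> : multi_index d k" and t: "t : {0..T}"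
  have "\<bar>b \<alpha>\<bar> <= (SUM \<alpha>:?A. \<bar>b \<alpha>\<bar>)" using k a by (intro member_le_sum) (auto simp: finite_multi_index)
  hence le: "b \<alpha> <= (SUM \<alpha>:?A. \<bar>b \<alpha>\<bar>)" by linarith
  have "\<alpha> : ?A" using k a by blast
  from sup_H_AE[OF b[OF this] t] show "AE y in Leb d. \<bar>gderiv d \<alpha> (ps t) y\<bar> <= (SUM \<alpha>:?A. \<bar>b \<alpha>\<bar>)"
   by eventually_elim (use le in linarith)
 qed
qed

lemma gDnorm_sq_meas:
 assumes "ps : B_space d T m" "k <= m" "t : {0..T}"
 shows "gDnorm_sq d k (ps t) : borel_measurable (Leb d)"
 unfolding gDnorm_sq_def[abs_def]
 using B_space_gderiv[OF assms(1,2) _ assms(3)] by (intro borel_measurable_sum borel_measurable_power) (auto simp: has_gderiv_def locally_integrable_def)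

lemma gDnorm_sq_nonneg: "0 <= gDnorm_sq d k ps x" by (simp add: gDnorm_sq_def sum_nonneg)

text \<open>\<open>B_norm\<close> passes through \<open>real_of_ereal\<close>, which would turn an
  infinite supremum into 0. So the supremum has to be shown finite, from the bounds on the single
  generalized derivatives, before the norm bounds anything.\<close>

lemma B_norm_AE:
 assumes ps: "ps : B_space d T m" and t: "t : {0..T}"
 shows "AE y in Leb d. (SUM k<=m. gDnorm_sq d k (ps t) y) <= (B_norm d T m ps)^2 & 0 <= B_norm d T m ps"
proof -
 let ?F = "%t x. SUM k<=m. gDnorm_sq d k (ps t) x"
 obtain B where B: "!!k \<alpha> t. k <= m ==> \<alpha> : multi_index d k ==> t : {0..T} ==> AE y in Leb d. \<bar>gderiv d \<alpha> (ps t) y\<bar> <= B"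
  using B_space_gderiv_bound[OF ps] by blast
 define S where "S = (SUM k<=m. SUM \<alpha>:multi_index d k. B\<^sup>2)"
 have "sup_H d T ?F <= ereal S"
  unfolding sup_H_def
 proof (rule SUP_least, rule esssup_I)
  fix t assume t: "t : {0..T}"
  have "(%x. ?F t x) : borel_measurable (Leb d)" using gDnorm_sq_meas[OF ps _ t] by (intro borel_measurable_sum) auto
  thus "(%x. ereal (?F t x)) : borel_measurable (Leb d)" by simp
  have "AE y in Leb d. ALL k:{..m}. ALL \<alpha>:multi_index d k. \<bar>gderiv d \<alpha> (ps t) y\<bar> <= B"
   using B t by (intro AE_finite_allI finite_multi_index) auto
  thus "AE y in Leb d. ereal (?F t y) <= ereal S"
  proof eventually_elim
   case (elim y)
   hence "(gderiv d \<alpha> (ps t) y)^2 <= B^2" if "k <= m" "\<alpha> : multi_index d k" for k \<alpha>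
    using that by (auto intro!: abs_le_square_iff[THEN iffD1] intro: order_trans[OF _ abs_ge_self])
   hence "?F t y <= S" unfolding S_def gDnorm_sq_def by (intro sum_mono) auto
   thus ?case by simp
  qed
 qed
 hence fin: "sup_H d T ?F ~= \<infinity>" by auto
 have up: "esssup (Leb d) (%x. ereal (?F t x)) <= sup_H d T ?F" unfolding sup_H_def by (rule SUP_upper[OF t])
 have "AE y in Leb d. ereal (?F t y) <= sup_H d T ?F"
  using esssup_AE[of "%x. ereal (?F t x)" "Leb d"] by eventually_elim (use up in order)
 thus ?thesis
 proof eventually_elim
  case (elim y)
  have F0: "0 <= ?F t y" by (simp add: sum_nonneg gDnorm_sq_nonneg)
  obtain s where s: "sup_H d T ?F = ereal s" using fin elim by (cases "sup_H d T ?F") auto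
  hence "?F t y <= s" using elim by simp
  thus ?case using F0 s by (simp add: B_norm_def)
 qed
qed

context moll
begin

text \<open>\<open>Leb d\<close> is not the zero measure, since the kernel has integral 1 with
  respect to it.\<close>

lemma AE_ex: "AE y in Leb d. Q ==> Q"
proof (rule ccontr)
 assume a: "AE y in Leb d. Q" "~ Q"
 from a(1) have "AE y in Leb d. R0 undefined y = 0" by eventually_elim (use a(2) in simp)
 hence "(\<integral>y. R0 undefined y \<partial>Leb d) = 0" by (rule integral_eq_zero_AE)
 thus False using R0_int[of undefined] by (simp add: has_bochner_integral_iff)
qed

lemma cvB:
 assumes ps: "ps : B_space d T m" and t: "t : {0..T}" and k: "k <= m"
 shows "D2 d k (cv0 (ps t)) x <= fact k * cv0 (gDnorm_sq d k (ps t)) x"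
  and "integrable (Leb d) (%y. gDnorm_sq d k (ps t) y * R0 x y)"
  and "D2 d k (cv0 (ps t)) x <= fact k * (B_norm d T m ps)^2" and "0 <= B_norm d T m ps"
proof -
 obtain C where C: "!!y. y : Rd d ==> \<bar>ps t y\<bar> <= C" using B_space_bounded[OF ps] t by blast
 obtain B where B: "!!k \<alpha> t. k <= m ==> \<alpha> : multi_index d k ==> t : {0..T} ==> AE y in Leb d. \<bar>gderiv d \<alpha> (ps t) y\<bar> <= B"
  using B_space_gderiv_bound[OF ps] by blast
 have g: "has_gderiv d \<alpha> (ps t) (gderiv d \<alpha> (ps t)) & gb B (gderiv d \<alpha> (ps t))" if "\<alpha> : multi_index d k" for \<alpha>
  using B_space_gderiv[OF ps k that t] B[OF k that t] by (auto simp: gb_def has_gderiv_def locally_integrable_def)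
 note D = D2_cv_le[OF B_space_meas[OF ps t] C g]
 show le: "D2 d k (cv0 (ps t)) x <= fact k * cv0 (gDnorm_sq d k (ps t)) x" by (rule D(1))
 show i: "integrable (Leb d) (%y. gDnorm_sq d k (ps t) y * R0 x y)" by (rule D(3))
 note AE = B_norm_AE[OF ps t]
 have "AE y in Leb d. gDnorm_sq d k (ps t) y <= (B_norm d T m ps)^2"
  using AE
 proof eventually_elim
  case (elim y)
  have "gDnorm_sq d k (ps t) y <= (SUM k<=m. gDnorm_sq d k (ps t) y)" using k gDnorm_sq_nonneg by (intro member_le_sum) auto
  thus ?case using elim by linarith
 qed
 from integral_R0_le[OF i this] have "fact k * cv0 (gDnorm_sq d k (ps t)) x <= fact k * (B_norm d T m ps)^2" by (intro mult_left_mono) auto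
 thus "D2 d k (cv0 (ps t)) x <= fact k * (B_norm d T m ps)^2" using le by linarith
 have "AE y in Leb d. 0 <= B_norm d T m ps" using AE by eventually_elim simp
 thus "0 <= B_norm d T m ps" by (rule AE_ex)
qed

text \<open>The sum over the directions is taken inside the convolution and bounded there by the
  regularity condition, so that no factor \<open>card La\<close> appears.\<close>

lemma cv_coef_bound:
 assumes reg: "regularity d T La q p c f g m M" and fin: "finite La" and t: "t : {0..T}" and k: "k <= m"
 shows "(SUM l:La. D2 d k (cv0 (q l t)) x + D2 d k (cv0 (p l t)) x) + D2 d k (cv0 (c t)) x <= fact k * (M k)^2"
proof -
 have B: "l : La ==> q l : B_space d T m" "l : La ==> p l : B_space d T m" "c : B_space d T m" for l
  using reg by (auto simp: regularity_def)
 let ?G = "%y. (SUM l:La. gDnorm_sq d k (q l t) y + gDnorm_sq d k (p l t) y) + gDnorm_sq d k (c t) y"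
 note i = cvB(2)[OF B(1) t k] cvB(2)[OF B(2) t k] cvB(2)[OF B(3) t k]
 have "(SUM l:La. D2 d k (cv0 (q l t)) x + D2 d k (cv0 (p l t)) x) + D2 d k (cv0 (c t)) x
  <= (SUM l:La. fact k * cv0 (gDnorm_sq d k (q l t)) x + fact k * cv0 (gDnorm_sq d k (p l t)) x) + fact k * cv0 (gDnorm_sq d k (c t)) x"
  by (intro add_mono sum_mono cvB(1)[where T = T and m = m] B t k)
 also have "... = fact k * cv0 ?G x"
 proof -
  have hb: "has_bochner_integral (Leb d) (%y. gDnorm_sq d k (q l t) y * R0 x y) (cv0 (gDnorm_sq d k (q l t)) x)"
   "has_bochner_integral (Leb d) (%y. gDnorm_sq d k (p l t) y * R0 x y) (cv0 (gDnorm_sq d k (p l t)) x)" if "l : La" for l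
   using i that by (simp_all add: has_bochner_integral_iff cv_def)
  have hc: "has_bochner_integral (Leb d) (%y. gDnorm_sq d k (c t) y * R0 x y) (cv0 (gDnorm_sq d k (c t)) x)"
   using i by (simp add: has_bochner_integral_iff cv_def)
  have "cv0 ?G x = (SUM l:La. cv0 (gDnorm_sq d k (q l t)) x + cv0 (gDnorm_sq d k (p l t)) x) + cv0 (gDnorm_sq d k (c t)) x"
   unfolding cv_def[of _ ?G] distrib_right sum_distrib_right
   by (intro has_bochner_integral_integral_eq has_bochner_integral_add has_bochner_integral_sum hb hc)
  thus ?thesis by (simp add: distrib_left sum_distrib_left)
 qed
 also have "... <= fact k * (M k)^2"
 proof (rule mult_left_mono)
  have "integrable (Leb d) (%y. ?G y * R0 x y)"
   unfolding distrib_right sum_distrib_right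
   by (intro Bochner_Integration.integrable_add Bochner_Integration.integrable_sum i)
  moreover have "AE y in Leb d. ?G y <= (M k)^2"
   by (rule sup_H_AE[OF _ t, where F = "%t y. (SUM l:La. gDnorm_sq d k (q l t) y + gDnorm_sq d k (p l t) y) + gDnorm_sq d k (c t) y"])
    (use reg k in "simp add: regularity_def")
  ultimately show "cv0 ?G x <= (M k)^2" by (rule integral_R0_le)
 qed simp
 finally show ?thesis .
qed

end

lemma BD_from_lists:
 assumes "BD E U N C' ph" "!!is x. set is \<subseteq> E ==> length is <= N ==> x : U ==> \<bar>foldr pd is ph x\<bar> <= C"
 shows "BD E U N C ph"
 using assms
proof (induction N arbitrary: ph)
 case 0 show ?case using 0(2)[of "[]"] by simp
next
 case (Suc N)
 have "BD E U N C (pd i ph)" if "i : E" for i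
 proof (rule Suc.IH)
  show "BD E U N C' (pd i ph)" using Suc.prems(1) that by simp
  show "\<bar>foldr pd is (pd i ph) x\<bar> <= C" if "set is \<subseteq> E" "length is <= N" "x : U" for "is" x
   using Suc.prems(2)[of "is @ [i]" x] that \<open>i : E\<close> by simp
 qed
 thus ?case using Suc.prems(1) Suc.prems(2)[of "[]"] by simp
qed

lemma BD_from_D2:
 assumes "BD {..<d} U N C' ph" "!!k x. k <= N ==> x : U ==> D2 d k ph x <= B"
 shows "BD {..<d} U N (sqrt B) ph"
proof (rule BD_from_lists[OF assms(1)])
 fix "is" x assume i: "set is \<subseteq> {..<d}" "length is <= N" and x: "x : U"
 have "(foldr pd is ph x)^2 <= D2 d (length is) ph x"
  unfolding D2_def by (rule member_le_sum[where f = "%is. (foldr pd is ph x)\<^sup>2"]) (use i in "auto simp: nl_def intro: finite_nl[unfolded nl_def]")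
 also have "... <= B" using assms(2) i x by simp
 finally show "\<bar>foldr pd is ph x\<bar> <= sqrt B" by (rule real_le_rsqrt[where x = "\<bar>_\<bar>", simplified])
qed

lemma moll_seq:
 obtains ka where "!!n. moll (1 / (real n + 1)) (ka n)"
proof -
 have "EX k. moll (1 / (real n + 1)) k" for n
 proof -
  obtain k :: "nat => real => real" where "!!n s. (k n has_real_derivative k (Suc n) s) (at s)" "!!j s. 1 / (real n + 1) < \<bar>s\<bar> ==> k j s = 0"
   "!!s. 0 <= k 0 s" "has_bochner_integral lborel (k 0) 1"
   using mollifier_exists[of "1 / (real n + 1)"] by auto
  hence "moll (1 / (real n + 1)) k" by unfold_locales auto
  thus ?thesis by blast
 qed
 thus ?thesis using that by metis
qed

text \<open>Bounded generalized derivatives of order m + 1 yield classical ones up to order m: the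
  mollifications have uniform bounds of order m + 1 and converge pointwise by continuity, and the
  limit loses one order.\<close>

lemma B_space_BD:
 assumes ps: "ps : B_space d T (Suc m)" and t: "t : {0..T}"
 shows "BD {..<d} (Rd d) m (sqrt (fact (Suc m) * (B_norm d T (Suc m) ps)^2)) (ps t)"
proof -
 interpret D: domR "{..<d}" "Rd d" "%_. UNIV" d by (rule domR_Rd)
 obtain ka where ka: "!!n. moll (1 / (real n + 1)) (ka n)" using moll_seq by blast
 define ph where "ph n = moll.cv d (ka n) (%_. 0) (ps t)" for n
 obtain C where C: "!!y. y : Rd d ==> \<bar>ps t y\<bar> <= C" using B_space_bounded[OF ps] t by blast
 note m = B_space_meas[OF ps t]
 let ?B = "fact (Suc m) * (B_norm d T (Suc m) ps)^2"
 show ?thesis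
 proof (rule D.BD_limit(1)[where ph = ph])
  fix n
  interpret moll d "1 / (real n + 1)" "ka n" by (rule ka)
  have "SM UNIV UNIV (UNIV :: unit set) (%_. cv0 (ps t))" by (rule SM_cv[OF m C])
  then obtain C' where "BD UNIV UNIV (Suc m) C' (ph n)" unfolding SM_def ph_def by blast
  from BD_subset[OF this subset_UNIV subset_UNIV] have "BD {..<d} (Rd d) (Suc m) C' (ph n)" .
  thus "BD {..<d} (Rd d) (Suc m) (sqrt ?B) (ph n)"
  proof (rule BD_from_D2)
   fix k x assume k: "k <= Suc m"
   have "D2 d k (ph n) x <= fact k * (B_norm d T (Suc m) ps)^2" unfolding ph_def by (rule cvB(3)[OF ps t k])
   also have "... <= ?B" using fact_mono[OF k] by (intro mult_right_mono) auto
   finally show "D2 d k (ph n) x <= ?B" .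
  qed
 next
  fix x assume x: "x : Rd d"
  have cont: "continuous_on (Rd d) (ps t)" using ps t by (simp add: B_space_def)
  show "(%n. ph n x) \<longlonglongrightarrow> ps t x"
  proof (rule LIMSEQ_I)
   fix r :: real assume r: "0 < r"
   have "EX N. ALL y:Rd d. (ALL i<d. \<bar>y i - x i\<bar> <= 1 / (real N + 1)) --> \<bar>ps t y - ps t x\<bar> <= r / 2"
   proof (rule ccontr)
    assume "~ ?thesis"
    then obtain y where y: "!!N. y N : Rd d" "!!N i. i < d ==> \<bar>y N i - x i\<bar> <= 1 / (real N + 1)" "!!N. r / 2 < \<bar>ps t (y N) - ps t x\<bar>"
     unfolding not_ex not_all not_le by (metis (no_types, lifting) not_le)
    have "(%N. y N i) \<longlonglongrightarrow> x i" if "i < d" for i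
    proof (rule Lim_null[THEN iffD2], rule Lim_null_comparison)
     show "\<forall>\<^sub>F N in sequentially. norm (y N i - x i) <= 1 / (real N + 1)" using y(2)[OF that] by simp
     show "(%N. 1 / (real N + 1)) \<longlonglongrightarrow> 0" using LIMSEQ_inverse_real_of_nat by (simp add: inverse_eq_divide add.commute)
    qed
    hence "y \<longlonglongrightarrow> x" by (rule tendsto_coordinates[OF x y(1)])
    hence "(%N. ps t (y N)) \<longlonglongrightarrow> ps t x" by (rule continuous_on_tendsto_compose[OF cont _ x]) (use y(1) in simp)
    hence "(%N. \<bar>ps t (y N) - ps t x\<bar>) \<longlonglongrightarrow> \<bar>ps t x - ps t x\<bar>" by (intro tendsto_intros)
    hence "r / 2 <= \<bar>ps t x - ps t x\<bar>" by (rule LIMSEQ_le_const) (use y(3) less_imp_le in blast)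
    thus False using r by simp
   qed
   then obtain N where N: "!!y. y : Rd d ==> (!!i. i < d ==> \<bar>y i - x i\<bar> <= 1 / (real N + 1)) ==> \<bar>ps t y - ps t x\<bar> <= r / 2" by blast
   show "EX N. ALL n>=N. norm (ph n x - ps t x) < r"
   proof (intro exI allI impI)
    fix n assume n: "N <= n"
    interpret moll d "1 / (real n + 1)" "ka n" by (rule ka)
    have le: "1 / (real n + 1) <= 1 / (real N + 1)" using n by (intro divide_left_mono) auto
    have "\<bar>cv0 (ps t) x - ps t x\<bar> <= r / 2"
    proof (rule cv_close[OF gbI[OF m C]])
     fix y assume "y : Rd d" "!!i. i < d ==> \<bar>y i - x i\<bar> <= 1 / (real n + 1)"
     thus "\<bar>ps t y - ps t x\<bar> <= r / 2" using le by (intro N) (auto intro: order_trans)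
    qed
    thus "norm (ph n x - ps t x) < r" using r by (simp add: ph_def)
   qed
  qed
 qed
qed

text \<open>A Lipschitz estimate on the support of the kernel. The order is written with two
  successors because one is lost in \<open>B_space_BD\<close> and a first derivative must remain.
  The factor \<open>d\<close> is admissible, since the rate is used only to pass to the
  limit.\<close>

lemma (in moll) cv_rate:
 assumes ps: "ps : B_space d T (Suc (Suc m))" and t: "t : {0..T}" and x: "x : Rd d"
 shows "\<bar>cv0 (ps t) x - ps t x\<bar> <= sqrt (fact (Suc (Suc m)) * (B_norm d T (Suc (Suc m)) ps)^2) * (real d * e)"
proof -
 interpret D: domR "{..<d}" "Rd d" "%_. UNIV" d by (rule domR_Rd)
 obtain C where C: "!!y. y : Rd d ==> \<bar>ps t y\<bar> <= C" using B_space_bounded[OF ps] t by blast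
 note b = B_space_BD[OF ps t]
 show ?thesis
 proof (rule cv_close[OF gbI[OF B_space_meas[OF ps t] C]])
  fix y assume y: "y : Rd d" and e: "!!i. i < d ==> \<bar>y i - x i\<bar> <= e"
  have "(%i. if i < d then y i else x i) = y" using x y by (auto simp: Rd_def PiE_iff extensional_def)
  hence "\<bar>ps t y - ps t x\<bar> <= sqrt (fact (Suc (Suc m)) * (B_norm d T (Suc (Suc m)) ps)^2) * (SUM i<d. \<bar>y i - x i\<bar>)"
   using D.BD_lip_multi[OF b x, of d y] by (simp del: fact_Suc)
  also have "(SUM i<d. \<bar>y i - x i\<bar>) <= real d * e" using sum_bounded_above[of "{..<d}" "%i. \<bar>y i - x i\<bar>" e] e by simp
  finally show "\<bar>ps t y - ps t x\<bar> <= sqrt (fact (Suc (Suc m)) * (B_norm d T (Suc (Suc m)) ps)^2) * (real d * e)"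
   by (simp add: mult_left_mono del: fact_Suc)
 qed auto
qed

section \<open>Convergence of the mollified problems\<close>

lemma Lh_alt: "scheme.Lh d La q p c h t ph x =
 (SUM l:La. (1 / h * q l t x + p l t x) * ((ph (shift d h l x) - ph x) / h)) - c t x * ph x"
 unfolding scheme.Lh_def scheme.\<delta>d_def sum_distrib_left sum.distrib[symmetric]
 by (intro arg_cong2[where f = "(-)"] sum.cong refl) (simp add: distrib_right add_divide_distrib)

lemma Lh_diff:
 "scheme.Lh d La Q P C h t v x - scheme.Lh d La q p c h t w x = scheme.Lh d La Q P C h t (%y. v y - w y) x
  + scheme.Lh d La (%l t x. Q l t x - q l t x) (%l t x. P l t x - p l t x) (%t x. C t x - c t x) h t w x"
proof -
 have "(SUM l:La. (1 / h * Q l t x + P l t x) * ((v (shift d h l x) - v x) / h)) - (SUM l:La. (1 / h * q l t x + p l t x) * ((w (shift d h l x) - w x) / h))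
  = (SUM l:La. (1 / h * Q l t x + P l t x) * ((v (shift d h l x) - w (shift d h l x) - (v x - w x)) / h))
   + (SUM l:La. (1 / h * (Q l t x - q l t x) + (P l t x - p l t x)) * ((w (shift d h l x) - w x) / h))"
  unfolding sum.distrib[symmetric] sum_subtractf[symmetric] by (intro sum.cong refl) (simp add: algebra_simps diff_divide_distrib add_divide_distrib)
 thus ?thesis unfolding Lh_alt by (simp add: algebra_simps)
qed

lemma Lh_bound:
 assumes "0 < h" "0 <= s" "0 <= Cu" and q: "!!l. l : La ==> \<bar>q l t x\<bar> <= s * A l" and p: "!!l. l : La ==> \<bar>p l t x\<bar> <= s * A' l"
  and c: "\<bar>c t x\<bar> <= s * A''" and ph: "!!y. y : Rd d ==> \<bar>ph y\<bar> <= Cu" and x: "x : Rd d"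
 shows "\<bar>scheme.Lh d La q p c h t ph x\<bar> <= s * ((SUM l:La. (1 / h * A l + A' l) * (2 * Cu / h)) + A'' * Cu)"
proof -
 have "\<bar>(1 / h * q l t x + p l t x) * ((ph (shift d h l x) - ph x) / h)\<bar> <= s * ((1 / h * A l + A' l) * (2 * Cu / h))" if l: "l : La" for l
 proof -
  have "shift d h l x : Rd d" by (simp add: shift_def Rd_def)
  hence "\<bar>ph (shift d h l x) - ph x\<bar> <= 2 * Cu" using ph[of "shift d h l x"] ph[OF x] by linarith
  hence 1: "\<bar>(ph (shift d h l x) - ph x) / h\<bar> <= 2 * Cu / h" using assms(1) by (simp add: divide_right_mono)
  have "\<bar>1 / h * q l t x\<bar> <= 1 / h * (s * A l)" using q[OF l] assms(1) by (simp add: abs_mult divide_right_mono)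
  hence "\<bar>1 / h * q l t x + p l t x\<bar> <= 1 / h * (s * A l) + s * A' l" using p[OF l] by linarith
  also have "... = s * (1 / h * A l + A' l)" by (simp add: distrib_left)
  finally have "\<bar>1 / h * q l t x + p l t x\<bar> <= s * (1 / h * A l + A' l)" .
  thus ?thesis unfolding abs_mult mult.assoc[symmetric, of s] using 1 by (intro mult_mono) auto
 qed
 hence "\<bar>SUM l:La. (1 / h * q l t x + p l t x) * ((ph (shift d h l x) - ph x) / h)\<bar> <= s * (SUM l:La. (1 / h * A l + A' l) * (2 * Cu / h))"
  unfolding sum_distrib_left by (intro sum_abs[THEN order_trans] sum_mono)
 moreover have "\<bar>c t x * ph x\<bar> <= s * A'' * Cu" unfolding abs_mult using c ph[OF x] by (intro mult_mono) auto
 ultimately show ?thesis unfolding Lh_alt by (simp add: distrib_left)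
qed

text \<open>The given problem together with a sequence of kernels of radius 1/(n + 1). The bound 4
  \<le> m, a consequence of 3k + 1 \<le> m for odd k, provides the classical third derivatives of
  the coefficients on which the transfer of the structural inequalities relies.\<close>

locale prob = structured d La ell \<tau>0 \<tau> q p c h0 T de K m
 for d La ell \<tau>0 \<tau> q p c h0 T de K m +
 fixes c0 nL nL\<tau> :: real and M :: "nat => real" and f :: "real => vec => real" and g :: "vec => real"
  and u :: "real => real => vec => real" and ka :: "nat => nat => real => real"
 assumes h00: "0 < h0" and T0: "0 < T" and de0: "0 < de" and c00: "0 < c0" and \<tau>00: "0 < \<tau>0" and m4: "4 <= m"
  and L1: "La \<subseteq> Rd d" and ell_inj: "inj_on ell {..<d}" and disj: "ell ` {..<d} \<inter> La = {}"
  and nL: "(SUM l:La. (vnorm d l)\<^sup>2) = nL^2" and nL\<tau>: "(SUM l:La. (\<tau> l * vnorm d l)\<^sup>2) = nL\<tau>^2"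
  and c_ge: "t : {0..T} ==> x : Rd d ==> c0 <= c t x"
  and reg: "regularity d T La q p c f g m M"
  and sym: "vneg d ` La = La"
  and q_sym: "l : La ==> t : {0..T} ==> x : Rd d ==> q (vneg d l) t x = q l t x"
  and p_sym: "l : La ==> t : {0..T} ==> x : Rd d ==> p (vneg d l) t x = - p l t x"
  and sol: "h : {0<..h0} ==> S.bounded_solution T f g h (u h)"
  and ka: "!!n. moll (1 / (real n + 1)) (ka n)"
begin

lemma B: "l : La ==> q l : B_space d T m" "l : La ==> p l : B_space d T m" "c : B_space d T m"
  "f : B_space d T m" "(%_. g) : B_space d T m"
 using reg by (auto simp: regularity_def)

abbreviation ee :: "nat => real" where "ee n \<equiv> 1 / (real n + 1)"
abbreviation mv :: "nat => (vec => real) => vec => real" where "mv n \<equiv> moll.cv d (ka n) (%_. 0)"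

definition bb :: "(real => vec => real) => real" where "bb ps = sqrt (fact m * (B_norm d T m ps)^2)"

lemma bb_nonneg: "0 <= bb ps" by (simp add: bb_def)

text \<open>The factorial is the price for passing from multi-indices to lists; the sum over k gives
  one bound for all orders up to m.\<close>

definition Mb :: real where "Mb = fact m * (SUM k<=m. (M k)\<^sup>2)"

lemma
 assumes ps: "ps : B_space d T m"
 shows mv_SM: "SM UNIV UNIV {0..T} (%t. mv n (ps t))"
  and mv_meas: "(%t. mv n (ps t) x) : time_measurable T"
  and mv_D2: "k <= m ==> t : {0..T} ==> D2 d k (mv n (ps t)) x <= fact m * (B_norm d T m ps)^2"
  and mv_rate: "t : {0..T} ==> y : Rd d ==> \<bar>mv n (ps t) y - ps t y\<bar> <= real d * ee n * bb ps"
  and mv_mono: "t : {0..T} ==> (!!y. y : Rd d ==> A <= ps t y) ==> A <= mv n (ps t) x"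
  and mv_bound: "t : {0..T} ==> \<bar>mv n (ps t) x\<bar> <= bb ps"
  and B_BD: "t : {0..T} ==> BD {..<d} (Rd d) 3 (bb ps) (ps t)"
  and B_bound: "t : {0..T} ==> y : Rd d ==> \<bar>ps t y\<bar> <= bb ps"
  and B_norm_nonneg: "0 <= B_norm d T m ps"
  and B_gb: "t : {0..T} ==> EX C. moll.gb d C (ps t)"
proof -
 interpret m: moll d "ee n" "ka n" by (rule ka)
 obtain C where C: "!!t y. t : {0..T} ==> y : Rd d ==> \<bar>ps t y\<bar> <= C" using B_space_bounded[OF ps] by blast
 note me = B_space_meas[OF ps]
 show "SM UNIV UNIV {0..T} (%t. mv n (ps t))" by (rule m.SM_cv[OF me C])
 show "(%t. mv n (ps t) x) : time_measurable T"
  by (rule m.cv_time_meas) (use ps in "simp add: B_space_def")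
 show D2: "D2 d k (mv n (ps t)) x <= fact m * (B_norm d T m ps)^2" if "k <= m" "t : {0..T}" for k t x
 proof -
  have "fact k * (B_norm d T m ps)^2 <= fact m * (B_norm d T m ps)^2" using fact_mono[OF that(1)] by (intro mult_right_mono) auto
  thus ?thesis using m.cvB(3)[OF ps that(2,1), of x] by linarith
 qed
 obtain j where j: "m = Suc (Suc j)" using m4 by (metis One_nat_def add_2_eq_Suc le_Suc_ex numeral_2_eq_2 numeral_Bit0 add.assoc)
 have e: "bb ps = sqrt (fact (Suc (Suc j)) * (B_norm d T (Suc (Suc j)) ps)^2)" unfolding bb_def unfolding j ..
 show "\<bar>mv n (ps t) y - ps t y\<bar> <= real d * ee n * bb ps" if "t : {0..T}" "y : Rd d"
  using m.cv_rate[OF ps[unfolded j] that] unfolding e by (simp only: mult.commute)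
 show gb: "EX C. moll.gb d C (ps t)" if "t : {0..T}" for t using m.gbI[OF me C] that by blast
 show "A <= mv n (ps t) x" if "t : {0..T}" "!!y. y : Rd d ==> A <= ps t y"
  using gb[OF that(1)] m.cv_mono that(2) by blast
 show "\<bar>mv n (ps t) x\<bar> <= bb ps" if "t : {0..T}"
  using D2[of 0 t x] that unfolding bb_def by (simp add: D2_0 real_le_rsqrt)
 have 3: "3 <= Suc j" using m4 j by simp
 have b: "BD {..<d} (Rd d) (Suc j) (bb ps) (ps t)" if "t : {0..T}" for t
  using B_space_BD[OF ps[unfolded j] that] unfolding e .
 show "BD {..<d} (Rd d) 3 (bb ps) (ps t)" if "t : {0..T}" by (rule D.BD_mono[OF b[OF that] order_refl 3])
 show "\<bar>ps t y\<bar> <= bb ps" if "t : {0..T}" "y : Rd d" using D.BD_bound[OF b] that by blast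
 show "0 <= B_norm d T m ps" by (rule m.cvB(4)[OF ps, of 0 0]) (use T0 in auto)
qed

lemma mv_inv: "mv n ps (x(d := r)) = mv n ps x" by (rule moll.cv_upd[OF ka])

lemma mv_cong: "(!!y. y : Rd d ==> ps y = \<xi> y) ==> mv n ps x = mv n \<xi> x" by (rule moll.cv_fun_cong[OF ka])

lemma mv_coef:
 assumes "k <= m" "t : {0..T}"
 shows "(SUM l:La. D2 d k (mv n (q l t)) x + D2 d k (mv n (p l t)) x) + D2 d k (mv n (c t)) x <= Mb"
proof -
 have "(SUM l:La. D2 d k (mv n (q l t)) x + D2 d k (mv n (p l t)) x) + D2 d k (mv n (c t)) x <= fact k * (M k)^2"
  by (rule moll.cv_coef_bound[OF ka reg fin assms(2,1)])
 also have "... <= fact m * (M k)^2" using fact_mono[OF assms(1)] by (intro mult_right_mono) auto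
 also have "... <= Mb" unfolding Mb_def using assms(1) by (intro mult_left_mono member_le_sum) auto
 finally show ?thesis .
qed

lemma mv_sym:
 assumes "l : La" "t : {0..T}"
 shows "mv n (q (vneg d l) t) x = mv n (q l t) x" "mv n (p (vneg d l) t) x = - mv n (p l t) x"
proof -
 show "mv n (q (vneg d l) t) x = mv n (q l t) x" by (rule mv_cong) (use q_sym assms in auto)
 have "mv n (p (vneg d l) t) x = mv n (%y. - p l t y) x" by (rule mv_cong) (use p_sym assms in auto)
 thus "mv n (p (vneg d l) t) x = - mv n (p l t) x" using moll.cv_uminus[OF ka] by simp
qed

lemma mv_qp:
 assumes h: "h : {0<..h0}" and l: "l : La" and t: "t : {0..T}"
 shows "0 <= mv n (q l t) x + h * mv n (p l t) x"
proof -
 interpret m: moll d "ee n" "ka n" by (rule ka)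
 obtain C C' where g: "m.gb C (q l t)" "m.gb C' (p l t)" using B_gb B l t by blast
 have "(%y. 1 * q l t y + h * p l t y) : borel_measurable (Leb d)" using B_space_meas B l t by simp
 moreover have "\<bar>1 * q l t y + h * p l t y\<bar> <= bb (q l) + h * bb (p l)" if "y : Rd d" for y
 proof -
  have "\<bar>h * p l t y\<bar> <= h * bb (p l)" using B_bound[OF B(2)[OF l] t that] h by (simp add: abs_mult mult_left_mono)
  thus ?thesis using B_bound[OF B(1)[OF l] t that] by linarith
 qed
 ultimately have gs: "m.gb (bb (q l) + h * bb (p l)) (%y. 1 * q l t y + h * p l t y)" by (rule m.gbI)
 have "0 <= m.cv0 (%y. 1 * q l t y + h * p l t y) x" by (rule m.cv_mono[OF gs]) (use qp[OF h l t] in simp)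
 thus ?thesis using m.cv_lin[OF g, of "%_. 0" 1 h x] by simp
qed

lemma transfer: "transfer d La ell \<tau>0 \<tau> q p c h0 T de K m (ee n) (ka n)"
proof -
 interpret m: moll d "ee n" "ka n" by (rule ka)
 show ?thesis by unfold_locales (use B_BD B in blast)+
qed

lemma energy_inst:
 assumes h: "h : {0<..h0}"
 shows "energy d La ell \<tau>0 \<tau> (%l t. mv n (q l t)) (%l t. mv n (p l t)) (%t. mv n (c t)) h T de K c0 nL nL\<tau> Mb m"
proof
 show "0 < h" "0 <= T" using h T0 by auto
 show "SM {..<d} (Rd d) {0..T} (%t. mv n (q l t))" "SM {..<d} (Rd d) {0..T} (%t. mv n (p l t))" if "l : La" for l
  using SM_subset[OF mv_SM[OF B(1)[OF that]] subset_UNIV subset_UNIV] SM_subset[OF mv_SM[OF B(2)[OF that]] subset_UNIV subset_UNIV] .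
 show "SM {..<d} (Rd d) {0..T} (%t. mv n (c t))" by (rule SM_subset[OF mv_SM[OF B(3)] subset_UNIV subset_UNIV])
qed (rule fin L1 ell_inj disj \<tau>00 de0 de1 K1 c00 nL nL\<tau> sym
   mv_meas B mv_qp[OF h] mv_mono[OF B(3)] c_ge mv_sym mv_coef transfer.struct_moll[OF transfer h]; assumption?)+

definition Y :: real where "Y = fact m * (B_norm d T m f + B_norm d T m (%_. g))^2"

lemma evol_inst:
 assumes et: "0 < et" "et < h0"
 shows "evol d et (h0 + 1) La (%l t. mv n (q l t)) (%l t. mv n (p l t)) (%t. mv n (c t)) T nL Mb m
  ell \<tau>0 \<tau> h0 de K c0 nL\<tau> (%t. mv n (f t)) (mv n g) Y"
proof -
 interpret slab d et "h0 + 1" using et by unfold_locales auto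
 have U: "SM UNIV US {0..T} (%t. mv n (ps t))" if "ps : B_space d T m" for ps
  by (rule SM_subset[OF mv_SM[OF that] subset_UNIV subset_UNIV])
 have le: "fact m * a^2 <= fact m * (a + b)^2" "fact m * b^2 <= fact m * (a + b)^2" if "0 <= a" "0 <= b" for a b :: real
  using that by (intro mult_left_mono power_mono; simp)+
 note le = le[OF B_norm_nonneg[OF B(4)] B_norm_nonneg[OF B(5)]]
 show ?thesis
 proof (intro evol.intro evol_axioms.intro slab_sym.intro slab_sym_axioms.intro slab_scheme.intro slab_scheme_axioms.intro)
  show "slab et (h0 + 1)" by (rule slab_axioms)
  show "0 <= T" "et < h0" "h0 < h0 + 1" using T0 et by auto
  show "energy d La ell \<tau>0 \<tau> (%l t. mv n (q l t)) (%l t. mv n (p l t)) (%t. mv n (c t)) h T de K c0 nL nL\<tau> Mb m"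
   if "et < h" "h <= h0" for h by (rule energy_inst) (use that et in simp)
  show "(SUM l:La. D2 d k (mv n (q l t)) x) <= Mb & (SUM l:La. D2 d k (mv n (p l t)) x) <= Mb" if "k <= m" "t : {0..T}" for k t x
  proof -
   have "0 <= (SUM l:La. D2 d k (mv n (q l t)) x)" "0 <= (SUM l:La. D2 d k (mv n (p l t)) x)" "0 <= D2 d k (mv n (c t)) x"
    by (auto intro: sum_nonneg D2_nonneg)
   thus ?thesis using mv_coef[OF that, of n x] unfolding sum.distrib by linarith
  qed
  show "D2 d j (mv n (f t)) x <= Y" if "j <= m" "t : {0..T}" for j t x
   using mv_D2[OF B(4) that, of n x] le(1) unfolding Y_def by linarith
  show "D2 d j (mv n g) x <= Y" if "j <= m" for j x
  proof -
   have "0 : {0..T}" using T0 by simp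
   from mv_D2[OF B(5) that this, of n x] le(2) show ?thesis unfolding Y_def by linarith
  qed
  show "0 <= Y" by (simp add: Y_def)
  show "SM UNIV US {0..T} (%_. mv n g)" using U[OF B(5)] .
 qed (rule fin L1 sym nL U mv_meas B mv_sym mv_inv; assumption?)+
qed

end

context prob
begin

lemma prim_u:
 assumes h: "h : {0<..h0}" and z: "z : Rd d"
 shows "prim T (%t. u h t z) (%t. S.Lh h t (u h t) z + f t z)" and "u h 0 z = g z"
  and "EX C>=0. ALL t:{0..T}. ALL y:Rd d. \<bar>u h t y\<bar> <= C"
proof -
 let ?r = "%s. S.Lh h s (u h s) z + f s z"
 obtain C where C: "!!t y. t : {0..T} ==> y : Rd d ==> \<bar>u h t y\<bar> <= C" using sol[OF h] unfolding S.bounded_solution_def by blast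
 have C0: "0 <= C" using C[of 0 z] T0 z by (auto intro: order_trans[OF abs_ge_zero])
 thus "EX C>=0. ALL t:{0..T}. ALL y:Rd d. \<bar>u h t y\<bar> <= C" using C by blast
 have int: "set_integrable lborel {0..t} ?r" "u h t z = g z + (LBINT s:{0..t}. ?r s)" if "t : {0..T}" for t
  using sol[OF h] that z unfolding S.bounded_solution_def by blast+
 show g: "u h 0 z = g z" using int(2)[of 0] T0 by (simp add: LBINT_point)
 show "prim T (%t. u h t z) ?r"
 proof (rule primI)
  have "(%s. indicator {0..T} s *\<^sub>R ?r s) : borel_measurable borel"
   using int(1)[of T] T0 borel_measurable_integrable unfolding set_integrable_def by fastforce
  thus "?r : time_measurable T" by (subst borel_measurable_restrict_space_iff) auto
  fix t assume t: "t : {0..T}"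
  have "\<bar>S.Lh h t (u h t) z\<bar> <= 1 * ((SUM l:La. (1 / h * bb (q l) + bb (p l)) * (2 * C / h)) + bb c * C)"
   by (rule Lh_bound) (use h C0 C t z B B_bound in auto)
  thus "\<bar>?r t\<bar> <= (SUM l:La. (1 / h * bb (q l) + bb (p l)) * (2 * C / h)) + bb c * C + bb f"
   unfolding mult_1 by (rule order_trans[OF abs_triangle_ineq add_mono[OF _ B_bound[OF B(4) t z]]])
  show "u h t z = u h 0 z + (LBINT s:{0..t}. ?r s)" using int(2)[OF t] g by simp
 qed
qed

abbreviation "US et \<equiv> slab.US d et (h0 + 1)"
abbreviation "Lopn n \<equiv> slab_scheme.Lop d La (%l t. mv n (q l t)) (%l t. mv n (p l t)) (%t. mv n (c t))"
abbreviation "Lhn n \<equiv> scheme.Lh d La (%l t. mv n (q l t)) (%l t. mv n (p l t)) (%t. mv n (c t))"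

definition approx :: "real => nat => (real => vec => real) => bool" where
 "approx et n v \<longleftrightarrow> SM UNIV (US et) {0..T} v & (ALL x:US et. v 0 x = mv n g x & prim T (%t. v t x) (%t. Lopn n t (v t) x + mv n (f t) x))"

lemma approx_exists: "0 < et ==> et < h0 ==> EX v. approx et n v"
proof -
 assume "0 < et" "et < h0"
 then interpret e: evol d et "h0 + 1" La "%l t. mv n (q l t)" "%l t. mv n (p l t)" "%t. mv n (c t)" T nL Mb m
  ell \<tau>0 \<tau> h0 de K c0 nL\<tau> "%t. mv n (f t)" "mv n g" Y by (rule evol_inst)
 show ?thesis using e.picard[OF e.fU e.gU e.f_meas] unfolding approx_def .
qed

text \<open>The maximum principle for the square of the difference. Nothing but boundedness is known
  of u_h, so its difference quotients are estimated by 2C/h; the resulting constant depends on h,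
  which is harmless because h stays fixed while n tends to infinity.\<close>

lemma error_bound:
 assumes et: "0 < et" "et < h0" and h: "et < h" "h <= h0" and v: "approx et n v" and C0: "0 <= C"
  and C: "!!t y. t : {0..T} ==> y : Rd d ==> \<bar>u h t y\<bar> <= C" and t: "t : {0..T}" and z: "z : Rd d"
 defines "\<Gamma> \<equiv> (SUM l:La. (1 / h * bb (q l) + bb (p l)) * (2 * C / h)) + bb c * C + bb f"
 shows "(v t (z(d := h)) - u h t z)^2 <= ((bb (%_. g))^2 + (\<Gamma> / c0)^2) * (real d * ee n)^2"
proof -
 interpret e: evol d et "h0 + 1" La "%l t. mv n (q l t)" "%l t. mv n (p l t)" "%t. mv n (c t)" T nL Mb m
  ell \<tau>0 \<tau> h0 de K c0 nL\<tau> "%t. mv n (f t)" "mv n g" Y by (rule evol_inst[OF et])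
 have hh: "h : {0<..h0}" "0 < h" using et h by auto
 have US: "y(d := h) : e.US" for y by (rule e.upd_US) (use h in auto)
 define s where "s = real d * ee n"
 have s0: "0 <= s" by (simp add: s_def)
 define E where "E t y = v t (y(d := h)) - u h t y" for t y
 define a where "a l t y = (1 / h * mv n (q l t) y + mv n (p l t) y) / h" for l t and y :: vec
 define r where "r t y = Lhn n h t (sl d h (v t)) y + mv n (f t) y - (S.Lh h t (u h t) y + f t y)" for t y
 define G where "G t y = r t y - Lhn n h t (E t) y" for t y
 have prim: "prim T (%t. E t y) (%t. r t y)" if y: "y : Rd d" for y
 proof -
  have "prim T (%t. v t (y(d := h))) (%t. Lopn n t (v t) (y(d := h)) + mv n (f t) (y(d := h)))"
   using v US unfolding approx_def by blast
  hence "prim T (%t. v t (y(d := h))) (%t. Lhn n h t (sl d h (v t)) y + mv n (f t) y)"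
   using e.Lop_sl[OF y hh(2)] by (simp only: mv_inv)
  from prim_diff[OF this prim_u(1)[OF hh(1) y]] show ?thesis unfolding E_def r_def .
 qed
 have G: "\<bar>G t y\<bar> <= s * \<Gamma>" if t: "t : {0..T}" and y: "y : Rd d" for t y
 proof -
  have "G t y = scheme.Lh d La (%l t x. mv n (q l t) x - q l t x) (%l t x. mv n (p l t) x - p l t x) (%t x. mv n (c t) x - c t x) h t (u h t) y
    + (mv n (f t) y - f t y)"
   unfolding G_def r_def E_def[abs_def]
   using Lh_diff[of d La "%l t. mv n (q l t)" "%l t. mv n (p l t)" "%t. mv n (c t)" h t "sl d h (v t)" y q p c "u h t"]
   by (simp add: sl_def)
  moreover have "\<bar>scheme.Lh d La (%l t x. mv n (q l t) x - q l t x) (%l t x. mv n (p l t) x - p l t x) (%t x. mv n (c t) x - c t x) h t (u h t) y\<bar>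
    <= s * ((SUM l:La. (1 / h * bb (q l) + bb (p l)) * (2 * C / h)) + bb c * C)"
   by (rule Lh_bound[OF hh(2) s0 C0]) (use mv_rate B t y C in "auto simp: s_def")
  moreover have "\<bar>mv n (f t) y - f t y\<bar> <= s * bb f" using mv_rate[OF B(4) t y] by (simp add: s_def)
  ultimately show ?thesis unfolding \<Gamma>_def distrib_left by linarith
 qed
 have a: "0 <= a l t y" "a l t y <= (SUM l:La. (1 / h * bb (q l) + bb (p l)) / h)" if l: "l : La" and t: "t : {0..T}" for l t y
 proof -
  have "a l t y = (mv n (q l t) y + h * mv n (p l t) y) / h^2" using hh by (simp add: a_def field_simps power2_eq_square)
  thus "0 <= a l t y" using mv_qp[OF hh(1) l t] by simp
  have "a l t y <= (1 / h * bb (q l) + bb (p l)) / h" unfolding a_def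
   using hh mv_bound[OF B(1)[OF l] t, of n y] mv_bound[OF B(2)[OF l] t, of n y] by (intro divide_right_mono add_mono mult_left_mono) auto
  also have "... <= (SUM l:La. (1 / h * bb (q l) + bb (p l)) / h)"
   using fin l hh bb_nonneg by (intro member_le_sum) auto
  finally show "a l t y <= (SUM l:La. (1 / h * bb (q l) + bb (p l)) / h)" .
 qed
 have Vb: "EX Bm. ALL t:{0..T}. ALL y:Rd d. (E t y)\<^sup>2 <= Bm"
 proof -
  obtain Cv where Cv: "!!t. t : {0..T} ==> BD UNIV e.US 0 Cv (v t)" using v unfolding approx_def SM_def by blast
  have "(E t y)^2 <= (Cv + C)^2" if "t : {0..T}" "y : Rd d" for t y
  proof -
   have "\<bar>v t (y(d := h))\<bar> <= Cv" using Cv[OF that(1)] US by (simp del: fun_upd_apply)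
   hence "\<bar>E t y\<bar> <= Cv + C" using C[OF that] unfolding E_def by linarith
   thus ?thesis by (simp add: abs_le_square_iff[symmetric])
  qed
  thus ?thesis by blast
 qed
 then obtain Bm where Bm: "!!t y. t : {0..T} ==> y : Rd d ==> (E t y)\<^sup>2 <= Bm" by blast
 have "(E t z)^2 <= max ((s * bb (%_. g))^2) ((s * \<Gamma>)^2 / c0 / (2 * (1 / 2) * c0))"
 proof (rule maximum_principle[where V = "%t y. (E t y)\<^sup>2" and v = "%t y. 2 * E t y * r t y" and L = La and X = "Rd d" and a = a and c = "%t. mv n (c t)" and sh = "shift d h" and T = T])
  show "prim T (%t. (E t y)\<^sup>2) (%t. 2 * E t y * r t y)" if "y : Rd d" for y by (rule prim_square[OF prim[OF that]])
  show "0 <= a l t y & a l t y <= (SUM l:La. (1 / h * bb (q l) + bb (p l)) / h)" if "l : La" "t : {0..T}" for l t y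
   using a that by blast
  show cc: "c0 <= mv n (c t) y & mv n (c t) y <= bb c" if "t : {0..T}" for t y
   using mv_mono[OF B(3) that c_ge[OF that], of n y] mv_bound[OF B(3) that, of n y] by (auto simp: abs_le_iff)
  show "(E 0 y)^2 <= (s * bb (%_. g))^2" if "y : Rd d" for y
  proof -
   have "v 0 (y(d := h)) = mv n g y" using v US[of y] unfolding approx_def by (metis mv_inv)
   hence "\<bar>E 0 y\<bar> <= s * bb (%_. g)" using mv_rate[OF B(5) _ that, of 0 n] T0 prim_u(2)[OF hh(1) that] by (simp add: E_def s_def)
   thus ?thesis by (simp add: abs_le_square_iff[symmetric])
  qed
  fix B t y assume B0: "0 <= B" and Bb: "!!t y. t : {0..T} ==> y : Rd d ==> (E t y)\<^sup>2 <= B" and t: "t : {0..T}" and y: "y : Rd d"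
  have rr: "r t y = (SUM l:La. a l t y * (E t (shift d h l y) - E t y)) - mv n (c t) y * E t y + G t y"
   unfolding G_def Lh_alt by (simp add: a_def)
  have "2 * E t y * (SUM l:La. a l t y * (E t (shift d h l y) - E t y)) <= (SUM l:La. a l t y * ((E t (shift d h l y))^2 - (E t y)\<^sup>2))"
   unfolding sum_distrib_left
  proof (rule sum_mono)
   fix l assume l: "l : La"
   have "0 <= (E t (shift d h l y) - E t y)^2" by simp
   hence "2 * E t y * (E t (shift d h l y) - E t y) <= (E t (shift d h l y))^2 - (E t y)\<^sup>2" by (simp add: power2_eq_square algebra_simps)
   hence "a l t y * (2 * E t y * (E t (shift d h l y) - E t y)) <= a l t y * ((E t (shift d h l y))^2 - (E t y)\<^sup>2)" by (rule mult_left_mono[OF _ a(1)[OF l t]])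
   thus "2 * E t y * (a l t y * (E t (shift d h l y) - E t y)) <= a l t y * ((E t (shift d h l y))^2 - (E t y)\<^sup>2)" by (simp only: mult.left_commute)
  qed
  moreover have "2 * E t y * G t y <= mv n (c t) y * B + (s * \<Gamma>)^2 / c0"
  proof -
   have "0 <= (c0 * E t y - G t y)^2 / c0" using c00 by simp
   also have "... = c0 * (E t y)^2 - 2 * E t y * G t y + (G t y)^2 / c0" using c00 by (simp add: power2_eq_square field_simps)
   finally have "2 * E t y * G t y <= c0 * (E t y)^2 + (G t y)^2 / c0" by linarith
   also have "... <= mv n (c t) y * B + (s * \<Gamma>)^2 / c0"
   proof (intro add_mono mult_mono divide_right_mono)
    show "(G t y)^2 <= (s * \<Gamma>)^2" using G[OF t y] by (simp add: abs_le_square_iff[symmetric])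
   qed (use cc[OF t, of y] Bb[OF t y] c00 in auto)
   finally show ?thesis .
  qed
  moreover have "2 * E t y * r t y = 2 * E t y * (SUM l:La. a l t y * (E t (shift d h l y) - E t y)) - 2 * mv n (c t) y * (E t y)^2 + 2 * E t y * G t y"
   unfolding rr by (simp add: algebra_simps power2_eq_square)
  ultimately show "2 * E t y * r t y <= (SUM l:La. a l t y * ((E t (shift d h l y))^2 - (E t y)\<^sup>2)) - 2 * mv n (c t) y * (E t y)\<^sup>2
    + 2 * (1 - 1 / 2) * mv n (c t) y * B + (s * \<Gamma>)^2 / c0" by simp
 qed (use T0 fin Bm c00 t z in "auto simp: shift_def Rd_def")
 also have "... <= (s * bb (%_. g))^2 + (s * \<Gamma>)^2 / c0 / (2 * (1 / 2) * c0)" using c00 by (intro max.boundedI) auto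
 also have "... = ((bb (%_. g))^2 + (\<Gamma> / c0)^2) * s^2" by (simp add: power2_eq_square algebra_simps)
 finally show ?thesis by (simp add: E_def s_def)
qed

lemma approx_tendsto:
 assumes et: "0 < et" "et < h0" and h: "et < h" "h <= h0" and v: "!!n. approx et n (v n)" and t: "t : {0..T}" and z: "z : Rd d"
 shows "(%n. v n t (z(d := h))) \<longlonglongrightarrow> u h t z"
proof -
 have hh: "h : {0<..h0}" using et h by auto
 obtain C where C: "0 <= C" "!!t y. t : {0..T} ==> y : Rd d ==> \<bar>u h t y\<bar> <= C" using prim_u(3)[OF hh z] by blast
 define D where "D = (bb (%_. g))^2 + (((SUM l:La. (1 / h * bb (q l) + bb (p l)) * (2 * C / h)) + bb c * C + bb f) / c0)^2"
 have "(%n. ee n) \<longlonglongrightarrow> 0" using LIMSEQ_inverse_real_of_nat by (simp add: inverse_eq_divide add.commute)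
 hence l0: "(%n. D * (real d * ee n)^2) \<longlonglongrightarrow> D * (real d * 0)^2" by (intro tendsto_intros)
 have "(%n. (v n t (z(d := h)) - u h t z)\<^sup>2) \<longlonglongrightarrow> 0"
 proof (rule Lim_null_comparison)
  show "(%n. D * (real d * ee n)^2) \<longlonglongrightarrow> 0" using l0 by simp
  have "(v n t (z(d := h)) - u h t z)^2 <= D * (real d * ee n)^2" for n
   unfolding D_def by (rule error_bound[OF et h v C t z])
  thus "\<forall>\<^sub>F n in sequentially. norm ((v n t (z(d := h)) - u h t z)^2) <= D * (real d * ee n)^2" by (simp del: fun_upd_apply)
 qed
 from tendsto_real_sqrt[OF this] have "(%n. v n t (z(d := h)) - u h t z) \<longlonglongrightarrow> 0" by (simp add: tendsto_rabs_zero_iff del: fun_upd_apply)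
 thus ?thesis by (rule Lim_null[THEN iffD2])
qed

abbreviation "CQ \<equiv> cQ m de K c0 \<tau>0 nL nL\<tau> Mb"

lemma approx_bounds:
 assumes et: "0 < et" "et < h0" and v: "approx et n v" and t: "t : {0..T}" and z: "z : Rd d" and h: "et < h" "h <= h0"
 shows "3 * k + r <= m ==> D2 d r ((pd d ^^ k) (v t)) (z(d := h)) <= CQ ^ (k + 1) * Y"
  and "odd k ==> 3 * k + r + 1 <= m ==> D2 d r ((pd d ^^ k) (v t)) (z(d := h)) <= CQ ^ (k + 1) * (h^2 * Y)"
  and "3 * k + 1 <= m ==> ((pd d ^^ Suc k) (v t) (z(d := h)))\<^sup>2 <= cA m de K c0 \<tau>0 nL nL\<tau> Mb *
   (real m * 4 ^ m * ((slab_sym.cE nL Mb m + slab_sym.cC et La nL Mb) * (CQ ^ (k + 1) * Y)))"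
  and "1 <= CQ" "0 <= Y"
proof -
 interpret e: evol d et "h0 + 1" La "%l t. mv n (q l t)" "%l t. mv n (p l t)" "%t. mv n (c t)" T nL Mb m
  ell \<tau>0 \<tau> h0 de K c0 nL\<tau> "%t. mv n (f t)" "mv n g" Y by (rule evol_inst[OF et])
 have v': "e.SU {0..T} v" "!!x. x : e.US ==> v 0 x = mv n g x" "!!x. x : e.US ==> prim T (%t. v t x) (%t. Lopn n t (v t) x + mv n (f t) x)"
  using v unfolding approx_def by blast+
 note V = e.V_bounds[OF v', of k, THEN spec, THEN spec, THEN spec, THEN spec, of r t z h]
 show "3 * k + r <= m ==> D2 d r ((pd d ^^ k) (v t)) (z(d := h)) <= CQ ^ (k + 1) * Y"
  "odd k ==> 3 * k + r + 1 <= m ==> D2 d r ((pd d ^^ k) (v t)) (z(d := h)) <= CQ ^ (k + 1) * (h^2 * Y)"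
  using V t z h by (simp_all del: fun_upd_apply)
 show "3 * k + 1 <= m ==> ((pd d ^^ Suc k) (v t) (z(d := h)))\<^sup>2 <= cA m de K c0 \<tau>0 nL nL\<tau> Mb *
   (real m * 4 ^ m * ((slab_sym.cE nL Mb m + slab_sym.cC et La nL Mb) * (CQ ^ (k + 1) * Y)))"
  by (rule e.V_crude[OF v' _ t z h])
 show "1 <= CQ" "0 <= Y" by (rule e.CQ1, rule e.Y0)
qed

text \<open>Induction on the order of the h-derivative: if the j-th derivatives of the
  approximations converge pointwise, bounds of order j + 2 let \<open>deriv_pointwise_limit\<close>
  produce the next one. To reach order k, bounds of order k + 1 are therefore needed. At h = h0 the
  limit is differentiated from the left only, as in \<open>Dh\<close>.\<close>

lemma h_derivs:
 assumes et: "0 < et" "et < h0" and v: "!!n. approx et n (v n)" and t: "t : {0..T}" and z: "z : Rd d" and k: "3 * k + 1 <= m"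
 shows "j <= k ==> et < h ==> h <= h0 ==> (%n. (pd d ^^ j) (v n t) (z(d := h))) \<longlonglongrightarrow> (Dh h0 ^^ j) (%h. u h t z) h"
  and "j < k ==> et < h ==> h <= h0 ==> (Dh h0 ^^ j) (%h. u h t z) differentiable (at h within {0<..h0})"
proof -
 interpret sb: slab d et "h0 + 1" using et by unfold_locales auto
 let ?S = "{et<..h0}"
 let ?F = "%j. (Dh h0 ^^ j) (%h. u h t z)"
 let ?f = "%n j h. (pd d ^^ j) (v n t) (z(d := h))"
 have US: "z(d := h) : sb.US" if "h : ?S" for h by (rule sb.upd_US) (use that in auto)
 have SU: "sb.SU {0..T} (%t. (pd d ^^ j) (v n t))" for n j
  using v[of n] sb.S.SM_foldr[of "{0..T}" "v n" "replicate j d"] by (simp add: approx_def foldr_replicate)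
 have dv: "(?f n j has_real_derivative ?f n (Suc j) h) (at h within ?S)" if "h : ?S" for n j h
  using sb.S.SM_DERIV[OF SU t US[OF that], of d j n] by (simp add: has_field_derivative_at_within del: fun_upd_apply) (simp add: has_field_derivative_at_within)
 \<comment> \<open>A common bound for all orders up to k + 1 on the slab, the last summand being the
   crude one. It depends on \<open>et\<close> but not on n, which suffices for the passage to the
   limit.\<close>
 define A where "A = (SUM i<=k. CQ ^ (i + 1) * Y) + cA m de K c0 \<tau>0 nL nL\<tau> Mb * (real m * 4 ^ m * ((slab_sym.cE nL Mb m + slab_sym.cC et La nL Mb) * (CQ ^ (k + 1) * Y)))"
 have bd: "\<bar>?f n i h\<bar> <= sqrt A" if i: "i <= Suc k" and h: "h : ?S" for n i h
 proof -
  have hh: "et < h" "h <= h0" using h by auto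
  note ab = approx_bounds[OF et v t z hh]
  have nn: "0 <= CQ ^ (i + 1) * Y" for i using ab(4,5) by simp
  have s0: "0 <= (SUM i<=k. CQ ^ (i + 1) * Y)" using nn by (intro sum_nonneg)
  have c0: "0 <= cA m de K c0 \<tau>0 nL nL\<tau> Mb * (real m * 4 ^ m * ((slab_sym.cE nL Mb m + slab_sym.cC et La nL Mb) * (CQ ^ (k + 1) * Y)))"
   using order_trans[OF zero_le_power2 ab(3)[OF k]] .
  have "(?f n i h)^2 <= A"
  proof (cases "i <= k")
   case True
   have "D2 d 0 ((pd d ^^ i) (v n t)) (z(d := h)) <= CQ ^ (i + 1) * Y" by (rule ab(1)) (use True k in simp)
   also have "... <= (SUM i<=k. CQ ^ (i + 1) * Y)" using True nn by (intro member_le_sum) auto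
   finally show ?thesis using c0 unfolding D2_0 A_def by linarith
  next
   case False
   hence "i = Suc k" using i by simp
   thus ?thesis using ab(3)[OF k, of n] s0 unfolding A_def by (simp del: fun_upd_apply funpow.simps)
  qed
  thus ?thesis by (simp add: real_le_rsqrt del: fun_upd_apply)
 qed
 have step: "?F j differentiable (at h within {0<..h0}) & (%n. ?f n (Suc j) h) \<longlonglongrightarrow> ?F (Suc j) h"
  if j: "j < k" and lim: "!!h. h : ?S ==> (%n. ?f n j h) \<longlonglongrightarrow> ?F j h" and h: "h : ?S" for j h
 proof -
  have nt: "at h within ?S ~= bot"
  proof -
   have "{et<..h} \<subseteq> ?S" "h islimpt {et<..h}" using h by auto
   thus ?thesis unfolding trivial_limit_within using islimpt_subset by blast
  qed
  have L: "\<bar>?f n (Suc j) x - ?f n (Suc j) y\<bar> <= sqrt A * \<bar>x - y\<bar>" if "x : ?S" "y : ?S" for n x y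
  proof -
   have "norm (?f n (Suc j) x - ?f n (Suc j) y) <= sqrt A * norm (x - y)"
    by (rule field_differentiable_bound[OF _ dv]) (use bd[of "Suc (Suc j)"] j that in auto)
   thus ?thesis by simp
  qed
  have "EX l. (%n. ?f n (Suc j) h) \<longlonglongrightarrow> l & (?F j has_real_derivative l) (at h within ?S)"
   by (rule deriv_pointwise_limit[OF _ dv L lim h nt]) auto
  then obtain l where l: "(%n. ?f n (Suc j) h) \<longlonglongrightarrow> l" "(?F j has_real_derivative l) (at h within ?S)" by blast
  have "at h within {0<..h0} = at h within ?S"
   by (rule at_within_nhd[where S = "{et<..}"]) (use h et in auto)
  hence d: "(?F j has_vector_derivative l) (at h within {0<..h0})" "at h within {0<..h0} ~= bot"
   using l(2) nt by (simp_all add: has_real_derivative_iff_has_vector_derivative)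
  hence "?F (Suc j) h = l" unfolding funpow.simps comp_def Dh_def by (intro vector_derivative_within)
  thus ?thesis using l(1) d(1) by (auto simp: has_vector_derivative_def differentiable_def)
 qed
 have lim: "j <= k ==> h : ?S ==> (%n. ?f n j h) \<longlonglongrightarrow> ?F j h" for j h
 proof (induction j arbitrary: h)
  case 0
  thus ?case using approx_tendsto[OF et _ _ v t z, of h] by (simp del: fun_upd_apply)
 next
  case (Suc j)
  thus ?case using step[of j h] by (simp del: fun_upd_apply funpow.simps)
 qed
 show "j <= k ==> et < h ==> h <= h0 ==> (%n. ?f n j h) \<longlonglongrightarrow> ?F j h" using lim[of j h] by simp
 show "j < k ==> et < h ==> h <= h0 ==> ?F j differentiable (at h within {0<..h0})" using step[of j h] lim[of j] by simp
qed

lemma final_bounds: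
 assumes k: "odd k" "3 * k + 1 <= m" and r: "3 * k + r + 1 <= m" and h: "h : {0<..h0}" and t: "t : {0..T}"
 defines "w \<equiv> %x. (Dh h0 ^^ k) (%h'. u h' t x) h"
 shows "x : Rd d ==> j < k ==> (Dh h0 ^^ j) (%h. u h t x) differentiable (at h within {0<..h0})"
  and "EX C. BD {..<d} (Rd d) r C w" and "x : Rd d ==> D2 d r w x <= CQ ^ (k + 1) * (h^2 * Y)" and "1 <= CQ"
proof -
 \<comment> \<open>Any lower end of the slab below h would do, because the bounds that enter the
   result do not depend on it.\<close>
 have et: "0 < h / 2" "h / 2 < h0" "h / 2 < h" "h <= h0" using h by auto
 have "ALL n. EX v. approx (h / 2) n v" using approx_exists et by blast
 then obtain v where v: "!!n. approx (h / 2) n (v n)" by metis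
 interpret sb: slab d "h / 2" "h0 + 1" using et by unfold_locales auto
 show "x : Rd d ==> j < k ==> (Dh h0 ^^ j) (%h. u h t x) differentiable (at h within {0<..h0})"
  by (rule h_derivs(2)[OF et(1,2) v t _ k(2) _ et(3,4)])
 have nn: "1 <= CQ" "0 <= Y" using approx_bounds(4,5)[OF et(1,2) v t _ et(3,4), of "vzero d"] by (auto simp: vzero_def Rd_def)
 thus "1 <= CQ" by simp
 define ph where "ph n = sl d h ((pd d ^^ k) (v n t))" for n
 let ?B = "CQ ^ (k + 1) * Y"
 \<comment> \<open>One x-derivative beyond r, for which the budget 3k + r + 1 \<le> m just suffices.
   Its bound lacks the factor h; it serves only to carry the derivatives up to order r to the
   limit.\<close>
 have b: "BD {..<d} (Rd d) (Suc r) (sqrt ?B) (ph n)" for n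
 proof -
  have SU: "sb.SU {0..T} (%t. (pd d ^^ k) (v n t))"
   using v[of n] sb.S.SM_foldr[of "{0..T}" "v n" "replicate k d"] by (simp add: approx_def foldr_replicate)
  have "SM {..<d} (Rd d) {0..T} (%t. sl d h ((pd d ^^ k) (v n t)))" by (rule sb.SM_sl[OF _ _ SU]) (use et in auto)
  then obtain C where "BD {..<d} (Rd d) (Suc r) C (ph n)" using t unfolding SM_def ph_def by blast
  thus ?thesis
  proof (rule BD_from_D2)
   show "D2 d i (ph n) x <= ?B" if "i <= Suc r" "x : Rd d" for i x
    unfolding ph_def D2_sl by (rule approx_bounds(1)[OF et(1,2) v t that(2) et(3,4)]) (use that r in simp)
  qed
 qed
 have lim: "(%n. ph n x) \<longlonglongrightarrow> w x" if "x : Rd d" for x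
  using h_derivs(1)[OF et(1,2) v t that k(2) order_refl et(3,4)] unfolding ph_def sl_def w_def .
 show "EX C. BD {..<d} (Rd d) r C w" using D.BD_limit(1)[OF b lim] by blast
 assume x: "x : Rd d"
 have "(%n. D2 d r (ph n) x) \<longlonglongrightarrow> D2 d r w x"
  unfolding D2_def by (intro tendsto_sum tendsto_power D.BD_limit(2)[OF b lim] x) (auto simp: nl_def)
 thus "D2 d r w x <= CQ ^ (k + 1) * (h^2 * Y)"
 proof (rule LIMSEQ_le_const2, intro exI allI impI)
  show "D2 d r (ph n) x <= CQ ^ (k + 1) * (h^2 * Y)" for n
   unfolding ph_def D2_sl by (rule approx_bounds(2)[OF et(1,2) v t x et(3,4) k(1) r])
 qed
qed

end

text \<open>A multi-index corresponds injectively to its sorted list of directions, so the sum over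
  multi-indices is part of the sum over lists.\<close>

lemma Dmulti_D2: "(SUM \<alpha>:multi_index d r. \<bar>Dmulti d \<alpha> w x\<bar>\<^sup>2) <= D2 d r w x"
proof -
 let ?g = "%\<alpha>::nat => nat. concat (map (%i. replicate (\<alpha> i) i) [0..<d])"
 have D: "foldr (%i. pd i ^^ \<alpha> i) is ph = foldr pd (concat (map (%i. replicate (\<alpha> i) i) is)) ph" for \<alpha> "is" and ph :: "vec => real"
  by (induction "is") (simp_all add: foldr_replicate)
 have cr: "count_list (replicate n a) b = (if a = b then n else 0)" for n and a b :: nat by (induction n) auto
 have cl: "count_list (?g \<alpha>) i = \<alpha> i" if "i < d" for \<alpha> i
 proof -
  have "count_list (concat (map (%i. replicate (\<alpha> i) i) is)) i = (if i : set is then \<alpha> i else 0)" if "distinct is" for "is"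
   using that by (induction "is") (auto simp: count_list_append cr)
  from this[of "[0..<d]"] show ?thesis using that by simp
 qed
 have "(SUM \<alpha>:multi_index d r. \<bar>Dmulti d \<alpha> w x\<bar>\<^sup>2) = (SUM \<alpha>:multi_index d r. (foldr pd (?g \<alpha>) w x)\<^sup>2)"
  unfolding Dmulti_def D by simp
 also have "... <= (SUM is:nl {..<d} r. (foldr pd is w x)\<^sup>2)"
 proof (rule sum_subset_image_le[where g = ?g])
  show "inj_on ?g (multi_index d r)"
  proof (rule inj_onI)
   fix \<alpha> be assume ab: "\<alpha> : multi_index d r" "be : multi_index d r" "?g \<alpha> = ?g be"
   have "\<alpha> i = be i" if "i < d" for i using cl[OF that, of \<alpha>] cl[OF that, of be] ab(3) by simp
   thus "\<alpha> = be" using ab(1,2) unfolding multi_index_def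
    by (intro PiE_ext[of \<alpha> "{..<d}" "%_. {..r}" be]) auto
  qed
  show "?g ` multi_index d r \<subseteq> nl {..<d} r"
  proof
   fix js assume "js : ?g ` multi_index d r"
   then obtain \<alpha> where a: "\<alpha> : multi_index d r" "js = ?g \<alpha>" by blast
   have "length (concat (map (%i. replicate (\<alpha> i) i) is)) = (SUM i<-is. \<alpha> i)" for "is" by (induction "is") auto
   from this[of "[0..<d]"] have "length (?g \<alpha>) = (SUM i<d. \<alpha> i)"
    using sum_list_distinct_conv_sum_set[of "[0..<d]" \<alpha>] by (simp only: distinct_upt set_upt atLeast0LessThan simp_thms)
   moreover have "set (?g \<alpha>) \<subseteq> {..<d}" by auto
   moreover have "(SUM i<d. \<alpha> i) = r" using a(1) by (simp add: multi_index_def)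
   ultimately show "js : nl {..<d} r" unfolding a(2) nl_def by simp
  qed
 qed (auto simp: finite_nl)
 finally show ?thesis by (simp add: D2_def)
qed

lemma BD_has_partials:
 assumes "BD {..<d} (Rd d) r C w" shows "has_partials d r w"
 unfolding has_partials_def
proof (intro allI impI)
 interpret D: domR "{..<d}" "Rd d" "%_. UNIV" d by (rule domR_Rd)
 fix "is" i x assume a: "set is \<subseteq> {..<d}" "length is < r" "i < d" "x : Rd d"
 have "BD {..<d} (Rd d) (Suc 0 + length is) C w" by (rule D.BD_mono[OF assms order_refl]) (use a(2) in simp)
 from D.BD_foldr[OF this a(1)] show "(%s. foldr pd is w (x(i := s))) differentiable (at (x i))" using a by simp
qed

theorem theorem2p11:
  fixes m :: nat and \<delta> c0 \<tau>0 K nL nL\<tau> :: real and M :: "nat \<Rightarrow> real"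
  assumes "0 < \<delta>" and "\<delta> \<le> 1" and "0 < c0" and "0 < \<tau>0" and "1 \<le> K"
  shows "\<exists>N::real. \<forall>(d::nat) (h0::real) (T::real) (\<Lambda>1::vec set) (ell::nat \<Rightarrow> vec) (\<tau>::vec \<Rightarrow> real)
      (q::vec \<Rightarrow> real \<Rightarrow> vec \<Rightarrow> real) (p::vec \<Rightarrow> real \<Rightarrow> vec \<Rightarrow> real) (c::real \<Rightarrow> vec \<Rightarrow> real)
      (f::real \<Rightarrow> vec \<Rightarrow> real) (g::vec \<Rightarrow> real) (u::real \<Rightarrow> real \<Rightarrow> vec \<Rightarrow> real) (k::nat) (r::nat).
    1 \<le> d \<longrightarrow> 0 < h0 \<longrightarrow> 0 < T \<longrightarrow>
    finite \<Lambda>1 \<longrightarrow> \<Lambda>1 \<subseteq> Rd d \<longrightarrow> vzero d \<notin> \<Lambda>1 \<longrightarrow>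
    (\<forall>l\<in>\<Lambda>1. 0 \<le> \<tau> l) \<longrightarrow>
    sqrt (\<Sum>l\<in>\<Lambda>1. (vnorm d l)\<^sup>2) = nL \<longrightarrow> sqrt (\<Sum>l\<in>\<Lambda>1. (\<tau> l * vnorm d l)\<^sup>2) = nL\<tau> \<longrightarrow>
    ell ` {..<d} \<subseteq> Rd d \<longrightarrow> inj_on ell {..<d} \<longrightarrow> ell ` {..<d} \<inter> \<Lambda>1 = {} \<longrightarrow>
    (\<forall>l\<in>\<Lambda>1. borel_on d {0..} (q l) \<and> borel_on d {0..} (p l)) \<longrightarrow> borel_on d {0..} c \<longrightarrow>
    (\<forall>l\<in>\<Lambda>1. \<forall>t\<ge>0. \<forall>x\<in>Rd d. 0 \<le> q l t x) \<longrightarrow>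
    odd k \<longrightarrow> 3 * k + 1 \<le> m \<longrightarrow>
    regularity d T \<Lambda>1 q p c f g m M \<longrightarrow>
    (\<forall>h\<in>{0<..h0}. \<forall>l\<in>\<Lambda>1. \<forall>t\<in>{0..T}. \<forall>x\<in>Rd d. 0 \<le> q l t x + h * p l t x) \<longrightarrow>
    (\<forall>t\<in>{0..T}. \<forall>x\<in>Rd d. \<forall>i<d. (\<Sum>l\<in>\<Lambda>1. l i * q l t x) = 0) \<longrightarrow>
    (\<forall>t\<ge>0. \<forall>x\<in>Rd d. c0 \<le> c t x) \<longrightarrow>
    scheme.first_structural d \<Lambda>1 ell \<tau>0 \<tau> q p c h0 T \<delta> K m \<longrightarrow>
    scheme.second_structural d \<Lambda>1 ell \<tau>0 \<tau> q p c h0 T \<delta> K m \<longrightarrow>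
    \<Lambda>1 = vneg d ` \<Lambda>1 \<longrightarrow>
    (\<forall>l\<in>\<Lambda>1. \<forall>t\<ge>0. \<forall>x\<in>Rd d. q l t x = q (vneg d l) t x \<and> p (vneg d l) t x = - p l t x) \<longrightarrow>
    (\<forall>h\<in>{0<..h0}. scheme.bounded_solution d \<Lambda>1 q p c T f g h (u h)) \<longrightarrow>
    3 * k + r \<le> m - 1 \<longrightarrow>
    (\<forall>t\<in>{0..T}. \<forall>x\<in>Rd d. has_h_derivs h0 k (\<lambda>h. u h t x)) \<and>
    (\<forall>h\<in>{0<..h0}. \<forall>t\<in>{0..T}.
       let v = (\<lambda>x. (Dh h0 ^^ k) (\<lambda>h'. u h' t x) h) in
       has_partials d r v \<and>
       (\<forall>x\<in>Rd d. sqrt (\<Sum>\<alpha>\<in>multi_index d r. \<bar>Dmulti d \<alpha> v x\<bar>\<^sup>2)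
                   \<le> N * (B_norm d T m f + B_norm d T m (\<lambda>_. g)) * h))"
proof -
 define Mb where "Mb = fact m * (SUM k<=m. (M k)\<^sup>2)"
 define CQ where "CQ = cQ m \<delta> K c0 \<tau>0 nL nL\<tau> Mb"
 \<comment> \<open>The energy bound has the factor \<open>CQ ^ (k + 1)\<close>, raised to the power
   m + 1 so that the witness does not depend on k; \<open>fact m\<close> comes from the energies of
   the data, and the square root from the energies being squares.\<close>
 show ?thesis
 proof (rule exI[of _ "sqrt (CQ ^ (m + 1) * fact m)"], intro allI impI, goal_cases)
  case (1 d h0 T La ell \<tau> q p c f g u k r)
  obtain ka where ka: "!!n. moll (1 / (real n + 1)) (ka n)" using moll_seq by blast
  have m4: "4 <= m" using 1(16,17) by (cases k) auto
  have nn: "(SUM l:La. (vnorm d l)\<^sup>2) = nL^2" "(SUM l:La. (\<tau> l * vnorm d l)\<^sup>2) = nL\<tau>^2"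
   unfolding 1(8)[symmetric] 1(9)[symmetric] by (simp_all add: sum_nonneg)
  interpret P: prob d La ell \<tau>0 \<tau> q p c h0 T \<delta> K m c0 nL nL\<tau> M f g u ka
  proof
   show "0 <= c t x" if "t : {0..T}" "x : Rd d" for t x
   proof -
    have "c0 <= c t x" using 1(21) that by simp
    thus ?thesis using assms(3) by simp
   qed
   show "c0 <= c t x" if "t : {0..T}" "x : Rd d" for t x using 1(21) that by simp
   show "0 <= q l t x + h * p l t x" if "h : {0<..h0}" "l : La" "t : {0..T}" "x : Rd d" for h l t x
    using 1(19) that by blast
   show "q (vneg d l) t x = q l t x" "p (vneg d l) t x = - p l t x" if "l : La" "t : {0..T}" "x : Rd d" for l t x
    using 1(25) that by simp_all
   show "scheme.bounded_solution d La q p c T f g h (u h)" if "h : {0<..h0}" for h using 1(26) that by blast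
   show "1 <= m" using m4 by simp
   show "vneg d ` La = La" using 1(24) by simp
  qed (rule assms 1(2-5) 1(11,12,18,22,23) nn m4 moll.e0[OF ka] moll.e1[OF ka] moll.ka_DERIV[OF ka] moll.ka_supp[OF ka]
    moll.ka_nonneg[OF ka] moll.ka_int[OF ka]; assumption?)+
  have eq: "P.Mb = Mb" by (simp add: P.Mb_def Mb_def)
  have r: "3 * k + r + 1 <= m" using 1(17,27) by simp
  note F = P.final_bounds[OF 1(16,17) r]
  show ?case
  proof (intro conjI ballI)
   show "has_h_derivs h0 k (%h. u h t x)" if "t : {0..T}" "x : Rd d" for t x
    unfolding has_h_derivs_def using F(1) that by blast
   fix h t assume h: "h : {0<..h0}" and t: "t : {0..T}"
   let ?v = "%x. (Dh h0 ^^ k) (%h'. u h' t x) h"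
   let ?b = "B_norm d T m f + B_norm d T m (%_. g)"
   have b0: "0 <= ?b" using P.B_norm_nonneg P.B by simp
   have hp: "has_partials d r ?v" using F(2)[OF h t] BD_has_partials by blast
   have "sqrt (SUM \<alpha>:multi_index d r. \<bar>Dmulti d \<alpha> ?v x\<bar>\<^sup>2) <= sqrt (CQ ^ (m + 1) * fact m) * ?b * h" if x: "x : Rd d" for x
   proof -
    have C1: "1 <= CQ" using F(4)[OF h t] unfolding CQ_def eq .
    have "(SUM \<alpha>:multi_index d r. \<bar>Dmulti d \<alpha> ?v x\<bar>\<^sup>2) <= CQ ^ (k + 1) * (h^2 * P.Y)"
     using Dmulti_D2[where d = d and r = r and w = ?v and x = x] F(3)[OF h t x] unfolding CQ_def eq by linarith
    also have "... <= CQ ^ (m + 1) * (h^2 * P.Y)"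
     using C1 1(17) by (intro mult_right_mono power_increasing) (auto simp: P.Y_def)
    also have "... = (CQ ^ (m + 1) * fact m) * (?b * h)^2" by (simp add: P.Y_def power_mult_distrib)
    finally have "sqrt (SUM \<alpha>:multi_index d r. \<bar>Dmulti d \<alpha> ?v x\<bar>\<^sup>2) <= sqrt ((CQ ^ (m + 1) * fact m) * (?b * h)^2)" by (rule real_sqrt_le_mono)
    also have "... = sqrt (CQ ^ (m + 1) * fact m) * (?b * h)" using b0 h by (simp add: real_sqrt_mult)
    finally show ?thesis by simp
   qed
   thus "let v = ?v in has_partials d r v & (ALL x:Rd d. sqrt (SUM \<alpha>:multi_index d r. \<bar>Dmulti d \<alpha> v x\<bar>\<^sup>2) <= sqrt (CQ ^ (m + 1) * fact m) * ?b * h)"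
    unfolding Let_def using hp by blast
  qed
 qed
qed

end
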